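(* Let $\mathcal F$ be a Frobenius exact category with class of admissible exact sequences $\mathscr S$, let $\mathcal K=\underline{\mathcal F}=\mathcal F/\operatorname{proj}(\mathscr S)$ be its stable (triangulated) category and let $\varpi\colon\mathcal F\to\mathcal K$ be the quotient functor. Suppose that $\mathcal E$ is a Frobenius class of triangles in $\mathcal K$. Define $\mathscr S_{\mathcal E}\subseteq\mathscr S$ to be the class of admissible sequences $$\mathscr S_{\mathcal E}:=\{\mathbb E=(M'\rightarrowtail M\twoheadrightarrow M'')\in\mathscr S\mid\text{the image triangle }\varpi\mathbb E\text{ belongs to }\mathcal E\text{ in }\mathcal K\}.$$ Then $\mathscr S_{\mathcal E}$ defines a Frobenius exact structure on $\mathcal F$ whose class of projective-injective objects is $\varpi^{-1}(\operatorname{proj}(\mathcal E))$, i.e. those objects of $\mathcal F$ which are $\mathcal E$-projective-injective in $\mathcal K$. Moreover, the stable category $\mathcal F/\operatorname{proj}(\mathscr S_{\mathcal E})$ of this new Frobenius category is equivalent to $\underline{\mathcal K}_{\mathcal E}$ as a triangulated category, via an equivalence $\Theta\colon\mathcal F/\operatorname{proj}(\mathscr S_{\mathcal E})\xrightarrow{\cong}\underline{\mathcal K}_{\mathcal E}$ such that $\Theta\circ\varpi'=\pi\circ\varpi$, where $\varpi'\colon\mathcal F\to\mathcal F/\operatorname{proj}(\mathscr S_{\mathcal E})$ and $\pi\colon\mathcal K\to\underline{\mathcal K}_{\mathcal E}$ are the quotient functors.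
   Context: Exact categories are in the sense of Quillen, and Frobenius means: enough projectives, enough injectives, and projectives and injectives coincide; $\operatorname{proj}(\mathscr S)$ denotes the projective(-injective) objects. The stable category $\mathcal F/\operatorname{proj}(\mathscr S)$ is the additive quotient with its usual triangulation. For $\mathbb E=(M'\rightarrowtail M\twoheadrightarrow M'')\in\mathscr S$, the image triangle $\varpi\mathbb E$ is the associated distinguished triangle $\varpi M'\to\varpi M\to\varpi M''\to\Sigma\varpi M'$. Standing assumption: $\mathcal K$ is essentially small, with suspension $\Sigma$. Subcategories are full and replete. Let $\mathcal E$ be a family of distinguished triangles $X\xrightarrow{f}Y\xrightarrow{g}Z\xrightarrow{h}\Sigma X$ in $\mathcal K$; for a triangle in $\mathcal E$ one calls $f$ an $\mathcal E$-monomorphism, $g$ an $\mathcal E$-epimorphism and $h$ an $\mathcal E$-phantom. $\mathcal E$ is a proper class of triangles if it is closed under isomorphisms, suspension (triple rotation), finite sums and retracts; contains all triangles $X\xrightarrow{\mathrm{id}}X\to0\to\Sigma X$ and $0\to Y\xrightarrow{\mathrm{id}}Y\to0$; $\mathcal E$-monomorphisms are closed under homotopy pushouts and $\mathcal E$-epimorphisms under homotopy pullbacks (along arbitrary morphisms); and $\mathcal E$ is saturated: if the homotopy pullback of a morphism $g$ along an $\mathcal E$-epimorphism is an $\mathcal E$-epimorphism, then $g$ is an $\mathcal E$-epimorphism. An object $P$ is $\mathcal E$-projective if $0\to\mathcal K(P,X)\to\mathcal K(P,Y)\to\mathcal K(P,Z)\to0$ is exact for every triangle in $\mathcal E$; $\mathcal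 E$-injectives are defined dually; $\operatorname{proj}(\mathcal E)$ and $\operatorname{inj}(\mathcal E)$ denote the classes of these. $\mathcal E$ has enough projectives (injectives) if every $X$ admits an $\mathcal E$-epimorphism $P\to X$ with $P\in\operatorname{proj}(\mathcal E)$ (an $\mathcal E$-monomorphism $X\to I$ with $I\in\operatorname{inj}(\mathcal E)$). $\mathcal E$ is Frobenius if it is a proper class with enough projectives, enough injectives and $\operatorname{proj}(\mathcal E)=\operatorname{inj}(\mathcal E)$. For $\mathcal E$ Frobenius, the relative stable category is the additive quotient $\pi\colon\mathcal K\to\underline{\mathcal K}_{\mathcal E}=\mathcal K/\operatorname{proj}(\mathcal E)$ (same objects, morphisms modulo those factoring through an object of $\operatorname{proj}(\mathcal E)$). It is triangulated (Beligiannis): for each $X$ choose an $\mathcal E$-monomorphism $i_X\colon X\to X_{\mathcal E}$ with $X_{\mathcal E}\in\operatorname{inj}(\mathcal E)$ and a distinguished triangle $X\xrightarrow{i_X}X_{\mathcal E}\to X'\to\Sigma X$, and set $\Sigma_{\mathcal E}X=\pi(X')$. For $f\colon X\to Y$ in $\mathcal K$ form the homotopy pushout $Z$ of $X_{\mathcal E}\leftarrow X\xrightarrow{f}Y$ and the induced map from $X\to X_{\mathcal E}\to X'\to\Sigma X$ to the distinguished triangle $Y\xrightarrow{g}Z\xrightarrow{h}X'\to\Sigma Y$ which is the identity on $X'$; the distinguished triangles in $\underline{\mathcal K}_{\mathcal E}$ are those isomorphic to some $X\xrightarrow{\pi f}Y\xrightarrow{\pi g}Z\xrightarrow{\pi h}\Sigma_{\mathcal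 E}X$. *)

theory Defs
  imports "HOL-Algebra.Group"
begin

section \<open>Additive categories\<close>

text \<open>
  A category is given by a set of objects and hom-sets, which are required to be pairwise disjoint,
  so that a morphism determines its source and its target. Composition is written in the usual
  order: in g \<open>\<cdot>\<close> f the morphism f comes first. All fields are only meaningful on objects,
  respectively on composable or parallel morphisms. Object collections are sets of a HOL type,
  hence every category considered is small.
\<close>

record ('o, 'm) addcat =
  Ob :: "'o set"
  Hom :: "'o \<Rightarrow> 'o \<Rightarrow> 'm set"
  Ide :: "'o \<Rightarrow> 'm"
  Comp :: "'m \<Rightarrow> 'm \<Rightarrow> 'm" (infixl "\<cdot>\<index>" 75)
  Add :: "'m \<Rightarrow> 'm \<Rightarrow> 'm" (infixl "\<boxplus>\<index>" 65)
  Zero :: "'o \<Rightarrow> 'o \<Rightarrow> 'm"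

definition hom_group :: "('o, 'm, 'z) addcat_scheme \<Rightarrow> 'o \<Rightarrow> 'o \<Rightarrow> 'm monoid" where
  "hom_group C x y = \<lparr>carrier = Hom C x y, monoid.mult = Add C, one = Zero C x y\<rparr>"

definition neg :: "('o, 'm, 'z) addcat_scheme \<Rightarrow> 'o \<Rightarrow> 'o \<Rightarrow> 'm \<Rightarrow> 'm" where
  "neg C x y f = inv\<^bsub>hom_group C x y\<^esub> f"

locale category =
  fixes C :: "('o, 'm, 'z) addcat_scheme" (structure)
  assumes hom_ob: "f \<in> Hom C x y \<Longrightarrow> x \<in> Ob C \<and> y \<in> Ob C"
    and hom_disjoint: "f \<in> Hom C x y \<Longrightarrow> f \<in> Hom C x' y' \<Longrightarrow> x = x' \<and> y = y'"
    and ide_hom: "x \<in> Ob C \<Longrightarrow> Ide C x \<in> Hom C x x"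
    and comp_hom: "f \<in> Hom C x y \<Longrightarrow> g \<in> Hom C y z \<Longrightarrow> g \<cdot> f \<in> Hom C x z"
    and comp_ide: "f \<in> Hom C x y \<Longrightarrow> f \<cdot> Ide C x = f"
    and ide_comp: "f \<in> Hom C x y \<Longrightarrow> Ide C y \<cdot> f = f"
    and comp_assoc: "f \<in> Hom C w x \<Longrightarrow> g \<in> Hom C x y \<Longrightarrow> h \<in> Hom C y z \<Longrightarrow>
      h \<cdot> (g \<cdot> f) = h \<cdot> g \<cdot> f"

definition is_zero_object :: "('o, 'm, 'z) addcat_scheme \<Rightarrow> 'o \<Rightarrow> bool" where
  "is_zero_object C z \<longleftrightarrow> z \<in> Ob C \<and>
     (\<forall>x\<in>Ob C. Hom C x z = {Zero C x z} \<and> Hom C z x = {Zero C z x})"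

definition is_biproduct ::
  "('o, 'm, 'z) addcat_scheme \<Rightarrow> 'o \<Rightarrow> 'o \<Rightarrow> 'o \<Rightarrow> 'm \<Rightarrow> 'm \<Rightarrow> 'm \<Rightarrow> 'm \<Rightarrow> bool" where
  "is_biproduct C a b s i1 i2 p1 p2 \<longleftrightarrow>
     i1 \<in> Hom C a s \<and> i2 \<in> Hom C b s \<and> p1 \<in> Hom C s a \<and> p2 \<in> Hom C s b \<and>
     p1 \<cdot>\<^bsub>C\<^esub> i1 = Ide C a \<and> p2 \<cdot>\<^bsub>C\<^esub> i2 = Ide C b \<and>
     p1 \<cdot>\<^bsub>C\<^esub> i2 = Zero C b a \<and> p2 \<cdot>\<^bsub>C\<^esub> i1 = Zero C a b \<and>
     (i1 \<cdot>\<^bsub>C\<^esub> p1) \<boxplus>\<^bsub>C\<^esub> (i2 \<cdot>\<^bsub>C\<^esub> p2) = Ide C s"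

locale additive_category = category C
  for C :: "('o, 'm, 'z) addcat_scheme" (structure) +
  assumes hom_comm_group: "x \<in> Ob C \<Longrightarrow> y \<in> Ob C \<Longrightarrow> comm_group (hom_group C x y)"
    and comp_add: "f \<in> Hom C x y \<Longrightarrow> f' \<in> Hom C x y \<Longrightarrow> g \<in> Hom C y z \<Longrightarrow>
      g \<cdot> (f \<boxplus> f') = g \<cdot> f \<boxplus> g \<cdot> f'"
    and add_comp: "f \<in> Hom C x y \<Longrightarrow> g \<in> Hom C y z \<Longrightarrow> g' \<in> Hom C y z \<Longrightarrow>
      (g \<boxplus> g') \<cdot> f = g \<cdot> f \<boxplus> g' \<cdot> f"
    and zero_object: "\<exists>z. is_zero_object C z"
    and biproducts: "a \<in> Ob C \<Longrightarrow> b \<in> Ob C \<Longrightarrow> \<exists>s i1 i2 p1 p2. is_biproduct C a b s i1 i2 p1 p2"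

definition is_iso :: "('o, 'm, 'z) addcat_scheme \<Rightarrow> 'm \<Rightarrow> bool" where
  "is_iso C f \<longleftrightarrow> (\<exists>x y g. f \<in> Hom C x y \<and> g \<in> Hom C y x \<and>
     g \<cdot>\<^bsub>C\<^esub> f = Ide C x \<and> f \<cdot>\<^bsub>C\<^esub> g = Ide C y)"

definition is_kernel :: "('o, 'm, 'z) addcat_scheme \<Rightarrow> 'm \<Rightarrow> 'm \<Rightarrow> bool" where
  "is_kernel C i p \<longleftrightarrow> (\<exists>x y z. i \<in> Hom C x y \<and> p \<in> Hom C y z \<and> p \<cdot>\<^bsub>C\<^esub> i = Zero C x z \<and>
     (\<forall>t\<in>Ob C. \<forall>u\<in>Hom C t y. p \<cdot>\<^bsub>C\<^esub> u = Zero C t z \<longrightarrow>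
        (\<exists>!v. v \<in> Hom C t x \<and> i \<cdot>\<^bsub>C\<^esub> v = u)))"

definition is_cokernel :: "('o, 'm, 'z) addcat_scheme \<Rightarrow> 'm \<Rightarrow> 'm \<Rightarrow> bool" where
  "is_cokernel C i p \<longleftrightarrow> (\<exists>x y z. i \<in> Hom C x y \<and> p \<in> Hom C y z \<and> p \<cdot>\<^bsub>C\<^esub> i = Zero C x z \<and>
     (\<forall>t\<in>Ob C. \<forall>u\<in>Hom C y t. u \<cdot>\<^bsub>C\<^esub> i = Zero C x t \<longrightarrow>
        (\<exists>!v. v \<in> Hom C z t \<and> v \<cdot>\<^bsub>C\<^esub> p = u)))"

text \<open>
  A square with top edge f : A \<open>\<rightarrow>\<close> B, left edge g : A \<open>\<rightarrow>\<close> D, bottom edge f' : D \<open>\<rightarrow>\<close> Q and right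
  edge g' : B \<open>\<rightarrow>\<close> Q is always passed as f, g, f', g'.
\<close>

definition is_square :: "('o, 'm, 'z) addcat_scheme \<Rightarrow> 'o \<Rightarrow> 'o \<Rightarrow> 'o \<Rightarrow> 'o \<Rightarrow>
    'm \<Rightarrow> 'm \<Rightarrow> 'm \<Rightarrow> 'm \<Rightarrow> bool" where
  "is_square C A B D Q f g f' g' \<longleftrightarrow>
     f \<in> Hom C A B \<and> g \<in> Hom C A D \<and> f' \<in> Hom C D Q \<and> g' \<in> Hom C B Q \<and>
     g' \<cdot>\<^bsub>C\<^esub> f = f' \<cdot>\<^bsub>C\<^esub> g"

definition is_pushout :: "('o, 'm, 'z) addcat_scheme \<Rightarrow> 'm \<Rightarrow> 'm \<Rightarrow> 'm \<Rightarrow> 'm \<Rightarrow> bool" where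
  "is_pushout C f g f' g' \<longleftrightarrow> (\<exists>A B D Q. is_square C A B D Q f g f' g' \<and>
     (\<forall>T\<in>Ob C. \<forall>u\<in>Hom C D T. \<forall>v\<in>Hom C B T. v \<cdot>\<^bsub>C\<^esub> f = u \<cdot>\<^bsub>C\<^esub> g \<longrightarrow>
        (\<exists>!w. w \<in> Hom C Q T \<and> w \<cdot>\<^bsub>C\<^esub> f' = u \<and> w \<cdot>\<^bsub>C\<^esub> g' = v)))"

definition is_pullback :: "('o, 'm, 'z) addcat_scheme \<Rightarrow> 'm \<Rightarrow> 'm \<Rightarrow> 'm \<Rightarrow> 'm \<Rightarrow> bool" where
  "is_pullback C f g f' g' \<longleftrightarrow> (\<exists>A B D Q. is_square C A B D Q f g f' g' \<and>
     (\<forall>T\<in>Ob C. \<forall>u\<in>Hom C T B. \<forall>v\<in>Hom C T D. g' \<cdot>\<^bsub>C\<^esub> u = f' \<cdot>\<^bsub>C\<^esub> v \<longrightarrow>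
        (\<exists>!w. w \<in> Hom C T A \<and> f \<cdot>\<^bsub>C\<^esub> w = u \<and> g \<cdot>\<^bsub>C\<^esub> w = v)))"


section \<open>Exact and Frobenius exact categories\<close>

text \<open>
  The set S of admissible short exact sequences consists of pairs (i, p) of an admissible
  monomorphism and an admissible epimorphism.
\<close>

definition adm_mono :: "('m \<times> 'm) set \<Rightarrow> 'm \<Rightarrow> bool" where
  "adm_mono S i \<longleftrightarrow> (\<exists>p. (i, p) \<in> S)"

definition adm_epi :: "('m \<times> 'm) set \<Rightarrow> 'm \<Rightarrow> bool" where
  "adm_epi S p \<longleftrightarrow> (\<exists>i. (i, p) \<in> S)"

text \<open>
  Quillen's axioms in their usual reduced form (Keller, Buehler); Quillen's remaining
  ``obscure'' axiom is a consequence.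
\<close>

locale exact_category = additive_category C
  for C :: "('o, 'm, 'z) addcat_scheme" (structure) and S :: "('m \<times> 'm) set" +
  assumes ker_coker: "(i, p) \<in> S \<Longrightarrow> is_kernel C i p \<and> is_cokernel C i p"
    and iso_closed: "(i, p) \<in> S \<Longrightarrow> i \<in> Hom C x y \<Longrightarrow> p \<in> Hom C y z \<Longrightarrow>
      i' \<in> Hom C x' y' \<Longrightarrow> p' \<in> Hom C y' z' \<Longrightarrow>
      a \<in> Hom C x x' \<Longrightarrow> b \<in> Hom C y y' \<Longrightarrow> c \<in> Hom C z z' \<Longrightarrow>
      is_iso C a \<Longrightarrow> is_iso C b \<Longrightarrow> is_iso C c \<Longrightarrow>
      b \<cdot> i = i' \<cdot> a \<Longrightarrow> c \<cdot> p = p' \<cdot> b \<Longrightarrow> (i', p') \<in> S"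
    and ide_adm_mono: "x \<in> Ob C \<Longrightarrow> adm_mono S (Ide C x)"
    and ide_adm_epi: "x \<in> Ob C \<Longrightarrow> adm_epi S (Ide C x)"
    and comp_adm_mono: "i \<in> Hom C x y \<Longrightarrow> j \<in> Hom C y z \<Longrightarrow> adm_mono S i \<Longrightarrow> adm_mono S j \<Longrightarrow>
      adm_mono S (j \<cdot> i)"
    and comp_adm_epi: "p \<in> Hom C x y \<Longrightarrow> q \<in> Hom C y z \<Longrightarrow> adm_epi S p \<Longrightarrow> adm_epi S q \<Longrightarrow>
      adm_epi S (q \<cdot> p)"
    and pushout_adm_mono: "i \<in> Hom C A B \<Longrightarrow> a \<in> Hom C A D \<Longrightarrow> adm_mono S i \<Longrightarrow>
      \<exists>i' a'. is_pushout C i a i' a' \<and> adm_mono S i'"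
    and pullback_adm_epi: "p \<in> Hom C B Q \<Longrightarrow> a \<in> Hom C D Q \<Longrightarrow> adm_epi S p \<Longrightarrow>
      \<exists>p' a'. is_pullback C a' p' a p \<and> adm_epi S p'"

definition exact_proj :: "('o, 'm, 'z) addcat_scheme \<Rightarrow> ('m \<times> 'm) set \<Rightarrow> 'o set" where
  "exact_proj C S = {P \<in> Ob C. \<forall>y z p f. p \<in> Hom C y z \<longrightarrow> adm_epi S p \<longrightarrow> f \<in> Hom C P z \<longrightarrow>
     (\<exists>g\<in>Hom C P y. p \<cdot>\<^bsub>C\<^esub> g = f)}"

definition exact_inj :: "('o, 'm, 'z) addcat_scheme \<Rightarrow> ('m \<times> 'm) set \<Rightarrow> 'o set" where
  "exact_inj C S = {I \<in> Ob C. \<forall>x y i f. i \<in> Hom C x y \<longrightarrow> adm_mono S i \<longrightarrow> f \<in> Hom C x I \<longrightarrow>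
     (\<exists>g\<in>Hom C y I. g \<cdot>\<^bsub>C\<^esub> i = f)}"

locale frobenius_exact_category = exact_category C S
  for C :: "('o, 'm, 'z) addcat_scheme" (structure) and S :: "('m \<times> 'm) set" +
  assumes enough_proj: "x \<in> Ob C \<Longrightarrow> \<exists>P\<in>exact_proj C S. \<exists>p\<in>Hom C P x. adm_epi S p"
    and enough_inj: "x \<in> Ob C \<Longrightarrow> \<exists>I\<in>exact_inj C S. \<exists>i\<in>Hom C x I. adm_mono S i"
    and proj_eq_inj: "exact_proj C S = exact_inj C S"


section \<open>Additive quotients\<close>

text \<open>
  For a class P of objects closed under finite sums, the morphisms factoring through an object
  of P form an ideal, and \<open>qcls C P f\<close> is the coset of f. Composition and addition of cosets
  are written as unions over representatives; these unions are again single cosets.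
\<close>

definition qcls :: "('o, 'm, 'z) addcat_scheme \<Rightarrow> 'o set \<Rightarrow> 'm \<Rightarrow> 'm set" where
  "qcls C P f = {f'. \<exists>x y. f \<in> Hom C x y \<and>
     (\<exists>p\<in>P. \<exists>a\<in>Hom C x p. \<exists>b\<in>Hom C p y. f' = f \<boxplus>\<^bsub>C\<^esub> b \<cdot>\<^bsub>C\<^esub> a)}"

definition quot_cat :: "('o, 'm, 'z) addcat_scheme \<Rightarrow> 'o set \<Rightarrow> ('o, 'm set) addcat" where
  "quot_cat C P = \<lparr>
     Ob = Ob C,
     Hom = (\<lambda>x y. qcls C P ` Hom C x y),
     Ide = (\<lambda>x. qcls C P (Ide C x)),
     Comp = (\<lambda>G F. \<Union>g\<in>G. \<Union>f\<in>F. qcls C P (g \<cdot>\<^bsub>C\<^esub> f)),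
     Add = (\<lambda>F G. \<Union>f\<in>F. \<Union>g\<in>G. qcls C P (f \<boxplus>\<^bsub>C\<^esub> g)),
     Zero = (\<lambda>x y. qcls C P (Zero C x y))\<rparr>"


section \<open>Triangles\<close>

record ('o, 'm) suscat = "('o, 'm) addcat" +
  SusO :: "'o \<Rightarrow> 'o"
  SusM :: "'m \<Rightarrow> 'm"

record ('o, 'm) tricat = "('o, 'm) suscat" +
  Dist :: "('m \<times> 'm \<times> 'm) set"

fun is_cand :: "('o, 'm, 'z) suscat_scheme \<Rightarrow> 'o \<Rightarrow> 'o \<Rightarrow> 'o \<Rightarrow> 'm \<times> 'm \<times> 'm \<Rightarrow> bool" where
  "is_cand K X Y Z (f, g, h) \<longleftrightarrow> f \<in> Hom K X Y \<and> g \<in> Hom K Y Z \<and> h \<in> Hom K Z (SusO K X)"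

fun tri_mor :: "('o, 'm, 'z) suscat_scheme \<Rightarrow> 'm \<times> 'm \<times> 'm \<Rightarrow> 'm \<times> 'm \<times> 'm \<Rightarrow>
    'm \<times> 'm \<times> 'm \<Rightarrow> bool" where
  "tri_mor K (f, g, h) (f', g', h') (a, b, c) \<longleftrightarrow>
     (\<exists>X Y Z X' Y' Z'. is_cand K X Y Z (f, g, h) \<and> is_cand K X' Y' Z' (f', g', h') \<and>
        a \<in> Hom K X X' \<and> b \<in> Hom K Y Y' \<and> c \<in> Hom K Z Z' \<and>
        b \<cdot>\<^bsub>K\<^esub> f = f' \<cdot>\<^bsub>K\<^esub> a \<and> c \<cdot>\<^bsub>K\<^esub> g = g' \<cdot>\<^bsub>K\<^esub> b \<and> SusM K a \<cdot>\<^bsub>K\<^esub> h = h' \<cdot>\<^bsub>K\<^esub> c)"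

definition tri_iso :: "('o, 'm, 'z) suscat_scheme \<Rightarrow> 'm \<times> 'm \<times> 'm \<Rightarrow> 'm \<times> 'm \<times> 'm \<Rightarrow> bool" where
  "tri_iso K T T' \<longleftrightarrow> (\<exists>a b c. tri_mor K T T' (a, b, c) \<and> is_iso K a \<and> is_iso K b \<and> is_iso K c)"

definition tri_retract ::
  "('o, 'm, 'z) suscat_scheme \<Rightarrow> 'm \<times> 'm \<times> 'm \<Rightarrow> 'm \<times> 'm \<times> 'm \<Rightarrow> bool" where
  "tri_retract K R T \<longleftrightarrow> (\<exists>X Y Z a b c a' b' c'. is_cand K X Y Z R \<and>
     tri_mor K R T (a, b, c) \<and> tri_mor K T R (a', b', c') \<and>
     a' \<cdot>\<^bsub>K\<^esub> a = Ide K X \<and> b' \<cdot>\<^bsub>K\<^esub> b = Ide K Y \<and> c' \<cdot>\<^bsub>K\<^esub> c = Ide K Z)"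

definition tri_sum ::
  "('o, 'm, 'z) suscat_scheme \<Rightarrow> 'm \<times> 'm \<times> 'm \<Rightarrow> 'm \<times> 'm \<times> 'm \<Rightarrow> 'm \<times> 'm \<times> 'm \<Rightarrow> bool" where
  "tri_sum K T1 T2 T \<longleftrightarrow> (\<exists>X1 Y1 Z1 X2 Y2 Z2 X Y Z a1 b1 c1 a2 b2 c2 a1' b1' c1' a2' b2' c2'.
     is_cand K X1 Y1 Z1 T1 \<and> is_cand K X2 Y2 Z2 T2 \<and> is_cand K X Y Z T \<and>
     tri_mor K T1 T (a1, b1, c1) \<and> tri_mor K T2 T (a2, b2, c2) \<and>
     tri_mor K T T1 (a1', b1', c1') \<and> tri_mor K T T2 (a2', b2', c2') \<and>
     is_biproduct K X1 X2 X a1 a2 a1' a2' \<and> is_biproduct K Y1 Y2 Y b1 b2 b1' b2' \<and>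
     is_biproduct K Z1 Z2 Z c1 c2 c1' c2')"

text \<open>
  The square f, g, f', g' is homotopy cartesian: the triangle
  A \<open>\<rightarrow>\<close> B \<open>\<oplus>\<close> D \<open>\<rightarrow>\<close> Q \<open>\<rightarrow>\<close> \<open>\<Sigma>\<close>A with maps (f, -g) and (g', f') is distinguished for a suitable third
  map. Thus f' is a homotopy pushout of f along g, and g is a homotopy pullback of g' along f'.
\<close>

definition hcart :: "('o, 'm, 'z) tricat_scheme \<Rightarrow> 'm \<Rightarrow> 'm \<Rightarrow> 'm \<Rightarrow> 'm \<Rightarrow> bool" where
  "hcart K f g f' g' \<longleftrightarrow> (\<exists>A B D Q s i1 i2 p1 p2 d. is_square K A B D Q f g f' g' \<and>
     is_biproduct K B D s i1 i2 p1 p2 \<and>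
     (i1 \<cdot>\<^bsub>K\<^esub> f \<boxplus>\<^bsub>K\<^esub> neg K A s (i2 \<cdot>\<^bsub>K\<^esub> g), g' \<cdot>\<^bsub>K\<^esub> p1 \<boxplus>\<^bsub>K\<^esub> f' \<cdot>\<^bsub>K\<^esub> p2, d) \<in> Dist K)"


section \<open>Proper and Frobenius classes of triangles\<close>

definition tri_mono :: "('m \<times> 'm \<times> 'm) set \<Rightarrow> 'm \<Rightarrow> bool" where
  "tri_mono E f \<longleftrightarrow> (\<exists>g h. (f, g, h) \<in> E)"

definition tri_epi :: "('m \<times> 'm \<times> 'm) set \<Rightarrow> 'm \<Rightarrow> bool" where
  "tri_epi E g \<longleftrightarrow> (\<exists>f h. (f, g, h) \<in> E)"

text \<open>The suspension of (f, g, h) is its threefold rotation, with all three signs negative.\<close>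

locale proper_class =
  fixes K :: "('o, 'm, 'z) tricat_scheme" (structure) and E :: "('m \<times> 'm \<times> 'm) set"
  assumes dist: "E \<subseteq> Dist K"
    and iso: "T \<in> E \<Longrightarrow> tri_iso K T T' \<Longrightarrow> T' \<in> E"
    and suspension: "(f, g, h) \<in> E \<Longrightarrow> is_cand K X Y Z (f, g, h) \<Longrightarrow>
      (neg K (SusO K X) (SusO K Y) (SusM K f), neg K (SusO K Y) (SusO K Z) (SusM K g),
       neg K (SusO K Z) (SusO K (SusO K X)) (SusM K h)) \<in> E"
    and sum: "T1 \<in> E \<Longrightarrow> T2 \<in> E \<Longrightarrow> tri_sum K T1 T2 T \<Longrightarrow> T \<in> E"
    and retract: "T \<in> E \<Longrightarrow> tri_retract K R T \<Longrightarrow> R \<in> E"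
    and split_left: "X \<in> Ob K \<Longrightarrow> is_zero_object K z \<Longrightarrow>
      (Ide K X, Zero K X z, Zero K z (SusO K X)) \<in> E"
    and split_right: "Y \<in> Ob K \<Longrightarrow> is_zero_object K z \<Longrightarrow>
      (Zero K z Y, Ide K Y, Zero K Y (SusO K z)) \<in> E"
    and mono_pushout: "tri_mono E f \<Longrightarrow> hcart K f g f' g' \<Longrightarrow> tri_mono E f'"
    and epi_pullback: "tri_epi E g' \<Longrightarrow> hcart K f g f' g' \<Longrightarrow> tri_epi E g"
    and saturated: "hcart K f g f' g' \<Longrightarrow> tri_epi E f' \<Longrightarrow> tri_epi E g \<Longrightarrow> tri_epi E g'"

text \<open>Exactness of 0 \<open>\<rightarrow>\<close> A \<open>\<rightarrow>\<close> B \<open>\<rightarrow>\<close> D \<open>\<rightarrow>\<close> 0 for homomorphisms of abelian groups.\<close>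

definition short_exact :: "'a monoid \<Rightarrow> 'a monoid \<Rightarrow> 'a monoid \<Rightarrow> ('a \<Rightarrow> 'a) \<Rightarrow> ('a \<Rightarrow> 'a) \<Rightarrow> bool" where
  "short_exact A B D u v \<longleftrightarrow> inj_on u (carrier A) \<and>
     u ` carrier A = {b \<in> carrier B. v b = \<one>\<^bsub>D\<^esub>} \<and> v ` carrier B = carrier D"

definition tri_proj :: "('o, 'm, 'z) tricat_scheme \<Rightarrow> ('m \<times> 'm \<times> 'm) set \<Rightarrow> 'o set" where
  "tri_proj K E = {P \<in> Ob K. \<forall>X Y Z f g h. (f, g, h) \<in> E \<longrightarrow> is_cand K X Y Z (f, g, h) \<longrightarrow>
     short_exact (hom_group K P X) (hom_group K P Y) (hom_group K P Z)
       (\<lambda>u. f \<cdot>\<^bsub>K\<^esub> u) (\<lambda>v. g \<cdot>\<^bsub>K\<^esub> v)}"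

definition tri_inj :: "('o, 'm, 'z) tricat_scheme \<Rightarrow> ('m \<times> 'm \<times> 'm) set \<Rightarrow> 'o set" where
  "tri_inj K E = {I \<in> Ob K. \<forall>X Y Z f g h. (f, g, h) \<in> E \<longrightarrow> is_cand K X Y Z (f, g, h) \<longrightarrow>
     short_exact (hom_group K Z I) (hom_group K Y I) (hom_group K X I)
       (\<lambda>u. u \<cdot>\<^bsub>K\<^esub> g) (\<lambda>v. v \<cdot>\<^bsub>K\<^esub> f)}"

locale frobenius_class = proper_class K E
  for K :: "('o, 'm, 'z) tricat_scheme" (structure) and E :: "('m \<times> 'm \<times> 'm) set" +
  assumes enough_tri_proj: "X \<in> Ob K \<Longrightarrow> \<exists>P\<in>tri_proj K E. \<exists>p\<in>Hom K P X. tri_epi E p"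
    and enough_tri_inj: "X \<in> Ob K \<Longrightarrow> \<exists>I\<in>tri_inj K E. \<exists>i\<in>Hom K X I. tri_mono E i"
    and tri_proj_eq_inj: "tri_proj K E = tri_inj K E"


section \<open>The stable category of a Frobenius exact category\<close>

text \<open>
  The triangulation depends on a choice, for every object X, of an admissible sequence
  X \<open>\<rightarrow>\<close> \<open>Env X\<close> \<open>\<rightarrow>\<close> \<open>Cosyz X\<close> with \<open>Env X\<close> injective; the choice is a parameter of the constructions.
\<close>

record ('o, 'm) envelope =
  Env :: "'o \<Rightarrow> 'o"
  Cosyz :: "'o \<Rightarrow> 'o"
  into :: "'o \<Rightarrow> 'm"
  onto :: "'o \<Rightarrow> 'm"

definition exact_envelope ::
  "('o, 'm, 'z) addcat_scheme \<Rightarrow> ('m \<times> 'm) set \<Rightarrow> ('o, 'm) envelope \<Rightarrow> bool" where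
  "exact_envelope C S J \<longleftrightarrow> (\<forall>X\<in>Ob C. Env J X \<in> exact_inj C S \<and>
     into J X \<in> Hom C X (Env J X) \<and> onto J X \<in> Hom C (Env J X) (Cosyz J X) \<and>
     (into J X, onto J X) \<in> S)"

definition stable_functor :: "('o, 'm, 'z) addcat_scheme \<Rightarrow> ('m \<times> 'm) set \<Rightarrow> 'm \<Rightarrow> 'm set" where
  "stable_functor C S f = qcls C (exact_proj C S) f"

text \<open>
  The suspension of the class of f : X \<open>\<rightarrow>\<close> Y is the class of any f' fitting into a morphism of
  the chosen sequences with first component f (again a union that is a single coset).
\<close>

definition stable_suscat :: "('o, 'm, 'z) addcat_scheme \<Rightarrow> ('m \<times> 'm) set \<Rightarrow> ('o, 'm) envelope \<Rightarrow>
    ('o, 'm set) suscat" where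
  "stable_suscat C S J = addcat.extend (quot_cat C (exact_proj C S)) (suscat.fields
     (Cosyz J)
     (\<lambda>F. \<Union>{stable_functor C S f' | f' f X Y e. f \<in> F \<and> f \<in> Hom C X Y \<and>
        e \<in> Hom C (Env J X) (Env J Y) \<and> f' \<in> Hom C (Cosyz J X) (Cosyz J Y) \<and>
        e \<cdot>\<^bsub>C\<^esub> into J X = into J Y \<cdot>\<^bsub>C\<^esub> f \<and> f' \<cdot>\<^bsub>C\<^esub> onto J X = onto J Y \<cdot>\<^bsub>C\<^esub> e}))"

text \<open>
  Happel's standard triangles: X \<open>\<rightarrow>\<close> Y \<open>\<rightarrow>\<close> Z \<open>\<rightarrow>\<close> \<open>Cosyz X\<close>, where Z is the pushout of
  X \<open>\<rightarrow>\<close> \<open>Env X\<close> along f.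
\<close>

definition stable_std :: "('o, 'm, 'z) addcat_scheme \<Rightarrow> ('m \<times> 'm) set \<Rightarrow> ('o, 'm) envelope \<Rightarrow>
    ('m set \<times> 'm set \<times> 'm set) set" where
  "stable_std C S J = {(stable_functor C S f, stable_functor C S g, stable_functor C S h) | f g h.
     \<exists>X Y Z k. f \<in> Hom C X Y \<and> g \<in> Hom C Y Z \<and> h \<in> Hom C Z (Cosyz J X) \<and>
       is_pushout C (into J X) f g k \<and>
       h \<cdot>\<^bsub>C\<^esub> g = Zero C Y (Cosyz J X) \<and> h \<cdot>\<^bsub>C\<^esub> k = onto J X}"

definition stable_cat :: "('o, 'm, 'z) addcat_scheme \<Rightarrow> ('m \<times> 'm) set \<Rightarrow> ('o, 'm) envelope \<Rightarrow>
    ('o, 'm set) tricat" where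
  "stable_cat C S J = suscat.extend (stable_suscat C S J) (tricat.fields
     {T. \<exists>T0\<in>stable_std C S J. tri_iso (stable_suscat C S J) T0 T})"

text \<open>
  The distinguished triangle of an admissible sequence (i, p) from X over Y to Z: if u extends
  X \<open>\<rightarrow>\<close> \<open>Env X\<close> along i and w is induced by u on the quotients, then its third map is the
  class of -w. The sign is forced by the choice of standard triangles above.
\<close>

definition image_triangle :: "('o, 'm, 'z) addcat_scheme \<Rightarrow> ('m \<times> 'm) set \<Rightarrow> ('o, 'm) envelope \<Rightarrow>
    'm \<times> 'm \<Rightarrow> 'm set \<times> 'm set \<times> 'm set" where
  "image_triangle C S J = (\<lambda>(i, p). THE T. \<exists>X Y Z u w.
     i \<in> Hom C X Y \<and> p \<in> Hom C Y Z \<and> u \<in> Hom C Y (Env J X) \<and> w \<in> Hom C Z (Cosyz J X) \<and>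
     u \<cdot>\<^bsub>C\<^esub> i = into J X \<and> w \<cdot>\<^bsub>C\<^esub> p = onto J X \<cdot>\<^bsub>C\<^esub> u \<and>
     T = (stable_functor C S i, stable_functor C S p, stable_functor C S (neg C Z (Cosyz J X) w)))"

definition rel_sequences :: "('o, 'm, 'z) addcat_scheme \<Rightarrow> ('m \<times> 'm) set \<Rightarrow> ('o, 'm) envelope \<Rightarrow>
    ('m set \<times> 'm set \<times> 'm set) set \<Rightarrow> ('m \<times> 'm) set" where
  "rel_sequences C S J E = {s \<in> S. image_triangle C S J s \<in> E}"


section \<open>The relative stable category of a Frobenius class of triangles\<close>

record ('o, 'm) tri_envelope = "('o, 'm) envelope" +
  bdry :: "'o \<Rightarrow> 'm"

definition class_envelope :: "('o, 'm, 'z) tricat_scheme \<Rightarrow> ('m \<times> 'm \<times> 'm) set \<Rightarrow>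
    ('o, 'm) tri_envelope \<Rightarrow> bool" where
  "class_envelope K E R \<longleftrightarrow> (\<forall>X\<in>Ob K. Env R X \<in> tri_inj K E \<and>
     is_cand K X (Env R X) (Cosyz R X) (into R X, onto R X, bdry R X) \<and>
     tri_mono E (into R X) \<and> (into R X, onto R X, bdry R X) \<in> Dist K)"

definition rel_functor :: "('o, 'm, 'z) tricat_scheme \<Rightarrow> ('m \<times> 'm \<times> 'm) set \<Rightarrow> 'm \<Rightarrow> 'm set" where
  "rel_functor K E f = qcls K (tri_proj K E) f"

definition rel_suscat :: "('o, 'm, 'z) tricat_scheme \<Rightarrow> ('m \<times> 'm \<times> 'm) set \<Rightarrow>
    ('o, 'm) tri_envelope \<Rightarrow> ('o, 'm set) suscat" where
  "rel_suscat K E R = addcat.extend (quot_cat K (tri_proj K E)) (suscat.fields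
     (Cosyz R)
     (\<lambda>F. \<Union>{rel_functor K E f' | f' f X Y e. f \<in> F \<and> f \<in> Hom K X Y \<and>
        tri_mor K (into R X, onto R X, bdry R X) (into R Y, onto R Y, bdry R Y) (f, e, f')}))"

text \<open>
  Beligiannis' standard triangles: (f, k, id) is a morphism of triangles from X \<open>\<rightarrow>\<close> \<open>Env X\<close> \<open>\<rightarrow>\<close>
  \<open>Cosyz X\<close> to (g, h, d) whose left square is a homotopy pushout.
\<close>

definition rel_std :: "('o, 'm, 'z) tricat_scheme \<Rightarrow> ('m \<times> 'm \<times> 'm) set \<Rightarrow>
    ('o, 'm) tri_envelope \<Rightarrow> ('m set \<times> 'm set \<times> 'm set) set" where
  "rel_std K E R = {(rel_functor K E f, rel_functor K E g, rel_functor K E h) | f g h.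
     \<exists>X Y Z k d. f \<in> Hom K X Y \<and> is_cand K Y Z (Cosyz R X) (g, h, d) \<and> (g, h, d) \<in> Dist K \<and>
       hcart K (into R X) f g k \<and>
       tri_mor K (into R X, onto R X, bdry R X) (g, h, d) (f, k, Ide K (Cosyz R X))}"

definition rel_stable_cat :: "('o, 'm, 'z) tricat_scheme \<Rightarrow> ('m \<times> 'm \<times> 'm) set \<Rightarrow>
    ('o, 'm) tri_envelope \<Rightarrow> ('o, 'm set) tricat" where
  "rel_stable_cat K E R = suscat.extend (rel_suscat K E R) (tricat.fields
     {T. \<exists>T0\<in>rel_std K E R. tri_iso (rel_suscat K E R) T0 T})"


section \<open>Triangulated equivalences\<close>

definition is_functor :: "('o, 'm, 'z) addcat_scheme \<Rightarrow> ('p, 'n, 'y) addcat_scheme \<Rightarrow>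
    ('o \<Rightarrow> 'p) \<Rightarrow> ('m \<Rightarrow> 'n) \<Rightarrow> bool" where
  "is_functor C D FO FM \<longleftrightarrow>
     (\<forall>x\<in>Ob C. FO x \<in> Ob D) \<and>
     (\<forall>x y. \<forall>f\<in>Hom C x y. FM f \<in> Hom D (FO x) (FO y)) \<and>
     (\<forall>x\<in>Ob C. FM (Ide C x) = Ide D (FO x)) \<and>
     (\<forall>x y z. \<forall>f\<in>Hom C x y. \<forall>g\<in>Hom C y z. FM (g \<cdot>\<^bsub>C\<^esub> f) = FM g \<cdot>\<^bsub>D\<^esub> FM f)"

definition is_additive_functor :: "('o, 'm, 'z) addcat_scheme \<Rightarrow> ('p, 'n, 'y) addcat_scheme \<Rightarrow>
    ('o \<Rightarrow> 'p) \<Rightarrow> ('m \<Rightarrow> 'n) \<Rightarrow> bool" where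
  "is_additive_functor C D FO FM \<longleftrightarrow> is_functor C D FO FM \<and>
     (\<forall>x y. \<forall>f\<in>Hom C x y. \<forall>g\<in>Hom C x y. FM (f \<boxplus>\<^bsub>C\<^esub> g) = FM f \<boxplus>\<^bsub>D\<^esub> FM g)"

definition is_natural_iso :: "('o, 'm, 'z) addcat_scheme \<Rightarrow> ('p, 'n, 'y) addcat_scheme \<Rightarrow>
    ('o \<Rightarrow> 'p) \<Rightarrow> ('m \<Rightarrow> 'n) \<Rightarrow> ('o \<Rightarrow> 'p) \<Rightarrow> ('m \<Rightarrow> 'n) \<Rightarrow> ('o \<Rightarrow> 'n) \<Rightarrow> bool" where
  "is_natural_iso C D FO FM GO GM \<eta> \<longleftrightarrow>
     (\<forall>x\<in>Ob C. \<eta> x \<in> Hom D (FO x) (GO x) \<and> is_iso D (\<eta> x)) \<and>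
     (\<forall>x y. \<forall>f\<in>Hom C x y. \<eta> y \<cdot>\<^bsub>D\<^esub> FM f = GM f \<cdot>\<^bsub>D\<^esub> \<eta> x)"

definition is_equivalence :: "('o, 'm, 'z) addcat_scheme \<Rightarrow> ('p, 'n, 'y) addcat_scheme \<Rightarrow>
    ('o \<Rightarrow> 'p) \<Rightarrow> ('m \<Rightarrow> 'n) \<Rightarrow> bool" where
  "is_equivalence C D FO FM \<longleftrightarrow> is_functor C D FO FM \<and>
     (\<exists>GO GM \<eta> \<epsilon>. is_functor D C GO GM \<and>
        is_natural_iso C C id id (GO \<circ> FO) (GM \<circ> FM) \<eta> \<and>
        is_natural_iso D D (FO \<circ> GO) (FM \<circ> GM) id id \<epsilon>)"

text \<open>
  An additive equivalence commuting with the suspensions up to a natural isomorphism \<open>\<xi>\<close> and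
  identifying the distinguished triangles. (That distinguished triangles are also reflected is
  automatic for an exact equivalence between triangulated categories.)
\<close>

definition is_tri_equivalence :: "('o, 'm, 'z) tricat_scheme \<Rightarrow> ('p, 'n, 'y) tricat_scheme \<Rightarrow>
    ('o \<Rightarrow> 'p) \<Rightarrow> ('m \<Rightarrow> 'n) \<Rightarrow> bool" where
  "is_tri_equivalence C D FO FM \<longleftrightarrow> is_additive_functor C D FO FM \<and> is_equivalence C D FO FM \<and>
     (\<exists>\<xi>. is_natural_iso C D (FO \<circ> SusO C) (FM \<circ> SusM C) (SusO D \<circ> FO) (SusM D \<circ> FM) \<xi> \<and>
        (\<forall>X Y Z f g h. is_cand C X Y Z (f, g, h) \<longrightarrow>
           ((f, g, h) \<in> Dist C \<longleftrightarrow> (FM f, FM g, \<xi> X \<cdot>\<^bsub>D\<^esub> FM h) \<in> Dist D)))"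

end

theory Submission
  imports Defs
begin

text \<open>
  Let \<open>\<pi>\<close> be the passage from a Frobenius category C to its stable category. The proof rests on a
  dictionary between distinguished triangles and conflations (admissible sequences) of C. Every
  distinguished triangle is isomorphic to the image triangle of a conflation (\<open>dist_realize\<close>), and
  a square between image triangles that commutes stably lifts to a morphism of conflations after
  changing a representative by a map through a projective-injective object (\<open>fill_right\<close>,
  \<open>fill_left\<close>, \<open>fill_middle\<close>). Fill-ins of isomorphisms are isomorphisms, because an endomorphism of
  a conflation with two stably trivial components is unipotent in the third (\<open>endo_iso\<close>). So
  those properties of a triangulated category that the proof uses (fill-ins, weak kernels, homotopy
  cartesian squares) come directly from C.

  For the exact structure, a distinguished triangle belongs to the class E as soon as its first or
  its second map is one of an E-triangle. An E-monomorphism into an E-injective object becomes an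
  inflation when an envelope, which is stably zero, is added to its target; hence C has enough
  relative injectives and, dually, projectives (\<open>enough_SE_inj\<close>, \<open>enough_SE_proj\<close>). Comparing a
  conflation with such a hull of its first object, by a morphism which is the identity there, gives a
  bicartesian and thus homotopy cartesian square. Closure of the E-epimorphisms under
  homotopy pullback then shows that a conflation is relative if and only if maps from its first object
  to E-injectives extend (\<open>SE_extend\<close>, \<open>SE_of_extend\<close>); dually for lifts of maps from E-projectives.
  With these two criteria the axioms of an exact category and the Frobenius property are formal.

  For the stable categories, a map of C factors through an E-projective object if and only if its
  stable class does, as the projective-injectives of C are E-projective. Hence the functor
  \<open>\<Theta>\<close> that is the identity on objects and sends the class of f to the class of \<open>\<pi> f\<close> is fully
  faithful. The suspensions are compared by maps between the cosyzygies of the two chosen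
  envelopes: maps into such a cosyzygy are determined, modulo E-projectives, by their composite with
  the boundary of the envelope triangle (\<open>middle_PE_unique\<close>), and this gives both the isomorphism
  \<open>\<xi>\<close> and its naturality. Finally, the standard triangle of a map f: X \<open>\<rightarrow>\<close> Y is, on either side, given by a
  distinguished triangle of the stable category that starts at Y and whose third map is the
  suspension of f composed with the boundary of X. The comparison of boundaries therefore extends
  to a comparison of standard triangles, invertible modulo E-projectives by another unipotency
  argument (\<open>std_rel_iso\<close>). Since \<open>\<Theta>\<close> is fully faithful, distinguished triangles are preserved and
  reflected.
\<close>

section \<open>Arithmetic in additive categories\<close>

text \<open>
  A morphism determines its source and target, so statements in Hom-sets can be replaced by the
  three facts \<open>Arr\<close>, \<open>Dom\<close> and \<open>Cod\<close>. In this form typing conditions are equations that the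
  simplifier discharges, and the laws of an additive category become conditional rewrite rules.
\<close>

definition Arr :: "('o, 'm, 'z) addcat_scheme \<Rightarrow> 'm \<Rightarrow> bool" where
  "Arr C f \<longleftrightarrow> (\<exists>x y. f \<in> Hom C x y)"

definition Dom :: "('o, 'm, 'z) addcat_scheme \<Rightarrow> 'm \<Rightarrow> 'o" where
  "Dom C f = (THE x. \<exists>y. f \<in> Hom C x y)"

definition Cod :: "('o, 'm, 'z) addcat_scheme \<Rightarrow> 'm \<Rightarrow> 'o" where
  "Cod C f = (THE y. \<exists>x. f \<in> Hom C x y)"

text \<open>
  Source and target are read off the second argument, so that no objects have to be supplied.
\<close>

definition diff :: "('o, 'm, 'z) addcat_scheme \<Rightarrow> 'm \<Rightarrow> 'm \<Rightarrow> 'm" (infixl "\<boxminus>\<index>" 65) where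
  "f \<boxminus>\<^bsub>C\<^esub> g = f \<boxplus>\<^bsub>C\<^esub> neg C (Dom C g) (Cod C g) g"

lemma hom_group_simps:
  "carrier (hom_group C x y) = Hom C x y" "(\<otimes>\<^bsub>hom_group C x y\<^esub>) = Add C" "\<one>\<^bsub>hom_group C x y\<^esub> = Zero C x y"
  by (simp_all add: hom_group_def)

context category
begin

lemma homD:
  assumes "f \<in> Hom C x y"
  shows "Arr C f \<and> Dom C f = x \<and> Cod C f = y \<and> x \<in> Ob C \<and> y \<in> Ob C"
proof -
  have "Dom C f = x" unfolding Dom_def by (rule the_equality) (use assms hom_disjoint in blast)+
  moreover have "Cod C f = y" unfolding Cod_def by (rule the_equality) (use assms hom_disjoint in blast)+
  ultimately show ?thesis using assms hom_ob[OF assms] unfolding Arr_def by blast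
qed

lemma Arr_hom: "Arr C f \<Longrightarrow> f \<in> Hom C (Dom C f) (Cod C f)"
  using homD unfolding Arr_def by blast

lemma hom_iff: "f \<in> Hom C x y \<longleftrightarrow> Arr C f \<and> Dom C f = x \<and> Cod C f = y"
  using homD Arr_hom by blast

lemma Arr_Ob [simp]: "Arr C f \<Longrightarrow> Dom C f \<in> Ob C" "Arr C f \<Longrightarrow> Cod C f \<in> Ob C"
  using homD Arr_hom by blast+

lemma Arr_Ide [simp]:
  "x \<in> Ob C \<Longrightarrow> Arr C (Ide C x)" "x \<in> Ob C \<Longrightarrow> Dom C (Ide C x) = x" "x \<in> Ob C \<Longrightarrow> Cod C (Ide C x) = x"
  using ide_hom homD by blast+

lemma Arr_comp [simp]:
  assumes "Arr C f" "Arr C g" "Cod C f = Dom C g"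
  shows "Arr C (g \<cdot> f)" "Dom C (g \<cdot> f) = Dom C f" "Cod C (g \<cdot> f) = Cod C g"
  using comp_hom[of f "Dom C f" "Cod C f" g "Cod C g"] assms Arr_hom homD by metis+

lemma comp_assoc' [simp]:
  assumes "Arr C f" "Arr C g" "Arr C h" "Cod C f = Dom C g" "Cod C g = Dom C h"
  shows "(h \<cdot> g) \<cdot> f = h \<cdot> (g \<cdot> f)"
  using comp_assoc assms Arr_hom by metis

lemma comp_Ide [simp]:
  assumes "Arr C f"
  shows "Dom C f = x \<Longrightarrow> f \<cdot> Ide C x = f" "Cod C f = x \<Longrightarrow> Ide C x \<cdot> f = f"
  using comp_ide ide_comp Arr_hom[OF assms] by blast+

lemma comp_Ide_left [simp]:
  assumes "Arr C f" "Arr C g" "Cod C f = Dom C g" "Dom C g = x"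
  shows "g \<cdot> (Ide C x \<cdot> f) = g \<cdot> f"
  using assms by simp

text \<open>
  Compositions are normalised by bracketing to the right. An equation for \<open>k \<cdot> i\<close> therefore has to be
  applied inside \<open>k \<cdot> (i \<cdot> x)\<close>; this rule produces the corresponding rewrite rule.
\<close>

lemma rewrite_under:
  assumes "k \<cdot> i = h" "Arr C x" "Arr C i" "Arr C k" "Cod C i = Dom C k" "Cod C x = Dom C i"
  shows "k \<cdot> (i \<cdot> x) = h \<cdot> x"
  using comp_assoc'[of x i k] assms by simp

lemma iso_cancel:
  assumes f: "is_iso C f" "f \<in> Hom C y z" and u: "u \<in> Hom C x y" "v \<in> Hom C x y" "f \<cdot> u = f \<cdot> v"
  shows "u = v"
proof -
  obtain k x' y' where k: "f \<in> Hom C x' y'" "k \<in> Hom C y' x'" "k \<cdot> f = Ide C x'" using f(1) unfolding is_iso_def by blast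
  have [simp]: "x' = y" "y' = z" using hom_disjoint[OF k(1) f(2)] by blast+
  have k': "k \<in> Hom C z y" "k \<cdot> f = Ide C y" using k by simp_all
  have "(k \<cdot> f) \<cdot> u = (k \<cdot> f) \<cdot> v"
    unfolding comp_assoc[OF u(1) f(2) k'(1), symmetric] comp_assoc[OF u(2) f(2) k'(1), symmetric] u(3) ..
  then show ?thesis unfolding k'(2) ide_comp[OF u(1)] ide_comp[OF u(2)] .
qed

end

context additive_category
begin

lemma add_hom:
  assumes "f \<in> Hom C x y" "g \<in> Hom C x y" shows "f \<boxplus> g \<in> Hom C x y"
proof -
  interpret G: comm_group "hom_group C x y" using hom_comm_group homD[OF assms(1)] by blast
  show ?thesis using G.m_closed assms unfolding hom_group_simps by blast
qed

lemma Arr_add [simp]: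
  assumes "Arr C f" "Arr C g" "Dom C f = Dom C g" "Cod C f = Cod C g"
  shows "Arr C (f \<boxplus> g)" "Dom C (f \<boxplus> g) = Dom C g" "Cod C (f \<boxplus> g) = Cod C g"
  using add_hom[of f "Dom C g" "Cod C g" g] Arr_hom[of f] Arr_hom[of g] assms homD by metis+

lemma Arr_Zero [simp]:
  assumes "x \<in> Ob C" "y \<in> Ob C"
  shows "Arr C (Zero C x y)" "Dom C (Zero C x y) = x" "Cod C (Zero C x y) = y"
proof -
  interpret G: comm_group "hom_group C x y" using hom_comm_group assms by blast
  have "Zero C x y \<in> Hom C x y" using G.one_closed unfolding hom_group_simps by blast
  then show "Arr C (Zero C x y)" "Dom C (Zero C x y) = x" "Cod C (Zero C x y) = y" using homD by blast+
qed

lemma Arr_neg [simp]: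
  assumes "Arr C f" "Dom C f = x" "Cod C f = y"
  shows "Arr C (neg C x y f)" "Dom C (neg C x y f) = x" "Cod C (neg C x y f) = y"
proof -
  interpret G: comm_group "hom_group C x y" using hom_comm_group assms by auto
  have "neg C x y f \<in> Hom C x y" using G.inv_closed Arr_hom[OF assms(1)] assms
    unfolding hom_group_simps neg_def by blast
  then show "Arr C (neg C x y f)" "Dom C (neg C x y f) = x" "Cod C (neg C x y f) = y" using homD by blast+
qed

lemma Arr_diff [simp]:
  assumes "Arr C f" "Arr C g" "Dom C f = Dom C g" "Cod C f = Cod C g"
  shows "Arr C (f \<boxminus> g)" "Dom C (f \<boxminus> g) = Dom C g" "Cod C (f \<boxminus> g) = Cod C g"
  using assms by (simp_all add: diff_def)

lemma add_assoc:
  assumes "Arr C f" "Arr C g" "Arr C h" "Dom C f = Dom C g" "Cod C f = Cod C g" "Dom C g = Dom C h" "Cod C g = Cod C h"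
  shows "f \<boxplus> g \<boxplus> h = f \<boxplus> (g \<boxplus> h)"
proof -
  interpret G: comm_group "hom_group C (Dom C h) (Cod C h)" using hom_comm_group assms by auto
  show ?thesis using G.m_assoc[of f g h] assms Arr_hom[of f] Arr_hom[of g] Arr_hom[of h] unfolding hom_group_simps by auto
qed

lemma add_comm:
  assumes "Arr C f" "Arr C g" "Dom C f = Dom C g" "Cod C f = Cod C g"
  shows "f \<boxplus> g = g \<boxplus> f"
proof -
  interpret G: comm_group "hom_group C (Dom C g) (Cod C g)" using hom_comm_group assms by auto
  show ?thesis using G.m_comm[of f g] assms Arr_hom[of f] Arr_hom[of g] unfolding hom_group_simps by auto
qed

lemma add_left_comm:
  assumes "Arr C f" "Arr C g" "Arr C h" "Dom C f = Dom C g" "Cod C f = Cod C g" "Dom C g = Dom C h" "Cod C g = Cod C h"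
  shows "f \<boxplus> (g \<boxplus> h) = g \<boxplus> (f \<boxplus> h)"
  using add_assoc[of f g h] add_assoc[of g f h] add_comm[of f g] assms by simp

lemmas add_ac = add_assoc add_comm add_left_comm

lemma add_Zero [simp]:
  assumes "Arr C f" "Dom C f = x" "Cod C f = y"
  shows "f \<boxplus> Zero C x y = f" "Zero C x y \<boxplus> f = f"
proof -
  interpret G: comm_group "hom_group C x y" using hom_comm_group assms by auto
  show "f \<boxplus> Zero C x y = f" "Zero C x y \<boxplus> f = f"
    using G.r_one[of f] G.l_one[of f] assms Arr_hom[of f] unfolding hom_group_simps by auto
qed

lemma add_neg [simp]:
  assumes "Arr C f" "Dom C f = x" "Cod C f = y"
  shows "f \<boxplus> neg C x y f = Zero C x y" "neg C x y f \<boxplus> f = Zero C x y"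
proof -
  interpret G: comm_group "hom_group C x y" using hom_comm_group assms by auto
  show "f \<boxplus> neg C x y f = Zero C x y" "neg C x y f \<boxplus> f = Zero C x y"
    using G.r_inv[of f] G.l_inv[of f] assms Arr_hom[of f] unfolding hom_group_simps neg_def by auto
qed

lemma diff_self [simp]: "Arr C f \<Longrightarrow> f \<boxminus> f = Zero C (Dom C f) (Cod C f)"
  by (simp add: diff_def)

lemma add_right_cancel:
  assumes "Arr C f" "Arr C g" "Arr C h" "Dom C f = Dom C g" "Cod C f = Cod C g" "Dom C g = Dom C h" "Cod C g = Cod C h"
  shows "f \<boxplus> h = g \<boxplus> h \<longleftrightarrow> f = g"
proof
  let ?n = "neg C (Dom C h) (Cod C h) h"
  have n: "Arr C ?n" "Dom C ?n = Dom C h" "Cod C ?n = Cod C h" "h \<boxplus> ?n = Zero C (Dom C h) (Cod C h)"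
    using assms(3) by simp_all
  have "f \<boxplus> h \<boxplus> ?n = f" "g \<boxplus> h \<boxplus> ?n = g"
    using add_assoc[of f h ?n] add_assoc[of g h ?n] n assms by simp_all
  then show "f = g" if "f \<boxplus> h = g \<boxplus> h" using that by metis
qed simp

lemma diff_add [simp]:
  assumes "Arr C f" "Arr C g" "Dom C f = Dom C g" "Cod C f = Cod C g"
  shows "f \<boxminus> g \<boxplus> g = f"
  using add_assoc[of f "neg C (Dom C g) (Cod C g) g" g] assms by (simp add: diff_def)

lemma add_diff [simp]:
  assumes "Arr C f" "Arr C g" "Dom C f = Dom C g" "Cod C f = Cod C g"
  shows "f \<boxplus> g \<boxminus> g = f"
  using add_assoc[of f g "neg C (Dom C g) (Cod C g) g"] assms by (simp add: diff_def)

lemma diff_eq_iff: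
  assumes "Arr C f" "Arr C g" "Arr C h" "Dom C f = Dom C g" "Cod C f = Cod C g" "Dom C g = Dom C h" "Cod C g = Cod C h"
  shows "f \<boxminus> g = h \<longleftrightarrow> f = h \<boxplus> g"
proof -
  have "f \<boxminus> g \<boxplus> g = f" "h \<boxplus> g \<boxminus> g = h" using assms by simp_all
  then show ?thesis by metis
qed

lemma diff_eq_Zero:
  assumes "Arr C f" "Arr C g" "Dom C f = Dom C g" "Cod C f = Cod C g" "Dom C g = x" "Cod C g = y"
  shows "f \<boxminus> g = Zero C x y \<longleftrightarrow> f = g"
proof -
  have "x \<in> Ob C" "y \<in> Ob C" using assms(2,5,6) by (metis Arr_Ob)+
  then have "f \<boxminus> g = Zero C x y \<longleftrightarrow> f = Zero C x y \<boxplus> g" by (intro diff_eq_iff) (use assms in simp_all)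
  then show ?thesis using assms by simp
qed

lemma add_Zero_unique:
  assumes "Arr C f" "Arr C g" "Dom C f = Dom C g" "Cod C f = Cod C g" "f \<boxplus> g = g"
  shows "f = Zero C (Dom C g) (Cod C g)"
  using assms add_right_cancel[of f "Zero C (Dom C g) (Cod C g)" g] by simp

lemma comp_distrib [simp]:
  assumes "Arr C f" "Arr C f'" "Arr C g" "Dom C f = Dom C f'" "Cod C f = Cod C f'" "Cod C f' = Dom C g"
  shows "g \<cdot> (f \<boxplus> f') = g \<cdot> f \<boxplus> g \<cdot> f'"
  using comp_add[of f "Dom C f'" "Dom C g" f' g "Cod C g"] assms Arr_hom[of f] Arr_hom[of f'] Arr_hom[of g] by auto

lemma distrib_comp [simp]:
  assumes "Arr C f" "Arr C g" "Arr C g'" "Dom C g = Dom C g'" "Cod C g = Cod C g'" "Cod C f = Dom C g'"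
  shows "(g \<boxplus> g') \<cdot> f = g \<cdot> f \<boxplus> g' \<cdot> f"
  using add_comp[of f "Dom C f" "Dom C g'" g "Cod C g'" g'] assms Arr_hom[of f] Arr_hom[of g] Arr_hom[of g'] by auto

lemma comp_Zero [simp]:
  assumes "Arr C g" "Dom C g = y" "x \<in> Ob C"
  shows "g \<cdot> Zero C x y = Zero C x (Cod C g)"
proof -
  have y: "y \<in> Ob C" using assms by auto
  have "g \<cdot> Zero C x y \<boxplus> g \<cdot> Zero C x y = g \<cdot> Zero C x y"
    using comp_distrib[of "Zero C x y" "Zero C x y" g] assms y by simp
  then show ?thesis using add_Zero_unique[of "g \<cdot> Zero C x y" "g \<cdot> Zero C x y"] assms y by simp
qed

lemma Zero_comp [simp]:
  assumes "Arr C f" "Cod C f = x" "y \<in> Ob C"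
  shows "Zero C x y \<cdot> f = Zero C (Dom C f) y"
proof -
  have x: "x \<in> Ob C" using assms by auto
  have "Zero C x y \<cdot> f \<boxplus> Zero C x y \<cdot> f = Zero C x y \<cdot> f"
    using distrib_comp[of f "Zero C x y" "Zero C x y"] assms x by simp
  then show ?thesis using add_Zero_unique[of "Zero C x y \<cdot> f" "Zero C x y \<cdot> f"] assms x by simp
qed

lemma neg_unique:
  assumes "Arr C f" "Arr C g" "Dom C f = x" "Cod C f = y" "Dom C g = x" "Cod C g = y" "g \<boxplus> f = Zero C x y"
  shows "g = neg C x y f"
  using add_right_cancel[of g "neg C x y f" f] assms by simp

lemma comp_neg [simp]:
  assumes "Arr C f" "Arr C g" "Dom C f = x" "Cod C f = y" "Cod C f = Dom C g"
  shows "g \<cdot> neg C x y f = neg C x (Cod C g) (g \<cdot> f)"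
proof (rule neg_unique)
  have "x \<in> Ob C" using assms by auto
  then show "g \<cdot> neg C x y f \<boxplus> g \<cdot> f = Zero C x (Cod C g)"
    using assms comp_distrib[of "neg C x y f" f g] by simp
qed (use assms in simp_all)

lemma neg_comp [simp]:
  assumes "Arr C f" "Arr C g" "Dom C g = x" "Cod C g = y" "Cod C f = Dom C g"
  shows "neg C x y g \<cdot> f = neg C (Dom C f) y (g \<cdot> f)"
proof (rule neg_unique)
  have "y \<in> Ob C" using assms by auto
  then show "neg C x y g \<cdot> f \<boxplus> g \<cdot> f = Zero C (Dom C f) y"
    using assms distrib_comp[of f "neg C x y g" g] by simp
qed (use assms in simp_all)

lemma neg_neg [simp]:
  assumes "Arr C f" "Dom C f = x" "Cod C f = y"
  shows "neg C x y (neg C x y f) = f"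
  by (rule neg_unique[symmetric]) (use assms in simp_all)

lemma neg_add [simp]:
  assumes "Arr C f" "Arr C g" "Dom C f = x" "Cod C f = y" "Dom C g = x" "Cod C g = y"
  shows "neg C x y (f \<boxplus> g) = neg C x y f \<boxplus> neg C x y g"
proof (rule neg_unique[symmetric])
  have "neg C x y f \<boxplus> neg C x y g \<boxplus> (f \<boxplus> g) = (neg C x y f \<boxplus> f) \<boxplus> (neg C x y g \<boxplus> g)"
    using assms by (simp only: add_ac Arr_neg Arr_add)
  also have "\<dots> = Zero C x y" using assms by auto
  finally show "neg C x y f \<boxplus> neg C x y g \<boxplus> (f \<boxplus> g) = Zero C x y" .
qed (use assms in simp_all)

lemma neg_Zero [simp]: "x \<in> Ob C \<Longrightarrow> y \<in> Ob C \<Longrightarrow> neg C x y (Zero C x y) = Zero C x y"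
  by (rule neg_unique[symmetric]) simp_all

lemma neg_eq_Zero [simp]:
  assumes "Arr C f" "Dom C f = x" "Cod C f = y"
  shows "neg C x y f = Zero C x y \<longleftrightarrow> f = Zero C x y"
  using assms neg_neg[OF assms] neg_Zero by (metis Arr_Ob)

lemma comp_diff [simp]:
  assumes "Arr C f" "Arr C f'" "Arr C g" "Dom C f = Dom C f'" "Cod C f = Cod C f'" "Cod C f' = Dom C g"
  shows "g \<cdot> (f \<boxminus> f') = g \<cdot> f \<boxminus> g \<cdot> f'"
  using assms by (simp add: diff_def)

lemma diff_comp [simp]:
  assumes "Arr C f" "Arr C g" "Arr C g'" "Dom C g = Dom C g'" "Cod C g = Cod C g'" "Cod C f = Dom C g'"
  shows "(g \<boxminus> g') \<cdot> f = g \<cdot> f \<boxminus> g' \<cdot> f"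
  using assms by (simp add: diff_def)

lemma diff_Zero [simp]: "Arr C f \<Longrightarrow> Dom C f = x \<Longrightarrow> Cod C f = y \<Longrightarrow> f \<boxminus> Zero C x y = f"
proof -
  assume a: "Arr C f" "Dom C f = x" "Cod C f = y"
  then have "x \<in> Ob C" "y \<in> Ob C" by (metis Arr_Ob)+
  then show ?thesis using a by (simp add: diff_def)
qed

lemma diff_hom: "f \<in> Hom C x y \<Longrightarrow> g \<in> Hom C x y \<Longrightarrow> f \<boxminus> g \<in> Hom C x y"
  unfolding hom_iff by simp

lemma Zero_hom: "x \<in> Ob C \<Longrightarrow> y \<in> Ob C \<Longrightarrow> Zero C x y \<in> Hom C x y"
  unfolding hom_iff by simp

lemma isoE:
  assumes "is_iso C f" "f \<in> Hom C x y"
  obtains g where "g \<in> Hom C y x" "g \<cdot> f = Ide C x" "f \<cdot> g = Ide C y" "is_iso C g"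
proof -
  obtain x' y' g where g: "f \<in> Hom C x' y'" "g \<in> Hom C y' x'" "g \<cdot> f = Ide C x'" "f \<cdot> g = Ide C y'"
    using assms(1) unfolding is_iso_def by blast
  have "x' = x" "y' = y" using hom_disjoint[OF g(1) assms(2)] by blast+
  then show ?thesis using that[of g] g unfolding is_iso_def by blast
qed

lemma isoI: "f \<in> Hom C x y \<Longrightarrow> g \<in> Hom C y x \<Longrightarrow> g \<cdot> f = Ide C x \<Longrightarrow> f \<cdot> g = Ide C y \<Longrightarrow> is_iso C f"
  unfolding is_iso_def by blast

lemma iso_Ide: "x \<in> Ob C \<Longrightarrow> is_iso C (Ide C x)"
  by (rule isoI[of _ x x "Ide C x"]) (simp_all add: hom_iff)

lemma iso_comp:
  assumes "is_iso C f" "is_iso C g" "f \<in> Hom C x y" "g \<in> Hom C y z"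
  shows "is_iso C (g \<cdot> f)"
proof -
  obtain f' where f': "f' \<in> Hom C y x" "f' \<cdot> f = Ide C x" "f \<cdot> f' = Ide C y" using isoE[OF assms(1,3)] .
  obtain g' where g': "g' \<in> Hom C z y" "g' \<cdot> g = Ide C y" "g \<cdot> g' = Ide C z" using isoE[OF assms(2,4)] .
  note [simp] = assms(3,4)[THEN homD] homD[OF f'(1)] homD[OF g'(1)] f'(2,3) g'(2,3)
    f'(2,3)[THEN rewrite_under] g'(2,3)[THEN rewrite_under]
  show ?thesis
    by (rule isoI[of _ x z "f' \<cdot> g'"]) (simp_all add: hom_iff)
qed

lemma iso_comp3:
  assumes "is_iso C f" "is_iso C g" "is_iso C h" "f \<in> Hom C w x" "g \<in> Hom C x y" "h \<in> Hom C y z"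
  shows "is_iso C (h \<cdot> (g \<cdot> f))"
  using iso_comp[OF iso_comp[OF assms(1,2,4,5)] assms(3) comp_hom[OF assms(4,5)] assms(6)] .

lemma iso_of_left_right:
  assumes "f \<in> Hom C x y" "g \<in> Hom C y x" "h \<in> Hom C y x" "g \<cdot> f = Ide C x" "f \<cdot> h = Ide C y"
  shows "is_iso C f"
proof -
  note [simp] = assms(1-3)[THEN homD]
  have "g \<cdot> f \<cdot> h = h" using assms(4) by (simp del: comp_assoc')
  then have "g = h" using assms(5) by simp
  then show ?thesis using isoI[OF assms(1,2,4)] assms(5) by blast
qed

lemma biproductD:
  assumes "is_biproduct C a b s i1 i2 p1 p2"
  shows "i1 \<in> Hom C a s" "i2 \<in> Hom C b s" "p1 \<in> Hom C s a" "p2 \<in> Hom C s b"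
    "p1 \<cdot> i1 = Ide C a" "p2 \<cdot> i2 = Ide C b" "p1 \<cdot> i2 = Zero C b a" "p2 \<cdot> i1 = Zero C a b"
    "i1 \<cdot> p1 \<boxplus> i2 \<cdot> p2 = Ide C s"
  using assms unfolding is_biproduct_def by blast+

lemma biproduct_simps:
  assumes "is_biproduct C a b s i1 i2 p1 p2"
  shows "Arr C i1 \<and> Dom C i1 = a \<and> Cod C i1 = s" "Arr C i2 \<and> Dom C i2 = b \<and> Cod C i2 = s"
    "Arr C p1 \<and> Dom C p1 = s \<and> Cod C p1 = a" "Arr C p2 \<and> Dom C p2 = s \<and> Cod C p2 = b"
    "a \<in> Ob C" "b \<in> Ob C" "s \<in> Ob C"
    "p1 \<cdot> i1 = Ide C a" "p2 \<cdot> i2 = Ide C b" "p1 \<cdot> i2 = Zero C b a" "p2 \<cdot> i1 = Zero C a b"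
    "Arr C x \<Longrightarrow> Cod C x = a \<Longrightarrow> p1 \<cdot> (i1 \<cdot> x) = x" "Arr C x \<Longrightarrow> Cod C x = b \<Longrightarrow> p2 \<cdot> (i2 \<cdot> x) = x"
    "Arr C x \<Longrightarrow> Cod C x = b \<Longrightarrow> p1 \<cdot> (i2 \<cdot> x) = Zero C (Dom C x) a"
    "Arr C x \<Longrightarrow> Cod C x = a \<Longrightarrow> p2 \<cdot> (i1 \<cdot> x) = Zero C (Dom C x) b"
proof -
  note d = biproductD[OF assms]
  note [simp] = d(1-4)[THEN homD] d(5-8)
    d(5-8)[THEN rewrite_under]
  show "Arr C i1 \<and> Dom C i1 = a \<and> Cod C i1 = s" "Arr C i2 \<and> Dom C i2 = b \<and> Cod C i2 = s"
    "Arr C p1 \<and> Dom C p1 = s \<and> Cod C p1 = a" "Arr C p2 \<and> Dom C p2 = s \<and> Cod C p2 = b"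
    "a \<in> Ob C" "b \<in> Ob C" "s \<in> Ob C"
    "p1 \<cdot> i1 = Ide C a" "p2 \<cdot> i2 = Ide C b" "p1 \<cdot> i2 = Zero C b a" "p2 \<cdot> i1 = Zero C a b"
    "Arr C x \<Longrightarrow> Cod C x = a \<Longrightarrow> p1 \<cdot> (i1 \<cdot> x) = x" "Arr C x \<Longrightarrow> Cod C x = b \<Longrightarrow> p2 \<cdot> (i2 \<cdot> x) = x"
    "Arr C x \<Longrightarrow> Cod C x = b \<Longrightarrow> p1 \<cdot> (i2 \<cdot> x) = Zero C (Dom C x) a"
    "Arr C x \<Longrightarrow> Cod C x = a \<Longrightarrow> p2 \<cdot> (i1 \<cdot> x) = Zero C (Dom C x) b"
    by simp_all
qed

lemma biproduct_decomp:
  assumes "is_biproduct C a b s i1 i2 p1 p2"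
  shows "Arr C u \<Longrightarrow> Cod C u = s \<Longrightarrow> i1 \<cdot> (p1 \<cdot> u) \<boxplus> i2 \<cdot> (p2 \<cdot> u) = u"
    "Arr C v \<Longrightarrow> Dom C v = s \<Longrightarrow> v \<cdot> (i1 \<cdot> p1) \<boxplus> v \<cdot> (i2 \<cdot> p2) = v"
proof -
  note [simp] = biproduct_simps[OF assms]
  note d = biproductD(9)[OF assms]
  show "i1 \<cdot> (p1 \<cdot> u) \<boxplus> i2 \<cdot> (p2 \<cdot> u) = u" if "Arr C u" "Cod C u = s"
    using that distrib_comp[of u "i1 \<cdot> p1" "i2 \<cdot> p2"] unfolding d by simp
  show "v \<cdot> (i1 \<cdot> p1) \<boxplus> v \<cdot> (i2 \<cdot> p2) = v" if "Arr C v" "Dom C v = s"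
    using that comp_distrib[of "i1 \<cdot> p1" "i2 \<cdot> p2" v] unfolding d by simp
qed

lemma biproduct_ext:
  assumes "is_biproduct C a b s i1 i2 p1 p2" "u \<in> Hom C t s" "v \<in> Hom C t s" "p1 \<cdot> u = p1 \<cdot> v" "p2 \<cdot> u = p2 \<cdot> v"
  shows "u = v"
proof -
  have "i1 \<cdot> (p1 \<cdot> u) \<boxplus> i2 \<cdot> (p2 \<cdot> u) = u" "i1 \<cdot> (p1 \<cdot> v) \<boxplus> i2 \<cdot> (p2 \<cdot> v) = v"
    using biproduct_decomp(1)[OF assms(1)] assms(2,3)[THEN homD] by blast+
  then show ?thesis unfolding assms(4,5) by (rule trans[OF sym])
qed

lemma biproduct_neg:
  assumes "is_biproduct C a b s i1 i2 p1 p2"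
  shows "is_biproduct C a b s i1 (neg C b s i2) p1 (neg C s b p2)"
  unfolding is_biproduct_def
  using biproductD(9)[OF assms] by (simp add: hom_iff biproduct_simps[OF assms])

lemma add_diff_left [simp]:
  assumes "Arr C f" "Arr C g" "Dom C f = Dom C g" "Cod C f = Cod C g"
  shows "f \<boxplus> (g \<boxminus> f) = g"
  using add_comm[of f "g \<boxminus> f"] assms by simp

lemma add_diff_right [simp]:
  assumes "Arr C f" "Arr C g" "Dom C f = Dom C g" "Cod C f = Cod C g"
  shows "f \<boxplus> g \<boxminus> f = g"
  using add_comm[of f g] assms by simp

text \<open>
  If \<open>f = 1 + n\<close> with \<open>n\<^sup>2 = 0\<close>, then \<open>1 - n\<close> is inverse to \<open>f\<close>.
\<close>

lemma unipotent_iso: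
  assumes f: "f \<in> Hom C x x" and n: "(f \<boxminus> Ide C x) \<cdot> (f \<boxminus> Ide C x) = Zero C x x"
  shows "is_iso C f"
proof -
  define n where "n = f \<boxminus> Ide C x"
  note [simp] = homD[OF f]
  have n': "n \<in> Hom C x x" unfolding n_def by (simp add: hom_iff)
  note [simp] = homD[OF n']
  have nn[simp]: "n \<cdot> n = Zero C x x" using n unfolding n_def .
  have fn: "f = n \<boxplus> Ide C x" unfolding n_def by simp
  have g: "Ide C x \<boxminus> n \<in> Hom C x x" by (simp add: hom_iff)
  have e: "n \<boxplus> (Ide C x \<boxminus> n) = Ide C x" by simp
  show ?thesis unfolding fn
    by (rule isoI[of _ x x "Ide C x \<boxminus> n"]) (simp_all add: hom_iff e)
qed

lemma iso_of_iso_comp: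
  assumes "f \<in> Hom C x y" "g \<in> Hom C y x" "is_iso C (g \<cdot> f)" "is_iso C (f \<cdot> g)"
  shows "is_iso C f"
proof -
  obtain k where k: "k \<in> Hom C x x" "k \<cdot> (g \<cdot> f) = Ide C x" using isoE[OF assms(3) comp_hom[OF assms(1,2)]] .
  obtain l where l: "l \<in> Hom C y y" "(f \<cdot> g) \<cdot> l = Ide C y" using isoE[OF assms(4) comp_hom[OF assms(2,1)]] .
  have "(k \<cdot> g) \<cdot> f = Ide C x" "f \<cdot> (g \<cdot> l) = Ide C y"
    using k l comp_assoc[OF assms(1,2) k(1)] comp_assoc[OF l(1) assms(2,1)] by simp_all
  then show ?thesis by (rule iso_of_left_right[OF assms(1) comp_hom[OF assms(2) k(1)] comp_hom[OF l(1) assms(2)]])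
qed

end

section \<open>The opposite category\<close>

text \<open>
  The opposite of an exact category is exact with the sequences read backwards; statements about
  deflations and kernels thus yield those about inflations and cokernels, and conversely.
\<close>

definition op_cat :: "('o, 'm, 'z) addcat_scheme \<Rightarrow> ('o, 'm, 'z) addcat_scheme" where
  "op_cat C = C\<lparr>Hom := (\<lambda>x y. Hom C y x), Comp := (\<lambda>g f. f \<cdot>\<^bsub>C\<^esub> g), Zero := (\<lambda>x y. Zero C y x)\<rparr>"

lemma op_simps [simp]:
  "Ob (op_cat C) = Ob C" "Hom (op_cat C) x y = Hom C y x" "Ide (op_cat C) = Ide C"
  "Comp (op_cat C) g f = Comp C f g" "Add (op_cat C) = Add C" "Zero (op_cat C) x y = Zero C y x"
  by (simp_all add: op_cat_def)

lemma op_hom_group [simp]: "hom_group (op_cat C) x y = hom_group C y x"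
  by (simp add: hom_group_def)

lemma op_neg [simp]: "neg (op_cat C) x y = neg C y x"
  by (simp add: neg_def fun_eq_iff)

lemma op_op [simp]: "op_cat (op_cat C) = C"
  by (simp add: op_cat_def)

lemma op_zero_object [simp]: "is_zero_object (op_cat C) z \<longleftrightarrow> is_zero_object C z"
  unfolding is_zero_object_def by auto

lemma op_biproduct [simp]:
  "is_biproduct (op_cat C) a b s i1 i2 p1 p2 \<longleftrightarrow> is_biproduct C a b s p1 p2 i1 i2"
  unfolding is_biproduct_def by auto

lemma op_iso [simp]: "is_iso (op_cat C) f \<longleftrightarrow> is_iso C f"
  unfolding is_iso_def by auto

lemma op_kernel [simp]: "is_kernel (op_cat C) i p \<longleftrightarrow> is_cokernel C p i"
  unfolding is_kernel_def is_cokernel_def op_simps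
  by (rule iffI; elim exE conjE; intro exI conjI; assumption)

lemma op_cokernel [simp]: "is_cokernel (op_cat C) i p \<longleftrightarrow> is_kernel C p i"
  using op_kernel[of "op_cat C" p i] by simp

lemma op_pushout [simp]: "is_pushout (op_cat C) f g f' g' \<longleftrightarrow> is_pullback C g' f' g f" (is "?l = ?r")
proof
  assume ?l
  then obtain A B D Q where *: "is_square (op_cat C) A B D Q f g f' g'"
    "\<forall>T\<in>Ob C. \<forall>u\<in>Hom C T D. \<forall>v\<in>Hom C T B. f \<cdot>\<^bsub>C\<^esub> v = g \<cdot>\<^bsub>C\<^esub> u \<longrightarrow>
      (\<exists>!w. w \<in> Hom C T Q \<and> f' \<cdot>\<^bsub>C\<^esub> w = u \<and> g' \<cdot>\<^bsub>C\<^esub> w = v)"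
    unfolding is_pushout_def by auto
  have "is_square C Q B D A g' f' g f" using *(1) unfolding is_square_def by simp
  then show ?r unfolding is_pullback_def using *(2) by (intro exI conjI) (assumption, metis)
next
  assume ?r
  then obtain A B D Q where *: "is_square C A B D Q g' f' g f"
    "\<forall>T\<in>Ob C. \<forall>u\<in>Hom C T B. \<forall>v\<in>Hom C T D. f \<cdot>\<^bsub>C\<^esub> u = g \<cdot>\<^bsub>C\<^esub> v \<longrightarrow>
      (\<exists>!w. w \<in> Hom C T A \<and> g' \<cdot>\<^bsub>C\<^esub> w = u \<and> f' \<cdot>\<^bsub>C\<^esub> w = v)"
    unfolding is_pullback_def by auto
  have sq: "is_square (op_cat C) Q B D A f g f' g'" using *(1) unfolding is_square_def by simp
  show ?l unfolding is_pushout_def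
    by (intro exI conjI, rule sq) (use *(2) in \<open>simp, metis\<close>)
qed

lemma op_pullback [simp]: "is_pullback (op_cat C) f g f' g' \<longleftrightarrow> is_pushout C g' f' g f"
  using op_pushout[of "op_cat C" g' f' g f] by simp

lemma (in category) op_category: "category (op_cat C)"
proof (rule category.intro, goal_cases)
  case (2 f x y x' y') then show ?case using hom_disjoint[of f y x y' x'] by simp
qed (simp_all add: hom_ob ide_hom comp_hom ide_comp comp_ide comp_assoc)

lemma (in additive_category) op_additive: "additive_category (op_cat C)"
proof (intro additive_category.intro additive_category_axioms.intro op_category)
  show "\<exists>s i1 i2 p1 p2. is_biproduct (op_cat C) a b s i1 i2 p1 p2" if ab: "a \<in> Ob (op_cat C)" "b \<in> Ob (op_cat C)" for a b
  proof -
    obtain s i1 i2 p1 p2 where "is_biproduct C a b s i1 i2 p1 p2" using biproducts[of a b] ab unfolding op_simps by blast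
    then have "is_biproduct (op_cat C) a b s p1 p2 i1 i2" by simp
    then show ?thesis by blast
  qed
qed (simp_all add: hom_comm_group comp_add add_comp zero_object)

lemma op_Dom [simp]: "Dom (op_cat C) f = Cod C f" "Cod (op_cat C) f = Dom C f"
  by (simp_all add: Dom_def Cod_def)

lemma op_Arr [simp]: "Arr (op_cat C) f = Arr C f"
  by (auto simp: Arr_def)

lemma op_diff [simp]: "f \<boxminus>\<^bsub>op_cat C\<^esub> g = f \<boxminus>\<^bsub>C\<^esub> g"
  by (simp add: diff_def)

section \<open>Conflations\<close>

lemma ex1_unique: "\<exists>!x. P x \<Longrightarrow> P a \<Longrightarrow> P b \<Longrightarrow> a = b"
  by blast

context exact_category
begin

lemma confE:
  assumes "(i, p) \<in> S"
  obtains x y z where "i \<in> Hom C x y" "p \<in> Hom C y z" "p \<cdot> i = Zero C x z"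
  using ker_coker[OF assms] unfolding is_kernel_def by blast

lemma conf_typed:
  assumes "(i, p) \<in> S" "i \<in> Hom C x y"
  obtains z where "p \<in> Hom C y z"
  using confE[OF assms(1)] assms(2) hom_disjoint by metis

lemma conf_typed':
  assumes "(i, p) \<in> S" "p \<in> Hom C y z"
  obtains x where "i \<in> Hom C x y"
  using confE[OF assms(1)] assms(2) hom_disjoint by metis

lemma conf_zero:
  assumes "(i, p) \<in> S" "i \<in> Hom C x y" "p \<in> Hom C y z"
  shows "p \<cdot> i = Zero C x z"
  using confE[OF assms(1)] assms hom_disjoint by metis

lemma ker_lift_unique:
  assumes "(i, p) \<in> S" "i \<in> Hom C x y" "p \<in> Hom C y z" "u \<in> Hom C t y" "p \<cdot> u = Zero C t z"
  shows "\<exists>!v. v \<in> Hom C t x \<and> i \<cdot> v = u"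
proof -
  obtain x' y' z' where *: "i \<in> Hom C x' y'" "p \<in> Hom C y' z'"
    "\<forall>t\<in>Ob C. \<forall>u\<in>Hom C t y'. p \<cdot> u = Zero C t z' \<longrightarrow> (\<exists>!v. v \<in> Hom C t x' \<and> i \<cdot> v = u)"
    using ker_coker[OF assms(1)] unfolding is_kernel_def by blast
  have "x' = x" "y' = y" "z' = z"
    using hom_disjoint[OF *(1) assms(2)] hom_disjoint[OF *(2) assms(3)] by blast+
  then show ?thesis using *(3) assms(4,5) hom_ob[OF assms(4)] by blast
qed

lemma coker_desc_unique:
  assumes "(i, p) \<in> S" "i \<in> Hom C x y" "p \<in> Hom C y z" "u \<in> Hom C y t" "u \<cdot> i = Zero C x t"
  shows "\<exists>!v. v \<in> Hom C z t \<and> v \<cdot> p = u"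
proof -
  obtain x' y' z' where *: "i \<in> Hom C x' y'" "p \<in> Hom C y' z'"
    "\<forall>t\<in>Ob C. \<forall>u\<in>Hom C y' t. u \<cdot> i = Zero C x' t \<longrightarrow> (\<exists>!v. v \<in> Hom C z' t \<and> v \<cdot> p = u)"
    using ker_coker[OF assms(1)] unfolding is_cokernel_def by blast
  have "x' = x" "y' = y" "z' = z"
    using hom_disjoint[OF *(1) assms(2)] hom_disjoint[OF *(2) assms(3)] by blast+
  then show ?thesis using *(3) assms(4,5) hom_ob[OF assms(4)] by blast
qed

lemma ker_lift:
  assumes "(i, p) \<in> S" "i \<in> Hom C x y" "p \<in> Hom C y z" "u \<in> Hom C t y" "p \<cdot> u = Zero C t z"
  obtains v where "v \<in> Hom C t x" "i \<cdot> v = u"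
  using ker_lift_unique[OF assms] by blast

lemma coker_desc:
  assumes "(i, p) \<in> S" "i \<in> Hom C x y" "p \<in> Hom C y z" "u \<in> Hom C y t" "u \<cdot> i = Zero C x t"
  obtains v where "v \<in> Hom C z t" "v \<cdot> p = u"
  using coker_desc_unique[OF assms] by blast

lemma infl_mono:
  assumes "(i, p) \<in> S" "i \<in> Hom C x y" "u \<in> Hom C t x" "v \<in> Hom C t x" "i \<cdot> u = i \<cdot> v"
  shows "u = v"
proof -
  obtain z where p: "p \<in> Hom C y z" using conf_typed[OF assms(1,2)] .
  note [simp] = assms(2-4)[THEN homD] homD[OF p]
  have "p \<cdot> (i \<cdot> u) = Zero C t z"
    using rewrite_under[OF conf_zero[OF assms(1,2) p], of u] by simp
  then have "\<exists>!w. w \<in> Hom C t x \<and> i \<cdot> w = i \<cdot> u"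
    using ker_lift_unique[OF assms(1,2) p, of "i \<cdot> u" t] by (simp add: hom_iff)
  then show ?thesis using assms(3-5) by metis
qed

lemma defl_epi:
  assumes "(i, p) \<in> S" "p \<in> Hom C y z" "u \<in> Hom C z t" "v \<in> Hom C z t" "u \<cdot> p = v \<cdot> p"
  shows "u = v"
proof -
  obtain x where i: "i \<in> Hom C x y" using conf_typed'[OF assms(1,2)] .
  note [simp] = assms(2-4)[THEN homD] homD[OF i]
  have "(u \<cdot> p) \<cdot> i = Zero C x t"
    by (simp add: conf_zero[OF assms(1) i assms(2)])
  then have "\<exists>!w. w \<in> Hom C z t \<and> w \<cdot> p = u \<cdot> p"
    using coker_desc_unique[OF assms(1) i assms(2), of "u \<cdot> p" t] by (simp add: hom_iff)
  then show ?thesis using assms(3-5) by metis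
qed

lemma op_exact: "exact_category (op_cat C) (S\<inverse>)"
proof -
  have m: "adm_mono (S\<inverse>) = adm_epi S" and e: "adm_epi (S\<inverse>) = adm_mono S"
    unfolding adm_mono_def adm_epi_def by (auto simp: fun_eq_iff)
  interpret O: additive_category "op_cat C" by (rule op_additive)
  show ?thesis
  proof (intro exact_category.intro exact_category_axioms.intro op_additive, goal_cases)
    case (1 i p) then show ?case using ker_coker by simp
  next
    case (2 i p x y z i' x' y' p' z' a b c)
    from 2(9-11) obtain a' b' c' where inv:
      "a' \<in> Hom C x x'" "a \<cdot> a' = Ide C x" "a' \<cdot> a = Ide C x'" "is_iso C a'"
      "b' \<in> Hom C y y'" "b \<cdot> b' = Ide C y" "b' \<cdot> b = Ide C y'" "is_iso C b'"
      "c' \<in> Hom C z z'" "c \<cdot> c' = Ide C z" "c' \<cdot> c = Ide C z'" "is_iso C c'"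
      using isoE[of a x' x] isoE[of b y' y] isoE[of c z' z] 2(6-8) by (simp, metis)
    have h: "i \<in> Hom C y x" "p \<in> Hom C z y" "i' \<in> Hom C y' x'" "p' \<in> Hom C z' y'"
      "a \<in> Hom C x' x" "b \<in> Hom C y' y" "c \<in> Hom C z' z" using 2 by simp_all
    note [simp] = h(1-7)[THEN homD]
      inv(1,5,9)[THEN homD]
      inv(2,3,6,7,10,11) inv(2,3,6,7,10,11)[THEN rewrite_under]
    have e: "i \<cdot> b = a \<cdot> i'" "p \<cdot> c = b \<cdot> p'" using 2 by simp_all
    have "b' \<cdot> (p \<cdot> c) \<cdot> c' = b' \<cdot> (b \<cdot> p') \<cdot> c'" "a' \<cdot> (i \<cdot> b) \<cdot> b' = a' \<cdot> (a \<cdot> i') \<cdot> b'" by (simp_all only: e)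
    then have "b' \<cdot> p = p' \<cdot> c'" "a' \<cdot> i = i' \<cdot> b'" by simp_all
    then have "(p', i') \<in> S"
      using iso_closed[of p i z y x p' z' y' i' x' c' b' a'] 2(1) h inv by simp
    then show ?case by simp
  next
    case (3 x) then show ?case using ide_adm_epi by (simp add: m)
  next
    case (4 x) then show ?case using ide_adm_mono by (simp add: e)
  next
    case (5 i x y j z) then show ?case using comp_adm_epi[of j z y i x] by (simp add: m)
  next
    case (6 i x y j z) then show ?case using comp_adm_mono[of j z y i x] by (simp add: e)
  next
    case (7 i A B a D)
    then obtain p' a' where "is_pullback C a' p' a i" "adm_epi S p'"
      using pullback_adm_epi[of i B A a D] by (auto simp: m)
    then show ?case by (auto simp: m)
  next
    case (8 p B Q a D)
    then obtain i' a' where "is_pushout C p a i' a'" "adm_mono S i'"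
      using pushout_adm_mono[of p Q B a D] by (auto simp: e)
    then show ?case by (auto simp: e)
  qed
qed

text \<open>
  A deflation forms a conflation with each of its kernels, since kernels are unique up to
  isomorphism.
\<close>

lemma conf_of_kernel:
  assumes "adm_epi S p" "is_kernel C i p"
  shows "(i, p) \<in> S"
proof -
  obtain n where n: "(n, p) \<in> S" using assms(1) unfolding adm_epi_def by blast
  obtain x y z where k: "i \<in> Hom C x y" "p \<in> Hom C y z" "p \<cdot> i = Zero C x z" and
    u: "\<And>t u. u \<in> Hom C t y \<Longrightarrow> p \<cdot> u = Zero C t z \<Longrightarrow> \<exists>!v. v \<in> Hom C t x \<and> i \<cdot> v = u"
    using assms(2) hom_ob unfolding is_kernel_def by blast
  obtain x' where n': "n \<in> Hom C x' y" using conf_typed'[OF n k(2)] .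
  obtain a where a: "a \<in> Hom C x' x" "i \<cdot> a = n" using u[OF n' conf_zero[OF n n' k(2)]] by blast
  obtain b where b: "b \<in> Hom C x x'" "n \<cdot> b = i" using ker_lift[OF n n' k(2) k(1) k(3)] .
  note [simp] = k(1,2)[THEN homD] homD[OF n'] homD[OF a(1)] homD[OF b(1)] a(2) b(2)
    rewrite_under[OF a(2)] rewrite_under[OF b(2)]
  have "b \<cdot> a = Ide C x'"
    by (rule infl_mono[OF n n']) (simp_all add: hom_iff)
  moreover have "a \<cdot> b = Ide C x"
    using u[OF k(1) k(3)] a b comp_hom[OF b(1) a(1)] ide_hom[of x] by (metis \<open>b \<cdot> a = Ide C x'\<close> comp_Ide(1) rewrite_under homD[OF k(1)] homD[OF a(1)] homD[OF b(1)])
  ultimately have "is_iso C a" using isoI[OF a(1) b(1)] by simp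
  then show ?thesis
    using iso_closed[OF n n' k(2) k(1,2) a(1) ide_hom ide_hom] iso_Ide by simp
qed

text \<open>
  Two conflations \<open>K \<rightarrow> P \<rightarrow> Z\<close> and \<open>X \<rightarrow> Y \<rightarrow> Z\<close> over the same object: the left square of a
  morphism between them is bicartesian. The reason is that \<open>P \<oplus> X\<close> is the pullback of the two
  deflations, because the first of them factors through the second.
\<close>

lemma conf_of_left_square:
  assumes mq: "(m, q) \<in> S" "m \<in> Hom C K P" "q \<in> Hom C P Z"
    and ip: "(i, p) \<in> S" "i \<in> Hom C X Y" "p \<in> Hom C Y Z"
    and t: "t \<in> Hom C P Y" "p \<cdot> t = q" and k: "k \<in> Hom C K X" "i \<cdot> k = t \<cdot> m"
    and bp: "is_biproduct C P X s i1 i2 p1 p2"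
  shows "(i1 \<cdot> m \<boxminus> i2 \<cdot> k, t \<cdot> p1 \<boxplus> i \<cdot> p2) \<in> S"
proof -
  let ?\<epsilon> = "t \<cdot> p1 \<boxplus> i \<cdot> p2"
  note [simp] = mq(2,3)[THEN homD] ip(2,3)[THEN homD] homD[OF t(1)] homD[OF k(1)]
    biproduct_simps[OF bp] conf_zero[OF ip] conf_zero[OF mq] rewrite_under[OF conf_zero[OF ip]]
    rewrite_under[OF conf_zero[OF mq]] t(2) rewrite_under[OF t(2)]
  have \<epsilon>: "?\<epsilon> \<in> Hom C s Y" by (simp add: hom_iff)
  obtain p' a' where pb: "is_pullback C a' p' p q" and p': "adm_epi S p'"
    using pullback_adm_epi[OF mq(3) ip(3)] mq(1) unfolding adm_epi_def by blast
  obtain A where A: "a' \<in> Hom C A P" "p' \<in> Hom C A Y" "q \<cdot> a' = p \<cdot> p'"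
    and U: "\<And>T u v. u \<in> Hom C T P \<Longrightarrow> v \<in> Hom C T Y \<Longrightarrow> q \<cdot> u = p \<cdot> v \<Longrightarrow>
      \<exists>!w. w \<in> Hom C T A \<and> a' \<cdot> w = u \<and> p' \<cdot> w = v"
  proof -
    obtain A B D Q where *: "is_square C A B D Q a' p' p q" and
      U: "\<forall>T\<in>Ob C. \<forall>u\<in>Hom C T B. \<forall>v\<in>Hom C T D. q \<cdot> u = p \<cdot> v \<longrightarrow>
        (\<exists>!w. w \<in> Hom C T A \<and> a' \<cdot> w = u \<and> p' \<cdot> w = v)"
      using pb unfolding is_pullback_def by blast
    have "B = P" "D = Y" using * hom_disjoint[of q B Q P Z] hom_disjoint[of p D Q Y Z] mq ip
      unfolding is_square_def by blast+
    then show ?thesis using that[of A] * U hom_ob unfolding is_square_def by blast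
  qed
  note [simp] = A(1,2)[THEN homD]
  have "q \<cdot> p1 = p \<cdot> ?\<epsilon>" by simp
  \<comment> \<open>\<open>\<phi>\<close> and \<open>\<psi>\<close> identify the pullback A of p and q with the biproduct of P and X.\<close>
  then obtain \<phi> where \<phi>: "\<phi> \<in> Hom C s A" "a' \<cdot> \<phi> = p1" "p' \<cdot> \<phi> = ?\<epsilon>"
    using U[OF biproductD(3)[OF bp] \<epsilon>] by blast
  have "p \<cdot> (p' \<boxminus> t \<cdot> a') = Zero C A Z" using A(3) by simp
  then obtain x where x: "x \<in> Hom C A X" "i \<cdot> x = p' \<boxminus> t \<cdot> a'"
    using ker_lift[OF ip, of "p' \<boxminus> t \<cdot> a'" A] by (auto simp: hom_iff)
  define \<psi> where "\<psi> = i1 \<cdot> a' \<boxplus> i2 \<cdot> x"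
  note [simp] = homD[OF \<phi>(1)] homD[OF x(1)] \<phi>(2,3) \<phi>(2,3)[THEN rewrite_under] x(2)
    rewrite_under[OF x(2)]
  have \<psi>: "\<psi> \<in> Hom C A s" by (simp add: hom_iff \<psi>_def)
  note [simp] = homD[OF \<psi>]
  have p\<psi>: "p1 \<cdot> \<psi> = a'" "p2 \<cdot> \<psi> = x" unfolding \<psi>_def by simp_all
  note [simp] = p\<psi> p\<psi>(1,2)[THEN rewrite_under]
  have "t \<cdot> a' \<boxplus> (p' \<boxminus> t \<cdot> a') = p'"
    using diff_add[of p' "t \<cdot> a'"] by (simp add: add_comm)
  then have "p' \<cdot> (\<phi> \<cdot> \<psi>) = p'" "a' \<cdot> (\<phi> \<cdot> \<psi>) = a'" by simp_all
  then have "\<phi> \<cdot> \<psi> \<in> Hom C A A \<and> a' \<cdot> (\<phi> \<cdot> \<psi>) = a' \<and> p' \<cdot> (\<phi> \<cdot> \<psi>) = p'"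
    using comp_hom[OF \<psi> \<phi>(1)] by blast
  moreover have "Ide C A \<in> Hom C A A \<and> a' \<cdot> Ide C A = a' \<and> p' \<cdot> Ide C A = p'"
    by (simp add: hom_iff)
  ultimately have \<phi>\<psi>: "\<phi> \<cdot> \<psi> = Ide C A" by (rule ex1_unique[OF U[OF A]])
  have "i \<cdot> (x \<cdot> \<phi>) = (t \<cdot> p1 \<boxplus> i \<cdot> p2) \<boxminus> t \<cdot> p1" by simp
  also have "t \<cdot> p1 \<boxplus> i \<cdot> p2 = i \<cdot> p2 \<boxplus> t \<cdot> p1" by (rule add_comm) simp_all
  also have "i \<cdot> p2 \<boxplus> t \<cdot> p1 \<boxminus> t \<cdot> p1 = i \<cdot> p2" by (rule add_diff) simp_all
  finally have ix: "i \<cdot> (x \<cdot> \<phi>) = i \<cdot> p2" .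
  have "x \<cdot> \<phi> = p2"
    by (rule infl_mono[OF ip(1,2) _ _ ix]) (simp_all add: hom_iff)
  then have \<psi>\<phi>: "\<psi> \<cdot> \<phi> = Ide C s"
    by - (rule biproduct_ext[OF bp], simp_all add: hom_iff)
  have iso: "is_iso C \<psi>" by (rule isoI[OF \<psi> \<phi>(1) \<phi>\<psi> \<psi>\<phi>])
  obtain n where n: "(n, p') \<in> S" using p' unfolding adm_epi_def by blast
  obtain N where n': "n \<in> Hom C N A" using conf_typed'[OF n A(2)] .
  note [simp] = homD[OF n'] rewrite_under[OF \<phi>\<psi>]
  have "(p' \<cdot> \<phi>) \<cdot> \<psi> = p' \<cdot> (\<phi> \<cdot> \<psi>)" by (rule comp_assoc') simp_all
  then have "?\<epsilon> \<cdot> \<psi> = p'" unfolding \<phi>(3) \<phi>\<psi> by simp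
  then have "(\<psi> \<cdot> n, ?\<epsilon>) \<in> S"
    using iso_closed[OF n n' A(2) comp_hom[OF n' \<psi>] \<epsilon> ide_hom \<psi> ide_hom] iso iso_Ide by simp
  then have epi: "adm_epi S ?\<epsilon>" unfolding adm_epi_def by blast
  let ?m = "i1 \<cdot> m \<boxminus> i2 \<cdot> k"
  have m: "?m \<in> Hom C K s" by (simp add: hom_iff)
  have "is_kernel C ?m ?\<epsilon>"
    unfolding is_kernel_def
  proof (intro exI conjI ballI impI)
    show "?m \<in> Hom C K s" "?\<epsilon> \<in> Hom C s Y" using m \<epsilon> .
    show "?\<epsilon> \<cdot> ?m = Zero C K Y" by (simp add: k(2))
    fix T u assume u: "u \<in> Hom C T s" "?\<epsilon> \<cdot> u = Zero C T Y"
    note [simp] = homD[OF u(1)]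
    have e: "t \<cdot> (p1 \<cdot> u) \<boxplus> i \<cdot> (p2 \<cdot> u) = Zero C T Y" using u(2) by simp
    have "p \<cdot> (t \<cdot> (p1 \<cdot> u) \<boxplus> i \<cdot> (p2 \<cdot> u)) = Zero C T Z" unfolding e by simp
    then have "q \<cdot> (p1 \<cdot> u) = Zero C T Z" by simp
    then obtain v where v: "v \<in> Hom C T K" "m \<cdot> v = p1 \<cdot> u"
      using ker_lift[OF mq, of "p1 \<cdot> u" T] by (auto simp: hom_iff)
    note [simp] = homD[OF v(1)] v(2) rewrite_under[OF k(2)]
    have "i \<cdot> (k \<cdot> v) \<boxplus> i \<cdot> (p2 \<cdot> u) = Zero C T Y" using e by simp
    then have "i \<cdot> (k \<cdot> v \<boxplus> p2 \<cdot> u) = i \<cdot> Zero C T X" by simp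
    then have "k \<cdot> v \<boxplus> p2 \<cdot> u = Zero C T X"
      by - (rule infl_mono[OF ip(1,2)], simp_all add: hom_iff)
    then have "p2 \<cdot> u = neg C T X (k \<cdot> v)"
      by - (rule neg_unique, simp_all add: add_comm)
    then have "?m \<cdot> v = u"
      by - (rule biproduct_ext[OF bp], simp_all add: hom_iff diff_def)
    moreover have "w = v" if "w \<in> Hom C T K" "?m \<cdot> w = u" for w
    proof -
      note [simp] = homD[OF that(1)]
      have "m \<cdot> w = p1 \<cdot> (?m \<cdot> w)" by (simp add: diff_def)
      then have "m \<cdot> w = m \<cdot> v" using that(2) by simp
      then show ?thesis by (rule infl_mono[OF mq(1,2) that(1) v(1)])
    qed
    ultimately show "\<exists>!v. v \<in> Hom C T K \<and> ?m \<cdot> v = u" using v(1) by blast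
  qed
  then show ?thesis by (rule conf_of_kernel[OF epi])
qed

text \<open>
  The dual statement, for conflations with the same first object.
\<close>

lemma conf_of_right_square:
  assumes ip: "(i, p) \<in> S" "i \<in> Hom C X Y" "p \<in> Hom C Y Z"
    and mq: "(m, q) \<in> S" "m \<in> Hom C X Y'" "q \<in> Hom C Y' Z'"
    and t: "t \<in> Hom C Y Y'" "t \<cdot> i = m" and k: "k \<in> Hom C Z Z'" "k \<cdot> p = q \<cdot> t"
    and bp: "is_biproduct C Y' Z s i1 i2 p1 p2"
  shows "(i1 \<cdot> t \<boxminus> i2 \<cdot> p, q \<cdot> p1 \<boxplus> k \<cdot> p2) \<in> S"
proof -
  note [simp] = ip(2,3)[THEN homD] mq(2,3)[THEN homD] homD[OF t(1)] homD[OF k(1)]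
    biproduct_simps[OF bp]
  \<comment> \<open>In the opposite category the minus sign falls on the other map of the conflation; negating
    the second injection and projection moves it back.\<close>
  have "is_biproduct (op_cat C) Y' Z s p1 (neg C s Z p2) i1 (neg C Z s i2)"
    using biproduct_neg[OF bp] by simp
  from exact_category.conf_of_left_square[OF op_exact, of q m Z' Y' X p i Z Y t k, OF _ _ _ _ _ _ _ _ _ _ this]
  have "(i1 \<cdot> t \<boxplus> neg C Z s i2 \<cdot> p, (q \<cdot> p1) \<boxminus> (k \<cdot> neg C s Z p2)) \<in> S"
    using ip mq t k by simp
  moreover have "i1 \<cdot> t \<boxplus> neg C Z s i2 \<cdot> p = i1 \<cdot> t \<boxminus> i2 \<cdot> p"
    "(q \<cdot> p1) \<boxminus> (k \<cdot> neg C s Z p2) = q \<cdot> p1 \<boxplus> k \<cdot> p2"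
    by (simp_all add: diff_def)
  ultimately show ?thesis by simp
qed

end

section \<open>Additive quotients\<close>

lemma truncate_simps [simp]:
  "Ob (addcat.truncate D) = Ob D" "Hom (addcat.truncate D) = Hom D" "Ide (addcat.truncate D) = Ide D"
  "Comp (addcat.truncate D) = Comp D" "Add (addcat.truncate D) = Add D" "Zero (addcat.truncate D) = Zero D"
  by (simp_all add: addcat.truncate_def)

definition factors :: "('o, 'm, 'z) addcat_scheme \<Rightarrow> 'o set \<Rightarrow> 'm \<Rightarrow> bool" where
  "factors C P f \<longleftrightarrow> (\<exists>x y. \<exists>p\<in>P. \<exists>a\<in>Hom C x p. \<exists>b\<in>Hom C p y. f = b \<cdot>\<^bsub>C\<^esub> a)"

text \<open>
  Only the truncation of Q is prescribed, because the stable categories considered below carry a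
  suspension and a class of triangles on top of the additive quotient.
\<close>

locale additive_quotient = additive_category C
  for C :: "('o, 'm, 'z) addcat_scheme" (structure) +
  fixes P :: "'o set" and Q :: "('o, 'm set, 'y) addcat_scheme"
  assumes P_ob: "p \<in> P \<Longrightarrow> p \<in> Ob C"
    and P_nonempty: "P \<noteq> {}"
    and P_sum: "a \<in> P \<Longrightarrow> b \<in> P \<Longrightarrow> \<exists>s\<in>P. \<exists>i1 i2 p1 p2. is_biproduct C a b s i1 i2 p1 p2"
    and Q_truncate: "addcat.truncate Q = quot_cat C P"
begin

abbreviation q where "q \<equiv> qcls C P"

lemma factorsI: "p \<in> P \<Longrightarrow> a \<in> Hom C x p \<Longrightarrow> b \<in> Hom C p y \<Longrightarrow> factors C P (b \<cdot> a)"
  unfolding factors_def by blast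

lemma factorsE:
  assumes "factors C P f" "f \<in> Hom C x y"
  obtains p a b where "p \<in> P" "a \<in> Hom C x p" "b \<in> Hom C p y" "f = b \<cdot> a"
proof -
  obtain x' y' p a b where f: "p \<in> P" "a \<in> Hom C x' p" "b \<in> Hom C p y'" "f = b \<cdot> a"
    using assms(1) unfolding factors_def by blast
  have "x' = x" "y' = y" using hom_disjoint[OF comp_hom[OF f(2,3)], of x y] assms(2) f(4) by blast+
  then show ?thesis using that f by blast
qed

lemma factors_Zero: "x \<in> Ob C \<Longrightarrow> y \<in> Ob C \<Longrightarrow> factors C P (Zero C x y)"
proof -
  assume xy: "x \<in> Ob C" "y \<in> Ob C"
  obtain p where p: "p \<in> P" using P_nonempty by blast
  note [simp] = P_ob[OF p] xy
  show ?thesis using factorsI[OF p Zero_hom Zero_hom, of x y] by simp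
qed

lemma factors_comp:
  assumes "factors C P f" "f \<in> Hom C x y" "g \<in> Hom C y z"
  shows "factors C P (g \<cdot> f)"
proof -
  obtain p a b where f: "p \<in> P" "a \<in> Hom C x p" "b \<in> Hom C p y" "f = b \<cdot> a" using factorsE[OF assms(1,2)] .
  note [simp] = f(2,3)[THEN homD] homD[OF assms(3)]
  show ?thesis using factorsI[OF f(1,2) comp_hom[OF f(3) assms(3)]] f(4) by simp
qed

lemma comp_factors:
  assumes "factors C P g" "f \<in> Hom C x y" "g \<in> Hom C y z"
  shows "factors C P (g \<cdot> f)"
proof -
  obtain p a b where g: "p \<in> P" "a \<in> Hom C y p" "b \<in> Hom C p z" "g = b \<cdot> a" using factorsE[OF assms(1,3)] .
  note [simp] = g(2,3)[THEN homD] homD[OF assms(2)]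
  show ?thesis using factorsI[OF g(1) comp_hom[OF assms(2) g(2)] g(3)] g(4) by simp
qed

lemma factors_add:
  assumes "factors C P f" "factors C P g" "f \<in> Hom C x y" "g \<in> Hom C x y"
  shows "factors C P (f \<boxplus> g)"
proof -
  obtain p a b where f: "p \<in> P" "a \<in> Hom C x p" "b \<in> Hom C p y" "f = b \<cdot> a" using factorsE[OF assms(1,3)] .
  obtain p' a' b' where g: "p' \<in> P" "a' \<in> Hom C x p'" "b' \<in> Hom C p' y" "g = b' \<cdot> a'" using factorsE[OF assms(2,4)] .
  obtain s i1 i2 p1 p2 where s: "s \<in> P" and bp: "is_biproduct C p p' s i1 i2 p1 p2" using P_sum[OF f(1) g(1)] by blast
  note [simp] = f(2,3)[THEN homD] g(2,3)[THEN homD] biproduct_simps[OF bp]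
  let ?a = "i1 \<cdot> a \<boxplus> i2 \<cdot> a'" and ?b = "b \<cdot> p1 \<boxplus> b' \<cdot> p2"
  have "factors C P (?b \<cdot> ?a)" by (rule factorsI[OF s, of _ x _ y]) (simp_all add: hom_iff)
  then show ?thesis by (simp add: f(4) g(4))
qed

lemma factors_neg:
  assumes "factors C P f" "f \<in> Hom C x y"
  shows "factors C P (neg C x y f)"
proof -
  note [simp] = homD[OF assms(2)]
  have "factors C P (f \<cdot> neg C x x (Ide C x))"
    by (rule comp_factors[OF assms(1) _ assms(2)]) (simp add: hom_iff)
  then show ?thesis by simp
qed

lemma q_members:
  assumes "f \<in> Hom C x y"
  shows "q f = {f' \<in> Hom C x y. factors C P (f' \<boxminus> f)}"
proof (rule Set.set_eqI, rule iffI)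
  note [simp] = homD[OF assms]
  fix f' assume "f' \<in> q f"
  then obtain p a b where *: "p \<in> P" "a \<in> Hom C x p" "b \<in> Hom C p y" "f' = f \<boxplus> b \<cdot> a"
    unfolding qcls_def using hom_disjoint[OF assms] by blast
  note [simp] = *(2,3)[THEN homD]
  have "f' \<boxminus> f = b \<cdot> a" using *(4) by (simp add: add_comm[of f])
  then show "f' \<in> {f' \<in> Hom C x y. factors C P (f' \<boxminus> f)}"
    using * factorsI[OF *(1-3)] by (simp add: hom_iff)
next
  note [simp] = homD[OF assms]
  fix f' assume "f' \<in> {f' \<in> Hom C x y. factors C P (f' \<boxminus> f)}"
  then have f': "f' \<in> Hom C x y" "factors C P (f' \<boxminus> f)" by auto
  note [simp] = homD[OF f'(1)]
  obtain p a b where *: "p \<in> P" "a \<in> Hom C x p" "b \<in> Hom C p y" "f' \<boxminus> f = b \<cdot> a"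
    using factorsE[OF f'(2) diff_hom[OF f'(1) assms]] .
  note [simp] = *(2,3)[THEN homD]
  have "f' = f \<boxplus> b \<cdot> a" unfolding *(4)[symmetric] by (subst add_comm) simp_all
  then show "f' \<in> q f" using * assms unfolding qcls_def by blast
qed

lemma diff_diff_cancel:
  assumes "Arr C f" "Arr C g" "Arr C h" "Dom C f = Dom C g" "Cod C f = Cod C g" "Dom C g = Dom C h" "Cod C g = Cod C h"
  shows "(f \<boxminus> g) \<boxplus> (g \<boxminus> h) = f \<boxminus> h"
proof -
  have "(f \<boxminus> g) \<boxplus> (g \<boxminus> h) \<boxplus> h = f"
    using assms by (simp add: add_assoc)
  from this[symmetric] have "f \<boxminus> h = (f \<boxminus> g) \<boxplus> (g \<boxminus> h)"
    by (rule iffD2[OF diff_eq_iff, rotated -1]) (use assms in simp_all)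
  then show ?thesis ..
qed

lemma neg_diff:
  assumes "Arr C f" "Arr C g" "Dom C f = Dom C g" "Cod C f = Cod C g" "Dom C g = x" "Cod C g = y"
  shows "neg C x y (f \<boxminus> g) = g \<boxminus> f"
  using assms by (simp add: diff_def add_comm)

lemma add_diff_add:
  assumes "Arr C f" "Arr C f'" "Arr C g" "Arr C g'" "Dom C f = Dom C g" "Cod C f = Cod C g" "Dom C f' = Dom C g"
    "Cod C f' = Cod C g" "Dom C g' = Dom C g" "Cod C g' = Cod C g"
  shows "(f \<boxplus> g) \<boxminus> (f' \<boxplus> g') = (f \<boxminus> f') \<boxplus> (g \<boxminus> g')"
  using assms by (simp add: diff_def add_ac)

lemma q_mem:
  assumes "f \<in> Hom C x y" shows "f \<in> q f"
  unfolding q_members[OF assms] using assms homD[OF assms] factors_Zero[of x y] by simp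

lemma q_eq_iff:
  assumes "f \<in> Hom C x y" "g \<in> Hom C x y"
  shows "q f = q g \<longleftrightarrow> factors C P (f \<boxminus> g)"
proof
  assume "q f = q g"
  then have "f \<in> q g" using q_mem[OF assms(1)] by simp
  then show "factors C P (f \<boxminus> g)" unfolding q_members[OF assms(2)] by simp
next
  assume n: "factors C P (f \<boxminus> g)"
  note [simp] = assms(1,2)[THEN homD]
  have n': "factors C P (g \<boxminus> f)" using factors_neg[OF n, of x y] by (simp add: hom_iff neg_diff)
  have "factors C P (h \<boxminus> g)" if "h \<in> Hom C x y" "factors C P (h \<boxminus> f)" for h
    using factors_add[OF that(2) n, of x y] homD[OF that(1)] by (simp add: hom_iff diff_diff_cancel)
  moreover have "factors C P (h \<boxminus> f)" if "h \<in> Hom C x y" "factors C P (h \<boxminus> g)" for h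
    using factors_add[OF that(2) n', of x y] homD[OF that(1)] by (simp add: hom_iff diff_diff_cancel)
  ultimately show "q f = q g" unfolding q_members[OF assms(1)] q_members[OF assms(2)] by blast
qed

lemma q_memE:
  assumes "f' \<in> q f" "f \<in> Hom C x y"
  shows "f' \<in> Hom C x y" "q f' = q f"
proof -
  show f': "f' \<in> Hom C x y" using assms q_members by blast
  show "q f' = q f" using q_eq_iff[OF f' assms(2)] assms q_members by blast
qed

lemma q_cong_comp:
  assumes "f \<in> Hom C x y" "f' \<in> Hom C x y" "g \<in> Hom C y z" "g' \<in> Hom C y z" "q f = q f'" "q g = q g'"
  shows "q (g \<cdot> f) = q (g' \<cdot> f')"
proof -
  note [simp] = assms(1-4)[THEN homD]
  have "factors C P (g \<cdot> (f \<boxminus> f'))" "factors C P ((g \<boxminus> g') \<cdot> f')"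
    using factors_comp[of "f \<boxminus> f'" x y g z] comp_factors[of "g \<boxminus> g'" f' x y z]
      q_eq_iff[OF assms(1,2)] q_eq_iff[OF assms(3,4)] assms(5,6)
    by (simp_all add: hom_iff)
  then have "factors C P ((g \<cdot> f \<boxminus> g \<cdot> f') \<boxplus> (g \<cdot> f' \<boxminus> g' \<cdot> f'))"
    by (intro factors_add) (simp_all add: hom_iff)
  then have "factors C P (g \<cdot> f \<boxminus> g' \<cdot> f')" by (simp add: diff_diff_cancel)
  then show ?thesis using q_eq_iff[of "g \<cdot> f" x z "g' \<cdot> f'"] by (simp add: hom_iff)
qed

lemma q_cong_add:
  assumes "f \<in> Hom C x y" "f' \<in> Hom C x y" "g \<in> Hom C x y" "g' \<in> Hom C x y" "q f = q f'" "q g = q g'"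
  shows "q (f \<boxplus> g) = q (f' \<boxplus> g')"
proof -
  note [simp] = assms(1-4)[THEN homD]
  have "factors C P ((f \<boxminus> f') \<boxplus> (g \<boxminus> g'))"
    using q_eq_iff[OF assms(1,2)] q_eq_iff[OF assms(3,4)] assms(5,6)
    by (intro factors_add) (simp_all add: hom_iff)
  then have "factors C P ((f \<boxplus> g) \<boxminus> (f' \<boxplus> g'))" by (simp add: add_diff_add)
  then show ?thesis using q_eq_iff[of "f \<boxplus> g" x y "f' \<boxplus> g'"] by (simp add: hom_iff)
qed

lemma Q_simps:
  "Ob Q = Ob C" "Hom Q x y = q ` Hom C x y" "Ide Q x = q (Ide C x)" "Zero Q x y = q (Zero C x y)"
  "Comp Q G F = (\<Union>g\<in>G. \<Union>f\<in>F. q (g \<cdot> f))" "Add Q F G = (\<Union>f\<in>F. \<Union>g\<in>G. q (f \<boxplus> g))"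
  using arg_cong[OF Q_truncate, of Ob] arg_cong[OF Q_truncate, of Hom] arg_cong[OF Q_truncate, of Ide]
   arg_cong[OF Q_truncate, of Zero] arg_cong[OF Q_truncate, of Comp] arg_cong[OF Q_truncate, of Add]
  by (simp_all add: quot_cat_def)

lemma q_comp_hom:
  assumes "f \<in> Hom C x y" "g \<in> Hom C y z"
  shows "q g \<cdot>\<^bsub>Q\<^esub> q f = q (g \<cdot> f)"
proof -
  have "q (g' \<cdot> f') = q (g \<cdot> f)" if "g' \<in> q g" "f' \<in> q f" for g' f'
    using q_cong_comp q_memE[OF that(1) assms(2)] q_memE[OF that(2) assms(1)] assms by blast
  then show ?thesis unfolding Q_simps using q_mem[OF assms(1)] q_mem[OF assms(2)] by blast
qed

lemma q_add_hom:
  assumes "f \<in> Hom C x y" "g \<in> Hom C x y"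
  shows "q f \<boxplus>\<^bsub>Q\<^esub> q g = q (f \<boxplus> g)"
proof -
  have "q (f' \<boxplus> g') = q (f \<boxplus> g)" if "f' \<in> q f" "g' \<in> q g" for g' f'
    using q_cong_add q_memE[OF that(1) assms(1)] q_memE[OF that(2) assms(2)] assms by blast
  then show ?thesis unfolding Q_simps using q_mem[OF assms(1)] q_mem[OF assms(2)] by blast
qed

lemma q_hom: "f \<in> Hom C x y \<Longrightarrow> q f \<in> Hom Q x y"
  unfolding Q_simps by blast

lemma Q_homE:
  assumes "F \<in> Hom Q x y"
  obtains f where "f \<in> Hom C x y" "F = q f"
  using assms unfolding Q_simps by blast

lemma Q_category: "category Q"
proof (rule category.intro, goal_cases)
  case (1 F x y) then show ?case using hom_ob by (elim Q_homE) (simp add: Q_simps(1))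
next
  case (2 F x y x' y')
  obtain f where f: "f \<in> Hom C x y" "F = q f" using Q_homE[OF 2(1)] .
  obtain f' where f': "f' \<in> Hom C x' y'" "F = q f'" using Q_homE[OF 2(2)] .
  have "f \<in> q f'" using q_mem f f' by metis
  then show ?case using q_memE(1)[OF _ f'(1)] f(1) hom_disjoint by blast
next
  case (3 x) then show ?case using q_hom[OF ide_hom[of x]] by (simp add: Q_simps(1,3) del: Q_simps(2))
next
  case (4 F x y G z)
  then obtain f g where *: "f \<in> Hom C x y" "F = q f" "g \<in> Hom C y z" "G = q g" by (elim Q_homE)
  show ?case unfolding *(2,4) q_comp_hom[OF *(1,3)] by (rule q_hom[OF comp_hom[OF *(1,3)]])
next
  case (5 F x y)
  then obtain f where f: "f \<in> Hom C x y" "F = q f" by (elim Q_homE)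
  show ?case unfolding f(2) Q_simps(3) using q_comp_hom[OF ide_hom f(1)] homD[OF f(1)] comp_ide[OF f(1)] by simp
next
  case (6 F x y)
  then obtain f where f: "f \<in> Hom C x y" "F = q f" by (elim Q_homE)
  show ?case unfolding f(2) Q_simps(3) using q_comp_hom[OF f(1) ide_hom] homD[OF f(1)] ide_comp[OF f(1)] by simp
next
  case (7 F w x G y H z)
  then obtain f g h where *: "f \<in> Hom C w x" "F = q f" "g \<in> Hom C x y" "G = q g" "h \<in> Hom C y z" "H = q h"
    by (elim Q_homE)
  show ?case using comp_assoc[OF *(1,3,5)]
    by (simp add: * q_comp_hom[OF *(1,3)] q_comp_hom[OF *(3,5)] q_comp_hom[OF *(1) comp_hom[OF *(3,5)]]
     q_comp_hom[OF comp_hom[OF *(1,3)] *(5)])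
qed

lemma Q_comm_group:
  assumes "x \<in> Ob C" "y \<in> Ob C"
  shows "comm_group (hom_group Q x y)"
proof (rule comm_groupI, goal_cases)
  case (1 F G)
  then obtain f g where *: "f \<in> Hom C x y" "F = q f" "g \<in> Hom C x y" "G = q g"
    unfolding hom_group_simps by (elim Q_homE)
  show ?case unfolding hom_group_simps *(2,4) q_add_hom[OF *(1,3)] by (rule q_hom[OF add_hom[OF *(1,3)]])
next
  case 2 show ?case unfolding hom_group_simps Q_simps(4) by (rule q_hom[OF Zero_hom[OF assms]])
next
  case (3 F G H)
  then obtain f g h where *: "f \<in> Hom C x y" "F = q f" "g \<in> Hom C x y" "G = q g" "h \<in> Hom C x y" "H = q h"
    unfolding hom_group_simps by (elim Q_homE)
  note [simp] = *(1,3,5)[THEN homD]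
  show ?case using q_add_hom[of _ x y] by (simp add: hom_group_simps * hom_iff add_assoc)
next
  case (4 F G)
  then obtain f g where *: "f \<in> Hom C x y" "F = q f" "g \<in> Hom C x y" "G = q g"
    unfolding hom_group_simps by (elim Q_homE)
  note [simp] = *(1,3)[THEN homD]
  show ?case using q_add_hom[of _ x y] add_comm[of f g] by (simp add: hom_group_simps * hom_iff)
next
  case (5 F)
  then obtain f where *: "f \<in> Hom C x y" "F = q f" unfolding hom_group_simps by (elim Q_homE)
  note [simp] = homD[OF *(1)]
  show ?case using q_add_hom[of _ x y] by (simp add: hom_group_simps * hom_iff Q_simps(4))
next
  case (6 F)
  then obtain f where *: "f \<in> Hom C x y" "F = q f" unfolding hom_group_simps by (elim Q_homE)
  note [simp] = homD[OF *(1)]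
  have "q (neg C x y f) \<boxplus>\<^bsub>Q\<^esub> q f = Zero Q x y" "q (neg C x y f) \<in> Hom Q x y"
    using q_add_hom[of _ x y] by (simp_all add: * hom_iff Q_simps(4) q_hom)
  then show ?case unfolding hom_group_simps *(2) by blast
qed

lemma q_biproduct:
  assumes "is_biproduct C a b s i1 i2 p1 p2"
  shows "is_biproduct Q a b s (q i1) (q i2) (q p1) (q p2)"
proof -
  note d = biproductD[OF assms]
  show ?thesis unfolding is_biproduct_def
    using d q_hom q_comp_hom q_add_hom[OF comp_hom[OF d(3,1)] comp_hom[OF d(4,2)]]
    by (simp add: Q_simps(3,4))
qed

lemma q_zero_object:
  assumes "p \<in> P"
  shows "is_zero_object Q p"
  unfolding is_zero_object_def
proof (intro conjI ballI)
  show "p \<in> Ob Q" using P_ob[OF assms] Q_simps(1) by simp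
  fix x assume "x \<in> Ob Q"
  then have xp: "x \<in> Ob C" "p \<in> Ob C" using P_ob[OF assms] Q_simps(1) by simp_all
  have "q f = q (Zero C x p)" if "f \<in> Hom C x p" for f
    using q_eq_iff[OF that Zero_hom[OF xp]] homD[OF that] factorsI[OF assms that ide_hom] ide_comp[OF that] by simp
  then show "Hom Q x p = {Zero Q x p}" unfolding Q_simps(2,4) using Zero_hom[OF xp] by blast
  have "q f = q (Zero C p x)" if "f \<in> Hom C p x" for f
    using q_eq_iff[OF that Zero_hom[OF xp(2,1)]] homD[OF that] factorsI[OF assms ide_hom that] comp_ide[OF that] by simp
  then show "Hom Q p x = {Zero Q p x}" unfolding Q_simps(2,4) using Zero_hom[OF xp(2,1)] by blast
qed

lemma Q_additive: "additive_category Q"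
proof (intro additive_category.intro additive_category_axioms.intro Q_category, goal_cases)
  case (1 x y) then show ?case using Q_comm_group Q_simps(1) by simp
next
  case (2 F x y F' G z)
  then obtain f f' g where *: "f \<in> Hom C x y" "F = q f" "f' \<in> Hom C x y" "F' = q f'" "g \<in> Hom C y z" "G = q g"
    by (elim Q_homE)
  show ?case using comp_add[OF *(1,3,5)] q_add_hom[OF *(1,3)] q_comp_hom[OF add_hom[OF *(1,3)] *(5)]
    q_comp_hom[OF *(1,5)] q_comp_hom[OF *(3,5)] q_add_hom[OF comp_hom[OF *(1,5)] comp_hom[OF *(3,5)]] by (simp add: *)
next
  case (3 F x y G z G')
  then obtain f g g' where *: "f \<in> Hom C x y" "F = q f" "g \<in> Hom C y z" "G = q g" "g' \<in> Hom C y z" "G' = q g'"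
    by (elim Q_homE)
  show ?case using add_comp[OF *(1,3,5)] q_add_hom[OF *(3,5)] q_comp_hom[OF *(1) add_hom[OF *(3,5)]]
    q_comp_hom[OF *(1,3)] q_comp_hom[OF *(1,5)] q_add_hom[OF comp_hom[OF *(1,3)] comp_hom[OF *(1,5)]] by (simp add: *)
next
  case 4 then show ?case using q_zero_object P_nonempty by blast
next
  case (5 a b) then show ?case using biproducts[of a b] q_biproduct Q_simps(1) by metis
qed

end

sublocale additive_quotient \<subseteq> Q: additive_category Q
  by (rule Q_additive)

context additive_quotient
begin

lemma q_Arr [simp]:
  assumes "Arr C f"
  shows "Arr Q (q f)" "Dom Q (q f) = Dom C f" "Cod Q (q f) = Cod C f"
  using Q.homD[OF q_hom[OF Arr_hom[OF assms]]] by simp_all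

lemma q_simps [simp]:
  "Ob Q = Ob C" "Ide Q x = q (Ide C x)" "Zero Q x y = q (Zero C x y)"
  "Arr C f \<Longrightarrow> Arr C g \<Longrightarrow> Cod C f = Dom C g \<Longrightarrow> q g \<cdot>\<^bsub>Q\<^esub> q f = q (g \<cdot> f)"
  "Arr C f \<Longrightarrow> Arr C g \<Longrightarrow> Dom C f = Dom C g \<Longrightarrow> Cod C f = Cod C g \<Longrightarrow> q f \<boxplus>\<^bsub>Q\<^esub> q g = q (f \<boxplus> g)"
  using Q_simps q_comp_hom[of f "Dom C f" "Cod C f" g "Cod C g"] q_add_hom[of f "Dom C g" "Cod C g" g] hom_iff by simp_all

lemma q_neg [simp]:
  assumes "Arr C f" "Dom C f = x" "Cod C f = y"
  shows "neg Q x y (q f) = q (neg C x y f)"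
  by (rule Q.neg_unique[symmetric]) (use assms in simp_all)

lemma q_diff [simp]:
  assumes "Arr C f" "Arr C g" "Dom C f = Dom C g" "Cod C f = Cod C g"
  shows "q f \<boxminus>\<^bsub>Q\<^esub> q g = q (f \<boxminus> g)"
  using assms by (simp add: diff_def)

lemma q_zero_iff:
  assumes "f \<in> Hom C x y"
  shows "q f = q (Zero C x y) \<longleftrightarrow> factors C P f"
  using q_eq_iff[OF assms Zero_hom] homD[OF assms] by simp

lemma q_zeroI:
  assumes "p \<in> P" "a \<in> Hom C x p" "b \<in> Hom C p y"
  shows "q (b \<cdot> a) = q (Zero C x y)"
  using q_zero_iff[OF comp_hom[OF assms(2,3)]] factorsI[OF assms] by simp

lemma q_zeroE:
  assumes "q f = q (Zero C x y)" "f \<in> Hom C x y"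
  obtains p a b where "p \<in> P" "a \<in> Hom C x p" "b \<in> Hom C p y" "f = b \<cdot> a"
  using assms q_zero_iff factorsE by metis

lemma q_eqE:
  assumes "q f = q g" "f \<in> Hom C x y" "g \<in> Hom C x y"
  obtains p a b where "p \<in> P" "a \<in> Hom C x p" "b \<in> Hom C p y" "f = g \<boxplus> b \<cdot> a"
proof -
  note [simp] = assms(2,3)[THEN homD]
  have "factors C P (f \<boxminus> g)" using assms q_eq_iff by blast
  then obtain p a b where *: "p \<in> P" "a \<in> Hom C x p" "b \<in> Hom C p y" "f \<boxminus> g = b \<cdot> a"
    using factorsE[OF _ diff_hom[OF assms(2,3)]] by metis
  have "f = g \<boxplus> b \<cdot> a" unfolding *(4)[symmetric] by (subst add_comm) simp_all
  then show ?thesis using that * by blast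
qed

lemma q_iso: "is_iso C f \<Longrightarrow> is_iso Q (q f)"
  unfolding is_iso_def using q_hom q_comp_hom by (metis q_simps(2))

end

section \<open>The stable category and its suspension\<close>

locale frobenius_envelope = frobenius_exact_category C S
  for C :: "('o, 'm, 'z) addcat_scheme" (structure) and S +
  fixes J :: "('o, 'm) envelope"
  assumes envelope: "exact_envelope C S J"

context exact_category
begin

definition conf where
  "conf X Y Z i p \<longleftrightarrow> (i, p) \<in> S \<and> i \<in> Hom C X Y \<and> p \<in> Hom C Y Z"

lemma confD:
  assumes "conf X Y Z i p"
  shows "(i, p) \<in> S" "i \<in> Hom C X Y" "p \<in> Hom C Y Z" "p \<cdot> i = Zero C X Z"
  using assms conf_zero unfolding conf_def by blast+

lemma conf_simps:
  assumes "conf X Y Z i p"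
  shows "Arr C i \<and> Dom C i = X \<and> Cod C i = Y" "Arr C p \<and> Dom C p = Y \<and> Cod C p = Z"
    "X \<in> Ob C" "Y \<in> Ob C" "Z \<in> Ob C" "p \<cdot> i = Zero C X Z"
    "Arr C x \<Longrightarrow> Cod C x = X \<Longrightarrow> p \<cdot> (i \<cdot> x) = Zero C (Dom C x) Z"
proof -
  note d = confD[OF assms]
  note [simp] = d(2,3)[THEN homD] d(4) rewrite_under[OF d(4)]
  show "Arr C i \<and> Dom C i = X \<and> Cod C i = Y" "Arr C p \<and> Dom C p = Y \<and> Cod C p = Z"
    "X \<in> Ob C" "Y \<in> Ob C" "Z \<in> Ob C" "p \<cdot> i = Zero C X Z"
    "Arr C x \<Longrightarrow> Cod C x = X \<Longrightarrow> p \<cdot> (i \<cdot> x) = Zero C (Dom C x) Z" by simp_all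
qed

lemma conf_lift:
  assumes "conf X Y Z i p" "u \<in> Hom C t Y" "p \<cdot> u = Zero C t Z"
  obtains v where "v \<in> Hom C t X" "i \<cdot> v = u"
  using ker_lift[OF confD(1-3)[OF assms(1)] assms(2,3)] .

lemma conf_desc:
  assumes "conf X Y Z i p" "u \<in> Hom C Y t" "u \<cdot> i = Zero C X t"
  obtains v where "v \<in> Hom C Z t" "v \<cdot> p = u"
  using coker_desc[OF confD(1-3)[OF assms(1)] assms(2,3)] .

lemma conf_mono:
  assumes "conf X Y Z i p" "u \<in> Hom C t X" "v \<in> Hom C t X" "i \<cdot> u = i \<cdot> v"
  shows "u = v"
  using infl_mono[OF confD(1,2)[OF assms(1)] assms(2-4)] .

lemma conf_epi:
  assumes "conf X Y Z i p" "u \<in> Hom C Z t" "v \<in> Hom C Z t" "u \<cdot> p = v \<cdot> p"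
  shows "u = v"
  using defl_epi[OF confD(1,3)[OF assms(1)] assms(2-4)] .

text \<open>
  The objects are recovered from the maps, which keeps the arguments of the predicate independent
  of the ambient set of conflations; the same morphisms serve for a smaller exact structure.
\<close>

definition conf_mor where
  "conf_mor i p i' p' a b c \<longleftrightarrow> a \<in> Hom C (Dom C i) (Dom C i') \<and> b \<in> Hom C (Cod C i) (Cod C i') \<and>
     c \<in> Hom C (Cod C p) (Cod C p') \<and> b \<cdot> i = i' \<cdot> a \<and> c \<cdot> p = p' \<cdot> b"

lemma conf_morI:
  assumes "conf X Y Z i p" "conf X' Y' Z' i' p'" "a \<in> Hom C X X'" "b \<in> Hom C Y Y'" "c \<in> Hom C Z Z'"
    "b \<cdot> i = i' \<cdot> a" "c \<cdot> p = p' \<cdot> b"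
  shows "conf_mor i p i' p' a b c"
  unfolding conf_mor_def using conf_simps[OF assms(1)] conf_simps[OF assms(2)] assms(3-7) by simp

lemma conf_morD:
  assumes "conf_mor i p i' p' a b c" "conf X Y Z i p" "conf X' Y' Z' i' p'"
  shows "a \<in> Hom C X X'" "b \<in> Hom C Y Y'" "c \<in> Hom C Z Z'" "b \<cdot> i = i' \<cdot> a" "c \<cdot> p = p' \<cdot> b"
  using assms(1) conf_simps[OF assms(2)] conf_simps[OF assms(3)] unfolding conf_mor_def by simp_all

lemma conf_mor_comp:
  assumes "conf_mor i p i' p' a b c" "conf_mor i' p' i'' p'' a' b' c'"
    and c: "conf X Y Z i p" "conf X' Y' Z' i' p'" "conf X'' Y'' Z'' i'' p''"
  shows "conf_mor i p i'' p'' (a' \<cdot> a) (b' \<cdot> b) (c' \<cdot> c)"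
proof -
  note m = conf_morD[OF assms(1) c(1,2)] and m' = conf_morD[OF assms(2) c(2,3)]
  note [simp] = conf_simps[OF c(1)] conf_simps[OF c(2)] conf_simps[OF c(3)]
    m(1-3)[THEN homD] m'(1-3)[THEN homD]
    m(4,5) m'(4,5) m(4,5)[THEN rewrite_under] m'(4,5)[THEN rewrite_under]
  show ?thesis by (rule conf_morI[OF c(1,3)]) (simp_all add: hom_iff)
qed

lemma conf_mor_diff:
  assumes "conf_mor i p i' p' a b c" "conf_mor i p i' p' a' b' c'"
    and c: "conf X Y Z i p" "conf X' Y' Z' i' p'"
  shows "conf_mor i p i' p' (a \<boxminus> a') (b \<boxminus> b') (c \<boxminus> c')"
proof -
  note m = conf_morD[OF assms(1) c(1,2)] and m' = conf_morD[OF assms(2) c(1,2)]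
  note [simp] = conf_simps[OF c(1)] conf_simps[OF c(2)]
    m(1-3)[THEN homD] m'(1-3)[THEN homD]
    m(4,5) m'(4,5)
  show ?thesis by (rule conf_morI[OF c(1,2)]) (simp_all add: hom_iff)
qed

lemma conf_mor_add:
  assumes "conf_mor i p i' p' a b c" "conf_mor i p i' p' a' b' c'"
    and c: "conf X Y Z i p" "conf X' Y' Z' i' p'"
  shows "conf_mor i p i' p' (a \<boxplus> a') (b \<boxplus> b') (c \<boxplus> c')"
proof -
  note m = conf_morD[OF assms(1) c(1,2)] and m' = conf_morD[OF assms(2) c(1,2)]
  note [simp] = conf_simps[OF c(1)] conf_simps[OF c(2)]
    m(1-3)[THEN homD] m'(1-3)[THEN homD]
    m(4,5) m'(4,5)
  show ?thesis by (rule conf_morI[OF c(1,2)]) (simp_all add: hom_iff)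
qed

lemma conf_mor_Ide:
  assumes "conf X Y Z i p"
  shows "conf_mor i p i p (Ide C X) (Ide C Y) (Ide C Z)"
  by (rule conf_morI[OF assms assms]) (simp_all add: hom_iff conf_simps[OF assms])

lemma proj_lift:
  assumes "W \<in> exact_proj C S" "conf X Y Z i p" "f \<in> Hom C W Z"
  obtains g where "g \<in> Hom C W Y" "p \<cdot> g = f"
  using assms confD[OF assms(2)] unfolding exact_proj_def adm_epi_def by blast

lemma inj_extend:
  assumes "W \<in> exact_inj C S" "conf X Y Z i p" "f \<in> Hom C X W"
  obtains g where "g \<in> Hom C Y W" "g \<cdot> i = f"
  using assms confD[OF assms(2)] unfolding exact_inj_def adm_mono_def by blast

lemma proj_sum:
  assumes "a \<in> exact_proj C S" "b \<in> exact_proj C S"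
  shows "\<exists>s\<in>exact_proj C S. \<exists>i1 i2 p1 p2. is_biproduct C a b s i1 i2 p1 p2"
proof -
  have "a \<in> Ob C" "b \<in> Ob C" using assms unfolding exact_proj_def by auto
  then obtain s i1 i2 p1 p2 where bp: "is_biproduct C a b s i1 i2 p1 p2" using biproducts by metis
  note [simp] = biproduct_simps[OF bp]
  have "\<exists>g\<in>Hom C s y. p \<cdot> g = f" if p: "p \<in> Hom C y z" "adm_epi S p" and f: "f \<in> Hom C s z" for y z p f
  proof -
    obtain i where i: "(i, p) \<in> S" using p(2) unfolding adm_epi_def by blast
    obtain x where "i \<in> Hom C x y" using conf_typed'[OF i p(1)] .
    then have c: "conf x y z i p" using i p unfolding conf_def by blast
    note [simp] = conf_simps[OF c] homD[OF f]
    have "f \<cdot> i1 \<in> Hom C a z" "f \<cdot> i2 \<in> Hom C b z" by (simp_all add: hom_iff)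
    then obtain g1 g2 where g: "g1 \<in> Hom C a y" "p \<cdot> g1 = f \<cdot> i1" "g2 \<in> Hom C b y" "p \<cdot> g2 = f \<cdot> i2"
      using proj_lift[OF assms(1) c] proj_lift[OF assms(2) c] by metis
    note [simp] = g(1,3)[THEN homD] g(2,4) g(2,4)[THEN rewrite_under]
    have "p \<cdot> (g1 \<cdot> p1 \<boxplus> g2 \<cdot> p2) = f"
      using biproduct_decomp(2)[OF bp, of f] by simp
    moreover have "g1 \<cdot> p1 \<boxplus> g2 \<cdot> p2 \<in> Hom C s y" by (simp add: hom_iff)
    ultimately show ?thesis by blast
  qed
  then have "s \<in> exact_proj C S" unfolding exact_proj_def by simp
  then show ?thesis using bp by blast
qed

end

context frobenius_exact_category
begin

lemma proj_quotient:
  assumes "addcat.truncate Q = quot_cat C (exact_proj C S)"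
  shows "additive_quotient C (exact_proj C S) Q"
proof
  show "p \<in> Ob C" if "p \<in> exact_proj C S" for p using that unfolding exact_proj_def by simp
  obtain z where "is_zero_object C z" using zero_object by blast
  then have "z \<in> Ob C" unfolding is_zero_object_def by blast
  then show "exact_proj C S \<noteq> {}" using enough_proj by blast
qed (rule proj_sum assms; assumption?)+

end

lemma stable_fields:
  "addcat.truncate (stable_cat C S J) = quot_cat C (exact_proj C S)"
  "SusO (stable_cat C S J) = Cosyz J"
  "SusM (stable_cat C S J) = SusM (stable_suscat C S J)"
  "Dist (stable_cat C S J) = {T. \<exists>T0\<in>stable_std C S J. tri_iso (stable_suscat C S J) T0 T}"
  by (simp_all add: stable_cat_def suscat.extend_def tricat.fields_def stable_suscat_def addcat.extend_def
      suscat.fields_def addcat.truncate_def)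

lemma tri_iso_stable: "tri_iso (stable_suscat C S J) = tri_iso (stable_cat C S J)"
proof -
  have "tri_mor (stable_suscat C S J) T T' m = tri_mor (stable_cat C S J) T T' m" for T T' m
    by (cases T; cases T'; cases m)
      (simp add: stable_cat_def suscat.extend_def tricat.fields_def stable_suscat_def addcat.extend_def
      suscat.fields_def)
  moreover have "is_iso (stable_suscat C S J) = is_iso (stable_cat C S J)"
    by (simp add: is_iso_def fun_eq_iff stable_cat_def suscat.extend_def tricat.fields_def stable_suscat_def addcat.extend_def
      suscat.fields_def)
  ultimately show ?thesis unfolding tri_iso_def fun_eq_iff by simp
qed

sublocale frobenius_envelope \<subseteq> K: additive_quotient C "exact_proj C S" "stable_cat C S J"
  by (rule proj_quotient[OF stable_fields(1)])

context frobenius_envelope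
begin

abbreviation Kc where "Kc \<equiv> stable_cat C S J"
abbreviation stable_comp (infixl "\<bullet>" 75) where "G \<bullet> F \<equiv> G \<cdot>\<^bsub>stable_cat C S J\<^esub> F"
abbreviation img where "img i p \<equiv> image_triangle C S J (i, p)"
abbreviation PI where "PI \<equiv> exact_proj C S"
abbreviation \<pi> where "\<pi> \<equiv> qcls C (exact_proj C S)"

lemma proj_extend:
  assumes "W \<in> PI" "conf X Y Z i p" "f \<in> Hom C X W"
  obtains g where "g \<in> Hom C Y W" "g \<cdot> i = f"
  using inj_extend[OF _ assms(2,3)] assms(1) proj_eq_inj by blast

lemma env:
  assumes "X \<in> Ob C"
  shows "conf X (Env J X) (Cosyz J X) (into J X) (onto J X)" "Env J X \<in> PI"
  using envelope assms proj_eq_inj unfolding exact_envelope_def conf_def by blast+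

text \<open>
  The stable class of \<open>f'\<close> is the suspension of the class of f. Working with this relation avoids a
  choice of extensions to the envelopes.
\<close>

definition suspends where
  "suspends f f' \<longleftrightarrow> (\<exists>e. conf_mor (into J (Dom C f)) (onto J (Dom C f)) (into J (Cod C f)) (onto J (Cod C f)) f e f')"

lemma suspendsD:
  assumes "suspends f f'" "f \<in> Hom C X Y"
  obtains e where "conf_mor (into J X) (onto J X) (into J Y) (onto J Y) f e f'"
    "e \<in> Hom C (Env J X) (Env J Y)" "f' \<in> Hom C (Cosyz J X) (Cosyz J Y)"
    "e \<cdot> into J X = into J Y \<cdot> f" "f' \<cdot> onto J X = onto J Y \<cdot> e"
proof -
  note [simp] = homD[OF assms(2)]
  obtain e where "conf_mor (into J X) (onto J X) (into J Y) (onto J Y) f e f'"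
    using assms(1) unfolding suspends_def by auto
  then show ?thesis using that conf_morD[OF _ env(1)[of X] env(1)[of Y]] by simp
qed

lemma suspends_hom: "suspends f f' \<Longrightarrow> f \<in> Hom C X Y \<Longrightarrow> f' \<in> Hom C (Cosyz J X) (Cosyz J Y)"
  using suspendsD by metis

lemma suspendsI:
  assumes "conf_mor (into J X) (onto J X) (into J Y) (onto J Y) f e f'" "f \<in> Hom C X Y"
  shows "suspends f f'"
  unfolding suspends_def using assms homD[OF assms(2)] by auto

lemma suspends_exists:
  assumes f: "f \<in> Hom C X Y"
  obtains f' where "suspends f f'"
proof -
  note [simp] = homD[OF f]
  have c: "conf X (Env J X) (Cosyz J X) (into J X) (onto J X)" "conf Y (Env J Y) (Cosyz J Y) (into J Y) (onto J Y)"
    using env by simp_all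
  note [simp] = conf_simps[OF c(1)] conf_simps[OF c(2)]
  have "into J Y \<cdot> f \<in> Hom C X (Env J Y)" by (simp add: hom_iff)
  then obtain e where e: "e \<in> Hom C (Env J X) (Env J Y)" "e \<cdot> into J X = into J Y \<cdot> f"
    using proj_extend[OF env(2) c(1)] homD[OF f] by blast
  note [simp] = homD[OF e(1)] e(2)
  have "onto J Y \<cdot> e \<in> Hom C (Env J X) (Cosyz J Y)" "(onto J Y \<cdot> e) \<cdot> into J X = Zero C X (Cosyz J Y)"
    by (simp_all add: hom_iff)
  then obtain f' where f': "f' \<in> Hom C (Cosyz J X) (Cosyz J Y)" "f' \<cdot> onto J X = onto J Y \<cdot> e"
    using conf_desc[OF c(1)] by blast
  show ?thesis using that suspendsI[OF conf_morI[OF c f e(1) f'(1) e(2) f'(2)] f] by blast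
qed

lemma suspends_Ide: "X \<in> Ob C \<Longrightarrow> suspends (Ide C X) (Ide C (Cosyz J X))"
  using suspendsI[OF conf_mor_Ide[OF env(1)] ide_hom] by blast

lemma suspends_comp:
  assumes "suspends f f'" "suspends g g'" "f \<in> Hom C X Y" "g \<in> Hom C Y Z"
  shows "suspends (g \<cdot> f) (g' \<cdot> f')"
proof -
  have "X \<in> Ob C" "Y \<in> Ob C" "Z \<in> Ob C" using assms(3,4)[THEN homD] by auto
  note c = env(1)[OF this(1)] env(1)[OF this(2)] env(1)[OF this(3)]
  show ?thesis using suspendsD[OF assms(1,3)] suspendsD[OF assms(2,4)] conf_mor_comp[OF _ _ c]
    suspendsI[OF _ comp_hom[OF assms(3,4)]] by metis
qed

lemma suspends_diff:
  assumes "suspends f f'" "suspends g g'" "f \<in> Hom C X Y" "g \<in> Hom C X Y"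
  shows "suspends (f \<boxminus> g) (f' \<boxminus> g')"
proof -
  have "X \<in> Ob C" "Y \<in> Ob C" using homD[OF assms(3)] by auto
  note c = env(1)[OF this(1)] env(1)[OF this(2)]
  show ?thesis using suspendsD[OF assms(1,3)] suspendsD[OF assms(2,4)] conf_mor_diff[OF _ _ c]
    suspendsI[OF _ diff_hom[OF assms(3,4)]] by metis
qed

lemma suspends_add:
  assumes "suspends f f'" "suspends g g'" "f \<in> Hom C X Y" "g \<in> Hom C X Y"
  shows "suspends (f \<boxplus> g) (f' \<boxplus> g')"
proof -
  have "X \<in> Ob C" "Y \<in> Ob C" using homD[OF assms(3)] by auto
  note c = env(1)[OF this(1)] env(1)[OF this(2)]
  show ?thesis using suspendsD[OF assms(1,3)] suspendsD[OF assms(2,4)] conf_mor_add[OF _ _ c]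
    suspendsI[OF _ add_hom[OF assms(3,4)]] by metis
qed

text \<open>
  The first component factors through a projective-injective object and this factorization extends
  along the inflation i. Subtracting the extension from the middle component leaves a map that
  vanishes on i, hence descends to the third object and lifts \<open>f'\<close> along \<open>p'\<close>. So \<open>f'\<close> factors
  through \<open>Y'\<close>. All well-definedness statements for suspensions and connecting maps are instances.
\<close>

lemma conf_mor_null:
  assumes m: "conf_mor i p i' p' f e f'" and c: "conf X Y Z i p" "conf X' Y' Z' i' p'" and PI: "Y' \<in> PI"
    and n: "\<pi> f = \<pi> (Zero C X X')"
  shows "\<pi> f' = \<pi> (Zero C Z Z')"
proof -
  note e = conf_morD[OF m c]
  note [simp] = conf_simps[OF c(1)] conf_simps[OF c(2)]
  obtain W a b where w: "W \<in> PI" "a \<in> Hom C X W" "b \<in> Hom C W X'" "f = b \<cdot> a" using K.q_zeroE[OF n e(1)] .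
  obtain a1 where a1: "a1 \<in> Hom C Y W" "a1 \<cdot> i = a" using proj_extend[OF w(1) c(1) w(2)] .
  note [simp] = e(1-3)[THEN homD] w(2,3)[THEN homD] homD[OF a1(1)] a1(2) e(4,5)
  have "(e \<boxminus> i' \<cdot> (b \<cdot> a1)) \<cdot> i = Zero C X Y'" using w(4) by simp
  moreover have "e \<boxminus> i' \<cdot> (b \<cdot> a1) \<in> Hom C Y Y'" by (simp add: hom_iff)
  ultimately obtain m where m: "m \<in> Hom C Z Y'" "m \<cdot> p = e \<boxminus> i' \<cdot> (b \<cdot> a1)"
    using conf_desc[OF c(1)] by blast
  note [simp] = homD[OF m(1)] m(2)
  have "f' = p' \<cdot> m"
    by (rule conf_epi[OF c(1) e(3)]) (simp_all add: hom_iff)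
  then show ?thesis using K.q_zeroI[OF PI m(1) confD(3)[OF c(2)]] by simp
qed

lemma suspends_null:
  assumes s: "suspends f f'" and f: "f \<in> Hom C X Y" and n: "\<pi> f = \<pi> (Zero C X Y)"
  shows "\<pi> f' = \<pi> (Zero C (Cosyz J X) (Cosyz J Y))"
proof -
  obtain e where e: "conf_mor (into J X) (onto J X) (into J Y) (onto J Y) f e f'" using suspendsD[OF s f] by metis
  have "X \<in> Ob C" "Y \<in> Ob C" using homD[OF f] by auto
  then show ?thesis using conf_mor_null[OF e env(1) env(1) env(2) n] by blast
qed

lemma suspends_cong:
  assumes "suspends f f'" "suspends g g'" "f \<in> Hom C X Y" "g \<in> Hom C X Y" "\<pi> f = \<pi> g"
  shows "\<pi> f' = \<pi> g'"
proof -
  note h = suspends_hom[OF assms(1,3)] suspends_hom[OF assms(2,4)]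
  have "\<pi> (f \<boxminus> g) = \<pi> (Zero C X Y)"
    using K.q_eq_iff[OF assms(3,4)] K.q_zero_iff[OF diff_hom[OF assms(3,4)]] assms(5) by blast
  then have "\<pi> (f' \<boxminus> g') = \<pi> (Zero C (Cosyz J X) (Cosyz J Y))"
    using suspends_null[OF suspends_diff[OF assms(1-4)] diff_hom[OF assms(3,4)]] by blast
  then show ?thesis using K.q_eq_iff[OF h] K.q_zero_iff[OF diff_hom[OF h]] by blast
qed

text \<open>
  The union in the definition of the suspension runs over a single coset.
\<close>

lemma SusM_eq:
  assumes "suspends f f'" "f \<in> Hom C X Y"
  shows "SusM Kc (\<pi> f) = \<pi> f'"
proof -
  let ?M = "{\<pi> f1' | f1' f1 X Y e. f1 \<in> \<pi> f \<and> f1 \<in> Hom C X Y \<and>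
        e \<in> Hom C (Env J X) (Env J Y) \<and> f1' \<in> Hom C (Cosyz J X) (Cosyz J Y) \<and>
        e \<cdot> into J X = into J Y \<cdot> f1 \<and> f1' \<cdot> onto J X = onto J Y \<cdot> e}"
  have ob: "X \<in> Ob C" "Y \<in> Ob C" using homD[OF assms(2)] by auto
  have "G = \<pi> f'" if G: "G \<in> ?M" for G
  proof -
    obtain f1' f1 X1 Y1 e where *: "G = \<pi> f1'" "f1 \<in> \<pi> f" "f1 \<in> Hom C X1 Y1"
        "e \<in> Hom C (Env J X1) (Env J Y1)" "f1' \<in> Hom C (Cosyz J X1) (Cosyz J Y1)"
        "e \<cdot> into J X1 = into J Y1 \<cdot> f1" "f1' \<cdot> onto J X1 = onto J Y1 \<cdot> e"
      using G by blast
    note m = K.q_memE[OF *(2) assms(2)]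
    have [simp]: "X1 = X" "Y1 = Y" using hom_disjoint[OF m(1) *(3)] by blast+
    have "suspends f1 f1'"
      using suspendsI[OF conf_morI[OF env(1)[OF ob(1)] env(1)[OF ob(2)]]] * by simp
    then show ?thesis using suspends_cong[OF _ assms(1) m(1) assms(2) m(2)] *(1) by simp
  qed
  moreover have "\<pi> f' \<in> ?M"
    using suspendsD[OF assms] K.q_mem[OF assms(2)] assms(2) by (smt (verit, ccfv_threshold) mem_Collect_eq)
  ultimately have "\<Union>?M = \<pi> f'" by blast
  moreover have "SusM Kc (\<pi> f) = \<Union>?M"
    unfolding stable_fields by (simp add: stable_suscat_def addcat.extend_def suscat.fields_def stable_functor_def)
  ultimately show ?thesis by simp
qed

end

section \<open>Image triangles of conflations and lifting of squares\<close>

context frobenius_envelope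
begin

text \<open>
  Y is the pullback of \<open>Y'\<close> and Z over \<open>Z'\<close>, because the right square is bicartesian.
\<close>

lemma pullback_lift:
  assumes c: "conf X Y Z i p" "conf X Y' Z' i' p'" and m: "conf_mor i p i' p' (Ide C X) u w"
    and x: "x \<in> Hom C T Y'" "z \<in> Hom C T Z" "p' \<cdot> x = w \<cdot> z"
  obtains v where "v \<in> Hom C T Y" "u \<cdot> v = x" "p \<cdot> v = z"
proof -
  note m = conf_morD[OF m c]
  note [simp] = conf_simps[OF c(1)] conf_simps[OF c(2)] m(2,3)[THEN homD] x(1,2)[THEN homD]
  obtain s i1 i2 p1 p2 where bp: "is_biproduct C Y' Z s i1 i2 p1 p2"
    using biproducts[of Y' Z] by auto
  note [simp] = biproduct_simps[OF bp]
  let ?i = "i1 \<cdot> u \<boxminus> i2 \<cdot> p" and ?p = "p' \<cdot> p1 \<boxplus> w \<cdot> p2"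
  have "(?i, ?p) \<in> S"
    using conf_of_right_square[OF confD(1-3)[OF c(1)] confD(1-3)[OF c(2)] m(2) _ m(3) m(5) bp] m(4) by simp
  then have cs: "conf Y s Z' ?i ?p" unfolding conf_def by (simp add: hom_iff)
  have "i1 \<cdot> x \<boxminus> i2 \<cdot> z \<in> Hom C T s" "?p \<cdot> (i1 \<cdot> x \<boxminus> i2 \<cdot> z) = Zero C T Z'"
    using x(3) by (simp_all add: hom_iff diff_def)
  then obtain v where v: "v \<in> Hom C T Y" "?i \<cdot> v = i1 \<cdot> x \<boxminus> i2 \<cdot> z" using conf_lift[OF cs] by blast
  note [simp] = homD[OF v(1)]
  have "p1 \<cdot> (?i \<cdot> v) = u \<cdot> v" "p2 \<cdot> (?i \<cdot> v) = neg C T Z (p \<cdot> v)" by (simp_all add: diff_def)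
  moreover have "p1 \<cdot> (i1 \<cdot> x \<boxminus> i2 \<cdot> z) = x" "p2 \<cdot> (i1 \<cdot> x \<boxminus> i2 \<cdot> z) = neg C T Z z" by (simp_all add: diff_def)
  ultimately have e: "u \<cdot> v = x" "neg C T Z (p \<cdot> v) = neg C T Z z" unfolding v(2) by simp_all
  have "p \<cdot> v = z" using arg_cong[OF e(2), of "neg C T Z"] by simp
  then show ?thesis using that v(1) e(1) by blast
qed

text \<open>
  The map w classifying the conflation: it is induced on the quotients by an extension of the
  envelope of the first object. The third map of the image triangle is the class of \<open>-w\<close>.
\<close>

definition conn where
  "conn i p w \<longleftrightarrow> (\<exists>u. conf_mor i p (into J (Dom C i)) (onto J (Dom C i)) (Ide C (Dom C i)) u w)"

lemma connE:
  assumes "conn i p w" "conf X Y Z i p"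
  obtains u where "conf_mor i p (into J X) (onto J X) (Ide C X) u w" "u \<in> Hom C Y (Env J X)"
    "w \<in> Hom C Z (Cosyz J X)" "u \<cdot> i = into J X" "w \<cdot> p = onto J X \<cdot> u"
proof -
  note [simp] = conf_simps[OF assms(2)]
  have e: "conf X (Env J X) (Cosyz J X) (into J X) (onto J X)" by (simp add: env)
  obtain u where "conf_mor i p (into J X) (onto J X) (Ide C X) u w" using assms(1) unfolding conn_def by auto
  then show ?thesis using that conf_morD[OF _ assms(2) e] conf_simps(1)[OF e] by simp
qed

lemma conn_exists:
  assumes c: "conf X Y Z i p"
  obtains w where "conn i p w" "w \<in> Hom C Z (Cosyz J X)"
proof -
  note [simp] = conf_simps[OF c]
  have e: "conf X (Env J X) (Cosyz J X) (into J X) (onto J X)" by (simp add: env)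
  note [simp] = conf_simps[OF e]
  obtain u where u: "u \<in> Hom C Y (Env J X)" "u \<cdot> i = into J X"
    using proj_extend[OF env(2) c confD(2)[OF e]] by auto
  note [simp] = homD[OF u(1)] u(2)
  have "onto J X \<cdot> u \<in> Hom C Y (Cosyz J X)" "(onto J X \<cdot> u) \<cdot> i = Zero C X (Cosyz J X)" by (simp_all add: hom_iff)
  then obtain w where w: "w \<in> Hom C Z (Cosyz J X)" "w \<cdot> p = onto J X \<cdot> u" using conf_desc[OF c] by blast
  have "conf_mor i p (into J X) (onto J X) (Ide C X) u w"
    by (rule conf_morI[OF c e]) (simp_all add: u w ide_hom)
  then have "conn i p w" unfolding conn_def by auto
  then show ?thesis using that w(1) by blast
qed

text \<open>
  The two ways around the square differ by the third component of a morphism of conflations whose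
  first component is zero, and such a component is stably zero by the preceding principle.
\<close>

lemma conn_natural:
  assumes c: "conf X Y Z i p" "conf X' Y' Z' i' p'" and m: "conf_mor i p i' p' a b c"
    and w: "conn i p w" "conn i' p' w'" and s: "suspends a a'"
  shows "\<pi> (a' \<cdot> w) = \<pi> (w' \<cdot> c)"
proof -
  note [simp] = conf_simps[OF c(1)] conf_simps[OF c(2)]
  have e: "conf X (Env J X) (Cosyz J X) (into J X) (onto J X)" "conf X' (Env J X') (Cosyz J X') (into J X') (onto J X')"
    by (simp_all add: env)
  note m' = conf_morD[OF m c]
  obtain u where u: "conf_mor i p (into J X) (onto J X) (Ide C X) u w" "w \<in> Hom C Z (Cosyz J X)" using connE[OF w(1) c(1)] by metis
  obtain u' where u': "conf_mor i' p' (into J X') (onto J X') (Ide C X') u' w'" "w' \<in> Hom C Z' (Cosyz J X')" using connE[OF w(2) c(2)] by metis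
  obtain f where f: "conf_mor (into J X) (onto J X) (into J X') (onto J X') a f a'" "a' \<in> Hom C (Cosyz J X) (Cosyz J X')"
    using suspendsD[OF s m'(1)] by metis
  note [simp] = m'(1,3)[THEN homD] homD[OF u(2)] homD[OF u'(2)] homD[OF f(2)]
  from conf_mor_diff[OF conf_mor_comp[OF u(1) f(1) c(1) e] conf_mor_comp[OF m u'(1) c e(2)] c(1) e(2)]
  have "conf_mor i p (into J X') (onto J X') (Zero C X X') (f \<cdot> u \<boxminus> u' \<cdot> b) (a' \<cdot> w \<boxminus> w' \<cdot> c)" by simp
  from conf_mor_null[OF this c(1) e(2) env(2)] have "\<pi> (a' \<cdot> w \<boxminus> w' \<cdot> c) = \<pi> (Zero C Z (Cosyz J X'))" by simp
  then show ?thesis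
    using K.q_eq_iff[of "a' \<cdot> w" Z "Cosyz J X'" "w' \<cdot> c"] K.q_zero_iff[of "a' \<cdot> w \<boxminus> w' \<cdot> c" Z "Cosyz J X'"]
    by (simp add: hom_iff)
qed

lemma conn_unique:
  assumes c: "conf X Y Z i p" and w: "conn i p w" "conn i p w'"
  shows "\<pi> w = \<pi> w'"
proof -
  note [simp] = conf_simps[OF c]
  have "w \<in> Hom C Z (Cosyz J X)" "w' \<in> Hom C Z (Cosyz J X)" using connE[OF w(1) c] connE[OF w(2) c] by metis+
  then show ?thesis
    using conn_natural[OF c c conf_mor_Ide[OF c] w suspends_Ide] by (simp add: hom_iff)
qed

lemma image_triangle_eq:
  assumes c: "conf X Y Z i p" and w: "conn i p w"
  shows "img i p = (\<pi> i, \<pi> p, \<pi> (neg C Z (Cosyz J X) w))"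
  unfolding image_triangle_def prod.case stable_functor_def
proof (rule the_equality)
  obtain u where u: "u \<in> Hom C Y (Env J X)" "w \<in> Hom C Z (Cosyz J X)" "u \<cdot> i = into J X" "w \<cdot> p = onto J X \<cdot> u"
    using connE[OF w c] by metis
  then show "\<exists>X' Y' Z' u' w'.
     i \<in> Hom C X' Y' \<and> p \<in> Hom C Y' Z' \<and> u' \<in> Hom C Y' (Env J X') \<and> w' \<in> Hom C Z' (Cosyz J X') \<and>
     u' \<cdot> i = into J X' \<and> w' \<cdot> p = onto J X' \<cdot> u' \<and>
     (\<pi> i, \<pi> p, \<pi> (neg C Z (Cosyz J X) w)) = (\<pi> i, \<pi> p, \<pi> (neg C Z' (Cosyz J X') w'))"
    using confD(2,3)[OF c] by blast
next
  fix T assume "\<exists>X' Y' Z' u' w'.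
     i \<in> Hom C X' Y' \<and> p \<in> Hom C Y' Z' \<and> u' \<in> Hom C Y' (Env J X') \<and> w' \<in> Hom C Z' (Cosyz J X') \<and>
     u' \<cdot> i = into J X' \<and> w' \<cdot> p = onto J X' \<cdot> u' \<and> T = (\<pi> i, \<pi> p, \<pi> (neg C Z' (Cosyz J X') w'))"
  then obtain X' Y' Z' u' w' where h: "i \<in> Hom C X' Y'" "p \<in> Hom C Y' Z'" "u' \<in> Hom C Y' (Env J X')" "w' \<in> Hom C Z' (Cosyz J X')"
     "u' \<cdot> i = into J X'" "w' \<cdot> p = onto J X' \<cdot> u'" "T = (\<pi> i, \<pi> p, \<pi> (neg C Z' (Cosyz J X') w'))" by blast
  note [simp] = conf_simps[OF c]
  have [simp]: "X' = X" "Y' = Y" "Z' = Z" using h(1,2)[THEN homD] by auto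
  have e: "conf X (Env J X) (Cosyz J X) (into J X) (onto J X)" by (simp add: env)
  note [simp] = conf_simps[OF e]
  have "conf_mor i p (into J X) (onto J X) (Ide C X) u' w'"
    by (rule conf_morI[OF c e]) (use h in \<open>simp_all add: ide_hom\<close>)
  then have w': "conn i p w'" unfolding conn_def by auto
  obtain "w \<in> Hom C Z (Cosyz J X)" using connE[OF w c] by metis
  note [simp] = homD[OF this] homD[OF h(4)]
  have "\<pi> (neg C Z (Cosyz J X) w) = neg Kc Z (Cosyz J X) (\<pi> w)" "\<pi> (neg C Z (Cosyz J X) w') = neg Kc Z (Cosyz J X) (\<pi> w')"
    by simp_all
  then have "\<pi> (neg C Z (Cosyz J X) w) = \<pi> (neg C Z (Cosyz J X) w')"
    by (simp only: conn_unique[OF c w w'])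
  then show "T = (\<pi> i, \<pi> p, \<pi> (neg C Z (Cosyz J X) w))" using h(7) by simp
qed

text \<open>
  A square that commutes only stably is made commutative by correcting its middle map: the
  difference factors through a projective-injective object, and the first factor extends along i.
  The third component is then induced on the cokernels.
\<close>

lemma fill_right:
  assumes c: "conf X Y Z i p" "conf X' Y' Z' i' p'" and a: "a \<in> Hom C X X'" "b \<in> Hom C Y Y'"
    and e: "\<pi> (b \<cdot> i) = \<pi> (i' \<cdot> a)"
  obtains b' c where "conf_mor i p i' p' a b' c" "\<pi> b' = \<pi> b"
proof -
  note [simp] = conf_simps[OF c(1)] conf_simps[OF c(2)] a(1,2)[THEN homD]
  obtain W \<alpha> \<beta> where w: "W \<in> PI" "\<alpha> \<in> Hom C X W" "\<beta> \<in> Hom C W Y'" "b \<cdot> i = i' \<cdot> a \<boxplus> \<beta> \<cdot> \<alpha>"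
    using K.q_eqE[OF e, of X Y'] by (auto simp: hom_iff)
  obtain \<alpha>' where \<alpha>': "\<alpha>' \<in> Hom C Y W" "\<alpha>' \<cdot> i = \<alpha>" using proj_extend[OF w(1) c(1) w(2)] .
  note [simp] = w(2,3)[THEN homD] homD[OF \<alpha>'(1)] \<alpha>'(2)
  let ?b = "b \<boxminus> \<beta> \<cdot> \<alpha>'"
  have b: "?b \<in> Hom C Y Y'" by (simp add: hom_iff)
  have bi: "?b \<cdot> i = i' \<cdot> a" using w(4) by simp
  then have "p' \<cdot> (?b \<cdot> i) = Zero C X Z'" by simp
  then have "(p' \<cdot> ?b) \<cdot> i = Zero C X Z'" "p' \<cdot> ?b \<in> Hom C Y Z'" by (simp_all add: hom_iff)
  then obtain c' where c': "c' \<in> Hom C Z Z'" "c' \<cdot> p = p' \<cdot> ?b" using conf_desc[OF c(1)] by metis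
  have "\<pi> ?b = \<pi> b \<boxminus>\<^bsub>Kc\<^esub> \<pi> (\<beta> \<cdot> \<alpha>')" by simp
  also have "\<dots> = \<pi> b" unfolding K.q_zeroI[OF w(1) \<alpha>'(1) w(3)] by simp
  finally show ?thesis using that conf_morI[OF c a(1) b c'(1) bi c'(2)] by blast
qed

text \<open>
  As before, with the correction obtained by lifting the second factor along the deflation.
\<close>

lemma fill_left:
  assumes c: "conf X Y Z i p" "conf X' Y' Z' i' p'" and b: "b \<in> Hom C Y Y'" "c \<in> Hom C Z Z'"
    and e: "\<pi> (c \<cdot> p) = \<pi> (p' \<cdot> b)"
  obtains a b' where "conf_mor i p i' p' a b' c" "\<pi> b' = \<pi> b"
proof -
  note [simp] = conf_simps[OF c(1)] conf_simps[OF c(2)] b(1,2)[THEN homD]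
  obtain W \<alpha> \<beta> where w: "W \<in> PI" "\<alpha> \<in> Hom C Y W" "\<beta> \<in> Hom C W Z'" "c \<cdot> p = p' \<cdot> b \<boxplus> \<beta> \<cdot> \<alpha>"
    using K.q_eqE[OF e, of Y Z'] by (auto simp: hom_iff)
  obtain \<beta>' where \<beta>': "\<beta>' \<in> Hom C W Y'" "p' \<cdot> \<beta>' = \<beta>" using proj_lift[OF w(1) c(2) w(3)] .
  note [simp] = w(2,3)[THEN homD] homD[OF \<beta>'(1)] \<beta>'(2) rewrite_under[OF \<beta>'(2)]
  let ?b = "b \<boxplus> \<beta>' \<cdot> \<alpha>"
  have b': "?b \<in> Hom C Y Y'" by (simp add: hom_iff)
  have cp: "c \<cdot> p = p' \<cdot> ?b" using w(4) by simp
  have "c \<cdot> (p \<cdot> i) = p' \<cdot> (?b \<cdot> i)" using rewrite_under[OF cp, of i] by simp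
  then have "p' \<cdot> (?b \<cdot> i) = Zero C X Z'" "?b \<cdot> i \<in> Hom C X Y'" by (simp_all add: hom_iff)
  then obtain a where a: "a \<in> Hom C X X'" "i' \<cdot> a = ?b \<cdot> i" using conf_lift[OF c(2)] by metis
  have "\<pi> ?b = \<pi> b \<boxplus>\<^bsub>Kc\<^esub> \<pi> (\<beta>' \<cdot> \<alpha>)" by simp
  also have "\<dots> = \<pi> b" unfolding K.q_zeroI[OF w(1,2) \<beta>'(1)] by simp
  finally show ?thesis using that conf_morI[OF c a(1) b' b(2) a(2)[symmetric] cp] by blast
qed

text \<open>
  \<open>Y'\<close> is a pullback of the envelope of \<open>X'\<close>, so a map into \<open>Y'\<close> is given by its two components. The
  component into the envelope is the composite of the extensions for the source, corrected by a
  lift of the error in the stable equation.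
\<close>

lemma fill_middle:
  assumes c: "conf X Y Z i p" "conf X' Y' Z' i' p'" and a: "a \<in> Hom C X X'" "c \<in> Hom C Z Z'"
    and w: "conn i p w" "conn i' p' w'" and s: "suspends a a'" and e: "\<pi> (w' \<cdot> c) = \<pi> (a' \<cdot> w)"
  obtains b where "conf_mor i p i' p' a b c"
proof -
  note [simp] = conf_simps[OF c(1)] conf_simps[OF c(2)] a(1,2)[THEN homD]
  have env': "conf X (Env J X) (Cosyz J X) (into J X) (onto J X)" "conf X' (Env J X') (Cosyz J X') (into J X') (onto J X')"
    by (simp_all add: env)
  note [simp] = conf_simps[OF env'(1)] conf_simps[OF env'(2)]
  obtain u where u: "u \<in> Hom C Y (Env J X)" "w \<in> Hom C Z (Cosyz J X)" "u \<cdot> i = into J X" "w \<cdot> p = onto J X \<cdot> u"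
    using connE[OF w(1) c(1)] by metis
  obtain u' where u': "conf_mor i' p' (into J X') (onto J X') (Ide C X') u' w'" "u' \<in> Hom C Y' (Env J X')"
    "w' \<in> Hom C Z' (Cosyz J X')" "u' \<cdot> i' = into J X'" "w' \<cdot> p' = onto J X' \<cdot> u'"
    using connE[OF w(2) c(2)] by metis
  obtain f where f: "f \<in> Hom C (Env J X) (Env J X')" "a' \<in> Hom C (Cosyz J X) (Cosyz J X')"
    "f \<cdot> into J X = into J X' \<cdot> a" "a' \<cdot> onto J X = onto J X' \<cdot> f"
    using suspendsD[OF s a(1)] by metis
  note [simp] = u(1,2)[THEN homD] u'(2,3)[THEN homD] f(1,2)[THEN homD]
    u(3,4) u'(4) f(3,4) rewrite_under[OF u(4)] rewrite_under[OF f(4)] rewrite_under[OF u'(4)]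
  obtain W \<alpha> \<beta> where W: "W \<in> PI" "\<alpha> \<in> Hom C Z W" "\<beta> \<in> Hom C W (Cosyz J X')" "w' \<cdot> c = a' \<cdot> w \<boxplus> \<beta> \<cdot> \<alpha>"
    using K.q_eqE[OF e, of Z "Cosyz J X'"] by (auto simp: hom_iff)
  obtain \<beta>' where \<beta>': "\<beta>' \<in> Hom C W (Env J X')" "onto J X' \<cdot> \<beta>' = \<beta>" using proj_lift[OF W(1) env'(2) W(3)] .
  note [simp] = W(2,3)[THEN homD] homD[OF \<beta>'(1)] \<beta>'(2) rewrite_under[OF \<beta>'(2)]
  \<comment> \<open>the summand with \<beta>' absorbs the difference between w' c and a' w\<close>
  let ?x = "f \<cdot> u \<boxplus> \<beta>' \<cdot> (\<alpha> \<cdot> p)"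
  have x: "?x \<in> Hom C Y (Env J X')" "c \<cdot> p \<in> Hom C Y Z'" by (simp_all add: hom_iff)
  have "onto J X' \<cdot> ?x = w' \<cdot> (c \<cdot> p)"
    using rewrite_under[OF W(4), of p] by simp
  then obtain b where b: "b \<in> Hom C Y Y'" "u' \<cdot> b = ?x" "p' \<cdot> b = c \<cdot> p"
    using pullback_lift[OF c(2) env'(2) u'(1) x] by blast
  note [simp] = homD[OF b(1)] b(2,3) b(2,3)[THEN rewrite_under]
  have "p' \<cdot> (b \<cdot> i \<boxminus> i' \<cdot> a) = Zero C X Z'" "b \<cdot> i \<boxminus> i' \<cdot> a \<in> Hom C X Y'" by (simp_all add: hom_iff)
  then obtain \<tau> where \<tau>: "\<tau> \<in> Hom C X X'" "i' \<cdot> \<tau> = b \<cdot> i \<boxminus> i' \<cdot> a" using conf_lift[OF c(2)] by blast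
  note [simp] = homD[OF \<tau>(1)]
  have "into J X' \<cdot> \<tau> = u' \<cdot> (i' \<cdot> \<tau>)" by simp
  also have "\<dots> = into J X' \<cdot> Zero C X X'" unfolding \<tau>(2) by simp
  finally have "\<tau> = Zero C X X'" using conf_mono[OF env'(2) \<tau>(1)] by (simp add: hom_iff)
  then have "b \<cdot> i \<boxminus> i' \<cdot> a = Zero C X Y'" using \<tau>(2) by simp
  then have bi: "b \<cdot> i = i' \<cdot> a" using diff_eq_Zero[of "b \<cdot> i" "i' \<cdot> a" X Y'] by simp
  show ?thesis using that conf_morI[OF c a(1) b(1) a(2) bi b(3)[symmetric]] by blast
qed

lemma null_comp_left: "\<pi> f = \<pi> (Zero C x y) \<Longrightarrow> f \<in> Hom C x y \<Longrightarrow> g \<in> Hom C y z \<Longrightarrow> \<pi> (g \<cdot> f) = \<pi> (Zero C x z)"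
  using K.q_cong_comp[OF _ Zero_hom] homD[of f x y] homD[of g y z] by simp

lemma null_comp_right: "\<pi> g = \<pi> (Zero C y z) \<Longrightarrow> f \<in> Hom C x y \<Longrightarrow> g \<in> Hom C y z \<Longrightarrow> \<pi> (g \<cdot> f) = \<pi> (Zero C x z)"
  using K.q_cong_comp[OF _ _ _ Zero_hom, of f x y f g z] homD[of f x y] homD[of g y z] by simp

text \<open>
  If two components of an endomorphism of a conflation are stably zero, the remaining one squares to
  zero in the stable category. After a correction by a stably zero map the component b kills i and
  factors as \<open>g \<cdot> p\<close>, so that \<open>c = p \<cdot> g\<close> and \<open>c \<cdot> c = p \<cdot> (g \<cdot> p) \<cdot> g\<close> contains a stably zero factor. In
  general c itself is not stably zero.
\<close>

lemma nil_right:
  assumes c: "conf X Y Z i p" and m: "conf_mor i p i p a b c"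
    and n: "\<pi> a = \<pi> (Zero C X X)" "\<pi> b = \<pi> (Zero C Y Y)"
  shows "\<pi> (c \<cdot> c) = \<pi> (Zero C Z Z)"
proof -
  note m = conf_morD[OF m c c]
  note [simp] = conf_simps[OF c] m(1-3)[THEN homD]
  obtain W \<alpha> \<beta> where w: "W \<in> PI" "\<alpha> \<in> Hom C X W" "\<beta> \<in> Hom C W X" "a = \<beta> \<cdot> \<alpha>" using K.q_zeroE[OF n(1) m(1)] .
  obtain \<alpha>' where \<alpha>': "\<alpha>' \<in> Hom C Y W" "\<alpha>' \<cdot> i = \<alpha>" using proj_extend[OF w(1) c w(2)] .
  note [simp] = w(2,3)[THEN homD] homD[OF \<alpha>'(1)] \<alpha>'(2)
  let ?k = "i \<cdot> (\<beta> \<cdot> \<alpha>')"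
  have k: "b \<boxminus> ?k \<in> Hom C Y Y" by (simp add: hom_iff)
  have "(b \<boxminus> ?k) \<cdot> i = Zero C X Y" using m(4) w(4) by simp
  then obtain g where g: "g \<in> Hom C Z Y" "g \<cdot> p = b \<boxminus> ?k" using conf_desc[OF c k] by blast
  note [simp] = homD[OF g(1)]
  have "\<pi> (g \<cdot> p) = \<pi> b \<boxminus>\<^bsub>Kc\<^esub> \<pi> ((i \<cdot> \<beta>) \<cdot> \<alpha>')" unfolding g(2) by simp
  also have "\<dots> = \<pi> (Zero C Y Y)"
    unfolding K.q_zeroI[OF w(1) \<alpha>'(1) comp_hom[OF w(3) confD(2)[OF c]]] n(2) by simp
  finally have gp: "\<pi> (g \<cdot> p) = \<pi> (Zero C Y Y)" .
  have "c = p \<cdot> g"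
  proof (rule conf_epi[OF c m(3)])
    have "c \<cdot> p = p \<cdot> (b \<boxminus> ?k)" using m(5) by simp
    then show "c \<cdot> p = p \<cdot> g \<cdot> p" unfolding g(2)[symmetric] by simp
  qed (simp add: hom_iff)
  then have "c \<cdot> c = p \<cdot> ((g \<cdot> p) \<cdot> g)" by simp
  moreover have "\<pi> (p \<cdot> ((g \<cdot> p) \<cdot> g)) = \<pi> (Zero C Z Z)"
    by (rule null_comp_left[OF null_comp_right[OF gp g(1)] _ confD(3)[OF c]]) (simp_all add: hom_iff)
  ultimately show ?thesis by simp
qed

lemma nil_left:
  assumes c: "conf X Y Z i p" and m: "conf_mor i p i p a b c"
    and n: "\<pi> b = \<pi> (Zero C Y Y)" "\<pi> c = \<pi> (Zero C Z Z)"
  shows "\<pi> (a \<cdot> a) = \<pi> (Zero C X X)"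
proof -
  note m = conf_morD[OF m c c]
  note [simp] = conf_simps[OF c] m(1-3)[THEN homD]
  obtain W \<alpha> \<beta> where w: "W \<in> PI" "\<alpha> \<in> Hom C Z W" "\<beta> \<in> Hom C W Z" "c = \<beta> \<cdot> \<alpha>" using K.q_zeroE[OF n(2) m(3)] .
  obtain \<beta>' where \<beta>': "\<beta>' \<in> Hom C W Y" "p \<cdot> \<beta>' = \<beta>" using proj_lift[OF w(1) c w(3)] .
  note [simp] = w(2,3)[THEN homD] homD[OF \<beta>'(1)] \<beta>'(2) rewrite_under[OF \<beta>'(2)]
  let ?k = "\<beta>' \<cdot> (\<alpha> \<cdot> p)"
  have k: "b \<boxminus> ?k \<in> Hom C Y Y" by (simp add: hom_iff)
  have "p \<cdot> (b \<boxminus> ?k) = Zero C Y Z" using m(5) w(4) by simp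
  then obtain g where g: "g \<in> Hom C Y X" "i \<cdot> g = b \<boxminus> ?k" using conf_lift[OF c k] by blast
  note [simp] = homD[OF g(1)]
  have "\<pi> (i \<cdot> g) = \<pi> b \<boxminus>\<^bsub>Kc\<^esub> \<pi> (\<beta>' \<cdot> (\<alpha> \<cdot> p))" unfolding g(2) by simp
  also have "\<dots> = \<pi> (Zero C Y Y)"
    unfolding K.q_zeroI[OF w(1) comp_hom[OF confD(3)[OF c] w(2)] \<beta>'(1)] n(1) by simp
  finally have gp: "\<pi> (i \<cdot> g) = \<pi> (Zero C Y Y)" .
  have "a = g \<cdot> i"
  proof (rule conf_mono[OF c m(1)])
    have "i \<cdot> a = (b \<boxminus> ?k) \<cdot> i" using m(4) by simp
    then show "i \<cdot> a = i \<cdot> (g \<cdot> i)" unfolding g(2)[symmetric] by simp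
  qed (simp add: hom_iff)
  then have "a \<cdot> a = g \<cdot> ((i \<cdot> g) \<cdot> i)" by simp
  moreover have "\<pi> (g \<cdot> ((i \<cdot> g) \<cdot> i)) = \<pi> (Zero C X X)"
    by (rule null_comp_left[OF null_comp_right[OF gp confD(2)[OF c]] _ g(1)]) (simp_all add: hom_iff)
  ultimately show ?thesis by simp
qed

text \<open>
  Applied to the difference with the identity, the nilpotency statements show that two stably
  trivial components make the third one unipotent. This replaces the five lemma.
\<close>

lemma endo_iso:
  assumes c: "conf X Y Z i p" and m: "conf_mor i p i p a b c"
  shows "\<pi> a = \<pi> (Ide C X) \<Longrightarrow> \<pi> b = \<pi> (Ide C Y) \<Longrightarrow> is_iso Kc (\<pi> c)"
    and "\<pi> b = \<pi> (Ide C Y) \<Longrightarrow> \<pi> c = \<pi> (Ide C Z) \<Longrightarrow> is_iso Kc (\<pi> a)"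
proof -
  note m' = conf_morD[OF m c c]
  note [simp] = conf_simps[OF c] m'(1-3)[THEN homD]
  note d = conf_mor_diff[OF m conf_mor_Ide[OF c] c c]
  have z: "\<pi> (f \<boxminus> Ide C T) = \<pi> (Zero C T T)" if "\<pi> f = \<pi> (Ide C T)" "f \<in> Hom C T T" for f T
  proof -
    note [simp] = homD[OF that(2)]
    have "\<pi> (f \<boxminus> Ide C T) = \<pi> f \<boxminus>\<^bsub>Kc\<^esub> \<pi> (Ide C T)" by simp
    then show ?thesis unfolding that(1) by simp
  qed
  have u: "is_iso Kc (\<pi> f)" if "f \<in> Hom C T T" "\<pi> ((f \<boxminus> Ide C T) \<cdot> (f \<boxminus> Ide C T)) = \<pi> (Zero C T T)" for f T
  proof -
    note [simp] = homD[OF that(1)]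
    show ?thesis
      by (rule K.Q.unipotent_iso[OF K.q_hom[OF that(1)]]) (use that(2) in \<open>simp del: comp_diff diff_comp\<close>)
  qed
  show "is_iso Kc (\<pi> c)" if "\<pi> a = \<pi> (Ide C X)" "\<pi> b = \<pi> (Ide C Y)"
    using u[OF m'(3) nil_right[OF c d z[OF that(1) m'(1)] z[OF that(2) m'(2)]]] .
  show "is_iso Kc (\<pi> a)" if "\<pi> b = \<pi> (Ide C Y)" "\<pi> c = \<pi> (Ide C Z)"
    using u[OF m'(1) nil_left[OF c d z[OF that(1) m'(2)] z[OF that(2) m'(3)]]] .
qed

end

section \<open>Triangles and their isomorphisms\<close>

declare tri_mor.simps [simp del]

text \<open>
  Composing and inverting morphisms of triangles uses only that the suspension is a functor.
\<close>

locale suspended_category = additive_category C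
  for C :: "('o, 'm, 'z) suscat_scheme" (structure) +
  assumes SusO_Ob: "X \<in> Ob C \<Longrightarrow> SusO C X \<in> Ob C"
    and SusM_hom: "f \<in> Hom C X Y \<Longrightarrow> SusM C f \<in> Hom C (SusO C X) (SusO C Y)"
    and SusM_comp: "f \<in> Hom C X Y \<Longrightarrow> g \<in> Hom C Y Z \<Longrightarrow> SusM C (g \<cdot> f) = SusM C g \<cdot> SusM C f"
    and SusM_Ide: "X \<in> Ob C \<Longrightarrow> SusM C (Ide C X) = Ide C (SusO C X)"
begin

lemma SusM_simps [simp]:
  "X \<in> Ob C \<Longrightarrow> SusO C X \<in> Ob C"
  "X \<in> Ob C \<Longrightarrow> SusM C (Ide C X) = Ide C (SusO C X)"
  "Arr C f \<Longrightarrow> Arr C (SusM C f)" "Arr C f \<Longrightarrow> Dom C (SusM C f) = SusO C (Dom C f)"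
  "Arr C f \<Longrightarrow> Cod C (SusM C f) = SusO C (Cod C f)"
  "Arr C f \<Longrightarrow> Arr C g \<Longrightarrow> Cod C f = Dom C g \<Longrightarrow> SusM C (g \<cdot> f) = SusM C g \<cdot> SusM C f"
  using SusO_Ob SusM_Ide homD[OF SusM_hom[OF Arr_hom[of f]]] SusM_comp[OF Arr_hom[of f], of g "Cod C g"] Arr_hom[of g]
  by simp_all

lemma cand_simps:
  assumes "is_cand C X Y Z (f, g, h)"
  shows "Arr C f \<and> Dom C f = X \<and> Cod C f = Y" "Arr C g \<and> Dom C g = Y \<and> Cod C g = Z"
    "Arr C h \<and> Dom C h = Z \<and> Cod C h = SusO C X" "X \<in> Ob C" "Y \<in> Ob C" "Z \<in> Ob C"
  using assms homD by (simp_all, blast+)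

lemma tri_mor_iff:
  assumes "is_cand C X Y Z (f, g, h)" "is_cand C X' Y' Z' (f', g', h')"
  shows "tri_mor C (f, g, h) (f', g', h') (a, b, c) \<longleftrightarrow> a \<in> Hom C X X' \<and> b \<in> Hom C Y Y' \<and> c \<in> Hom C Z Z' \<and>
    b \<cdot> f = f' \<cdot> a \<and> c \<cdot> g = g' \<cdot> b \<and> SusM C a \<cdot> h = h' \<cdot> c" (is "?l = ?r")
proof
  assume ?l
  then obtain X1 Y1 Z1 X2 Y2 Z2 where *: "is_cand C X1 Y1 Z1 (f, g, h)" "is_cand C X2 Y2 Z2 (f', g', h')"
    "a \<in> Hom C X1 X2 \<and> b \<in> Hom C Y1 Y2 \<and> c \<in> Hom C Z1 Z2 \<and>
    b \<cdot> f = f' \<cdot> a \<and> c \<cdot> g = g' \<cdot> b \<and> SusM C a \<cdot> h = h' \<cdot> c" unfolding tri_mor.simps by blast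
  have "X1 = X" "Y1 = Y" "Z1 = Z" "X2 = X'" "Y2 = Y'" "Z2 = Z'"
    using cand_simps[OF *(1)] cand_simps[OF *(2)] cand_simps[OF assms(1)] cand_simps[OF assms(2)] by simp_all
  then show ?r using *(3) by blast
next
  assume ?r
  then show ?l using assms unfolding tri_mor.simps by blast
qed

lemma tri_mor_cand:
  assumes "tri_mor C T T' m"
  shows "(\<exists>X Y Z. is_cand C X Y Z T) \<and> (\<exists>X Y Z. is_cand C X Y Z T')"
  using assms by (cases T; cases T'; cases m) (simp only: tri_mor.simps, blast)

lemma tri_mor_comp:
  assumes "tri_mor C T T' (a, b, c)" "tri_mor C T' T'' (a', b', c')"
  shows "tri_mor C T T'' (a' \<cdot> a, b' \<cdot> b, c' \<cdot> c)"
proof -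
  obtain f g h f' g' h' f'' g'' h'' where T: "T = (f, g, h)" "T' = (f', g', h')" "T'' = (f'', g'', h'')"
    by (metis prod_cases3)
  obtain X Y Z X' Y' Z' X'' Y'' Z'' where c: "is_cand C X Y Z (f, g, h)" "is_cand C X' Y' Z' (f', g', h')"
     "is_cand C X'' Y'' Z'' (f'', g'', h'')"
    using tri_mor_cand[OF assms(1)] tri_mor_cand[OF assms(2)] unfolding T by blast
  note m = assms[unfolded T tri_mor_iff[OF c(1,2)] tri_mor_iff[OF c(2,3)]]
  have m1: "a \<in> Hom C X X'" "b \<in> Hom C Y Y'" "c \<in> Hom C Z Z'"
    "b \<cdot> f = f' \<cdot> a" "c \<cdot> g = g' \<cdot> b" "SusM C a \<cdot> h = h' \<cdot> c"
   "a' \<in> Hom C X' X''" "b' \<in> Hom C Y' Y''" "c' \<in> Hom C Z' Z''"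
    "b' \<cdot> f' = f'' \<cdot> a'" "c' \<cdot> g' = g'' \<cdot> b'" "SusM C a' \<cdot> h' = h'' \<cdot> c'" using m by blast+
  note [simp] = cand_simps[OF c(1)] cand_simps[OF c(2)] cand_simps[OF c(3)]
    m1(1-3,7-9)[THEN homD]
    m1(4-6) m1(10-12) m1(4-6,10-12)[THEN rewrite_under]
  show ?thesis unfolding T tri_mor_iff[OF c(1,3)] by (simp add: hom_iff)
qed

lemma tri_mor_inverse:
  assumes m: "tri_mor C T T' (a, b, c)" and i: "is_iso C a" "is_iso C b" "is_iso C c"
    and T: "is_cand C X Y Z T" "is_cand C X' Y' Z' T'"
  obtains a' b' c' where "tri_mor C T' T (a', b', c')" "is_iso C a'" "is_iso C b'" "is_iso C c'"
    "a' \<cdot> a = Ide C X" "a \<cdot> a' = Ide C X'" "b' \<cdot> b = Ide C Y" "b \<cdot> b' = Ide C Y'" "c' \<cdot> c = Ide C Z" "c \<cdot> c' = Ide C Z'"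
proof -
  obtain f g h f' g' h' where [simp]: "T = (f, g, h)" "T' = (f', g', h')" using prod_cases3 by metis
  note c = T[simplified \<open>T = _\<close> \<open>T' = _\<close>]
  have m: "a \<in> Hom C X X'" "b \<in> Hom C Y Y'" "c \<in> Hom C Z Z'"
    "b \<cdot> f = f' \<cdot> a" "c \<cdot> g = g' \<cdot> b" "SusM C a \<cdot> h = h' \<cdot> c"
    using m tri_mor_iff[OF c] by auto
  obtain a' where a': "a' \<in> Hom C X' X" "a' \<cdot> a = Ide C X" "a \<cdot> a' = Ide C X'" "is_iso C a'" using isoE[OF i(1) m(1)] .
  obtain b' where b': "b' \<in> Hom C Y' Y" "b' \<cdot> b = Ide C Y" "b \<cdot> b' = Ide C Y'" "is_iso C b'" using isoE[OF i(2) m(2)] .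
  obtain c' where c': "c' \<in> Hom C Z' Z" "c' \<cdot> c = Ide C Z" "c \<cdot> c' = Ide C Z'" "is_iso C c'" using isoE[OF i(3) m(3)] .
  note [simp] = cand_simps[OF c(1)] cand_simps[OF c(2)]
    m(1-3)[THEN homD] homD[OF a'(1)] homD[OF b'(1)] homD[OF c'(1)]
    a'(2,3) b'(2,3) c'(2,3) rewrite_under[OF a'(2)] rewrite_under[OF b'(2)] rewrite_under[OF c'(2)]
    rewrite_under[OF a'(3)] rewrite_under[OF b'(3)] rewrite_under[OF c'(3)]
  have sa: "SusM C a' \<cdot> SusM C a = Ide C (SusO C X)"
    using SusM_comp[OF m(1) a'(1)] by simp
  note [simp] = rewrite_under[OF sa]
  have "b' \<cdot> (b \<cdot> f) \<cdot> a' = b' \<cdot> (f' \<cdot> a) \<cdot> a'" "c' \<cdot> (c \<cdot> g) \<cdot> b' = c' \<cdot> (g' \<cdot> b) \<cdot> b'"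
    "SusM C a' \<cdot> (SusM C a \<cdot> h) \<cdot> c' = SusM C a' \<cdot> (h' \<cdot> c) \<cdot> c'" by (simp_all only: m)
  then have "b' \<cdot> f' = f \<cdot> a'" "c' \<cdot> g' = g \<cdot> b'" "SusM C a' \<cdot> h' = h \<cdot> c'" by simp_all
  then have "tri_mor C T' T (a', b', c')" using tri_mor_iff[OF c(2,1)] a'(1) b'(1) c'(1) by simp
  then show ?thesis using that a' b' c' by blast
qed

lemma tri_iso_sym:
  assumes "tri_iso C T T'" shows "tri_iso C T' T"
proof -
  obtain a b c where *: "tri_mor C T T' (a, b, c)" "is_iso C a" "is_iso C b" "is_iso C c" using assms unfolding tri_iso_def by blast
  obtain X Y Z X' Y' Z' where "is_cand C X Y Z T" "is_cand C X' Y' Z' T'" using tri_mor_cand[OF *(1)] by blast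
  from tri_mor_inverse[OF * this] show ?thesis unfolding tri_iso_def by metis
qed

lemma tri_iso_trans:
  assumes "tri_iso C T T'" "tri_iso C T' T''" shows "tri_iso C T T''"
proof -
  obtain a b c where *: "tri_mor C T T' (a, b, c)" "is_iso C a" "is_iso C b" "is_iso C c" using assms(1) unfolding tri_iso_def by blast
  obtain a' b' c' where **: "tri_mor C T' T'' (a', b', c')" "is_iso C a'" "is_iso C b'" "is_iso C c'" using assms(2) unfolding tri_iso_def by blast
  obtain f g h f' g' h' f'' g'' h'' where T: "T = (f, g, h)" "T' = (f', g', h')" "T'' = (f'', g'', h'')"
    by (metis prod_cases3)
  obtain X Y Z X' Y' Z' X'' Y'' Z'' where c: "is_cand C X Y Z (f, g, h)" "is_cand C X' Y' Z' (f', g', h')"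
     "is_cand C X'' Y'' Z'' (f'', g'', h'')"
    using tri_mor_cand[OF *(1)] tri_mor_cand[OF **(1)] unfolding T by blast
  note m = *(1)[unfolded T tri_mor_iff[OF c(1,2)]] **(1)[unfolded T tri_mor_iff[OF c(2,3)]]
  have "is_iso C (a' \<cdot> a)" "is_iso C (b' \<cdot> b)" "is_iso C (c' \<cdot> c)"
    using iso_comp[OF *(2) **(2)] iso_comp[OF *(3) **(3)] iso_comp[OF *(4) **(4)] m by blast+
  then show ?thesis using tri_mor_comp[OF *(1) **(1)] unfolding tri_iso_def by blast
qed

end

text \<open>
  An isomorphism of triangles together with its inverse. Interpreting this locale makes all
  commuting squares in both directions available as rewrite rules, which is how triangles are
  replaced by image triangles of conflations.
\<close>

locale triangle_isomorphism = suspended_category C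
  for C :: "('o, 'm, 'z) suscat_scheme" (structure) +
  fixes X Y Z f g h X' Y' Z' f' g' h' a b c a' b' c'
  assumes source: "is_cand C X Y Z (f, g, h)" and target: "is_cand C X' Y' Z' (f', g', h')"
    and mor: "tri_mor C (f, g, h) (f', g', h') (a, b, c)"
    and inverse_mor: "tri_mor C (f', g', h') (f, g, h) (a', b', c')"
    and inverse: "a' \<cdot> a = Ide C X" "a \<cdot> a' = Ide C X'" "b' \<cdot> b = Ide C Y" "b \<cdot> b' = Ide C Y'"
      "c' \<cdot> c = Ide C Z" "c \<cdot> c' = Ide C Z'"
begin

lemma homs:
  "a \<in> Hom C X X'" "b \<in> Hom C Y Y'" "c \<in> Hom C Z Z'" "a' \<in> Hom C X' X" "b' \<in> Hom C Y' Y" "c' \<in> Hom C Z' Z"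
  and squares: "b \<cdot> f = f' \<cdot> a" "c \<cdot> g = g' \<cdot> b" "SusM C a \<cdot> h = h' \<cdot> c"
    "b' \<cdot> f' = f \<cdot> a'" "c' \<cdot> g' = g \<cdot> b'" "SusM C a' \<cdot> h' = h \<cdot> c'"
  using mor inverse_mor unfolding tri_mor_iff[OF source target] tri_mor_iff[OF target source] by blast+

lemmas [simp] = homs[THEN homD] source[THEN cand_simps(1)] source[THEN cand_simps(2)] source[THEN cand_simps(3)]
  target[THEN cand_simps(1)] target[THEN cand_simps(2)] target[THEN cand_simps(3)] inverse squares

lemmas under [simp] = inverse[THEN rewrite_under] squares[THEN rewrite_under]

lemma isos: "is_iso C a" "is_iso C b" "is_iso C c" "is_iso C a'" "is_iso C b'" "is_iso C c'"
  using isoI[OF homs(1,4)] isoI[OF homs(2,5)] isoI[OF homs(3,6)] isoI[OF homs(4,1)] isoI[OF homs(5,2)] isoI[OF homs(6,3)]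
    inverse by blast+

end

section \<open>Pushouts of conflations and distinguished triangles\<close>

context exact_category
begin

lemma conf_of_cokernel:
  assumes "adm_mono S i" "is_cokernel C i p"
  shows "(i, p) \<in> S"
  using exact_category.conf_of_kernel[OF op_exact, of i p] assms unfolding adm_mono_def adm_epi_def by simp

lemma pushoutE:
  assumes "is_pushout C f g f' g'" "f \<in> Hom C A B" "g \<in> Hom C A D"
  obtains Q where "f' \<in> Hom C D Q" "g' \<in> Hom C B Q" "g' \<cdot> f = f' \<cdot> g"
    "\<And>T u v. u \<in> Hom C D T \<Longrightarrow> v \<in> Hom C B T \<Longrightarrow> v \<cdot> f = u \<cdot> g \<Longrightarrow> \<exists>!w. w \<in> Hom C Q T \<and> w \<cdot> f' = u \<and> w \<cdot> g' = v"
proof -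
  obtain A' B' D' Q where *: "is_square C A' B' D' Q f g f' g'" and
    U: "\<forall>T\<in>Ob C. \<forall>u\<in>Hom C D' T. \<forall>v\<in>Hom C B' T. v \<cdot> f = u \<cdot> g \<longrightarrow>
        (\<exists>!w. w \<in> Hom C Q T \<and> w \<cdot> f' = u \<and> w \<cdot> g' = v)"
    using assms(1) unfolding is_pushout_def by blast
  have [simp]: "B' = B" "D' = D" using * hom_disjoint[OF assms(2)] hom_disjoint[OF assms(3)] unfolding is_square_def by blast+
  show ?thesis using that[of Q] * U hom_ob unfolding is_square_def by simp
qed

lemma pushout_sym:
  assumes "is_pushout C f g f' g'" shows "is_pushout C g f g' f'"
proof -
  obtain A B D Q where *: "is_square C A B D Q f g f' g'" and
    U: "\<forall>T\<in>Ob C. \<forall>u\<in>Hom C D T. \<forall>v\<in>Hom C B T. v \<cdot> f = u \<cdot> g \<longrightarrow>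
        (\<exists>!w. w \<in> Hom C Q T \<and> w \<cdot> f' = u \<and> w \<cdot> g' = v)"
    using assms(1) unfolding is_pushout_def by blast
  have "is_square C A D B Q g f g' f'" using * unfolding is_square_def by simp
  moreover have "\<forall>T\<in>Ob C. \<forall>u\<in>Hom C B T. \<forall>v\<in>Hom C D T. v \<cdot> g = u \<cdot> f \<longrightarrow>
        (\<exists>!w. w \<in> Hom C Q T \<and> w \<cdot> g' = u \<and> w \<cdot> f' = v)"
  proof (intro ballI impI)
    fix T u v assume "T \<in> Ob C" "u \<in> Hom C B T" "v \<in> Hom C D T" "v \<cdot> g = u \<cdot> f"
    then have "\<exists>!w. w \<in> Hom C Q T \<and> w \<cdot> f' = v \<and> w \<cdot> g' = u" using U by metis
    then show "\<exists>!w. w \<in> Hom C Q T \<and> w \<cdot> g' = u \<and> w \<cdot> f' = v" by metis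
  qed
  ultimately show ?thesis unfolding is_pushout_def by blast
qed

text \<open>
  The axioms only provide some pushout of an inflation that is again an inflation; since pushouts
  are unique up to isomorphism every pushout is of this kind, and it has the same cokernel.
\<close>

lemma pushout_conf:
  assumes c: "conf X Y Z i p" and a: "a \<in> Hom C X D" and po: "is_pushout C i a i' a'"
  obtains Q p' where "conf D Q Z i' p'" "a' \<in> Hom C Y Q" "p' \<cdot> a' = p"
proof -
  note [simp] = conf_simps[OF c] homD[OF a]
  obtain Q where i': "i' \<in> Hom C D Q" "a' \<in> Hom C Y Q" "a' \<cdot> i = i' \<cdot> a" and
    U: "\<And>T u v. u \<in> Hom C D T \<Longrightarrow> v \<in> Hom C Y T \<Longrightarrow> v \<cdot> i = u \<cdot> a \<Longrightarrow> \<exists>!w. w \<in> Hom C Q T \<and> w \<cdot> i' = u \<and> w \<cdot> a' = v"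
    using pushoutE[OF po confD(2)[OF c] a] by blast
  note [simp] = i'(1,2)[THEN homD]
  obtain j b where pj: "is_pushout C i a j b" and j: "adm_mono S j"
    using pushout_adm_mono[OF confD(2)[OF c] a] confD(1)[OF c] unfolding adm_mono_def by blast
  obtain R where j': "j \<in> Hom C D R" "b \<in> Hom C Y R" "b \<cdot> i = j \<cdot> a" and
    V: "\<And>T u v. u \<in> Hom C D T \<Longrightarrow> v \<in> Hom C Y T \<Longrightarrow> v \<cdot> i = u \<cdot> a \<Longrightarrow> \<exists>!w. w \<in> Hom C R T \<and> w \<cdot> j = u \<and> w \<cdot> b = v"
    using pushoutE[OF pj confD(2)[OF c] a] by blast
  note [simp] = j'(1,2)[THEN homD]
  obtain \<phi> where \<phi>: "\<phi> \<in> Hom C R Q" "\<phi> \<cdot> j = i'" "\<phi> \<cdot> b = a'" using V[OF i'] by blast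
  obtain \<psi> where \<psi>: "\<psi> \<in> Hom C Q R" "\<psi> \<cdot> i' = j" "\<psi> \<cdot> a' = b" using U[OF j'] by blast
  note [simp] = homD[OF \<phi>(1)] homD[OF \<psi>(1)] \<phi>(2,3) \<psi>(2,3)
  have "\<phi> \<cdot> \<psi> \<in> Hom C Q Q \<and> (\<phi> \<cdot> \<psi>) \<cdot> i' = i' \<and> (\<phi> \<cdot> \<psi>) \<cdot> a' = a'"
    "Ide C Q \<in> Hom C Q Q \<and> Ide C Q \<cdot> i' = i' \<and> Ide C Q \<cdot> a' = a'" by (simp_all add: hom_iff)
  then have 1: "\<phi> \<cdot> \<psi> = Ide C Q" by (rule ex1_unique[OF U[OF i']])
  have "\<psi> \<cdot> \<phi> \<in> Hom C R R \<and> (\<psi> \<cdot> \<phi>) \<cdot> j = j \<and> (\<psi> \<cdot> \<phi>) \<cdot> b = b"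
    "Ide C R \<in> Hom C R R \<and> Ide C R \<cdot> j = j \<and> Ide C R \<cdot> b = b" by (simp_all add: hom_iff)
  then have 2: "\<psi> \<cdot> \<phi> = Ide C R" by (rule ex1_unique[OF V[OF j']])
  have iso: "is_iso C \<phi>" by (rule isoI[OF \<phi>(1) \<psi>(1) 2 1])
  obtain r where r: "(j, r) \<in> S" using j unfolding adm_mono_def by blast
  obtain Z' where r': "r \<in> Hom C R Z'" using conf_typed[OF r j'(1)] .
  note [simp] = homD[OF r'] rewrite_under[OF 2] rewrite_under[OF 1]
  have "(i', r \<cdot> \<psi>) \<in> S"
    by (rule iso_closed[OF r j'(1) r' i'(1) comp_hom[OF \<psi>(1) r'] ide_hom \<phi>(1) ide_hom iso_Ide iso iso_Ide])
      (simp_all add: 2)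
  then have mono: "adm_mono S i'" unfolding adm_mono_def by blast
  have "Zero C D Z \<in> Hom C D Z" "p \<cdot> i = Zero C D Z \<cdot> a" by (simp_all add: Zero_hom)
  then obtain p' where p': "p' \<in> Hom C Q Z" "p' \<cdot> i' = Zero C D Z" "p' \<cdot> a' = p" using U[OF _ confD(3)[OF c]] by blast
  note [simp] = homD[OF p'(1)] p'(2,3)
  have "is_cokernel C i' p'"
    unfolding is_cokernel_def
  proof (intro exI conjI ballI impI)
    show "i' \<in> Hom C D Q" "p' \<in> Hom C Q Z" "p' \<cdot> i' = Zero C D Z" using i' p' by simp_all
    fix T u assume u: "u \<in> Hom C Q T" "u \<cdot> i' = Zero C D T"
    note [simp] = homD[OF u(1)] u(2) rewrite_under[OF u(2)]
    have "(u \<cdot> a') \<cdot> i = Zero C X T" "u \<cdot> a' \<in> Hom C Y T" using i'(3) by (simp_all add: hom_iff)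
    then obtain v where v: "v \<in> Hom C Z T" "v \<cdot> p = u \<cdot> a'" using conf_desc[OF c] by blast
    note [simp] = homD[OF v(1)]
    have h: "v \<cdot> p' \<in> Hom C Q T \<and> (v \<cdot> p') \<cdot> i' = Zero C D T \<and> (v \<cdot> p') \<cdot> a' = u \<cdot> a'"
      "u \<in> Hom C Q T \<and> u \<cdot> i' = Zero C D T \<and> u \<cdot> a' = u \<cdot> a'" using u(1) v by (simp_all add: hom_iff)
    have "\<exists>!w. w \<in> Hom C Q T \<and> w \<cdot> i' = Zero C D T \<and> w \<cdot> a' = u \<cdot> a'"
      by (rule U) (use i'(3) in \<open>simp_all add: hom_iff\<close>)
    from ex1_unique[OF this h] have "v \<cdot> p' = u" .
    moreover have "v' = v" if "v' \<in> Hom C Z T" "v' \<cdot> p' = u" for v'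
    proof (rule conf_epi[OF c that(1) v(1)])
      note [simp] = homD[OF that(1)]
      have "v' \<cdot> (p' \<cdot> a') = u \<cdot> a'" using rewrite_under[OF that(2), of a'] by simp
      then show "v' \<cdot> p = v \<cdot> p" using v(2) by simp
    qed
    ultimately show "\<exists>!v. v \<in> Hom C Z T \<and> v \<cdot> p' = u" using v(1) by blast
  qed
  then have "conf D Q Z i' p'" using conf_of_cokernel[OF mono] i' p' unfolding conf_def by blast
  then show ?thesis using that i' p' by blast
qed

end

context frobenius_envelope
begin

lemma SusO_Kc [simp]: "SusO Kc X = Cosyz J X"
  by (simp add: stable_fields(2))

lemma Cosyz_Ob [simp]: "X \<in> Ob C \<Longrightarrow> Cosyz J X \<in> Ob C"
  using conf_simps(5)[OF env(1)] .

lemma SusM_pi: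
  assumes "f \<in> Hom C X Y"
  obtains f' where "suspends f f'" "f' \<in> Hom C (Cosyz J X) (Cosyz J Y)" "SusM Kc (\<pi> f) = \<pi> f'"
  using suspends_exists[OF assms] SusM_eq suspends_hom assms by metis

end

sublocale frobenius_envelope \<subseteq> KS: suspended_category "stable_cat C S J"
proof (unfold_locales, goal_cases)
  case (1 X)
  then show ?case by simp
next
  case (2 F X Y)
  obtain f where f: "f \<in> Hom C X Y" "F = \<pi> f" using K.Q_homE[OF 2] .
  obtain f' where "f' \<in> Hom C (Cosyz J X) (Cosyz J Y)" "SusM Kc (\<pi> f) = \<pi> f'" using SusM_pi[OF f(1)] by metis
  then show ?case using f(2) K.q_hom SusO_Kc by metis
next
  case (3 F X Y G Z)
  obtain f where f: "f \<in> Hom C X Y" "F = \<pi> f" using K.Q_homE[OF 3(1)] .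
  obtain g where g: "g \<in> Hom C Y Z" "G = \<pi> g" using K.Q_homE[OF 3(2)] .
  obtain f' where f': "suspends f f'" "f' \<in> Hom C (Cosyz J X) (Cosyz J Y)" "SusM Kc (\<pi> f) = \<pi> f'" using SusM_pi[OF f(1)] .
  obtain g' where g': "suspends g g'" "g' \<in> Hom C (Cosyz J Y) (Cosyz J Z)" "SusM Kc (\<pi> g) = \<pi> g'" using SusM_pi[OF g(1)] .
  have "SusM Kc (\<pi> (g \<cdot> f)) = \<pi> (g' \<cdot> f')"
    using SusM_eq[OF suspends_comp[OF f'(1) g'(1) f(1) g(1)] comp_hom[OF f(1) g(1)]] .
  then show ?case using K.q_comp_hom[OF f(1) g(1)] K.q_comp_hom[OF f'(2) g'(2)] f(2) g(2) f'(3) g'(3) by simp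
next
  case (4 X)
  then have X: "X \<in> Ob C" by simp
  show ?case using SusM_eq[OF suspends_Ide[OF X] ide_hom[OF X]] by simp
qed

context frobenius_envelope
begin

lemma image_cand:
  assumes c: "conf X Y Z i p"
  obtains w where "conn i p w" "w \<in> Hom C Z (Cosyz J X)"
    "img i p = (\<pi> i, \<pi> p, \<pi> (neg C Z (Cosyz J X) w))"
    "is_cand Kc X Y Z (\<pi> i, \<pi> p, \<pi> (neg C Z (Cosyz J X) w))"
proof -
  note [simp] = conf_simps[OF c]
  obtain w where w: "conn i p w" "w \<in> Hom C Z (Cosyz J X)" using conn_exists[OF c] .
  note [simp] = homD[OF w(2)]
  have "is_cand Kc X Y Z (\<pi> i, \<pi> p, \<pi> (neg C Z (Cosyz J X) w))"
    using K.Q.hom_iff by simp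
  then show ?thesis using that w image_triangle_eq[OF c w(1)] by blast
qed

lemma image_mor:
  assumes c: "conf X Y Z i p" "conf X' Y' Z' i' p'" and m: "conf_mor i p i' p' a b c"
  shows "tri_mor Kc (img i p) (img i' p') (\<pi> a, \<pi> b, \<pi> c)"
proof -
  obtain w where w: "conn i p w" "w \<in> Hom C Z (Cosyz J X)"
    "img i p = (\<pi> i, \<pi> p, \<pi> (neg C Z (Cosyz J X) w))"
    "is_cand Kc X Y Z (\<pi> i, \<pi> p, \<pi> (neg C Z (Cosyz J X) w))" using image_cand[OF c(1)] .
  obtain w' where w': "conn i' p' w'" "w' \<in> Hom C Z' (Cosyz J X')"
    "img i' p' = (\<pi> i', \<pi> p', \<pi> (neg C Z' (Cosyz J X') w'))"
    "is_cand Kc X' Y' Z' (\<pi> i', \<pi> p', \<pi> (neg C Z' (Cosyz J X') w'))" using image_cand[OF c(2)] .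
  note m' = conf_morD[OF m c]
  obtain a' where a': "suspends a a'" "a' \<in> Hom C (Cosyz J X) (Cosyz J X')" "SusM Kc (\<pi> a) = \<pi> a'"
    using SusM_pi[OF m'(1)] .
  note [simp] = conf_simps[OF c(1)] conf_simps[OF c(2)] homD[OF w(2)] homD[OF w'(2)] m'(1-3)[THEN homD] homD[OF a'(2)]
  have "neg Kc Z (Cosyz J X') (\<pi> (a' \<cdot> w)) = neg Kc Z (Cosyz J X') (\<pi> (w' \<cdot> c))"
    using conn_natural[OF c m w(1) w'(1) a'(1)] by simp
  then have "SusM Kc (\<pi> a) \<bullet> \<pi> (neg C Z (Cosyz J X) w) = \<pi> (neg C Z' (Cosyz J X') w') \<bullet> \<pi> c"
    by (simp add: a'(3))
  then show ?thesis unfolding w(3) w'(3) KS.tri_mor_iff[OF w(4) w'(4)]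
    using K.q_hom[OF m'(1)] K.q_hom[OF m'(2)] K.q_hom[OF m'(3)] m'(4,5) by simp
qed

text \<open>
  The pushout Q of i and of the envelope of X gives the standard triangle of i. As Y is extended to
  the envelope by u, the pushed out inflation of the envelope splits, so the projection of Q onto Z
  is a stable isomorphism. It identifies the third map of the standard triangle with \<open>-w\<close>: this is
  the origin of the sign in the image triangle.
\<close>

lemma image_in_Dist:
  assumes c: "conf X Y Z i p"
  shows "img i p \<in> Dist Kc"
proof -
  note [simp] = conf_simps[OF c]
  have e: "conf X (Env J X) (Cosyz J X) (into J X) (onto J X)" by (simp add: env)
  note [simp] = conf_simps[OF e]
  obtain w where w: "conn i p w" "w \<in> Hom C Z (Cosyz J X)"
    "img i p = (\<pi> i, \<pi> p, \<pi> (neg C Z (Cosyz J X) w))"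
    "is_cand Kc X Y Z (\<pi> i, \<pi> p, \<pi> (neg C Z (Cosyz J X) w))" using image_cand[OF c] .
  obtain u where u: "u \<in> Hom C Y (Env J X)" "u \<cdot> i = into J X" "w \<cdot> p = onto J X \<cdot> u"
    using connE[OF w(1) c] by metis
  note [simp] = homD[OF u(1)] homD[OF w(2)] u(2,3)
  obtain k g where po: "is_pushout C i (into J X) k g"
    using pushout_adm_mono[OF confD(2)[OF c] confD(2)[OF e]] confD(1)[OF c] unfolding adm_mono_def by blast
  obtain Q q where kq: "conf (Env J X) Q Z k q" "g \<in> Hom C Y Q" "q \<cdot> g = p"
    using pushout_conf[OF c confD(2)[OF e] po] .
  obtain Q' where kg: "k \<in> Hom C (Env J X) Q'" "g \<in> Hom C Y Q'" "g \<cdot> i = k \<cdot> into J X" and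
    U: "\<And>T u v. u \<in> Hom C (Env J X) T \<Longrightarrow> v \<in> Hom C Y T \<Longrightarrow> v \<cdot> i = u \<cdot> into J X \<Longrightarrow>
      \<exists>!w. w \<in> Hom C Q' T \<and> w \<cdot> k = u \<and> w \<cdot> g = v"
    using pushoutE[OF po confD(2)[OF c] confD(2)[OF e]] by blast
  note [simp] = conf_simps[OF kq(1)] homD[OF kq(2)] kq(3)
  have [simp]: "Q' = Q" using homD[OF kg(2)] by simp
  obtain h where h: "h \<in> Hom C Q (Cosyz J X)" "h \<cdot> k = onto J X" "h \<cdot> g = Zero C Y (Cosyz J X)"
    using U[OF confD(3)[OF e] Zero_hom[of Y "Cosyz J X"]] by auto
  \<comment> \<open>the extension u splits the inflation of the envelope into the pushout\<close>
  obtain v where v: "v \<in> Hom C Q (Env J X)" "v \<cdot> k = Ide C (Env J X)" "v \<cdot> g = u"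
    using U[OF ide_hom[of "Env J X"] u(1)] by auto
  note [simp] = homD[OF h(1)] homD[OF v(1)] h(2,3) v(2,3) rewrite_under[OF v(2)] rewrite_under[OF kq(3)]
  have "(\<pi> i, \<pi> g, \<pi> h) \<in> stable_std C S J"
    unfolding stable_std_def stable_functor_def using confD(2)[OF c] kq(2) h pushout_sym[OF po] by blast
  moreover have "tri_iso Kc (\<pi> i, \<pi> g, \<pi> h) (img i p)"
  proof -
    have cand: "is_cand Kc X Y Q (\<pi> i, \<pi> g, \<pi> h)" using K.Q.hom_iff by simp
    \<comment> \<open>both sides restrict to onto J X along k and to onto J X \<cdot> u along g\<close>
    have "h \<boxplus> w \<cdot> q = onto J X \<cdot> v"
      by (rule ex1_unique[OF U[of "onto J X" "Cosyz J X" "onto J X \<cdot> u"]]) (simp_all add: hom_iff)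
    then have "\<pi> (h \<boxplus> w \<cdot> q) = \<pi> (Zero C Q (Cosyz J X))"
      using K.q_zeroI[OF env(2) v(1) confD(3)[OF e]] by simp
    then have "\<pi> h = neg Kc Q (Cosyz J X) (\<pi> (w \<cdot> q))"
      by - (rule K.Q.neg_unique, simp_all)
    then have hw: "\<pi> h = \<pi> (neg C Q (Cosyz J X) (w \<cdot> q))" by simp
    have "(Ide C Q \<boxminus> k \<cdot> v) \<cdot> k = Zero C (Env J X) Q" "Ide C Q \<boxminus> k \<cdot> v \<in> Hom C Q Q" by (simp_all add: hom_iff)
    then obtain s where s: "s \<in> Hom C Z Q" "s \<cdot> q = Ide C Q \<boxminus> k \<cdot> v" using conf_desc[OF kq(1)] by blast
    note [simp] = homD[OF s(1)] s(2)
    have qs: "q \<cdot> s = Ide C Z" by (rule conf_epi[OF kq(1)]) (simp_all add: hom_iff)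
    have "\<pi> (s \<cdot> q) = \<pi> (Ide C Q) \<boxminus>\<^bsub>Kc\<^esub> \<pi> (k \<cdot> v)" by simp
    also have "\<dots> = \<pi> (Ide C Q)" unfolding K.q_zeroI[OF env(2) v(1) confD(2)[OF kq(1)], simplified] by simp
    finally have "\<pi> (s \<cdot> q) = \<pi> (Ide C Q)" .
    then have "\<pi> s \<bullet> \<pi> q = Ide Kc Q" "\<pi> q \<bullet> \<pi> s = Ide Kc Z" using qs by (simp_all del: s(2))
    then have "is_iso Kc (\<pi> q)" using K.Q.isoI[OF K.q_hom[OF confD(3)[OF kq(1)]] K.q_hom[OF s(1)]] by blast
    moreover have "tri_mor Kc (\<pi> i, \<pi> g, \<pi> h) (img i p) (\<pi> (Ide C X), \<pi> (Ide C Y), \<pi> q)"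
      unfolding w(3) KS.tri_mor_iff[OF cand w(4)] using hw KS.SusM_Ide[of X] by (simp add: K.Q.hom_iff)
    ultimately show ?thesis unfolding tri_iso_def using K.Q.iso_Ide[of X] K.Q.iso_Ide[of Y] by auto
  qed
  ultimately show ?thesis unfolding stable_fields tri_iso_stable by blast
qed

lemma std_conf:
  assumes f: "f \<in> Hom C X Y" and g: "g \<in> Hom C Y Z" and h: "h \<in> Hom C Z (Cosyz J X)"
    and po: "is_pushout C (into J X) f g k" and z: "h \<cdot> g = Zero C Y (Cosyz J X)" "h \<cdot> k = onto J X"
  shows "conf Y Z (Cosyz J X) g h" "conf_mor (into J X) (onto J X) g h f k (Ide C (Cosyz J X))"
proof -
  note [simp] = homD[OF f] homD[OF g] homD[OF h] z
  have e: "conf X (Env J X) (Cosyz J X) (into J X) (onto J X)" by (simp add: env)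
  note [simp] = conf_simps[OF e]
  obtain Z' h' where gh: "conf Y Z' (Cosyz J X) g h'" "k \<in> Hom C (Env J X) Z'" "h' \<cdot> k = onto J X"
    using pushout_conf[OF e f po] .
  have [simp]: "Z' = Z" using homD[OF confD(2)[OF gh(1)]] by simp
  obtain Q where kg: "g \<in> Hom C Y Q" "k \<in> Hom C (Env J X) Q" "k \<cdot> into J X = g \<cdot> f" and
    U: "\<And>T u v. u \<in> Hom C Y T \<Longrightarrow> v \<in> Hom C (Env J X) T \<Longrightarrow> v \<cdot> into J X = u \<cdot> f \<Longrightarrow>
      \<exists>!w. w \<in> Hom C Q T \<and> w \<cdot> g = u \<and> w \<cdot> k = v"
    using pushoutE[OF po confD(2)[OF e] f] by blast
  have [simp]: "Q = Z" using homD[OF kg(1)] by simp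
  note [simp] = homD[OF gh(2)]
  have "h' = h"
    by (rule ex1_unique[OF U[of "Zero C Y (Cosyz J X)" "Cosyz J X" "onto J X"]])
      (use gh confD[OF gh(1)] in \<open>simp_all add: hom_iff\<close>)
  then show c: "conf Y Z (Cosyz J X) g h" using gh(1) by simp
  show "conf_mor (into J X) (onto J X) g h f k (Ide C (Cosyz J X))"
    by (rule conf_morI[OF e c f]) (simp_all add: kg(3) hom_iff)
qed

text \<open>
  The pushout square defining a standard triangle is bicartesian and yields the conflation
  \<open>X \<rightarrow> Env X \<oplus> Y \<rightarrow> Z\<close>, whose middle term is stably isomorphic to Y.
\<close>

lemma std_realize:
  assumes T: "T \<in> stable_std C S J"
  obtains X Y Z i p where "conf X Y Z i p" "tri_iso Kc (img i p) T"
proof -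
  obtain f g h X Y Z k where *: "T = (\<pi> f, \<pi> g, \<pi> h)" "f \<in> Hom C X Y" "g \<in> Hom C Y Z" "h \<in> Hom C Z (Cosyz J X)"
     "is_pushout C (into J X) f g k" "h \<cdot> g = Zero C Y (Cosyz J X)" "h \<cdot> k = onto J X"
    using T unfolding stable_std_def stable_functor_def by blast
  note [simp] = *(2-4)[THEN homD] *(6,7)
  have e: "conf X (Env J X) (Cosyz J X) (into J X) (onto J X)" by (simp add: env)
  note [simp] = conf_simps[OF e]
  note sc = std_conf[OF *(2-7)]
  have cgh: "conf Y Z (Cosyz J X) g h" by (rule sc(1))
  note k = conf_morD[OF sc(2) e cgh]
  note [simp] = homD[OF k(2)]
  obtain s i1 i2 p1 p2 where bp: "is_biproduct C (Env J X) Y s i1 i2 p1 p2" using biproducts[of "Env J X" Y] by auto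
  note [simp] = biproduct_simps[OF bp] conf_simps(6,7)[OF cgh] rewrite_under[OF *(7)]
  let ?i = "i1 \<cdot> into J X \<boxminus> i2 \<cdot> f" and ?p = "k \<cdot> p1 \<boxplus> g \<cdot> p2"
  have "(?i, ?p) \<in> S"
    by (rule conf_of_left_square[OF confD(1-3)[OF e] confD(1-3)[OF cgh] k(2) *(7,2) k(4)[symmetric] bp])
  then have c: "conf X s Z ?i ?p" unfolding conf_def by (simp add: hom_iff)
  have "conf_mor ?i ?p (into J X) (onto J X) (Ide C X) p1 h"
    by (rule conf_morI[OF c e]) (simp_all add: hom_iff diff_def)
  then have w: "conn ?i ?p h" unfolding conn_def by auto
  note im = image_triangle_eq[OF c w]
  have cand: "is_cand Kc X s Z (\<pi> ?i, \<pi> ?p, \<pi> (neg C Z (Cosyz J X) h))" "is_cand Kc X Y Z (\<pi> f, \<pi> g, \<pi> h)"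
    using K.Q.hom_iff by simp_all
  have z: "\<pi> (k \<cdot> p1) = \<pi> (Zero C s Z)" "\<pi> (i1 \<cdot> p1) = \<pi> (Zero C s s)"
    using K.q_zeroI[OF env(2) biproductD(3)[OF bp]] k(2) biproductD(1)[OF bp] by simp_all
  have "neg Kc s Z (\<pi> ?p) = neg Kc s Z (\<pi> (k \<cdot> p1) \<boxplus>\<^bsub>Kc\<^esub> \<pi> (g \<cdot> p2))" by simp
  also have "\<dots> = \<pi> (neg C s Z (g \<cdot> p2))" unfolding z by simp
  finally have gp: "\<pi> (neg C s Z ?p) = \<pi> (neg C s Z (g \<cdot> p2))" by simp
  have "\<pi> (i2 \<cdot> p2) = \<pi> (i1 \<cdot> p1) \<boxplus>\<^bsub>Kc\<^esub> \<pi> (i2 \<cdot> p2)" unfolding z by simp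
  also have "\<dots> = \<pi> (Ide C s)" using biproductD(9)[OF bp] by simp
  finally have i2p2: "\<pi> (i2 \<cdot> p2) = \<pi> (Ide C s)" .
  \<comment> \<open>i is stably -i2 f, and the third map of the image triangle is -h: both signs are absorbed here\<close>
  let ?b = "neg C s Y p2" and ?c = "neg C Z Z (Ide C Z)"
  have b: "is_iso Kc (\<pi> ?b)"
    by (rule K.Q.isoI[of _ s Y "\<pi> (neg C Y s i2)"]) (use i2p2 in \<open>simp_all add: K.Q.hom_iff\<close>)
  have c': "is_iso Kc (\<pi> ?c)"
    by (rule K.Q.isoI[of _ Z Z "\<pi> ?c"]) (simp_all add: K.Q.hom_iff)
  have "tri_mor Kc (img ?i ?p) T (\<pi> (Ide C X), \<pi> ?b, \<pi> ?c)"
    unfolding *(1) im KS.tri_mor_iff[OF cand] using gp KS.SusM_Ide[of X] by (simp add: K.Q.hom_iff diff_def)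
  then have "tri_iso Kc (img ?i ?p) T"
    unfolding tri_iso_def using b c' K.Q.iso_Ide[of X] by auto
  then show ?thesis using that c by blast
qed

lemma dist_realize:
  assumes "T \<in> Dist Kc"
  obtains X Y Z i p where "conf X Y Z i p" "tri_iso Kc (img i p) T"
proof -
  obtain T0 where "T0 \<in> stable_std C S J" "tri_iso Kc T0 T" using assms unfolding stable_fields tri_iso_stable by blast
  then show ?thesis using std_realize that KS.tri_iso_trans by metis
qed

end

section \<open>Fill-ins and weak kernels of distinguished triangles\<close>

context additive_quotient
begin

lemma Q_unit_simps [simp]:
  "Arr Q F \<Longrightarrow> Dom Q F = x \<Longrightarrow> F \<cdot>\<^bsub>Q\<^esub> q (Ide C x) = F"
  "Arr Q F \<Longrightarrow> Cod Q F = x \<Longrightarrow> q (Ide C x) \<cdot>\<^bsub>Q\<^esub> F = F"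
  "Arr Q F \<Longrightarrow> Arr Q G \<Longrightarrow> Cod Q F = Dom Q G \<Longrightarrow> Dom Q G = x \<Longrightarrow> G \<cdot>\<^bsub>Q\<^esub> (q (Ide C x) \<cdot>\<^bsub>Q\<^esub> F) = G \<cdot>\<^bsub>Q\<^esub> F"
  "Arr Q G \<Longrightarrow> Dom Q G = y \<Longrightarrow> x \<in> Ob C \<Longrightarrow> G \<cdot>\<^bsub>Q\<^esub> q (Zero C x y) = q (Zero C x (Cod Q G))"
  "Arr Q F \<Longrightarrow> Cod Q F = x \<Longrightarrow> y \<in> Ob C \<Longrightarrow> q (Zero C x y) \<cdot>\<^bsub>Q\<^esub> F = q (Zero C (Dom Q F) y)"
  "Arr Q F \<Longrightarrow> Dom Q F = x \<Longrightarrow> Cod Q F = y \<Longrightarrow> F \<boxplus>\<^bsub>Q\<^esub> q (Zero C x y) = F"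
  "Arr Q F \<Longrightarrow> Dom Q F = x \<Longrightarrow> Cod Q F = y \<Longrightarrow> q (Zero C x y) \<boxplus>\<^bsub>Q\<^esub> F = F"
  "Arr Q F \<Longrightarrow> Dom Q F = x \<Longrightarrow> Cod Q F = y \<Longrightarrow> F \<boxminus>\<^bsub>Q\<^esub> q (Zero C x y) = F"
  using Q.comp_Ide[of F x] Q.comp_Ide_left[of F G x] Q.comp_Zero[of G y x] Q.Zero_comp[of F x y] Q.add_Zero[of F x y]
    Q.diff_Zero[of F x y] by simp_all

lemma Q_homD:
  "F \<in> Hom Q x y \<Longrightarrow> Arr Q F \<and> Dom Q F = x \<and> Cod Q F = y \<and> x \<in> Ob C \<and> y \<in> Ob C"
  using Q.homD[of F x y] by simp

end

context frobenius_envelope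
begin

lemmas cand_simps = KS.cand_simps[unfolded K.q_simps(1) SusO_Kc]

text \<open>
  Morphisms in both directions that are mutually inverse in two components: both composites are
  stable isomorphisms in the third one.
\<close>

lemma conf_mor_iso:
  assumes c: "conf X Y Z i p" "conf X' Y' Z' i' p'"
    and m: "conf_mor i p i' p' a b c" "conf_mor i' p' i p a' b' c'"
  defines "A \<equiv> \<pi> (a' \<cdot> a) = \<pi> (Ide C X) \<and> \<pi> (a \<cdot> a') = \<pi> (Ide C X')"
    and "B \<equiv> \<pi> (b' \<cdot> b) = \<pi> (Ide C Y) \<and> \<pi> (b \<cdot> b') = \<pi> (Ide C Y')"
    and "D \<equiv> \<pi> (c' \<cdot> c) = \<pi> (Ide C Z) \<and> \<pi> (c \<cdot> c') = \<pi> (Ide C Z')"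
  shows "A \<Longrightarrow> B \<Longrightarrow> is_iso Kc (\<pi> c)" "B \<Longrightarrow> D \<Longrightarrow> is_iso Kc (\<pi> a)"
proof -
  note h = conf_morD[OF m(1) c] conf_morD[OF m(2) c(2,1)]
  note e = conf_mor_comp[OF m c(1,2,1)] conf_mor_comp[OF m(2,1) c(2,1,2)]
  have iso: "is_iso Kc (\<pi> f)" if "f \<in> Hom C x y" "g \<in> Hom C y x" "is_iso Kc (\<pi> (g \<cdot> f))" "is_iso Kc (\<pi> (f \<cdot> g))" for f g x y
    using K.Q.iso_of_iso_comp[OF K.q_hom[OF that(1)] K.q_hom[OF that(2)]] that
    by (simp add: K.q_comp_hom[OF that(1,2)] K.q_comp_hom[OF that(2,1)])
  show "is_iso Kc (\<pi> c)" if A B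
    by (rule iso[OF h(3) h(8)]) (use endo_iso(1)[OF c(1) e(1)] endo_iso(1)[OF c(2) e(2)] that A_def B_def in blast)+
  show "is_iso Kc (\<pi> a)" if B D
    by (rule iso[OF h(1) h(6)]) (use endo_iso(2)[OF c(1) e(1)] endo_iso(2)[OF c(2) e(2)] that D_def B_def in blast)+
qed

lemma rep_inverse:
  assumes "is_iso Kc (\<pi> f)" "f \<in> Hom C x y"
  obtains g where "g \<in> Hom C y x" "\<pi> (g \<cdot> f) = \<pi> (Ide C x) \<and> \<pi> (f \<cdot> g) = \<pi> (Ide C y)"
proof -
  obtain G where G: "G \<in> Hom Kc y x" "G \<bullet> \<pi> f = Ide Kc x" "\<pi> f \<bullet> G = Ide Kc y"
    using K.Q.isoE[OF assms(1) K.q_hom[OF assms(2)]] .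
  obtain g where "g \<in> Hom C y x" "G = \<pi> g" using K.Q_homE[OF G(1)] .
  then show ?thesis using that G homD[OF assms(2)] homD[of g y x] by simp
qed

text \<open>
  Besides the existence of the fill-in the lemma records that it is an isomorphism if the given maps
  are. The inverse square is filled separately, and the two fill-ins compose to unipotent maps.
\<close>

lemma image_fill_right:
  assumes c: "conf X Y Z i p" "conf X' Y' Z' i' p'"
    and A: "A \<in> Hom Kc X X'" and B: "B \<in> Hom Kc Y Y'" and e: "B \<bullet> \<pi> i = \<pi> i' \<bullet> A"
  shows "\<exists>D. tri_mor Kc (img i p) (img i' p') (A, B, D) \<and>
    (is_iso Kc A \<longrightarrow> is_iso Kc B \<longrightarrow> is_iso Kc D)"
proof -
  note [simp] = conf_simps[OF c(1)] conf_simps[OF c(2)]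
  obtain a where a: "a \<in> Hom C X X'" "A = \<pi> a" using K.Q_homE[OF A] .
  obtain b where b: "b \<in> Hom C Y Y'" "B = \<pi> b" using K.Q_homE[OF B] .
  note [simp] = homD[OF a(1)] homD[OF b(1)]
  have e': "\<pi> (b \<cdot> i) = \<pi> (i' \<cdot> a)" using e unfolding a b by simp
  obtain b1 c1 where m: "conf_mor i p i' p' a b1 c1" "\<pi> b1 = \<pi> b" using fill_right[OF c a(1) b(1) e'] .
  have "is_iso Kc (\<pi> c1)" if iso: "is_iso Kc A" "is_iso Kc B"
  proof -
    obtain a' where a': "a' \<in> Hom C X' X" "\<pi> (a' \<cdot> a) = \<pi> (Ide C X) \<and> \<pi> (a \<cdot> a') = \<pi> (Ide C X')"
      using rep_inverse[OF iso(1)[unfolded a] a(1)] .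
    obtain b' where b': "b' \<in> Hom C Y' Y" "\<pi> (b' \<cdot> b) = \<pi> (Ide C Y) \<and> \<pi> (b \<cdot> b') = \<pi> (Ide C Y')"
      using rep_inverse[OF iso(2)[unfolded b] b(1)] .
    note [simp] = homD[OF a'(1)] homD[OF b'(1)]
    have "\<pi> (b' \<cdot> i') = \<pi> (b' \<cdot> i') \<bullet> \<pi> (a \<cdot> a')" using a'(2) by simp
    also have "\<dots> = \<pi> b' \<bullet> (\<pi> (i' \<cdot> a) \<bullet> \<pi> a')" by simp
    also have "\<dots> = \<pi> (b' \<cdot> b) \<bullet> \<pi> (i \<cdot> a')" unfolding e'[symmetric] by simp
    also have "\<dots> = \<pi> (i \<cdot> a')" using b'(2) by simp
    finally have e'': "\<pi> (b' \<cdot> i') = \<pi> (i \<cdot> a')" .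
    obtain b2 c2 where m2: "conf_mor i' p' i p a' b2 c2" "\<pi> b2 = \<pi> b'" using fill_right[OF c(2,1) a'(1) b'(1) e''] .
    note h = conf_morD[OF m(1) c] conf_morD[OF m2(1) c(2,1)]
    have "\<pi> (b2 \<cdot> b1) = \<pi> (Ide C Y) \<and> \<pi> (b1 \<cdot> b2) = \<pi> (Ide C Y')"
      using b'(2) m(2) m2(2) K.q_comp_hom[OF h(2) h(7)] K.q_comp_hom[OF h(7) h(2)]
         K.q_comp_hom[OF b(1) b'(1)] K.q_comp_hom[OF b'(1) b(1)] by simp
    then show ?thesis using conf_mor_iso(1)[OF c m(1) m2(1) a'(2)] by blast
  qed
  then show ?thesis using image_mor[OF c m(1)] m(2) a(2) b(2) by auto
qed

lemma image_fill_left: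
  assumes c: "conf X Y Z i p" "conf X' Y' Z' i' p'"
    and B: "B \<in> Hom Kc Y Y'" and D: "D \<in> Hom Kc Z Z'" and e: "D \<bullet> \<pi> p = \<pi> p' \<bullet> B"
  shows "\<exists>A. tri_mor Kc (img i p) (img i' p') (A, B, D) \<and>
    (is_iso Kc B \<longrightarrow> is_iso Kc D \<longrightarrow> is_iso Kc A)"
proof -
  note [simp] = conf_simps[OF c(1)] conf_simps[OF c(2)]
  obtain d where d: "d \<in> Hom C Z Z'" "D = \<pi> d" using K.Q_homE[OF D] .
  obtain b where b: "b \<in> Hom C Y Y'" "B = \<pi> b" using K.Q_homE[OF B] .
  note [simp] = homD[OF d(1)] homD[OF b(1)]
  have e': "\<pi> (d \<cdot> p) = \<pi> (p' \<cdot> b)" using e unfolding d b by simp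
  obtain a1 b1 where m: "conf_mor i p i' p' a1 b1 d" "\<pi> b1 = \<pi> b" using fill_left[OF c b(1) d(1) e'] .
  have "is_iso Kc (\<pi> a1)" if iso: "is_iso Kc B" "is_iso Kc D"
  proof -
    obtain d' where d': "d' \<in> Hom C Z' Z" "\<pi> (d' \<cdot> d) = \<pi> (Ide C Z) \<and> \<pi> (d \<cdot> d') = \<pi> (Ide C Z')"
      using rep_inverse[OF iso(2)[unfolded d] d(1)] .
    obtain b' where b': "b' \<in> Hom C Y' Y" "\<pi> (b' \<cdot> b) = \<pi> (Ide C Y) \<and> \<pi> (b \<cdot> b') = \<pi> (Ide C Y')"
      using rep_inverse[OF iso(1)[unfolded b] b(1)] .
    note [simp] = homD[OF d'(1)] homD[OF b'(1)]
    have "\<pi> (d' \<cdot> p') = \<pi> (d' \<cdot> p') \<bullet> \<pi> (b \<cdot> b')" using b'(2) by simp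
    also have "\<dots> = \<pi> d' \<bullet> (\<pi> (p' \<cdot> b) \<bullet> \<pi> b')" by simp
    also have "\<dots> = \<pi> (d' \<cdot> d) \<bullet> \<pi> (p \<cdot> b')" unfolding e'[symmetric] by simp
    also have "\<dots> = \<pi> (p \<cdot> b')" using d'(2) by simp
    finally have e'': "\<pi> (d' \<cdot> p') = \<pi> (p \<cdot> b')" .
    obtain a2 b2 where m2: "conf_mor i' p' i p a2 b2 d'" "\<pi> b2 = \<pi> b'" using fill_left[OF c(2,1) b'(1) d'(1) e''] .
    note h = conf_morD[OF m(1) c] conf_morD[OF m2(1) c(2,1)]
    have "\<pi> (b2 \<cdot> b1) = \<pi> (Ide C Y) \<and> \<pi> (b1 \<cdot> b2) = \<pi> (Ide C Y')"
      using b'(2) m(2) m2(2) K.q_comp_hom[OF h(2) h(7)] K.q_comp_hom[OF h(7) h(2)]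
         K.q_comp_hom[OF b(1) b'(1)] K.q_comp_hom[OF b'(1) b(1)] by simp
    then show ?thesis using conf_mor_iso(2)[OF c m(1) m2(1) _ d'(2)] by blast
  qed
  then show ?thesis using image_mor[OF c m(1)] m(2) d(2) b(2) by auto
qed

lemma image_fill_middle:
  assumes c: "conf X Y Z i p" "conf X' Y' Z' i' p'"
    and A: "A \<in> Hom Kc X X'" and D: "D \<in> Hom Kc Z Z'"
    and im: "img i p = (f, g, h)" "img i' p' = (f', g', h')"
    and e: "SusM Kc A \<bullet> h = h' \<bullet> D"
  shows "\<exists>B. tri_mor Kc (f, g, h) (f', g', h') (A, B, D)"
proof -
  note [simp] = conf_simps[OF c(1)] conf_simps[OF c(2)]
  obtain a where a: "a \<in> Hom C X X'" "A = \<pi> a" using K.Q_homE[OF A] .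
  obtain d where d: "d \<in> Hom C Z Z'" "D = \<pi> d" using K.Q_homE[OF D] .
  obtain w where w: "conn i p w" "w \<in> Hom C Z (Cosyz J X)"
    "img i p = (\<pi> i, \<pi> p, \<pi> (neg C Z (Cosyz J X) w))" using image_cand[OF c(1)] .
  obtain w' where w': "conn i' p' w'" "w' \<in> Hom C Z' (Cosyz J X')"
    "img i' p' = (\<pi> i', \<pi> p', \<pi> (neg C Z' (Cosyz J X') w'))" using image_cand[OF c(2)] .
  obtain a' where a': "suspends a a'" "a' \<in> Hom C (Cosyz J X) (Cosyz J X')" "SusM Kc (\<pi> a) = \<pi> a'"
    using SusM_pi[OF a(1)] .
  note [simp] = homD[OF w(2)] homD[OF w'(2)] homD[OF a(1)] homD[OF d(1)] homD[OF a'(2)]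
  have "\<pi> (neg C Z (Cosyz J X') (a' \<cdot> w)) = \<pi> (neg C Z (Cosyz J X') (w' \<cdot> d))"
  proof -
    have h: "h = \<pi> (neg C Z (Cosyz J X) w)" "h' = \<pi> (neg C Z' (Cosyz J X') w')" using im w(3) w'(3) by simp_all
    show ?thesis using e unfolding h a(2) d(2) a'(3) by simp
  qed
  then have "neg Kc Z (Cosyz J X') (\<pi> (neg C Z (Cosyz J X') (w' \<cdot> d))) = neg Kc Z (Cosyz J X') (\<pi> (neg C Z (Cosyz J X') (a' \<cdot> w)))"
    by (simp only:)
  then have "\<pi> (w' \<cdot> d) = \<pi> (a' \<cdot> w)" by simp
  then obtain b where "conf_mor i p i' p' a b d" using fill_middle[OF c a(1) d(1) w(1) w'(1) a'(1)] by blast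
  then show ?thesis using image_mor[OF c] im a(2) d(2) by metis
qed

lemma dist_cand:
  assumes "T \<in> Dist Kc" obtains X Y Z where "is_cand Kc X Y Z T"
proof -
  obtain X Y Z i p where "tri_iso Kc (img i p) T" using dist_realize[OF assms] by metis
  then show ?thesis using that KS.tri_mor_cand unfolding tri_iso_def by blast
qed

lemma dist_realize_iso:
  assumes T: "(f, g, h) \<in> Dist Kc" "is_cand Kc X Y Z (f, g, h)"
  obtains X0 Y0 Z0 i p h0 a b c a1 b1 c1 where "conf X0 Y0 Z0 i p" "img i p = (\<pi> i, \<pi> p, h0)"
    "triangle_isomorphism Kc X0 Y0 Z0 (\<pi> i) (\<pi> p) h0 X Y Z f g h a b c a1 b1 c1"
proof -
  obtain X0 Y0 Z0 i p where c: "conf X0 Y0 Z0 i p" "tri_iso Kc (img i p) (f, g, h)"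
    using dist_realize[OF T(1)] .
  obtain h0 where w: "img i p = (\<pi> i, \<pi> p, h0)" "is_cand Kc X0 Y0 Z0 (\<pi> i, \<pi> p, h0)" using image_cand[OF c(1)] by blast
  obtain a b d where m: "tri_mor Kc (\<pi> i, \<pi> p, h0) (f, g, h) (a, b, d)" "is_iso Kc a" "is_iso Kc b" "is_iso Kc d"
    using c(2) unfolding w(1) tri_iso_def by blast
  obtain a' b' d' where m': "tri_mor Kc (f, g, h) (\<pi> i, \<pi> p, h0) (a', b', d')"
    "is_iso Kc a'" "is_iso Kc b'" "is_iso Kc d'"
    "a' \<bullet> a = Ide Kc X0" "a \<bullet> a' = Ide Kc X" "b' \<bullet> b = Ide Kc Y0" "b \<bullet> b' = Ide Kc Y" "d' \<bullet> d = Ide Kc Z0" "d \<bullet> d' = Ide Kc Z"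
    using KS.tri_mor_inverse[OF m w(2) T(2)] .
  have "triangle_isomorphism Kc X0 Y0 Z0 (\<pi> i) (\<pi> p) h0 X Y Z f g h a b d a' b' d'"
    by (intro triangle_isomorphism.intro triangle_isomorphism_axioms.intro KS.suspended_category_axioms w(2) T(2) m(1) m')
  then show ?thesis by (rule that[OF c(1) w(1)])
qed

text \<open>
  Both triangles are replaced by image triangles of conflations, where the square can be lifted.
\<close>

lemma dist_fill_right:
  assumes T: "(f, g, h) \<in> Dist Kc" "is_cand Kc X Y Z (f, g, h)" "(f', g', h') \<in> Dist Kc" "is_cand Kc X' Y' Z' (f', g', h')"
    and A: "A \<in> Hom Kc X X'" and B: "B \<in> Hom Kc Y Y'" and e: "B \<bullet> f = f' \<bullet> A"
  shows "\<exists>D. tri_mor Kc (f, g, h) (f', g', h') (A, B, D) \<and> (is_iso Kc A \<longrightarrow> is_iso Kc B \<longrightarrow> is_iso Kc D)"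
proof -
  obtain X0 Y0 Z0 i p h0 a b c a1 b1 c1 where r: "conf X0 Y0 Z0 i p" "img i p = (\<pi> i, \<pi> p, h0)" and
    "triangle_isomorphism Kc X0 Y0 Z0 (\<pi> i) (\<pi> p) h0 X Y Z f g h a b c a1 b1 c1" using dist_realize_iso[OF T(1,2)] .
  then interpret I: triangle_isomorphism Kc X0 Y0 Z0 "\<pi> i" "\<pi> p" h0 X Y Z f g h a b c a1 b1 c1 by simp
  note [simp] = cand_simps[OF T(2)] conf_simps[OF r(1)]
  obtain X1 Y1 Z1 i' p' h1 a' b' c' a1' b1' c1' where r': "conf X1 Y1 Z1 i' p'" "img i' p' = (\<pi> i', \<pi> p', h1)" and
    "triangle_isomorphism Kc X1 Y1 Z1 (\<pi> i') (\<pi> p') h1 X' Y' Z' f' g' h' a' b' c' a1' b1' c1'" using dist_realize_iso[OF T(3,4)] .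
  then interpret I': triangle_isomorphism Kc X1 Y1 Z1 "\<pi> i'" "\<pi> p'" h1 X' Y' Z' f' g' h' a' b' c' a1' b1' c1' by simp
  note [simp] = cand_simps[OF T(4)] conf_simps[OF r'(1)]
  note [simp] = K.Q_homD[OF A] K.Q_homD[OF B] e K.Q.rewrite_under[OF e]
  let ?A = "a1' \<bullet> (A \<bullet> a)" and ?B = "b1' \<bullet> (B \<bullet> b)"
  have "?A \<in> Hom Kc X0 X1" "?B \<in> Hom Kc Y0 Y1" "?B \<bullet> \<pi> i = \<pi> i' \<bullet> ?A" by (simp_all add: K.Q.hom_iff)
  then obtain D where D: "tri_mor Kc (img i p) (img i' p') (?A, ?B, D)" "is_iso Kc ?A \<longrightarrow> is_iso Kc ?B \<longrightarrow> is_iso Kc D"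
    using image_fill_right[OF r(1) r'(1)] by blast
  have m: "tri_mor Kc (f, g, h) (f', g', h') (a' \<bullet> (?A \<bullet> a1), b' \<bullet> (?B \<bullet> b1), c' \<bullet> (D \<bullet> c1))"
    using KS.tri_mor_comp[OF KS.tri_mor_comp[OF I.inverse_mor D(1)[unfolded r(2) r'(2)]] I'.mor] .
  have "is_iso Kc (c' \<bullet> (D \<bullet> c1))" if iso: "is_iso Kc A" "is_iso Kc B"
  proof -
    have "is_iso Kc ?A" "is_iso Kc ?B"
      by (intro K.Q.iso_comp3[OF I.isos(1) iso(1) I'.isos(4) I.homs(1) A I'.homs(4)]
        K.Q.iso_comp3[OF I.isos(2) iso(2) I'.isos(5) I.homs(2) B I'.homs(5)])+
    then have "is_iso Kc D" using D(2) by blast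
    moreover have "D \<in> Hom Kc Z0 Z1" using D(1) unfolding r(2) r'(2) KS.tri_mor_iff[OF I.source I'.source] by blast
    ultimately show ?thesis using K.Q.iso_comp3[OF I.isos(6) _ I'.isos(3) I.homs(6) _ I'.homs(3)] by blast
  qed
  then show ?thesis using m by auto
qed

lemma dist_fill_left:
  assumes T: "(f, g, h) \<in> Dist Kc" "is_cand Kc X Y Z (f, g, h)" "(f', g', h') \<in> Dist Kc" "is_cand Kc X' Y' Z' (f', g', h')"
    and B: "B \<in> Hom Kc Y Y'" and D: "D \<in> Hom Kc Z Z'" and e: "D \<bullet> g = g' \<bullet> B"
  shows "\<exists>A. tri_mor Kc (f, g, h) (f', g', h') (A, B, D) \<and> (is_iso Kc B \<longrightarrow> is_iso Kc D \<longrightarrow> is_iso Kc A)"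
proof -
  obtain X0 Y0 Z0 i p h0 a b c a1 b1 c1 where r: "conf X0 Y0 Z0 i p" "img i p = (\<pi> i, \<pi> p, h0)" and
    "triangle_isomorphism Kc X0 Y0 Z0 (\<pi> i) (\<pi> p) h0 X Y Z f g h a b c a1 b1 c1" using dist_realize_iso[OF T(1,2)] .
  then interpret I: triangle_isomorphism Kc X0 Y0 Z0 "\<pi> i" "\<pi> p" h0 X Y Z f g h a b c a1 b1 c1 by simp
  note [simp] = cand_simps[OF T(2)] conf_simps[OF r(1)]
  obtain X1 Y1 Z1 i' p' h1 a' b' c' a1' b1' c1' where r': "conf X1 Y1 Z1 i' p'" "img i' p' = (\<pi> i', \<pi> p', h1)" and
    "triangle_isomorphism Kc X1 Y1 Z1 (\<pi> i') (\<pi> p') h1 X' Y' Z' f' g' h' a' b' c' a1' b1' c1'" using dist_realize_iso[OF T(3,4)] .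
  then interpret I': triangle_isomorphism Kc X1 Y1 Z1 "\<pi> i'" "\<pi> p'" h1 X' Y' Z' f' g' h' a' b' c' a1' b1' c1' by simp
  note [simp] = cand_simps[OF T(4)] conf_simps[OF r'(1)]
  note [simp] = K.Q_homD[OF B] K.Q_homD[OF D] e K.Q.rewrite_under[OF e]
  let ?B = "b1' \<bullet> (B \<bullet> b)" and ?D = "c1' \<bullet> (D \<bullet> c)"
  have "?B \<in> Hom Kc Y0 Y1" "?D \<in> Hom Kc Z0 Z1" "?D \<bullet> \<pi> p = \<pi> p' \<bullet> ?B" by (simp_all add: K.Q.hom_iff)
  then obtain A where A: "tri_mor Kc (img i p) (img i' p') (A, ?B, ?D)" "is_iso Kc ?B \<longrightarrow> is_iso Kc ?D \<longrightarrow> is_iso Kc A"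
    using image_fill_left[OF r(1) r'(1)] by blast
  have m: "tri_mor Kc (f, g, h) (f', g', h') (a' \<bullet> (A \<bullet> a1), b' \<bullet> (?B \<bullet> b1), c' \<bullet> (?D \<bullet> c1))"
    using KS.tri_mor_comp[OF KS.tri_mor_comp[OF I.inverse_mor A(1)[unfolded r(2) r'(2)]] I'.mor] .
  have "is_iso Kc (a' \<bullet> (A \<bullet> a1))" if iso: "is_iso Kc B" "is_iso Kc D"
  proof -
    have "is_iso Kc ?B" "is_iso Kc ?D"
      by (intro K.Q.iso_comp3[OF I.isos(2) iso(1) I'.isos(5) I.homs(2) B I'.homs(5)]
        K.Q.iso_comp3[OF I.isos(3) iso(2) I'.isos(6) I.homs(3) D I'.homs(6)])+
    then have "is_iso Kc A" using A(2) by blast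
    moreover have "A \<in> Hom Kc X0 X1" using A(1) unfolding r(2) r'(2) KS.tri_mor_iff[OF I.source I'.source] by blast
    ultimately show ?thesis using K.Q.iso_comp3[OF I.isos(4) _ I'.isos(1) I.homs(4) _ I'.homs(1)] by blast
  qed
  then show ?thesis using m by auto
qed

lemma dist_fill_middle:
  assumes T: "(f, g, h) \<in> Dist Kc" "is_cand Kc X Y Z (f, g, h)" "(f', g', h') \<in> Dist Kc" "is_cand Kc X' Y' Z' (f', g', h')"
    and A: "A \<in> Hom Kc X X'" and D: "D \<in> Hom Kc Z Z'" and e: "SusM Kc A \<bullet> h = h' \<bullet> D"
  shows "\<exists>B. tri_mor Kc (f, g, h) (f', g', h') (A, B, D)"
proof -
  obtain X0 Y0 Z0 i p h0 a b c a1 b1 c1 where r: "conf X0 Y0 Z0 i p" "img i p = (\<pi> i, \<pi> p, h0)" and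
    "triangle_isomorphism Kc X0 Y0 Z0 (\<pi> i) (\<pi> p) h0 X Y Z f g h a b c a1 b1 c1" using dist_realize_iso[OF T(1,2)] .
  then interpret I: triangle_isomorphism Kc X0 Y0 Z0 "\<pi> i" "\<pi> p" h0 X Y Z f g h a b c a1 b1 c1 by simp
  note [simp] = cand_simps[OF T(2)] conf_simps[OF r(1)]
  obtain X1 Y1 Z1 i' p' h1 a' b' c' a1' b1' c1' where r': "conf X1 Y1 Z1 i' p'" "img i' p' = (\<pi> i', \<pi> p', h1)" and
    "triangle_isomorphism Kc X1 Y1 Z1 (\<pi> i') (\<pi> p') h1 X' Y' Z' f' g' h' a' b' c' a1' b1' c1'" using dist_realize_iso[OF T(3,4)] .
  then interpret I': triangle_isomorphism Kc X1 Y1 Z1 "\<pi> i'" "\<pi> p'" h1 X' Y' Z' f' g' h' a' b' c' a1' b1' c1' by simp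
  note [simp] = cand_simps[OF T(4)] conf_simps[OF r'(1)]
  note [simp] = K.Q_homD[OF A] K.Q_homD[OF D] e K.Q.rewrite_under[OF e]
  let ?A = "a1' \<bullet> (A \<bullet> a)" and ?D = "c1' \<bullet> (D \<bullet> c)"
  have "?A \<in> Hom Kc X0 X1" "?D \<in> Hom Kc Z0 Z1" "SusM Kc ?A \<bullet> h0 = h1 \<bullet> ?D" by (simp_all add: K.Q.hom_iff)
  then obtain B where B: "tri_mor Kc (\<pi> i, \<pi> p, h0) (\<pi> i', \<pi> p', h1) (?A, B, ?D)"
    using image_fill_middle[OF r(1) r'(1) _ _ r(2) r'(2)] by blast
  have "tri_mor Kc (f, g, h) (f', g', h') (a' \<bullet> (?A \<bullet> a1), b' \<bullet> (B \<bullet> b1), c' \<bullet> (?D \<bullet> c1))"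
    using KS.tri_mor_comp[OF KS.tri_mor_comp[OF I.inverse_mor B] I'.mor] .
  then show ?thesis by auto
qed

end

context exact_category
begin

text \<open>
  Adding the middle term of a conflation that starts at X turns any morphism out of X into an
  inflation. If the middle term is injective, the stable class of the morphism changes only by a
  sign and by a stably zero summand of the target.
\<close>

lemma graph_conf:
  assumes c: "conf X I Z j q" and f: "f \<in> Hom C X Y" and bp: "is_biproduct C I Y s i1 i2 p1 p2"
  obtains W \<rho> where "conf X s W (i1 \<cdot> j \<boxminus> i2 \<cdot> f) \<rho>"
proof -
  note [simp] = conf_simps[OF c] homD[OF f] biproduct_simps[OF bp]
  obtain g k where po: "is_pushout C j f g k"
    using pushout_adm_mono[OF confD(2)[OF c] f] confD(1)[OF c] unfolding adm_mono_def by blast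
  obtain Q h where gh: "conf Y Q Z g h" "k \<in> Hom C I Q" "h \<cdot> k = q" using pushout_conf[OF c f po] .
  obtain Q' where kg: "g \<in> Hom C Y Q'" "k \<cdot> j = g \<cdot> f" using pushoutE[OF po confD(2)[OF c] f] by metis
  note [simp] = conf_simps[OF gh(1)] homD[OF gh(2)]
  have "(i1 \<cdot> j \<boxminus> i2 \<cdot> f, k \<cdot> p1 \<boxplus> g \<cdot> p2) \<in> S"
    by (rule conf_of_left_square[OF confD(1-3)[OF c] confD(1-3)[OF gh(1)] gh(2,3) f kg(2)[symmetric] bp])
  then have "conf X s Q (i1 \<cdot> j \<boxminus> i2 \<cdot> f) (k \<cdot> p1 \<boxplus> g \<cdot> p2)" unfolding conf_def by (simp add: hom_iff)
  then show ?thesis by (rule that)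
qed

lemma op_conf: "exact_category.conf (op_cat C) (S\<inverse>) X Y Z p i \<longleftrightarrow> conf Z Y X i p"
  unfolding conf_def exact_category.conf_def[OF op_exact] by auto

lemma cograph_conf:
  assumes c: "conf N P Z j q" and f: "f \<in> Hom C Y Z" and bp: "is_biproduct C P Y s i1 i2 p1 p2"
  obtains W \<iota> where "conf W s Z \<iota> (q \<cdot> p1 \<boxminus> f \<cdot> p2)"
proof -
  have "is_biproduct (op_cat C) P Y s p1 p2 i1 i2" using bp by simp
  from exact_category.graph_conf[OF op_exact _ _ this, unfolded op_conf, where X = Z and Z = N and j = q and q = j and f = f] c f
  show ?thesis using that by auto
qed

end

context frobenius_envelope
begin

text \<open>
  A representative of s composed with the deflation p factors through a projective object; lifting
  that factorization and subtracting it leaves a map that factors through the kernel of p.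
\<close>

lemma dist_weak_kernel_middle:
  assumes T: "(f, g, h) \<in> Dist Kc" "is_cand Kc X Y Z (f, g, h)"
    and s: "s \<in> Hom Kc V Y" "g \<bullet> s = Zero Kc V Z"
  obtains t where "t \<in> Hom Kc V X" "s = f \<bullet> t"
proof -
  obtain X0 Y0 Z0 i p h0 a b c a1 b1 c1 where r: "conf X0 Y0 Z0 i p" "img i p = (\<pi> i, \<pi> p, h0)" and
    "triangle_isomorphism Kc X0 Y0 Z0 (\<pi> i) (\<pi> p) h0 X Y Z f g h a b c a1 b1 c1" using dist_realize_iso[OF T(1,2)] .
  then interpret I: triangle_isomorphism Kc X0 Y0 Z0 "\<pi> i" "\<pi> p" h0 X Y Z f g h a b c a1 b1 c1 by simp
  note [simp] = cand_simps[OF T(2)] conf_simps[OF r(1)]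
  note [simp] = K.Q_homD[OF s(1)]
  have "\<pi> p \<bullet> (b1 \<bullet> s) = c1 \<bullet> (g \<bullet> s)" by simp
  then have z: "\<pi> p \<bullet> (b1 \<bullet> s) = Zero Kc V Z0" unfolding s(2) by simp
  obtain s0 where s0: "s0 \<in> Hom C V Y0" "b1 \<bullet> s = \<pi> s0" using K.Q_homE[OF K.Q.comp_hom[OF s(1) I.homs(5)]] .
  note [simp] = homD[OF s0(1)]
  have "\<pi> (p \<cdot> s0) = \<pi> (Zero C V Z0)" using z unfolding s0(2) by simp
  then obtain W \<alpha> \<beta> where w: "W \<in> PI" "\<alpha> \<in> Hom C V W" "\<beta> \<in> Hom C W Z0" "p \<cdot> s0 = \<beta> \<cdot> \<alpha>"
    using K.q_zeroE comp_hom[OF s0(1) confD(3)[OF r(1)]] by blast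
  obtain \<beta>' where \<beta>': "\<beta>' \<in> Hom C W Y0" "p \<cdot> \<beta>' = \<beta>" using proj_lift[OF w(1) r(1) w(3)] .
  note [simp] = w(2,3)[THEN homD] homD[OF \<beta>'(1)] \<beta>'(2) rewrite_under[OF \<beta>'(2)]
  have "p \<cdot> (s0 \<boxminus> \<beta>' \<cdot> \<alpha>) = Zero C V Z0" "s0 \<boxminus> \<beta>' \<cdot> \<alpha> \<in> Hom C V Y0" using w(4) by (simp_all add: hom_iff)
  then obtain t where t: "t \<in> Hom C V X0" "i \<cdot> t = s0 \<boxminus> \<beta>' \<cdot> \<alpha>" using conf_lift[OF r(1)] by blast
  note [simp] = homD[OF t(1)]
  have "\<pi> i \<bullet> \<pi> t = \<pi> s0 \<boxminus>\<^bsub>Kc\<^esub> \<pi> (\<beta>' \<cdot> \<alpha>)" using t(2) by simp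
  also have "\<dots> = b1 \<bullet> s" unfolding K.q_zeroI[OF w(1,2) \<beta>'(1)] s0(2) by simp
  finally have e: "b1 \<bullet> s = \<pi> i \<bullet> \<pi> t" ..
  have "s = b \<bullet> (b1 \<bullet> s)" by simp
  also have "\<dots> = (f \<bullet> a) \<bullet> \<pi> t" unfolding e by (rule K.Q.rewrite_under[OF I.squares(1)]) simp_all
  also have "\<dots> = f \<bullet> (a \<bullet> \<pi> t)" by simp
  finally show ?thesis using that[of "a \<bullet> \<pi> t"] K.Q.comp_hom[OF K.q_hom[OF t(1)] I.homs(1)] by blast
qed

text \<open>
  For a conflation with connecting map w, a stable factorization of \<open>w \<cdot> s\<close> through zero lifts to
  the envelope, and the pullback property of the middle term turns this into a lift of s along p.
\<close>

lemma dist_weak_kernel_right: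
  assumes T: "(f, g, h) \<in> Dist Kc" "is_cand Kc X Y Z (f, g, h)"
    and s: "s \<in> Hom Kc V Z" "h \<bullet> s = Zero Kc V (Cosyz J X)"
  obtains t where "t \<in> Hom Kc V Y" "s = g \<bullet> t"
proof -
  obtain X0 Y0 Z0 i p h0 a b c a1 b1 c1 where r: "conf X0 Y0 Z0 i p" "img i p = (\<pi> i, \<pi> p, h0)" and
    "triangle_isomorphism Kc X0 Y0 Z0 (\<pi> i) (\<pi> p) h0 X Y Z f g h a b c a1 b1 c1" using dist_realize_iso[OF T(1,2)] .
  then interpret I: triangle_isomorphism Kc X0 Y0 Z0 "\<pi> i" "\<pi> p" h0 X Y Z f g h a b c a1 b1 c1 by simp
  note [simp] = cand_simps[OF T(2)] conf_simps[OF r(1)]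
  have env': "conf X0 (Env J X0) (Cosyz J X0) (into J X0) (onto J X0)" by (simp add: env)
  note [simp] = K.Q_homD[OF s(1)] conf_simps[OF env']
  have "h0 \<bullet> (c1 \<bullet> s) = SusM Kc a1 \<bullet> (h \<bullet> s)" by simp
  then have z: "h0 \<bullet> (c1 \<bullet> s) = Zero Kc V (Cosyz J X0)" unfolding s(2) by simp
  obtain s0 where s0: "s0 \<in> Hom C V Z0" "c1 \<bullet> s = \<pi> s0" using K.Q_homE[OF K.Q.comp_hom[OF s(1) I.homs(6)]] .
  obtain w where w: "conn i p w" "w \<in> Hom C Z0 (Cosyz J X0)"
    "img i p = (\<pi> i, \<pi> p, \<pi> (neg C Z0 (Cosyz J X0) w))" using image_cand[OF r(1)] .
  obtain u where u: "conf_mor i p (into J X0) (onto J X0) (Ide C X0) u w" using connE[OF w(1) r(1)] by metis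
  note [simp] = homD[OF s0(1)] homD[OF w(2)]
  have "h0 = \<pi> (neg C Z0 (Cosyz J X0) w)" using r(2) w(3) by simp
  then have "\<pi> (neg C V (Cosyz J X0) (w \<cdot> s0)) = \<pi> (Zero C V (Cosyz J X0))" using z unfolding s0(2) by simp
  then have "neg Kc V (Cosyz J X0) (\<pi> (w \<cdot> s0)) = Zero Kc V (Cosyz J X0)" by simp
  then have "\<pi> (w \<cdot> s0) = \<pi> (Zero C V (Cosyz J X0))"
    using K.Q.neg_eq_Zero[of "\<pi> (w \<cdot> s0)" V "Cosyz J X0"] by simp
  then obtain W \<alpha> \<beta> where W: "W \<in> PI" "\<alpha> \<in> Hom C V W" "\<beta> \<in> Hom C W (Cosyz J X0)" "w \<cdot> s0 = \<beta> \<cdot> \<alpha>"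
    using K.q_zeroE comp_hom[OF s0(1) w(2)] by blast
  obtain \<beta>' where \<beta>': "\<beta>' \<in> Hom C W (Env J X0)" "onto J X0 \<cdot> \<beta>' = \<beta>" using proj_lift[OF W(1) env' W(3)] .
  note [simp] = W(2,3)[THEN homD] homD[OF \<beta>'(1)] \<beta>'(2) rewrite_under[OF \<beta>'(2)]
  have "onto J X0 \<cdot> (\<beta>' \<cdot> \<alpha>) = w \<cdot> s0" using W(4) by simp
  then obtain v where v: "v \<in> Hom C V Y0" "p \<cdot> v = s0"
    using pullback_lift[OF r(1) env' u comp_hom[OF W(2) \<beta>'(1)] s0(1)] by blast
  note [simp] = homD[OF v(1)]
  have e: "c1 \<bullet> s = \<pi> p \<bullet> \<pi> v" unfolding s0(2) using v(2) by simp
  have "s = c \<bullet> (c1 \<bullet> s)" by simp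
  also have "\<dots> = (g \<bullet> b) \<bullet> \<pi> v" unfolding e by (rule K.Q.rewrite_under[OF I.squares(2)]) simp_all
  also have "\<dots> = g \<bullet> (b \<bullet> \<pi> v)" by simp
  finally show ?thesis using that[of "b \<bullet> \<pi> v"] K.Q.comp_hom[OF K.q_hom[OF v(1)] I.homs(2)] by blast
qed

text \<open>
  Compare an image triangle, by the morphism with components i and the identity, with the image
  triangle of the trivial conflation from Y to Y to zero.
\<close>

lemma dist_Sus_zero:
  assumes T: "(f, g, h) \<in> Dist Kc" "is_cand Kc X Y Z (f, g, h)"
  shows "SusM Kc f \<bullet> h = Zero Kc Z (Cosyz J Y)"
proof -
  obtain X0 Y0 Z0 i p h0 a b c a1 b1 c1 where r: "conf X0 Y0 Z0 i p" "img i p = (\<pi> i, \<pi> p, h0)" and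
    "triangle_isomorphism Kc X0 Y0 Z0 (\<pi> i) (\<pi> p) h0 X Y Z f g h a b c a1 b1 c1" using dist_realize_iso[OF T(1,2)] .
  then interpret I: triangle_isomorphism Kc X0 Y0 Z0 "\<pi> i" "\<pi> p" h0 X Y Z f g h a b c a1 b1 c1 by simp
  note [simp] = cand_simps[OF T(2)] conf_simps[OF r(1)]
  \<comment> \<open>q is a cokernel of the identity, hence zero\<close>
  obtain q where q: "(Ide C Y0, q) \<in> S" using ide_adm_mono[of Y0] unfolding adm_mono_def by auto
  obtain R where "q \<in> Hom C Y0 R" using conf_typed[OF q ide_hom] by auto
  then have cq: "conf Y0 Y0 R (Ide C Y0) q" using q unfolding conf_def by (simp add: ide_hom)
  note [simp] = conf_simps(1-5)[OF cq]
  have qz: "q = Zero C Y0 R" using conf_simps(6)[OF cq] by simp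
  obtain d where v: "img (Ide C Y0) q = (\<pi> (Ide C Y0), \<pi> q, d)" "is_cand Kc Y0 Y0 R (\<pi> (Ide C Y0), \<pi> q, d)"
    using image_cand[OF cq] by metis
  have "conf_mor i p (Ide C Y0) q i (Ide C Y0) (Zero C Z0 R)"
    by (rule conf_morI[OF r(1) cq confD(2)[OF r(1)]]) (simp_all add: hom_iff qz)
  from image_mor[OF r(1) cq this] have "SusM Kc (\<pi> i) \<bullet> h0 = d \<bullet> \<pi> (Zero C Z0 R)"
    unfolding r(2) v(1) KS.tri_mor_iff[OF I.source v(2)] by blast
  also have "\<dots> = Zero Kc Z0 (Cosyz J Y0)" using cand_simps[OF v(2)] by simp
  finally have z: "SusM Kc (\<pi> i) \<bullet> h0 = Zero Kc Z0 (Cosyz J Y0)" .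
  have sq: "SusM Kc f \<bullet> SusM Kc a = SusM Kc b \<bullet> SusM Kc (\<pi> i)"
    using arg_cong[OF I.squares(1), of "SusM Kc"] by (simp del: I.squares)
  have "SusM Kc f \<bullet> h = SusM Kc f \<bullet> ((h \<bullet> c) \<bullet> c1)" by simp
  also have "\<dots> = (SusM Kc f \<bullet> SusM Kc a) \<bullet> (h0 \<bullet> c1)" unfolding I.squares(3)[symmetric] by (simp del: I.squares I.under)
  also have "\<dots> = SusM Kc b \<bullet> ((SusM Kc (\<pi> i) \<bullet> h0) \<bullet> c1)" unfolding sq by simp
  also have "\<dots> = Zero Kc Z (Cosyz J Y)" unfolding z by simp
  finally show ?thesis .
qed

text \<open>
  The bicartesian square is a conflation with the biproduct in the middle, and its image triangle is
  the one required for a homotopy cartesian square.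
\<close>

lemma hcart_of_right_square:
  assumes c: "conf X Y Z i p" "conf X Y' Z' m q" and t: "t \<in> Hom C Y Y'" "t \<cdot> i = m" and k: "k \<in> Hom C Z Z'" "k \<cdot> p = q \<cdot> t"
  shows "hcart Kc (\<pi> t) (\<pi> p) (\<pi> k) (\<pi> q)"
proof -
  note [simp] = conf_simps[OF c(1)] conf_simps[OF c(2)] homD[OF t(1)] homD[OF k(1)]
  obtain s i1 i2 p1 p2 where bp: "is_biproduct C Y' Z s i1 i2 p1 p2" using biproducts[of Y' Z] by auto
  note [simp] = biproduct_simps[OF bp]
  have "(i1 \<cdot> t \<boxminus> i2 \<cdot> p, q \<cdot> p1 \<boxplus> k \<cdot> p2) \<in> S"
    by (rule conf_of_right_square[OF confD(1-3)[OF c(1)] confD(1-3)[OF c(2)] t k bp])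
  then have "conf Y s Z' (i1 \<cdot> t \<boxminus> i2 \<cdot> p) (q \<cdot> p1 \<boxplus> k \<cdot> p2)" unfolding conf_def by (simp add: hom_iff)
  from image_in_Dist[OF this] image_cand[OF this] obtain d where
    "(\<pi> (i1 \<cdot> t \<boxminus> i2 \<cdot> p), \<pi> (q \<cdot> p1 \<boxplus> k \<cdot> p2), d) \<in> Dist Kc" by metis
  moreover have "\<pi> i1 \<bullet> \<pi> t \<boxplus>\<^bsub>Kc\<^esub> neg Kc Y s (\<pi> i2 \<bullet> \<pi> p) = \<pi> (i1 \<cdot> t \<boxminus> i2 \<cdot> p)"
    "\<pi> q \<bullet> \<pi> p1 \<boxplus>\<^bsub>Kc\<^esub> \<pi> k \<bullet> \<pi> p2 = \<pi> (q \<cdot> p1 \<boxplus> k \<cdot> p2)" by (simp_all add: diff_def)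
  moreover have "is_square Kc Y Y' Z Z' (\<pi> t) (\<pi> p) (\<pi> k) (\<pi> q)"
    unfolding is_square_def using k(2) by (simp add: K.Q.hom_iff)
  ultimately show ?thesis unfolding hcart_def using K.q_biproduct[OF bp] by metis
qed

lemma hcart_of_left_square:
  assumes c: "conf N P Z m q" "conf X Y Z i p" and t: "t \<in> Hom C P Y" "p \<cdot> t = q" and k: "k \<in> Hom C N X" "i \<cdot> k = t \<cdot> m"
  shows "hcart Kc (\<pi> m) (\<pi> k) (\<pi> i) (\<pi> t)"
proof -
  note [simp] = conf_simps[OF c(1)] conf_simps[OF c(2)] homD[OF t(1)] homD[OF k(1)]
  obtain s i1 i2 p1 p2 where bp: "is_biproduct C P X s i1 i2 p1 p2" using biproducts[of P X] by auto
  note [simp] = biproduct_simps[OF bp]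
  have "(i1 \<cdot> m \<boxminus> i2 \<cdot> k, t \<cdot> p1 \<boxplus> i \<cdot> p2) \<in> S"
    by (rule conf_of_left_square[OF confD(1-3)[OF c(1)] confD(1-3)[OF c(2)] t k bp])
  then have "conf N s Y (i1 \<cdot> m \<boxminus> i2 \<cdot> k) (t \<cdot> p1 \<boxplus> i \<cdot> p2)" unfolding conf_def by (simp add: hom_iff)
  from image_in_Dist[OF this] image_cand[OF this] obtain d where
    "(\<pi> (i1 \<cdot> m \<boxminus> i2 \<cdot> k), \<pi> (t \<cdot> p1 \<boxplus> i \<cdot> p2), d) \<in> Dist Kc" by metis
  moreover have "\<pi> i1 \<bullet> \<pi> m \<boxplus>\<^bsub>Kc\<^esub> neg Kc N s (\<pi> i2 \<bullet> \<pi> k) = \<pi> (i1 \<cdot> m \<boxminus> i2 \<cdot> k)"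
    "\<pi> t \<bullet> \<pi> p1 \<boxplus>\<^bsub>Kc\<^esub> \<pi> i \<bullet> \<pi> p2 = \<pi> (t \<cdot> p1 \<boxplus> i \<cdot> p2)" by (simp_all add: diff_def)
  moreover have "is_square Kc N P X Y (\<pi> m) (\<pi> k) (\<pi> i) (\<pi> t)"
    unfolding is_square_def using k(2) by (simp add: K.Q.hom_iff)
  ultimately show ?thesis unfolding hcart_def using K.q_biproduct[OF bp] by metis
qed

end

section \<open>The relative exact structure\<close>

locale frobenius_stable_class = frobenius_envelope C S J
  for C :: "('o, 'm, 'z) addcat_scheme" (structure) and S and J +
  fixes E :: "('m set \<times> 'm set \<times> 'm set) set"
  assumes frobenius_E: "frobenius_class (stable_cat C S J) E"

sublocale frobenius_stable_class \<subseteq> E: frobenius_class "stable_cat C S J" E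
  by (rule frobenius_E)

context frobenius_stable_class
begin

abbreviation SE where "SE \<equiv> rel_sequences C S J E"
abbreviation PE where "PE \<equiv> tri_proj Kc E"

lemma PE_Ob: "X \<in> PE \<Longrightarrow> X \<in> Ob C"
  unfolding tri_proj_def by simp

text \<open>
  A square with invertible verticals extends to an isomorphism of distinguished triangles, so
  membership in E is decided by the first map alone; \<open>E_transport_left\<close> does the same for the second.
\<close>

lemma E_transport_right:
  assumes T: "(f, g, h) \<in> E" "is_cand Kc X Y Z (f, g, h)" "(f', g', h') \<in> Dist Kc" "is_cand Kc X' Y' Z' (f', g', h')"
    and A: "A \<in> Hom Kc X X'" "is_iso Kc A" and B: "B \<in> Hom Kc Y Y'" "is_iso Kc B" and e: "B \<bullet> f = f' \<bullet> A"
  shows "(f', g', h') \<in> E"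
proof -
  have "(f, g, h) \<in> Dist Kc" using T(1) E.dist by blast
  then obtain D where "tri_mor Kc (f, g, h) (f', g', h') (A, B, D)" "is_iso Kc D"
    using dist_fill_right[OF _ T(2-4) A(1) B(1) e] A(2) B(2) by blast
  then have "tri_iso Kc (f, g, h) (f', g', h')" unfolding tri_iso_def using A(2) B(2) by blast
  then show ?thesis by (rule E.iso[OF T(1)])
qed

lemma E_transport_left:
  assumes T: "(f, g, h) \<in> E" "is_cand Kc X Y Z (f, g, h)" "(f', g', h') \<in> Dist Kc" "is_cand Kc X' Y' Z' (f', g', h')"
    and B: "B \<in> Hom Kc Y Y'" "is_iso Kc B" and D: "D \<in> Hom Kc Z Z'" "is_iso Kc D" and e: "D \<bullet> g = g' \<bullet> B"
  shows "(f', g', h') \<in> E"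
proof -
  have "(f, g, h) \<in> Dist Kc" using T(1) E.dist by blast
  then obtain A where "tri_mor Kc (f, g, h) (f', g', h') (A, B, D)" "is_iso Kc A"
    using dist_fill_left[OF _ T(2-4) B(1) D(1) e] B(2) D(2) by blast
  then have "tri_iso Kc (f, g, h) (f', g', h')" unfolding tri_iso_def using B(2) D(2) by blast
  then show ?thesis by (rule E.iso[OF T(1)])
qed

lemma E_of_mono:
  assumes T: "(f, g, h) \<in> Dist Kc" and m: "tri_mono E f"
  shows "(f, g, h) \<in> E"
proof -
  obtain g' h' where e: "(f, g', h') \<in> E" using m unfolding tri_mono_def by blast
  then have T': "(f, g', h') \<in> Dist Kc" using E.dist by blast
  obtain X Y Z where c: "is_cand Kc X Y Z (f, g, h)" using dist_cand[OF T] .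
  obtain X' Y' Z' where "is_cand Kc X' Y' Z' (f, g', h')" using dist_cand[OF T'] .
  moreover from this have "X' = X" "Y' = Y" using cand_simps(1)[OF c] cand_simps(1)[of X' Y' Z'] by auto
  ultimately have c': "is_cand Kc X Y Z' (f, g', h')" by simp
  note [simp] = cand_simps[OF c] cand_simps[OF c']
  have i: "Ide Kc X \<in> Hom Kc X X" "Ide Kc Y \<in> Hom Kc Y Y" "Ide Kc Y \<bullet> f = f \<bullet> Ide Kc X"
    by (simp_all add: K.Q.hom_iff)
  have X: "X \<in> Ob Kc" "Y \<in> Ob Kc" by simp_all
  show ?thesis
    by (rule E_transport_right[OF e c' T c i(1) K.Q.iso_Ide[OF X(1)] i(2) K.Q.iso_Ide[OF X(2)] i(3)])
qed

lemma E_of_epi: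
  assumes T: "(f, g, h) \<in> Dist Kc" and m: "tri_epi E g"
  shows "(f, g, h) \<in> E"
proof -
  obtain f' h' where e: "(f', g, h') \<in> E" using m unfolding tri_epi_def by blast
  then have T': "(f', g, h') \<in> Dist Kc" using E.dist by blast
  obtain X Y Z where c: "is_cand Kc X Y Z (f, g, h)" using dist_cand[OF T] .
  obtain X' Y' Z' where "is_cand Kc X' Y' Z' (f', g, h')" using dist_cand[OF T'] .
  moreover from this have "Z' = Z" "Y' = Y" using cand_simps(2)[OF c] cand_simps(2)[of X' Y' Z'] by auto
  ultimately have c': "is_cand Kc X' Y Z (f', g, h')" by simp
  note [simp] = cand_simps[OF c] cand_simps[OF c']
  have i: "Ide Kc Y \<in> Hom Kc Y Y" "Ide Kc Z \<in> Hom Kc Z Z" "Ide Kc Z \<bullet> g = g \<bullet> Ide Kc Y"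
    by (simp_all add: K.Q.hom_iff)
  have X: "Y \<in> Ob Kc" "Z \<in> Ob Kc" by simp_all
  show ?thesis
    by (rule E_transport_left[OF e c' T c i(1) K.Q.iso_Ide[OF X(1)] i(2) K.Q.iso_Ide[OF X(2)] i(3)])
qed

text \<open>
  Both descriptions of the relative conflations are needed: the first matches the closure under
  homotopy pushouts, the second the closure under homotopy pullbacks.
\<close>

lemma SE_iff:
  assumes c: "conf X Y Z i p"
  shows "(i, p) \<in> SE \<longleftrightarrow> tri_mono E (\<pi> i)" "(i, p) \<in> SE \<longleftrightarrow> tri_epi E (\<pi> p)"
proof -
  obtain d where w: "img i p = (\<pi> i, \<pi> p, d)" using image_cand[OF c] by metis
  note d = image_in_Dist[OF c, unfolded w]
  have "(i, p) \<in> SE \<longleftrightarrow> (\<pi> i, \<pi> p, d) \<in> E"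
    unfolding rel_sequences_def using confD(1)[OF c] w by simp
  then show "(i, p) \<in> SE \<longleftrightarrow> tri_mono E (\<pi> i)" "(i, p) \<in> SE \<longleftrightarrow> tri_epi E (\<pi> p)"
    using E_of_mono[OF d] E_of_epi[OF d] unfolding tri_mono_def tri_epi_def by blast+
qed

lemma SE_image: "(i, p) \<in> SE \<Longrightarrow> img i p \<in> E"
  unfolding rel_sequences_def by simp

lemma SE_conf:
  assumes "(i, p) \<in> SE" obtains X Y Z where "conf X Y Z i p"
proof -
  have "(i, p) \<in> S" using assms unfolding rel_sequences_def by simp
  then show ?thesis using that confE unfolding conf_def by metis
qed

lemma PE_extend:
  assumes "I \<in> PE" "(f, g, h) \<in> E" "is_cand Kc X Y Z (f, g, h)" "v \<in> Hom Kc X I"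
  obtains u where "u \<in> Hom Kc Y I" "u \<bullet> f = v"
proof -
  have "I \<in> tri_inj Kc E" using assms(1) E.tri_proj_eq_inj by simp
  then have "short_exact (hom_group Kc Z I) (hom_group Kc Y I) (hom_group Kc X I) (\<lambda>u. u \<bullet> g) (\<lambda>v. v \<bullet> f)"
    unfolding tri_inj_def using assms(2,3) by blast
  then have "v \<in> (\<lambda>v. v \<bullet> f) ` Hom Kc Y I" using assms(4) unfolding short_exact_def hom_group_simps by blast
  then show ?thesis using that by blast
qed

lemma PE_lift:
  assumes "P \<in> PE" "(f, g, h) \<in> E" "is_cand Kc X Y Z (f, g, h)" "v \<in> Hom Kc P Z"
  obtains u where "u \<in> Hom Kc P Y" "g \<bullet> u = v"
proof -
  have "short_exact (hom_group Kc P X) (hom_group Kc P Y) (hom_group Kc P Z) (\<lambda>u. f \<bullet> u) (\<lambda>v. g \<bullet> v)"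
    using assms(1-3) unfolding tri_proj_def by blast
  then have "v \<in> (\<lambda>v. g \<bullet> v) ` Hom Kc P Y" using assms(4) unfolding short_exact_def hom_group_simps by blast
  then show ?thesis using that by blast
qed

text \<open>
  The exact sequences that define projectivity of X are retracts of those for P.
\<close>

lemma PE_retract:
  assumes P: "P \<in> PE" and r: "r \<in> Hom Kc P X" "s \<in> Hom Kc X P" "r \<bullet> s = Ide Kc X"
  shows "X \<in> PE"
proof -
  note [simp] = r(1,2)[THEN K.Q_homD] r(3) K.Q.rewrite_under[OF r(3)]
  have "short_exact (hom_group Kc X U) (hom_group Kc X V) (hom_group Kc X W) (\<lambda>u. f \<bullet> u) (\<lambda>v. g \<bullet> v)"
    if e: "(f, g, h) \<in> E" and c: "is_cand Kc U V W (f, g, h)" for U V W f g h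
  proof -
    note [simp] = cand_simps[OF c]
    have x: "short_exact (hom_group Kc P U) (hom_group Kc P V) (hom_group Kc P W) (\<lambda>u. f \<bullet> u) (\<lambda>v. g \<bullet> v)"
      using P e c unfolding tri_proj_def by blast
    note x1 = x[unfolded short_exact_def hom_group_simps, THEN conjunct1]
      and x2 = x[unfolded short_exact_def hom_group_simps, THEN conjunct2, THEN conjunct1]
    have inj: "u = v" if "u \<in> Hom Kc P U" "v \<in> Hom Kc P U" "f \<bullet> u = f \<bullet> v" for u v
      using inj_onD[OF x1 that(3,1,2)] .
    have im: "f \<bullet> u \<in> Hom Kc P V \<and> g \<bullet> (f \<bullet> u) = Zero Kc P W" if "u \<in> Hom Kc P U" for u
    proof -
      have "f \<bullet> u \<in> {b \<in> Hom Kc P V. g \<bullet> b = Zero Kc P W}"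
        unfolding x2[symmetric] using that by (rule imageI)
      then show ?thesis by (rule CollectD)
    qed
    have ker: "\<exists>u\<in>Hom Kc P U. f \<bullet> u = v" if "v \<in> Hom Kc P V" "g \<bullet> v = Zero Kc P W" for v
    proof -
      have "v \<in> {b \<in> Hom Kc P V. g \<bullet> b = Zero Kc P W}" using that by (intro CollectI conjI)
      then have "v \<in> (\<lambda>u. f \<bullet> u) ` Hom Kc P U" unfolding x2 .
      then show ?thesis by (rule imageE) (rule bexI, simp_all)
    qed
    have ret: "(k \<bullet> r) \<bullet> s = k" if "k \<in> Hom Kc X T" for k T
      using K.Q_homD[OF that] by simp
    show ?thesis unfolding short_exact_def hom_group_simps
    proof (intro conjI)
      show "inj_on (\<lambda>u. f \<bullet> u) (Hom Kc X U)"
      proof (rule inj_onI)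
        fix u v assume uv: "u \<in> Hom Kc X U" "v \<in> Hom Kc X U" "f \<bullet> u = f \<bullet> v"
        note [simp] = uv(1,2)[THEN K.Q_homD]
        have "f \<bullet> (u \<bullet> r) = f \<bullet> (v \<bullet> r)" using K.Q.rewrite_under[OF uv(3), of r] by simp
        then have "u \<bullet> r = v \<bullet> r" using inj[OF K.Q.comp_hom[OF r(1) uv(1)] K.Q.comp_hom[OF r(1) uv(2)]] by blast
        then show "u = v" using ret[OF uv(1)] ret[OF uv(2)] by metis
      qed
      show "(\<lambda>u. f \<bullet> u) ` Hom Kc X U = {b \<in> Hom Kc X V. g \<bullet> b = Zero Kc X W}"
      proof (rule Set.set_eqI, rule iffI)
        fix b assume "b \<in> (\<lambda>u. f \<bullet> u) ` Hom Kc X U"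
        then obtain u where u: "u \<in> Hom Kc X U" "b = f \<bullet> u" by blast
        note [simp] = K.Q_homD[OF u(1)]
        have z: "g \<bullet> (f \<bullet> (u \<bullet> r)) = Zero Kc P W" using im[OF K.Q.comp_hom[OF r(1) u(1)]] by blast
        have "g \<bullet> b = (g \<bullet> (f \<bullet> (u \<bullet> r))) \<bullet> s" unfolding u(2) by simp
        also have "\<dots> = Zero Kc X W" unfolding z by simp
        finally show "b \<in> {b \<in> Hom Kc X V. g \<bullet> b = Zero Kc X W}" using u(2) by (simp add: K.Q.hom_iff)
      next
        fix b assume "b \<in> {b \<in> Hom Kc X V. g \<bullet> b = Zero Kc X W}"
        then have b: "b \<in> Hom Kc X V" "g \<bullet> b = Zero Kc X W" by blast+
        note [simp] = K.Q_homD[OF b(1)]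
        have "g \<bullet> (b \<bullet> r) = Zero Kc P W" using K.Q.rewrite_under[OF b(2), of r] by simp
        then obtain u where u: "u \<in> Hom Kc P U" "f \<bullet> u = b \<bullet> r" using ker[OF K.Q.comp_hom[OF r(1) b(1)]] by blast
        note [simp] = K.Q_homD[OF u(1)]
        have "f \<bullet> (u \<bullet> s) = b" using K.Q.rewrite_under[OF u(2), of s] by simp
        then show "b \<in> (\<lambda>u. f \<bullet> u) ` Hom Kc X U" using K.Q.comp_hom[OF r(2) u(1)] by blast
      qed
      show "(\<lambda>v. g \<bullet> v) ` Hom Kc X V = Hom Kc X W"
      proof (rule Set.set_eqI, rule iffI)
        fix k assume "k \<in> (\<lambda>v. g \<bullet> v) ` Hom Kc X V"
        then show "k \<in> Hom Kc X W" using K.Q.comp_hom c by auto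
      next
        fix k assume k: "k \<in> Hom Kc X W"
        note [simp] = K.Q_homD[OF k]
        obtain u where u: "u \<in> Hom Kc P V" "g \<bullet> u = k \<bullet> r" using PE_lift[OF P e c K.Q.comp_hom[OF r(1) k]] .
        note [simp] = K.Q_homD[OF u(1)]
        have "g \<bullet> (u \<bullet> s) = k" using K.Q.rewrite_under[OF u(2), of s] by simp
        then show "k \<in> (\<lambda>v. g \<bullet> v) ` Hom Kc X V" using K.Q.comp_hom[OF r(2) u(1)] by blast
      qed
    qed
  qed
  then show ?thesis unfolding tri_proj_def by simp
qed

text \<open>
  The extension exists in the stable category. Its error factors through a projective-injective
  object of the original structure, and that factorization extends along any inflation.
\<close>

lemma SE_extend:
  assumes I: "I \<in> PE" and ip: "(i, p) \<in> SE" "conf X Y Z i p" and f: "f \<in> Hom C X I"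
  obtains g where "g \<in> Hom C Y I" "g \<cdot> i = f"
proof -
  note [simp] = conf_simps[OF ip(2)] homD[OF f]
  obtain d where w: "img i p = (\<pi> i, \<pi> p, d)"
    "is_cand Kc X Y Z (\<pi> i, \<pi> p, d)" using image_cand[OF ip(2)] by metis
  obtain V where V: "V \<in> Hom Kc Y I" "V \<bullet> \<pi> i = \<pi> f"
    using PE_extend[OF I SE_image[OF ip(1), unfolded w(1)] w(2) K.q_hom[OF f]] .
  obtain v where v: "v \<in> Hom C Y I" "V = \<pi> v" using K.Q_homE[OF V(1)] .
  note [simp] = homD[OF v(1)]
  have "\<pi> f = \<pi> (v \<cdot> i)" using V(2) unfolding v(2) by simp
  then obtain W a b where W: "W \<in> PI" "a \<in> Hom C X W" "b \<in> Hom C W I" "f = v \<cdot> i \<boxplus> b \<cdot> a"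
    using K.q_eqE[OF _ f comp_hom[OF confD(2)[OF ip(2)] v(1)]] by blast
  obtain a' where a': "a' \<in> Hom C Y W" "a' \<cdot> i = a" using proj_extend[OF W(1) ip(2) W(2)] .
  note [simp] = W(2,3)[THEN homD] homD[OF a'(1)] a'(2)
  have "(v \<boxplus> b \<cdot> a') \<cdot> i = f" using W(4) by simp
  moreover have "v \<boxplus> b \<cdot> a' \<in> Hom C Y I" by (simp add: hom_iff)
  ultimately show ?thesis using that by blast
qed

lemma SE_lift:
  assumes P: "P \<in> PE" and ip: "(i, p) \<in> SE" "conf X Y Z i p" and f: "f \<in> Hom C P Z"
  obtains g where "g \<in> Hom C P Y" "p \<cdot> g = f"
proof -
  note [simp] = conf_simps[OF ip(2)] homD[OF f]
  obtain d where w: "img i p = (\<pi> i, \<pi> p, d)"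
    "is_cand Kc X Y Z (\<pi> i, \<pi> p, d)" using image_cand[OF ip(2)] by metis
  obtain V where V: "V \<in> Hom Kc P Y" "\<pi> p \<bullet> V = \<pi> f"
    using PE_lift[OF P SE_image[OF ip(1), unfolded w(1)] w(2) K.q_hom[OF f]] .
  obtain v where v: "v \<in> Hom C P Y" "V = \<pi> v" using K.Q_homE[OF V(1)] .
  note [simp] = homD[OF v(1)]
  have "\<pi> f = \<pi> (p \<cdot> v)" using V(2) unfolding v(2) by simp
  then obtain W a b where W: "W \<in> PI" "a \<in> Hom C P W" "b \<in> Hom C W Z" "f = p \<cdot> v \<boxplus> b \<cdot> a"
    using K.q_eqE[OF _ f comp_hom[OF v(1) confD(3)[OF ip(2)]]] by blast
  obtain b' where b': "b' \<in> Hom C W Y" "p \<cdot> b' = b" using proj_lift[OF W(1) ip(2) W(3)] .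
  note [simp] = W(2,3)[THEN homD] homD[OF b'(1)] b'(2) rewrite_under[OF b'(2)]
  have "p \<cdot> (v \<boxplus> b' \<cdot> a) = f" using W(4) by simp
  moreover have "v \<boxplus> b' \<cdot> a \<in> Hom C P Y" by (simp add: hom_iff)
  ultimately show ?thesis using that by blast
qed

lemma PI_cancel:
  assumes bp: "is_biproduct C W Y s i1 i2 p1 p2" and W: "W \<in> PI"
  shows "\<pi> (i2 \<cdot> p2) = \<pi> (Ide C s)"
proof -
  note [simp] = biproduct_simps[OF bp]
  have z: "\<pi> (i1 \<cdot> p1) = \<pi> (Zero C s s)"
    using K.q_zeroI[OF W biproductD(3,1)[OF bp]] .
  have "\<pi> (i2 \<cdot> p2) = \<pi> (i1 \<cdot> p1) \<boxplus>\<^bsub>Kc\<^esub> \<pi> (i2 \<cdot> p2)" unfolding z by simp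
  also have "\<dots> = \<pi> (Ide C s)" using biproductD(9)[OF bp] by simp
  finally show ?thesis .
qed

lemma PI_sum_PE:
  assumes bp: "is_biproduct C W Y s i1 i2 p1 p2" and W: "W \<in> PI" and Y: "Y \<in> PE"
  shows "s \<in> PE"
proof (rule PE_retract[OF Y])
  note [simp] = biproduct_simps[OF bp]
  show "\<pi> i2 \<in> Hom Kc Y s" "\<pi> p2 \<in> Hom Kc s Y" by (simp_all add: K.Q.hom_iff)
  show "\<pi> i2 \<bullet> \<pi> p2 = Ide Kc s" using PI_cancel[OF bp W] by simp
qed

text \<open>
  An E-monomorphism of X into an E-injective object need not be represented by an inflation, but
  together with an envelope of X it becomes one. The additional summand is stably zero, hence changes
  neither the membership in E nor the relative injectivity of the target.
\<close>

lemma enough_SE_inj: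
  assumes X: "X \<in> Ob C"
  obtains I Z e r where "conf X I Z e r" "(e, r) \<in> SE" "I \<in> PE"
proof -
  obtain I0 e where I0: "I0 \<in> PE" "e \<in> Hom Kc X I0" "tri_mono E e"
    using E.enough_tri_inj[of X] E.tri_proj_eq_inj X by auto
  obtain g h where T: "(e, g, h) \<in> E" using I0(3) unfolding tri_mono_def by blast
  have TD: "(e, g, h) \<in> Dist Kc" using T E.dist by blast
  obtain X' Y' Z' where "is_cand Kc X' Y' Z' (e, g, h)" using dist_cand[OF TD] .
  moreover from this have "X' = X" "Y' = I0" using K.Q_homD[OF I0(2)] cand_simps(1)[of X' Y' Z'] by auto
  ultimately have Tc: "is_cand Kc X I0 Z' (e, g, h)" by simp
  obtain e0 where e0: "e0 \<in> Hom C X I0" "e = \<pi> e0" using K.Q_homE[OF I0(2)] .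
  obtain s i1 i2 p1 p2 where bp: "is_biproduct C (Env J X) I0 s i1 i2 p1 p2"
    using biproducts[of "Env J X" I0] conf_simps(4)[OF env(1)[OF X]] PE_Ob[OF I0(1)] by blast
  note ec = env(1)[OF X]
  let ?j = "i1 \<cdot> into J X \<boxminus> i2 \<cdot> e0"
  obtain V \<rho> where c: "conf X s V ?j \<rho>" using graph_conf[OF ec e0(1) bp] .
  note [simp] = biproduct_simps[OF bp] homD[OF e0(1)] conf_simps[OF ec] conf_simps(2,5)[OF c] cand_simps[OF Tc]
  obtain d where w: "img ?j \<rho> = (\<pi> ?j, \<pi> \<rho>, d)"
    "is_cand Kc X s V (\<pi> ?j, \<pi> \<rho>, d)" using image_cand[OF c] by metis
  let ?b = "neg C I0 s i2"
  have z: "\<pi> (i1 \<cdot> into J X) = \<pi> (Zero C X s)"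
    using K.q_zeroI[OF env(2)[OF X] confD(2)[OF ec] biproductD(1)[OF bp]] .
  have "\<pi> ?j = \<pi> (i1 \<cdot> into J X) \<boxplus>\<^bsub>Kc\<^esub> \<pi> (neg C X s (i2 \<cdot> e0))" by (simp add: diff_def)
  also have "\<dots> = \<pi> ?b \<bullet> \<pi> e0" unfolding z by simp
  finally have ej: "\<pi> ?b \<bullet> e = \<pi> ?j \<bullet> Ide Kc X" unfolding e0(2) by simp
  have h: "Ide Kc X \<in> Hom Kc X X" "\<pi> ?b \<in> Hom Kc I0 s" by (simp_all add: K.Q.hom_iff)
  have iso: "is_iso Kc (\<pi> ?b)"
    by (rule K.Q.isoI[of _ I0 s "\<pi> (neg C s I0 p2)"])
      (use PI_cancel[OF bp env(2)[OF X]] in \<open>simp_all add: K.Q.hom_iff\<close>)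
  have "(\<pi> ?j, \<pi> \<rho>, d) \<in> E"
    by (rule E_transport_right[OF T Tc image_in_Dist[OF c, unfolded w(1)] w(2) h(1) K.Q.iso_Ide h(2) iso ej])
      (simp add: X)
  then have "(?j, \<rho>) \<in> SE" unfolding rel_sequences_def using confD(1)[OF c] w(1) by simp
  then show ?thesis using that[OF c] PI_sum_PE[OF bp env(2)[OF X] I0(1)] by blast
qed

lemma enough_SE_proj:
  assumes X: "X \<in> Ob C"
  obtains N P e r where "conf N P X e r" "(e, r) \<in> SE" "P \<in> PE"
proof -
  obtain P0 e where P0: "P0 \<in> PE" "e \<in> Hom Kc P0 X" "tri_epi E e"
    using E.enough_tri_proj[of X] X by auto
  obtain f h where T: "(f, e, h) \<in> E" using P0(3) unfolding tri_epi_def by blast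
  have TD: "(f, e, h) \<in> Dist Kc" using T E.dist by blast
  obtain X' Y' Z' where "is_cand Kc X' Y' Z' (f, e, h)" using dist_cand[OF TD] .
  moreover from this have "Z' = X" "Y' = P0" using K.Q_homD[OF P0(2)] cand_simps(2)[of X' Y' Z'] by auto
  ultimately have Tc: "is_cand Kc X' P0 X (f, e, h)" by simp
  obtain e0 where e0: "e0 \<in> Hom C P0 X" "e = \<pi> e0" using K.Q_homE[OF P0(2)] .
  obtain W q where W: "W \<in> PI" "q \<in> Hom C W X" "adm_epi S q" using enough_proj[OF X] by blast
  obtain j where j: "(j, q) \<in> S" using W(3) unfolding adm_epi_def by blast
  obtain M where "j \<in> Hom C M W" using conf_typed'[OF j W(2)] .
  then have ec: "conf M W X j q" using j W(2) unfolding conf_def by blast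
  obtain s i1 i2 p1 p2 where bp: "is_biproduct C W P0 s i1 i2 p1 p2"
    using biproducts[of W P0] conf_simps(4)[OF ec] PE_Ob[OF P0(1)] by blast
  let ?j = "q \<cdot> p1 \<boxminus> e0 \<cdot> p2"
  obtain V \<iota> where c: "conf V s X \<iota> ?j" using cograph_conf[OF ec e0(1) bp] .
  note [simp] = biproduct_simps[OF bp] homD[OF e0(1)] conf_simps[OF ec] conf_simps(1,3)[OF c] cand_simps[OF Tc]
  obtain d where w: "img \<iota> ?j = (\<pi> \<iota>, \<pi> ?j, d)"
    "is_cand Kc V s X (\<pi> \<iota>, \<pi> ?j, d)" using image_cand[OF c] by metis
  let ?b = "neg C P0 s i2"
  have z: "\<pi> (q \<cdot> p1) = \<pi> (Zero C s X)"
    using K.q_zeroI[OF W(1) biproductD(3)[OF bp] W(2)] .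
  have "\<pi> ?j = \<pi> (q \<cdot> p1) \<boxplus>\<^bsub>Kc\<^esub> \<pi> (neg C s X (e0 \<cdot> p2))" by (simp add: diff_def)
  also have "\<dots> = \<pi> (neg C s X (e0 \<cdot> p2))" unfolding z by simp
  finally have "\<pi> ?j = \<pi> (neg C s X (e0 \<cdot> p2))" .
  then have ej: "Ide Kc X \<bullet> e = \<pi> ?j \<bullet> \<pi> ?b" unfolding e0(2) by simp
  have h: "\<pi> ?b \<in> Hom Kc P0 s" "Ide Kc X \<in> Hom Kc X X" by (simp_all add: K.Q.hom_iff)
  have iso: "is_iso Kc (\<pi> ?b)"
    by (rule K.Q.isoI[of _ P0 s "\<pi> (neg C s P0 p2)"])
      (use PI_cancel[OF bp W(1)] in \<open>simp_all add: K.Q.hom_iff\<close>)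
  have "(\<pi> \<iota>, \<pi> ?j, d) \<in> E"
    by (rule E_transport_left[OF T Tc image_in_Dist[OF c, unfolded w(1)] w(2) h(1) iso h(2) K.Q.iso_Ide ej])
      (simp add: X)
  then have "(\<iota>, ?j) \<in> SE" unfolding rel_sequences_def using confD(1)[OF c] w(1) by simp
  then show ?thesis using that[OF c] PI_sum_PE[OF bp W(1) P0(1)] by blast
qed

text \<open>
  The converse of \<open>SE_extend\<close>. Extending a relative injective hull \<open>X \<rightarrow> I\<close> over Y gives a morphism of
  conflations which is the identity on X; its right square exhibits p as a homotopy pullback of an
  E-epimorphism.
\<close>

lemma SE_of_extend:
  assumes c: "conf X Y Z i p" and x: "\<And>I f. I \<in> PE \<Longrightarrow> f \<in> Hom C X I \<Longrightarrow> \<exists>g\<in>Hom C Y I. g \<cdot> i = f"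
  shows "(i, p) \<in> SE"
proof -
  note [simp] = conf_simps[OF c]
  obtain I W e r where e: "conf X I W e r" "(e, r) \<in> SE" "I \<in> PE" using enough_SE_inj[OF conf_simps(3)[OF c]] .
  obtain t where t: "t \<in> Hom C Y I" "t \<cdot> i = e" using x[OF e(3) confD(2)[OF e(1)]] by blast
  note [simp] = conf_simps[OF e(1)] homD[OF t(1)] t(2)
  have "(r \<cdot> t) \<cdot> i = Zero C X W" "r \<cdot> t \<in> Hom C Y W" by (simp_all add: hom_iff)
  then obtain k where k: "k \<in> Hom C Z W" "k \<cdot> p = r \<cdot> t" using conf_desc[OF c] by blast
  have "tri_epi E (\<pi> p)"
    using E.epi_pullback[OF _ hcart_of_right_square[OF c e(1) t k]] SE_iff(2)[OF e(1)] e(2) by blast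
  then show ?thesis using SE_iff(2)[OF c] by blast
qed

text \<open>
  Here i is a homotopy pushout of the kernel of a relative projective cover of Z.
\<close>

lemma SE_of_lift:
  assumes c: "conf X Y Z i p" and x: "\<And>P f. P \<in> PE \<Longrightarrow> f \<in> Hom C P Z \<Longrightarrow> \<exists>g\<in>Hom C P Y. p \<cdot> g = f"
  shows "(i, p) \<in> SE"
proof -
  note [simp] = conf_simps[OF c]
  obtain N P m q where e: "conf N P Z m q" "(m, q) \<in> SE" "P \<in> PE" using enough_SE_proj[OF conf_simps(5)[OF c]] .
  obtain t where t: "t \<in> Hom C P Y" "p \<cdot> t = q" using x[OF e(3) confD(3)[OF e(1)]] by blast
  note [simp] = conf_simps[OF e(1)] homD[OF t(1)] t(2) rewrite_under[OF t(2)]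
  have "p \<cdot> (t \<cdot> m) = Zero C N Z" "t \<cdot> m \<in> Hom C N Y" by (simp_all add: hom_iff)
  then obtain k where k: "k \<in> Hom C N X" "i \<cdot> k = t \<cdot> m" using conf_lift[OF c] by blast
  have "tri_mono E (\<pi> i)"
    using E.mono_pushout[OF _ hcart_of_left_square[OF e(1) c t k]] SE_iff(1)[OF e(1)] e(2) by blast
  then show ?thesis using SE_iff(1)[OF c] by blast
qed

lemma SE_adm:
  assumes "adm_mono SE i" "i \<in> Hom C X Y"
  obtains Z p where "conf X Y Z i p" "(i, p) \<in> SE"
proof -
  obtain p where p: "(i, p) \<in> SE" using assms(1) unfolding adm_mono_def by blast
  obtain X' Y' Z where c: "conf X' Y' Z i p" using SE_conf[OF p] .
  have "X' = X" "Y' = Y" using hom_disjoint[OF confD(2)[OF c] assms(2)] by blast+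
  then show ?thesis using that c p by blast
qed

lemma SE_adm_epi:
  assumes "adm_epi SE p" "p \<in> Hom C Y Z"
  obtains X i where "conf X Y Z i p" "(i, p) \<in> SE"
proof -
  obtain i where p: "(i, p) \<in> SE" using assms(1) unfolding adm_epi_def by blast
  obtain X Y' Z' where c: "conf X Y' Z' i p" using SE_conf[OF p] .
  have "Z' = Z" "Y' = Y" using hom_disjoint[OF confD(3)[OF c] assms(2)] by blast+
  then show ?thesis using that c p by blast
qed

lemma adm_monoI: "(i, p) \<in> T \<Longrightarrow> adm_mono T i" and adm_epiI: "(i, p) \<in> T \<Longrightarrow> adm_epi T p"
  unfolding adm_mono_def adm_epi_def by blast+

lemma adm_conf:
  assumes "adm_mono S i" "i \<in> Hom C X Y"
  obtains Z p where "conf X Y Z i p"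
proof -
  obtain p where p: "(i, p) \<in> S" using assms(1) unfolding adm_mono_def by blast
  then show ?thesis using that conf_typed[OF p assms(2)] assms(2) unfolding conf_def by metis
qed

lemma adm_epi_conf:
  assumes "adm_epi S p" "p \<in> Hom C Y Z"
  obtains X i where "conf X Y Z i p"
proof -
  obtain i where p: "(i, p) \<in> S" using assms(1) unfolding adm_epi_def by blast
  then show ?thesis using that conf_typed'[OF p assms(2)] assms(2) unfolding conf_def by metis
qed

text \<open>
  By the two criteria, a conflation is relative exactly if maps from its first object into relative
  injectives extend, equivalently if maps from relative projectives into its last object lift. The
  first condition is visibly stable under composition of inflations and under pushout, the second
  under composition of deflations and under pullback.
\<close>

lemma SE_exact: "exact_category C SE"
proof (intro exact_category.intro exact_category_axioms.intro additive_category_axioms, goal_cases)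
  case (1 i p)
  then show ?case using ker_coker unfolding rel_sequences_def by blast
next
  case (2 i p x y z i' x' y' p' z' a b c)
  have ip: "(i, p) \<in> S" using 2(1) unfolding rel_sequences_def by blast
  have ip': "(i', p') \<in> S" by (rule iso_closed[OF ip 2(2-13)])
  have c: "conf x y z i p" "conf x' y' z' i' p'" using ip ip' 2(2-5) unfolding conf_def by blast+
  have "conf_mor i p i' p' a b c" by (rule conf_morI[OF c 2(6-8) 2(12,13)])
  from image_mor[OF c this] have "tri_iso Kc (img i p) (img i' p')"
    unfolding tri_iso_def using K.q_iso 2(9-11) by blast
  then have "img i' p' \<in> E" using E.iso[OF SE_image[OF 2(1)]] by blast
  then show ?case unfolding rel_sequences_def using ip' by blast
next
  case (3 x)
  note x = ide_hom[OF 3]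
  obtain Z p where c: "conf x x Z (Ide C x) p" using adm_conf[OF ide_adm_mono[OF 3] x] .
  have "(Ide C x, p) \<in> SE"
    by (rule SE_of_extend[OF c]) (use comp_ide in blast)
  then show ?case by (rule adm_monoI)
next
  case (4 x)
  note x = ide_hom[OF 4]
  obtain Z i where c: "conf Z x x i (Ide C x)" using adm_epi_conf[OF ide_adm_epi[OF 4] x] .
  have "(i, Ide C x) \<in> SE"
    by (rule SE_of_lift[OF c]) (use ide_comp in blast)
  then show ?case by (rule adm_epiI)
next
  case (5 i x y j z)
  obtain Z1 p where i: "conf x y Z1 i p" "(i, p) \<in> SE" using SE_adm[OF 5(3,1)] .
  obtain Z2 q where j: "conf y z Z2 j q" "(j, q) \<in> SE" using SE_adm[OF 5(4,2)] .
  obtain Z3 r where c: "conf x z Z3 (j \<cdot> i) r"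
    using adm_conf[OF comp_adm_mono[OF 5(1,2) adm_monoI[OF confD(1)[OF i(1)]] adm_monoI[OF confD(1)[OF j(1)]]] comp_hom[OF 5(1,2)]] .
  have "(j \<cdot> i, r) \<in> SE"
  proof (rule SE_of_extend[OF c])
    fix I f assume f: "I \<in> PE" "f \<in> Hom C x I"
    obtain g where g: "g \<in> Hom C y I" "g \<cdot> i = f" using SE_extend[OF f(1) i(2,1) f(2)] .
    obtain h where h: "h \<in> Hom C z I" "h \<cdot> j = g" using SE_extend[OF f(1) j(2,1) g(1)] .
    have "h \<cdot> (j \<cdot> i) = f" using comp_assoc[OF 5(1,2) h(1)] h(2) g(2) by simp
    then show "\<exists>g\<in>Hom C z I. g \<cdot> (j \<cdot> i) = f" using h(1) by blast
  qed
  then show ?case by (rule adm_monoI)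
next
  case (6 p x y q z)
  obtain Z1 i where i: "conf Z1 x y i p" "(i, p) \<in> SE" using SE_adm_epi[OF 6(3,1)] .
  obtain Z2 j where j: "conf Z2 y z j q" "(j, q) \<in> SE" using SE_adm_epi[OF 6(4,2)] .
  obtain Z3 r where c: "conf Z3 x z r (q \<cdot> p)"
    using adm_epi_conf[OF comp_adm_epi[OF 6(1,2) adm_epiI[OF confD(1)[OF i(1)]] adm_epiI[OF confD(1)[OF j(1)]]] comp_hom[OF 6(1,2)]] .
  have "(r, q \<cdot> p) \<in> SE"
  proof (rule SE_of_lift[OF c])
    fix P f assume f: "P \<in> PE" "f \<in> Hom C P z"
    obtain g where g: "g \<in> Hom C P y" "q \<cdot> g = f" using SE_lift[OF f(1) j(2,1) f(2)] .
    obtain h where h: "h \<in> Hom C P x" "p \<cdot> h = g" using SE_lift[OF f(1) i(2,1) g(1)] .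
    have "(q \<cdot> p) \<cdot> h = f" using comp_assoc[OF h(1) 6(1,2)] h(2) g(2) by simp
    then show "\<exists>g\<in>Hom C P x. (q \<cdot> p) \<cdot> g = f" using h(1) by blast
  qed
  then show ?case by (rule adm_epiI)
next
  case (7 i A B a D)
  obtain Z p where i: "conf A B Z i p" "(i, p) \<in> SE" using SE_adm[OF 7(3,1)] .
  obtain i' a' where po: "is_pushout C i a i' a'"
    using pushout_adm_mono[OF 7(1,2) adm_monoI[OF confD(1)[OF i(1)]]] by blast
  obtain Q p' where c: "conf D Q Z i' p'" and "a' \<in> Hom C B Q" "p' \<cdot> a' = p"
    using pushout_conf[OF i(1) 7(2) po] .
  obtain Q' where Q': "i' \<in> Hom C D Q'" "a' \<in> Hom C B Q'" "a' \<cdot> i = i' \<cdot> a" "\<And>T u v. u \<in> Hom C D T \<Longrightarrow> v \<in> Hom C B T \<Longrightarrow> v \<cdot> i = u \<cdot> a \<Longrightarrow>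
      \<exists>!w. w \<in> Hom C Q' T \<and> w \<cdot> i' = u \<and> w \<cdot> a' = v"
    using pushoutE[OF po 7(1,2)] by blast
  have "Q' = Q" using hom_disjoint[OF Q'(1) confD(2)[OF c]] by blast
  have "(i', p') \<in> SE"
  proof (rule SE_of_extend[OF c])
    fix I f assume f: "I \<in> PE" "f \<in> Hom C D I"
    obtain g where g: "g \<in> Hom C B I" "g \<cdot> i = f \<cdot> a" using SE_extend[OF f(1) i(2,1) comp_hom[OF 7(2) f(2)]] .
    show "\<exists>g\<in>Hom C Q I. g \<cdot> i' = f" using Q'(4)[OF f(2) g] unfolding \<open>Q' = Q\<close> by blast
  qed
  from po adm_monoI[OF this] show ?case by blast
next
  case (8 p B Q a D)
  obtain Z i where i: "conf Z B Q i p" "(i, p) \<in> SE" using SE_adm_epi[OF 8(3,1)] .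
  obtain p' a' where pb: "is_pullback C a' p' a p" "adm_epi S p'"
    using pullback_adm_epi[OF 8(1,2) adm_epiI[OF confD(1)[OF i(1)]]] by blast
  have po: "is_pushout (op_cat C) p a p' a'" using pb(1) by simp
  obtain A where A: "p' \<in> Hom C A D" "\<And>T u v. u \<in> Hom C T D \<Longrightarrow> v \<in> Hom C T B \<Longrightarrow> p \<cdot> v = a \<cdot> u \<Longrightarrow>
      \<exists>!w. w \<in> Hom C T A \<and> p' \<cdot> w = u \<and> a' \<cdot> w = v"
  proof -
    have "p \<in> Hom (op_cat C) Q B" "a \<in> Hom (op_cat C) Q D" using 8(1,2) by simp_all
    from exact_category.pushoutE[OF op_exact po this] obtain A where
      "p' \<in> Hom (op_cat C) D A" "a' \<in> Hom (op_cat C) B A" "a' \<cdot>\<^bsub>op_cat C\<^esub> p = p' \<cdot>\<^bsub>op_cat C\<^esub> a"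
      "\<And>T u v. u \<in> Hom (op_cat C) D T \<Longrightarrow> v \<in> Hom (op_cat C) B T \<Longrightarrow> v \<cdot>\<^bsub>op_cat C\<^esub> p = u \<cdot>\<^bsub>op_cat C\<^esub> a \<Longrightarrow>
      \<exists>!w. w \<in> Hom (op_cat C) A T \<and> w \<cdot>\<^bsub>op_cat C\<^esub> p' = u \<and> w \<cdot>\<^bsub>op_cat C\<^esub> a' = v" by blast
    then show ?thesis using that unfolding op_simps by blast
  qed
  obtain N n where c: "conf N A D n p'" using adm_epi_conf[OF pb(2) A(1)] .
  have "(n, p') \<in> SE"
  proof (rule SE_of_lift[OF c])
    fix P f assume f: "P \<in> PE" "f \<in> Hom C P D"
    obtain g where g: "g \<in> Hom C P B" "p \<cdot> g = a \<cdot> f" using SE_lift[OF f(1) i(2,1) comp_hom[OF f(2) 8(2)]] .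
    show "\<exists>g\<in>Hom C P A. p' \<cdot> g = f" using A(2)[OF f(2) g] by blast
  qed
  from pb(1) adm_epiI[OF this] show ?case by blast
qed

text \<open>
  A relative projective object is a retract of any of its covers by an object of PE.
\<close>

lemma exact_proj_SE: "exact_proj C SE = PE"
proof (rule Set.set_eqI, rule iffI)
  fix X assume X: "X \<in> exact_proj C SE"
  then have Xo: "X \<in> Ob C" unfolding exact_proj_def by blast
  obtain N P m q where e: "conf N P X m q" "(m, q) \<in> SE" "P \<in> PE" using enough_SE_proj[OF Xo] .
  obtain s where s: "s \<in> Hom C X P" "q \<cdot> s = Ide C X"
    using X confD(3)[OF e(1)] adm_epiI[OF e(2)] ide_hom[OF Xo] unfolding exact_proj_def by blast
  show "X \<in> PE"
    by (rule PE_retract[OF e(3) K.q_hom[OF confD(3)[OF e(1)]] K.q_hom[OF s(1)]])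
      (use K.q_comp_hom[OF s(1) confD(3)[OF e(1)]] s(2) in simp)
next
  fix X assume X: "X \<in> PE"
  have "\<exists>g\<in>Hom C X y. p \<cdot> g = f" if h: "p \<in> Hom C y z" "adm_epi SE p" "f \<in> Hom C X z" for y z p f
  proof -
    obtain x i where "conf x y z i p" "(i, p) \<in> SE" using SE_adm_epi[OF h(2,1)] .
    from SE_lift[OF X this(2,1) h(3)] show ?thesis by blast
  qed
  then show "X \<in> exact_proj C SE" unfolding exact_proj_def using PE_Ob[OF X] by blast
qed

lemma exact_inj_SE: "exact_inj C SE = PE"
proof (rule Set.set_eqI, rule iffI)
  fix X assume X: "X \<in> exact_inj C SE"
  then have Xo: "X \<in> Ob C" unfolding exact_inj_def by blast
  obtain I N m q where e: "conf X I N m q" "(m, q) \<in> SE" "I \<in> PE" using enough_SE_inj[OF Xo] .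
  obtain s where s: "s \<in> Hom C I X" "s \<cdot> m = Ide C X"
    using X confD(2)[OF e(1)] adm_monoI[OF e(2)] ide_hom[OF Xo] unfolding exact_inj_def by blast
  show "X \<in> PE"
    by (rule PE_retract[OF e(3) K.q_hom[OF s(1)] K.q_hom[OF confD(2)[OF e(1)]]])
      (use K.q_comp_hom[OF confD(2)[OF e(1)] s(1)] s(2) in simp)
next
  fix X assume X: "X \<in> PE"
  have "\<exists>g\<in>Hom C y X. g \<cdot> i = f" if h: "i \<in> Hom C x y" "adm_mono SE i" "f \<in> Hom C x X" for x y i f
  proof -
    obtain z p where "conf x y z i p" "(i, p) \<in> SE" using SE_adm[OF h(2,1)] .
    from SE_extend[OF X this(2,1) h(3)] show ?thesis by blast
  qed
  then show "X \<in> exact_inj C SE" unfolding exact_inj_def using PE_Ob[OF X] by blast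
qed

lemma SE_frobenius: "frobenius_exact_category C SE"
proof (intro frobenius_exact_category.intro frobenius_exact_category_axioms.intro SE_exact)
  show "\<exists>P\<in>exact_proj C SE. \<exists>p\<in>Hom C P x. adm_epi SE p" if xo: "x \<in> Ob C" for x
  proof -
    obtain N P e r where *: "conf N P x e r" "(e, r) \<in> SE" "P \<in> PE" using enough_SE_proj[OF xo] .
    show ?thesis using *(3) confD(3)[OF *(1)] adm_epiI[OF *(2)] unfolding exact_proj_SE by blast
  qed
  show "\<exists>I\<in>exact_inj C SE. \<exists>i\<in>Hom C x I. adm_mono SE i" if xo: "x \<in> Ob C" for x
  proof -
    obtain I Z e r where *: "conf x I Z e r" "(e, r) \<in> SE" "I \<in> PE" using enough_SE_inj[OF xo] .
    show ?thesis using *(3) confD(2)[OF *(1)] adm_monoI[OF *(2)] unfolding exact_inj_SE by blast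
  qed
qed (simp add: exact_proj_SE exact_inj_SE)

end

section \<open>The relative stable category\<close>

context frobenius_envelope
begin

lemma SusM_add:
  assumes F: "F \<in> Hom Kc X Y" and G: "G \<in> Hom Kc X Y"
  shows "SusM Kc (F \<boxplus>\<^bsub>Kc\<^esub> G) = SusM Kc F \<boxplus>\<^bsub>Kc\<^esub> SusM Kc G"
proof -
  obtain f where f: "f \<in> Hom C X Y" "F = \<pi> f" using K.Q_homE[OF F] .
  obtain g where g: "g \<in> Hom C X Y" "G = \<pi> g" using K.Q_homE[OF G] .
  obtain f' where f': "suspends f f'" "f' \<in> Hom C (Cosyz J X) (Cosyz J Y)" "SusM Kc (\<pi> f) = \<pi> f'" using SusM_pi[OF f(1)] .
  obtain g' where g': "suspends g g'" "g' \<in> Hom C (Cosyz J X) (Cosyz J Y)" "SusM Kc (\<pi> g) = \<pi> g'" using SusM_pi[OF g(1)] .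
  have "SusM Kc (\<pi> (f \<boxplus> g)) = \<pi> (f' \<boxplus> g')"
    using SusM_eq[OF suspends_add[OF f'(1) g'(1) f(1) g(1)] add_hom[OF f(1) g(1)]] .
  then show ?thesis using K.q_add_hom[OF f(1) g(1)] K.q_add_hom[OF f'(2) g'(2)] f(2) g(2) f'(3) g'(3) by simp
qed

lemma dist_iso:
  assumes "T \<in> Dist Kc" "tri_iso Kc T T'" shows "T' \<in> Dist Kc"
  using assms KS.tri_iso_trans unfolding stable_fields tri_iso_stable by blast

text \<open>
  Distinguished triangles are realized by conflations only up to isomorphism, so homotopy cartesian
  squares have to be transported along isomorphisms of the two upper corners.
\<close>

lemma hcart_iso:
  assumes h: "hcart Kc f g f' g'" and f: "f \<in> Hom Kc A B" "g \<in> Hom Kc A D"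
    and a: "a \<in> Hom Kc A A'" "a1 \<in> Hom Kc A' A" "a1 \<bullet> a = Ide Kc A" "a \<bullet> a1 = Ide Kc A'"
    and b: "b \<in> Hom Kc B B'" "b1 \<in> Hom Kc B' B" "b1 \<bullet> b = Ide Kc B" "b \<bullet> b1 = Ide Kc B'"
  shows "hcart Kc (b \<bullet> (f \<bullet> a1)) (g \<bullet> a1) f' (g' \<bullet> b1)"
proof -
  obtain A0 B0 D0 Q s i1 i2 p1 p2 d where h: "is_square Kc A0 B0 D0 Q f g f' g'" "is_biproduct Kc B0 D0 s i1 i2 p1 p2"
    "(i1 \<bullet> f \<boxplus>\<^bsub>Kc\<^esub> neg Kc A0 s (i2 \<bullet> g), g' \<bullet> p1 \<boxplus>\<^bsub>Kc\<^esub> f' \<bullet> p2, d) \<in> Dist Kc"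
    using h unfolding hcart_def by blast
  have h0: "f \<in> Hom Kc A0 B0" "g \<in> Hom Kc A0 D0" "f' \<in> Hom Kc D0 Q" "g' \<in> Hom Kc B0 Q" "g' \<bullet> f = f' \<bullet> g"
    using h(1) unfolding is_square_def by blast+
  have [simp]: "A0 = A" "B0 = B" "D0 = D" using f(1,2)[THEN K.Q_homD] h0(1,2)[THEN K.Q_homD] by auto
  note [simp] = K.Q.biproduct_simps[OF h(2), simplified] a(1,2)[THEN K.Q_homD] b(1,2)[THEN K.Q_homD]
    f(1,2)[THEN K.Q_homD] K.Q_homD[OF h0(3), simplified] K.Q_homD[OF h0(4), simplified]
    a(3,4) b(3,4) a(3,4)[THEN K.Q.rewrite_under] b(3,4)[THEN K.Q.rewrite_under]
  let ?f = "b \<bullet> (f \<bullet> a1)" and ?g = "g \<bullet> a1" and ?g' = "g' \<bullet> b1"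
  have "is_square Kc A' B' D Q ?f ?g f' ?g'"
    unfolding is_square_def using K.Q.rewrite_under[OF h0(5), of a1] by (simp add: K.Q.hom_iff)
  moreover have bp: "is_biproduct Kc B' D s (i1 \<bullet> b1) i2 (b \<bullet> p1) p2"
    unfolding is_biproduct_def using K.Q.biproductD(9)[OF h(2)] by (simp add: K.Q.hom_iff)
  moreover have "((i1 \<bullet> b1) \<bullet> ?f \<boxplus>\<^bsub>Kc\<^esub> neg Kc A' s (i2 \<bullet> ?g), ?g' \<bullet> (b \<bullet> p1) \<boxplus>\<^bsub>Kc\<^esub> f' \<bullet> p2, SusM Kc a \<bullet> d) \<in> Dist Kc"
  proof (rule dist_iso[OF h(3)])
    have d: "d \<in> Hom Kc Q (Cosyz J A)"
    proof -
      obtain X Y Z where "is_cand Kc X Y Z (i1 \<bullet> f \<boxplus>\<^bsub>Kc\<^esub> neg Kc A0 s (i2 \<bullet> g), g' \<bullet> p1 \<boxplus>\<^bsub>Kc\<^esub> f' \<bullet> p2, d)"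
        using dist_cand[OF h(3)] .
      from cand_simps[OF this] show ?thesis by (simp add: K.Q.hom_iff)
    qed
    note [simp] = K.Q_homD[OF d]
    have c: "is_cand Kc A s Q (i1 \<bullet> f \<boxplus>\<^bsub>Kc\<^esub> neg Kc A0 s (i2 \<bullet> g), g' \<bullet> p1 \<boxplus>\<^bsub>Kc\<^esub> f' \<bullet> p2, d)"
      "is_cand Kc A' s Q ((i1 \<bullet> b1) \<bullet> ?f \<boxplus>\<^bsub>Kc\<^esub> neg Kc A' s (i2 \<bullet> ?g), ?g' \<bullet> (b \<bullet> p1) \<boxplus>\<^bsub>Kc\<^esub> f' \<bullet> p2, SusM Kc a \<bullet> d)"
      by (simp_all add: K.Q.hom_iff)
    have "tri_mor Kc (i1 \<bullet> f \<boxplus>\<^bsub>Kc\<^esub> neg Kc A0 s (i2 \<bullet> g), g' \<bullet> p1 \<boxplus>\<^bsub>Kc\<^esub> f' \<bullet> p2, d)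
     ((i1 \<bullet> b1) \<bullet> ?f \<boxplus>\<^bsub>Kc\<^esub> neg Kc A' s (i2 \<bullet> ?g), ?g' \<bullet> (b \<bullet> p1) \<boxplus>\<^bsub>Kc\<^esub> f' \<bullet> p2, SusM Kc a \<bullet> d)
      (a, Ide Kc s, Ide Kc Q)"
      unfolding KS.tri_mor_iff[OF c] by (simp add: K.Q.hom_iff)
    moreover have "is_iso Kc a" using K.Q.isoI[OF a] .
    ultimately show "tri_iso Kc (i1 \<bullet> f \<boxplus>\<^bsub>Kc\<^esub> neg Kc A0 s (i2 \<bullet> g), g' \<bullet> p1 \<boxplus>\<^bsub>Kc\<^esub> f' \<bullet> p2, d)
     ((i1 \<bullet> b1) \<bullet> ?f \<boxplus>\<^bsub>Kc\<^esub> neg Kc A' s (i2 \<bullet> ?g), ?g' \<bullet> (b \<bullet> p1) \<boxplus>\<^bsub>Kc\<^esub> f' \<bullet> p2, SusM Kc a \<bullet> d)"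
      unfolding tri_iso_def using K.Q.iso_Ide[of s] K.Q.iso_Ide[of Q] by auto
  qed
  ultimately show ?thesis unfolding hcart_def by blast
qed

end

lemma rel_fields:
  "addcat.truncate (rel_stable_cat K E R) = quot_cat K (tri_proj K E)"
  "SusO (rel_stable_cat K E R) = Cosyz R"
  "SusM (rel_stable_cat K E R) = SusM (rel_suscat K E R)"
  "Dist (rel_stable_cat K E R) = {T. \<exists>T0\<in>rel_std K E R. tri_iso (rel_suscat K E R) T0 T}"
  by (simp_all add: rel_stable_cat_def suscat.extend_def tricat.fields_def rel_suscat_def addcat.extend_def
      suscat.fields_def addcat.truncate_def)

lemma tri_iso_rel: "tri_iso (rel_suscat K E R) = tri_iso (rel_stable_cat K E R)"
proof -
  have "tri_mor (rel_suscat K E R) T T' m = tri_mor (rel_stable_cat K E R) T T' m" for T T' m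
    by (cases T; cases T'; cases m)
      (simp add: tri_mor.simps rel_stable_cat_def suscat.extend_def tricat.fields_def rel_suscat_def addcat.extend_def
      suscat.fields_def)
  moreover have "is_iso (rel_suscat K E R) = is_iso (rel_stable_cat K E R)"
    by (simp add: is_iso_def fun_eq_iff rel_stable_cat_def suscat.extend_def tricat.fields_def rel_suscat_def addcat.extend_def
      suscat.fields_def)
  ultimately show ?thesis unfolding tri_iso_def fun_eq_iff by simp
qed

locale frobenius_comparison = frobenius_stable_class C S J E
  for C :: "('o, 'm, 'z) addcat_scheme" (structure) and S and J and E +
  fixes J' :: "('o, 'm) envelope" and R :: "('o, 'm set) tri_envelope"
  assumes J': "exact_envelope C (rel_sequences C S J E) J'"
    and R: "class_envelope (stable_cat C S J) E R"

sublocale frobenius_comparison \<subseteq> F: frobenius_envelope C "rel_sequences C S J E" J'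
  by (intro frobenius_envelope.intro frobenius_envelope_axioms.intro SE_frobenius J')

context frobenius_comparison
begin

lemma PI_PE: "W \<in> PI \<Longrightarrow> W \<in> PE"
  unfolding exact_proj_SE[symmetric] unfolding exact_proj_def rel_sequences_def adm_epi_def by blast

lemma rel_quotient: "additive_quotient Kc PE (rel_stable_cat Kc E R)"
proof
  show "p \<in> Ob Kc" if "p \<in> PE" for p using PE_Ob[OF that] by simp
  show "PE \<noteq> {}" using K.P_nonempty PI_PE by blast
  show "\<exists>s\<in>PE. \<exists>i1 i2 p1 p2. is_biproduct Kc a b s i1 i2 p1 p2" if ab: "a \<in> PE" "b \<in> PE" for a b
  proof -
    obtain s i1 i2 p1 p2 where "s \<in> PE" "is_biproduct C a b s i1 i2 p1 p2"
      using F.proj_sum[of a b] ab unfolding exact_proj_SE by blast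
    then show ?thesis using K.q_biproduct by blast
  qed
qed (rule rel_fields(1))

end

sublocale frobenius_comparison \<subseteq> D: additive_quotient "stable_cat C S J" "tri_proj (stable_cat C S J) E"
    "rel_stable_cat (stable_cat C S J) E R"
  by (rule rel_quotient)

context frobenius_comparison
begin

abbreviation Dc where "Dc \<equiv> rel_stable_cat Kc E R"
abbreviation \<rho> where "\<rho> \<equiv> qcls Kc PE"
abbreviation \<sigma> where "\<sigma> \<equiv> qcls C (exact_proj C SE)"

text \<open>
  Maps into an object of PE extend along E-monomorphisms, which makes the class envelope functorial modulo PE.
\<close>

lemma PE_fill:
  assumes T: "(f, g, h) \<in> E" "is_cand Kc X I Z (f, g, h)" "(f', g', h') \<in> Dist Kc" "is_cand Kc X' I' Z' (f', g', h')"
    and I: "I' \<in> PE" and A: "A \<in> Hom Kc X X'"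
  obtains B D where "tri_mor Kc (f, g, h) (f', g', h') (A, B, D)" "D \<in> Hom Kc Z Z'" "SusM Kc A \<bullet> h = h' \<bullet> D"
proof -
  have "f' \<in> Hom Kc X' I'" using T(4) by simp
  then obtain B where B: "B \<in> Hom Kc I I'" "B \<bullet> f = f' \<bullet> A"
    using PE_extend[OF I T(1,2) K.Q.comp_hom[OF A]] by blast
  have "(f, g, h) \<in> Dist Kc" using T(1) E.dist by blast
  then obtain D where D: "tri_mor Kc (f, g, h) (f', g', h') (A, B, D)" using dist_fill_right[OF _ T(2-4) A B] by blast
  then show ?thesis using that[OF D] D[unfolded KS.tri_mor_iff[OF T(2,4)]] by blast
qed

text \<open>
  The difference of the two maps is killed by h, hence factors through the object I of PE. So maps
  into a relative cosyzygy are determined modulo PE by their composite with the boundary, and every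
  identification of relative suspensions reduces to an equation of boundaries.
\<close>

lemma middle_PE_unique:
  assumes T: "(f, g, h) \<in> Dist Kc" "is_cand Kc X I Z (f, g, h)" and I: "I \<in> PE"
    and G: "G \<in> Hom Kc V Z" "G' \<in> Hom Kc V Z" "h \<bullet> G = h \<bullet> G'"
  shows "\<rho> G = \<rho> G'"
proof -
  note [simp] = G(1,2)[THEN K.Q_homD] cand_simps[OF T(2)]
  have d: "G \<boxminus>\<^bsub>Kc\<^esub> G' \<in> Hom Kc V Z" by (simp add: K.Q.hom_iff)
  have "h \<bullet> (G \<boxminus>\<^bsub>Kc\<^esub> G') = h \<bullet> G \<boxminus>\<^bsub>Kc\<^esub> h \<bullet> G'" by simp
  also have "\<dots> = Zero Kc V (Cosyz J X)" unfolding G(3) by simp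
  finally obtain t where t: "t \<in> Hom Kc V I" "G \<boxminus>\<^bsub>Kc\<^esub> G' = g \<bullet> t"
    using dist_weak_kernel_right[OF T d] by blast
  have "g \<in> Hom Kc I Z" using T(2) by simp
  then have "factors Kc PE (G \<boxminus>\<^bsub>Kc\<^esub> G')" unfolding t(2) by (rule D.factorsI[OF I t(1)])
  then show ?thesis using D.q_eq_iff[OF G(1,2)] by blast
qed

lemma rtri:
  assumes X: "X \<in> Ob C"
  shows "(into R X, onto R X, bdry R X) \<in> Dist Kc" "(into R X, onto R X, bdry R X) \<in> E"
    "is_cand Kc X (Env R X) (Cosyz R X) (into R X, onto R X, bdry R X)" "Env R X \<in> PE"
proof -
  have "X \<in> Ob Kc" using X by simp
  note h = R[unfolded class_envelope_def, rule_format, OF this]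
  show d: "(into R X, onto R X, bdry R X) \<in> Dist Kc" using h by blast
  show "(into R X, onto R X, bdry R X) \<in> E" using E_of_mono[OF d] h by blast
  show "is_cand Kc X (Env R X) (Cosyz R X) (into R X, onto R X, bdry R X)" using h by blast
  show "Env R X \<in> PE" using h E.tri_proj_eq_inj by blast
qed

lemma rtri_simps:
  assumes X: "X \<in> Ob C"
  shows "Arr Kc (into R X) \<and> Dom Kc (into R X) = X \<and> Cod Kc (into R X) = Env R X"
    "Arr Kc (onto R X) \<and> Dom Kc (onto R X) = Env R X \<and> Cod Kc (onto R X) = Cosyz R X"
    "Arr Kc (bdry R X) \<and> Dom Kc (bdry R X) = Cosyz R X \<and> Cod Kc (bdry R X) = Cosyz J X"
    "Env R X \<in> Ob C" "Cosyz R X \<in> Ob C"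
  using cand_simps[OF rtri(3)[OF X]] by blast+

lemma rel_suspends_exists:
  assumes F: "F \<in> Hom Kc X Y"
  obtains B F' where "tri_mor Kc (into R X, onto R X, bdry R X) (into R Y, onto R Y, bdry R Y) (F, B, F')"
    "F' \<in> Hom Kc (Cosyz R X) (Cosyz R Y)" "SusM Kc F \<bullet> bdry R X = bdry R Y \<bullet> F'"
proof -
  have "X \<in> Ob C" "Y \<in> Ob C" using K.Q_homD[OF F] by blast+
  then show ?thesis using PE_fill[OF rtri(2,3) rtri(1,3,4) F] that by blast
qed

text \<open>
  A map factoring through PE extends along \<open>into R X\<close>, and \<open>SusM Kc (into R X) \<bullet> bdry R X\<close> vanishes.
\<close>

lemma SusM_bdry_cong:
  assumes F: "F \<in> Hom Kc X Y" "F1 \<in> Hom Kc X Y" "\<rho> F = \<rho> F1"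
  shows "SusM Kc F \<bullet> bdry R X = SusM Kc F1 \<bullet> bdry R X"
proof -
  obtain P a b where w: "P \<in> PE" "a \<in> Hom Kc X P" "b \<in> Hom Kc P Y" "F = F1 \<boxplus>\<^bsub>Kc\<^esub> b \<bullet> a"
    using D.q_eqE[OF F(3,1,2)] .
  have X: "X \<in> Ob C" using K.Q_homD[OF F(1)] by blast
  obtain a' where a': "a' \<in> Hom Kc (Env R X) P" "a' \<bullet> into R X = a" using PE_extend[OF w(1) rtri(2,3)[OF X] w(2)] .
  note [simp] = rtri_simps[OF X] K.Q_homD[OF F(2)] w(2,3)[THEN K.Q_homD] K.Q_homD[OF a'(1)]
  have "SusM Kc (b \<bullet> a) \<bullet> bdry R X = SusM Kc b \<bullet> (SusM Kc a' \<bullet> (SusM Kc (into R X) \<bullet> bdry R X))"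
    unfolding a'(2)[symmetric] by simp
  also have "\<dots> = Zero Kc (Cosyz R X) (Cosyz J Y)" unfolding dist_Sus_zero[OF rtri(1,3)[OF X]] by simp
  finally have z: "SusM Kc (b \<bullet> a) \<bullet> bdry R X = Zero Kc (Cosyz R X) (Cosyz J Y)" .
  have "SusM Kc F \<bullet> bdry R X = (SusM Kc F1 \<boxplus>\<^bsub>Kc\<^esub> SusM Kc (b \<bullet> a)) \<bullet> bdry R X"
    unfolding w(4) SusM_add[OF F(2) K.Q.comp_hom[OF w(2,3)]] ..
  also have "\<dots> = SusM Kc F1 \<bullet> bdry R X \<boxplus>\<^bsub>Kc\<^esub> SusM Kc (b \<bullet> a) \<bullet> bdry R X"
    by (rule K.Q.distrib_comp) simp_all
  also have "\<dots> = SusM Kc F1 \<bullet> bdry R X" unfolding z by simp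
  finally show ?thesis .
qed

text \<open>
  The middle component of a morphism of envelope triangles is immaterial: compatibility with the
  boundaries determines the class of the third component.
\<close>

lemma SusM_Dc:
  assumes F: "F \<in> Hom Kc X Y" and F': "F' \<in> Hom Kc (Cosyz R X) (Cosyz R Y)"
    and e: "SusM Kc F \<bullet> bdry R X = bdry R Y \<bullet> F'"
  shows "SusM Dc (\<rho> F) = \<rho> F'"
proof -
  let ?M = "{\<rho> f' | f' f X Y e. f \<in> \<rho> F \<and> f \<in> Hom Kc X Y \<and>
        tri_mor Kc (into R X, onto R X, bdry R X) (into R Y, onto R Y, bdry R Y) (f, e, f')}"
  have X: "X \<in> Ob C" and Y: "Y \<in> Ob C" using K.Q_homD[OF F] by blast+
  have *: "\<rho> F1' = \<rho> F'" if F1: "F1 \<in> Hom Kc X Y" "\<rho> F1 = \<rho> F" and F1': "F1' \<in> Hom Kc (Cosyz R X) (Cosyz R Y)"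
     and e1: "SusM Kc F1 \<bullet> bdry R X = bdry R Y \<bullet> F1'" for F1 F1'
    using middle_PE_unique[OF rtri(1,3,4)[OF Y] F1' F'] SusM_bdry_cong[OF F1(1) F F1(2)] e e1 by simp
  have "G = \<rho> F'" if G: "G \<in> ?M" for G
  proof -
    obtain f' f X1 Y1 b where g: "G = \<rho> f'" "f \<in> \<rho> F" "f \<in> Hom Kc X1 Y1"
      "tri_mor Kc (into R X1, onto R X1, bdry R X1) (into R Y1, onto R Y1, bdry R Y1) (f, b, f')" using G by blast
    note m = D.q_memE[OF g(2) F]
    have [simp]: "X1 = X" "Y1 = Y" using K.Q.hom_disjoint[OF m(1) g(3)] by blast+
    show ?thesis using *[OF m] g(1) g(4)[simplified, unfolded KS.tri_mor_iff[OF rtri(3)[OF X] rtri(3)[OF Y]]] by blast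
  qed
  moreover have "\<rho> F' \<in> ?M"
  proof -
    obtain B F1 where F1: "tri_mor Kc (into R X, onto R X, bdry R X) (into R Y, onto R Y, bdry R Y) (F, B, F1)"
     "F1 \<in> Hom Kc (Cosyz R X) (Cosyz R Y)" "SusM Kc F \<bullet> bdry R X = bdry R Y \<bullet> F1" using rel_suspends_exists[OF F] .
    have "\<rho> F' = \<rho> F1" using *[OF F refl F1(2,3)] by simp
    then show ?thesis using D.q_mem[OF F] F F1(1) by blast
  qed
  ultimately have "\<Union>?M = \<rho> F'" by blast
  moreover have "SusM Dc (\<rho> F) = \<Union>?M"
    unfolding rel_fields by (simp add: rel_suscat_def addcat.extend_def suscat.fields_def rel_functor_def)
  ultimately show ?thesis by simp
qed

lemma SusO_Dc [simp]: "SusO Dc X = Cosyz R X"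
  by (simp add: rel_fields(2))

end

sublocale frobenius_comparison \<subseteq> DS: suspended_category "rel_stable_cat (stable_cat C S J) E R"
proof (unfold_locales, goal_cases)
  case (1 X)
  then have "X \<in> Ob C" by simp
  from rtri_simps(5)[OF this] show ?case by simp
next
  case (2 F X Y)
  obtain f where f: "f \<in> Hom Kc X Y" "F = \<rho> f" using D.Q_homE[OF 2] .
  obtain B f' where f': "f' \<in> Hom Kc (Cosyz R X) (Cosyz R Y)" "SusM Kc f \<bullet> bdry R X = bdry R Y \<bullet> f'"
    using rel_suspends_exists[OF f(1)] by metis
  show ?case using SusM_Dc[OF f(1) f'] f(2) D.q_hom[OF f'(1)] by simp
next
  case (3 F X Y G Z)
  obtain f where f: "f \<in> Hom Kc X Y" "F = \<rho> f" using D.Q_homE[OF 3(1)] .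
  obtain g where g: "g \<in> Hom Kc Y Z" "G = \<rho> g" using D.Q_homE[OF 3(2)] .
  obtain f' where f': "f' \<in> Hom Kc (Cosyz R X) (Cosyz R Y)" "SusM Kc f \<bullet> bdry R X = bdry R Y \<bullet> f'"
    using rel_suspends_exists[OF f(1)] by metis
  obtain g' where g': "g' \<in> Hom Kc (Cosyz R Y) (Cosyz R Z)" "SusM Kc g \<bullet> bdry R Y = bdry R Z \<bullet> g'"
    using rel_suspends_exists[OF g(1)] by metis
  have X: "X \<in> Ob C" "Y \<in> Ob C" "Z \<in> Ob C" using K.Q_homD[OF f(1)] K.Q_homD[OF g(1)] by blast+
  note [simp] = rtri_simps[OF X(1)] rtri_simps[OF X(2)] rtri_simps[OF X(3)] K.Q_homD[OF f(1)] K.Q_homD[OF g(1)] K.Q_homD[OF f'(1)] K.Q_homD[OF g'(1)]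
  have "SusM Kc (g \<bullet> f) \<bullet> bdry R X = bdry R Z \<bullet> (g' \<bullet> f')"
    using f'(2) K.Q.rewrite_under[OF g'(2), of f'] by simp
  from SusM_Dc[OF K.Q.comp_hom[OF f(1) g(1)] K.Q.comp_hom[OF f'(1) g'(1)] this]
  show ?case using D.q_comp_hom[OF f(1) g(1)] D.q_comp_hom[OF f'(1) g'(1)] SusM_Dc[OF f(1) f'] SusM_Dc[OF g(1) g'] f(2) g(2) by simp
next
  case (4 X)
  then have X: "X \<in> Ob C" by simp
  note [simp] = rtri_simps[OF X] X
  have "Ide Kc X \<in> Hom Kc X X" "Ide Kc (Cosyz R X) \<in> Hom Kc (Cosyz R X) (Cosyz R X)" by (simp_all add: K.Q.hom_iff)
  from SusM_Dc[OF this] show ?case using KS.SusM_Ide[of X] by simp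
qed

section \<open>The comparison functor\<close>

context frobenius_comparison
begin

lemma Dc_unit_simps [simp]:
  "Arr Dc F \<Longrightarrow> Dom Dc F = x \<Longrightarrow> F \<cdot>\<^bsub>Dc\<^esub> \<rho> (\<pi> (Ide C x)) = F"
  "Arr Dc F \<Longrightarrow> Cod Dc F = x \<Longrightarrow> \<rho> (\<pi> (Ide C x)) \<cdot>\<^bsub>Dc\<^esub> F = F"
  using D.Q_unit_simps(1)[of F x] D.Q_unit_simps(2)[of F x] by simp_all

lemma Dc_homD:
  "F \<in> Hom Dc x y \<Longrightarrow> Arr Dc F \<and> Dom Dc F = x \<and> Cod Dc F = y \<and> x \<in> Ob C \<and> y \<in> Ob C"
  using D.Q_homD[of F x y] by simp

text \<open>
  A factorization through PE in the stable category lifts to C up to a map through PI, which is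
  contained in PE. Hence the comparison functor is well defined and faithful.
\<close>

lemma \<sigma>_eq_iff:
  assumes f: "f \<in> Hom C X Y" "g \<in> Hom C X Y"
  shows "\<sigma> f = \<sigma> g \<longleftrightarrow> \<rho> (\<pi> f) = \<rho> (\<pi> g)"
proof
  assume "\<sigma> f = \<sigma> g"
  then obtain P a b where w: "P \<in> PE" "a \<in> Hom C X P" "b \<in> Hom C P Y" "f = g \<boxplus> b \<cdot> a"
    using F.K.q_eqE[OF _ f] unfolding exact_proj_SE by metis
  note [simp] = homD[OF f(2)] w(2,3)[THEN homD]
  have z: "\<rho> (\<pi> b \<bullet> \<pi> a) = \<rho> (Zero Kc X Y)"
    by (rule D.q_zeroI[OF w(1)]) (simp_all add: K.Q.hom_iff)
  have "\<rho> (\<pi> f) = \<rho> (\<pi> g) \<boxplus>\<^bsub>Dc\<^esub> \<rho> (\<pi> b \<bullet> \<pi> a)" unfolding w(4) by simp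
  also have "\<dots> = \<rho> (\<pi> g)" unfolding z by simp
  finally show "\<rho> (\<pi> f) = \<rho> (\<pi> g)" .
next
  assume "\<rho> (\<pi> f) = \<rho> (\<pi> g)"
  then obtain P A B where w: "P \<in> PE" "A \<in> Hom Kc X P" "B \<in> Hom Kc P Y" "\<pi> f = \<pi> g \<boxplus>\<^bsub>Kc\<^esub> B \<bullet> A"
    using D.q_eqE[OF _ K.q_hom[OF f(1)] K.q_hom[OF f(2)]] by metis
  obtain a where a: "a \<in> Hom C X P" "A = \<pi> a" using K.Q_homE[OF w(2)] .
  obtain b where b: "b \<in> Hom C P Y" "B = \<pi> b" using K.Q_homE[OF w(3)] .
  note [simp] = f(1,2)[THEN homD] homD[OF a(1)] homD[OF b(1)]
  have "\<pi> f = \<pi> (g \<boxplus> b \<cdot> a)" using w(4) unfolding a(2) b(2) by simp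
  then obtain W c d where v: "W \<in> PI" "c \<in> Hom C X W" "d \<in> Hom C W Y" "f = g \<boxplus> b \<cdot> a \<boxplus> d \<cdot> c"
    using K.q_eqE[OF _ f(1), of "g \<boxplus> b \<cdot> a"] by (auto simp: hom_iff)
  note [simp] = v(2,3)[THEN homD]
  have z: "\<sigma> (b \<cdot> a) = \<sigma> (Zero C X Y)" "\<sigma> (d \<cdot> c) = \<sigma> (Zero C X Y)"
    using F.K.q_zeroI[OF _ a(1) b(1)] w(1) F.K.q_zeroI[OF _ v(2,3)] PI_PE[OF v(1)] unfolding exact_proj_SE by blast+
  have "\<sigma> f = \<sigma> g \<boxplus>\<^bsub>F.Kc\<^esub> \<sigma> (b \<cdot> a) \<boxplus>\<^bsub>F.Kc\<^esub> \<sigma> (d \<cdot> c)" unfolding v(4) by simp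
  also have "\<dots> = \<sigma> g" unfolding z by simp
  finally show "\<sigma> f = \<sigma> g" .
qed

text \<open>
  The functor sends the class of f to the class of its stable class. Any element of a coset may serve
  as representative, and \<open>\<Theta>'\<close> inverts this on morphisms.
\<close>

definition \<Theta> where "\<Theta> G = \<rho> (\<pi> (SOME f. f \<in> G))"
definition \<Theta>' where "\<Theta>' H = \<sigma> (SOME f. Arr C f \<and> \<rho> (\<pi> f) = H)"

lemma \<Theta>_\<sigma>:
  assumes f: "f \<in> Hom C X Y"
  shows "\<Theta> (\<sigma> f) = \<rho> (\<pi> f)"
proof -
  have "(SOME f'. f' \<in> \<sigma> f) \<in> \<sigma> f" using F.K.q_mem[OF f] by (rule someI)
  from F.K.q_memE[OF this f] show ?thesis unfolding \<Theta>_def using \<sigma>_eq_iff[OF _ f] by blast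
qed

lemma \<Theta>_Arr [simp]: "Arr C f \<Longrightarrow> \<Theta> (\<sigma> f) = \<rho> (\<pi> f)"
  using \<Theta>_\<sigma>[OF Arr_hom] .

lemma \<Theta>'_\<rho>:
  assumes f: "f \<in> Hom C X Y"
  shows "\<Theta>' (\<rho> (\<pi> f)) = \<sigma> f"
proof -
  have "Arr C f \<and> \<rho> (\<pi> f) = \<rho> (\<pi> f)" using homD[OF f] by blast
  then have s: "Arr C (SOME f'. Arr C f' \<and> \<rho> (\<pi> f') = \<rho> (\<pi> f)) \<and> \<rho> (\<pi> (SOME f'. Arr C f' \<and> \<rho> (\<pi> f') = \<rho> (\<pi> f))) = \<rho> (\<pi> f)"
    by (rule someI)
  define f' where "f' = (SOME f'. Arr C f' \<and> \<rho> (\<pi> f') = \<rho> (\<pi> f))"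
  have f': "Arr C f'" "\<rho> (\<pi> f') = \<rho> (\<pi> f)" using s unfolding f'_def by blast+
  have "Dom Dc (\<rho> (\<pi> f')) = Dom Dc (\<rho> (\<pi> f))" "Cod Dc (\<rho> (\<pi> f')) = Cod Dc (\<rho> (\<pi> f))" unfolding f'(2) by simp_all
  then have "f' \<in> Hom C X Y" using f'(1) homD[OF f] by (simp add: hom_iff)
  then have "\<sigma> f' = \<sigma> f" using \<sigma>_eq_iff[OF _ f] f'(2) by blast
  then show ?thesis unfolding \<Theta>'_def f'_def .
qed

lemma Dc_homE:
  assumes "G \<in> Hom Dc X Y"
  obtains f where "f \<in> Hom C X Y" "G = \<rho> (\<pi> f)"
proof -
  obtain F where F: "F \<in> Hom Kc X Y" "G = \<rho> F" using D.Q_homE[OF assms] .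
  obtain f where "f \<in> Hom C X Y" "F = \<pi> f" using K.Q_homE[OF F(1)] .
  then show ?thesis using that F(2) by blast
qed

lemma \<rho>\<pi>_hom: "f \<in> Hom C X Y \<Longrightarrow> \<rho> (\<pi> f) \<in> Hom Dc X Y"
  using D.q_hom[OF K.q_hom] .

lemma \<Theta>_hom:
  assumes "G \<in> Hom F.Kc X Y" shows "\<Theta> G \<in> Hom Dc X Y"
proof -
  obtain g where "g \<in> Hom C X Y" "G = \<sigma> g" using F.K.Q_homE[OF assms] .
  then show ?thesis using \<Theta>_\<sigma> \<rho>\<pi>_hom by metis
qed

lemma \<Theta>_comp:
  assumes "G \<in> Hom F.Kc X Y" "H \<in> Hom F.Kc Y Z" shows "\<Theta> (H \<cdot>\<^bsub>F.Kc\<^esub> G) = \<Theta> H \<cdot>\<^bsub>Dc\<^esub> \<Theta> G"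
proof -
  obtain g where g: "g \<in> Hom C X Y" "G = \<sigma> g" using F.K.Q_homE[OF assms(1)] .
  obtain h where h: "h \<in> Hom C Y Z" "H = \<sigma> h" using F.K.Q_homE[OF assms(2)] .
  note [simp] = homD[OF g(1)] homD[OF h(1)]
  show ?thesis unfolding g(2) h(2) by simp
qed

lemma \<Theta>_inj:
  assumes "G \<in> Hom F.Kc X Y" "H \<in> Hom F.Kc X Y" "\<Theta> G = \<Theta> H" shows "G = H"
proof -
  obtain g where g: "g \<in> Hom C X Y" "G = \<sigma> g" using F.K.Q_homE[OF assms(1)] .
  obtain h where h: "h \<in> Hom C X Y" "H = \<sigma> h" using F.K.Q_homE[OF assms(2)] .
  show ?thesis using assms(3) \<sigma>_eq_iff[OF g(1) h(1)] unfolding g(2) h(2) \<Theta>_\<sigma>[OF g(1)] \<Theta>_\<sigma>[OF h(1)] by blast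
qed

lemma \<Theta>_surj:
  assumes "H \<in> Hom Dc X Y" obtains G where "G \<in> Hom F.Kc X Y" "\<Theta> G = H"
proof -
  obtain f where f: "f \<in> Hom C X Y" "H = \<rho> (\<pi> f)" using Dc_homE[OF assms] .
  show ?thesis using that[OF F.K.q_hom[OF f(1)]] \<Theta>_\<sigma>[OF f(1)] f(2) by blast
qed

lemma \<Theta>_iso_iff:
  assumes "G \<in> Hom F.Kc X Y"
  shows "is_iso Dc (\<Theta> G) \<longleftrightarrow> is_iso F.Kc G"
proof
  have XY: "X \<in> Ob C" "Y \<in> Ob C" using F.K.Q_homD[OF assms] by blast+
  note i = F.K.q_hom[OF ide_hom[OF XY(1)]] F.K.q_hom[OF ide_hom[OF XY(2)]]
  {
    assume "is_iso F.Kc G"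
    then obtain H where H: "H \<in> Hom F.Kc Y X" "H \<cdot>\<^bsub>F.Kc\<^esub> G = Ide F.Kc X" "G \<cdot>\<^bsub>F.Kc\<^esub> H = Ide F.Kc Y"
      using F.K.Q.isoE[OF _ assms] by metis
    have "\<Theta> (H \<cdot>\<^bsub>F.Kc\<^esub> G) = Ide Dc X" "\<Theta> (G \<cdot>\<^bsub>F.Kc\<^esub> H) = Ide Dc Y" unfolding H(2,3) using XY by simp_all
    then show "is_iso Dc (\<Theta> G)" unfolding \<Theta>_comp[OF assms H(1)] \<Theta>_comp[OF H(1) assms]
      by (rule D.Q.isoI[OF \<Theta>_hom[OF assms] \<Theta>_hom[OF H(1)]])
  next
    assume "is_iso Dc (\<Theta> G)"
    then obtain H' where H': "H' \<in> Hom Dc Y X" "H' \<cdot>\<^bsub>Dc\<^esub> \<Theta> G = Ide Dc X" "\<Theta> G \<cdot>\<^bsub>Dc\<^esub> H' = Ide Dc Y"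
      using D.Q.isoE[OF _ \<Theta>_hom[OF assms]] by metis
    obtain H where H: "H \<in> Hom F.Kc Y X" "\<Theta> H = H'" using \<Theta>_surj[OF H'(1)] .
    have "\<Theta> (H \<cdot>\<^bsub>F.Kc\<^esub> G) = \<Theta> (\<sigma> (Ide C X))" "\<Theta> (G \<cdot>\<^bsub>F.Kc\<^esub> H) = \<Theta> (\<sigma> (Ide C Y))"
      unfolding \<Theta>_comp[OF assms H(1)] \<Theta>_comp[OF H(1) assms] H(2) H'(2,3) using XY by simp_all
    then have "H \<cdot>\<^bsub>F.Kc\<^esub> G = Ide F.Kc X" "G \<cdot>\<^bsub>F.Kc\<^esub> H = Ide F.Kc Y"
      using \<Theta>_inj[OF F.K.Q.comp_hom[OF assms H(1)] i(1)] \<Theta>_inj[OF F.K.Q.comp_hom[OF H(1) assms] i(2)] by simp_all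
    then show "is_iso F.Kc G" by (rule F.K.Q.isoI[OF assms H(1)])
  }
qed

text \<open>
  The third map of the image triangle of the chosen relative envelope of X. This triangle is another
  class envelope of X in the stable category, to be compared with the one chosen in R.
\<close>

definition bd where "bd X = snd (snd (img (into J' X) (onto J' X)))"

lemma jtri:
  assumes X: "X \<in> Ob C"
  shows "conf X (Env J' X) (Cosyz J' X) (into J' X) (onto J' X)"
    "img (into J' X) (onto J' X) = (\<pi> (into J' X), \<pi> (onto J' X), bd X)"
    "(\<pi> (into J' X), \<pi> (onto J' X), bd X) \<in> E" "(\<pi> (into J' X), \<pi> (onto J' X), bd X) \<in> Dist Kc"
    "is_cand Kc X (Env J' X) (Cosyz J' X) (\<pi> (into J' X), \<pi> (onto J' X), bd X)" "Env J' X \<in> PE"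
proof -
  note c' = F.env[OF X]
  have s: "(into J' X, onto J' X) \<in> SE" using F.confD(1)[OF c'(1)] .
  show c: "conf X (Env J' X) (Cosyz J' X) (into J' X) (onto J' X)"
    using F.confD(1-3)[OF c'(1)] unfolding conf_def rel_sequences_def by blast
  obtain d where w: "img (into J' X) (onto J' X) = (\<pi> (into J' X), \<pi> (onto J' X), d)"
    "is_cand Kc X (Env J' X) (Cosyz J' X) (\<pi> (into J' X), \<pi> (onto J' X), d)"
    using image_cand[OF c] by metis
  have b: "d = bd X" unfolding bd_def w(1) by simp
  show im: "img (into J' X) (onto J' X) = (\<pi> (into J' X), \<pi> (onto J' X), bd X)" using w(1) unfolding b .
  show "is_cand Kc X (Env J' X) (Cosyz J' X) (\<pi> (into J' X), \<pi> (onto J' X), bd X)" using w(2) unfolding b .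
  show "(\<pi> (into J' X), \<pi> (onto J' X), bd X) \<in> E" using SE_image[OF s] unfolding im .
  show "(\<pi> (into J' X), \<pi> (onto J' X), bd X) \<in> Dist Kc" using image_in_Dist[OF c] unfolding im .
  show "Env J' X \<in> PE" using c'(2) unfolding exact_proj_SE .
qed

lemma jtri_simps:
  assumes X: "X \<in> Ob C"
  shows "Arr Kc (bd X) \<and> Dom Kc (bd X) = Cosyz J' X \<and> Cod Kc (bd X) = Cosyz J X"
    "Env J' X \<in> Ob C" "Cosyz J' X \<in> Ob C"
  using cand_simps[OF jtri(5)[OF X]] by blast+

lemma \<xi>_exists:
  assumes X: "X \<in> Ob C"
  shows "\<exists>k. k \<in> Hom Kc (Cosyz J' X) (Cosyz R X) \<and> bdry R X \<bullet> k = bd X"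
    "\<exists>k. k \<in> Hom Kc (Cosyz R X) (Cosyz J' X) \<and> bd X \<bullet> k = bdry R X"
proof -
  have i: "Ide Kc X \<in> Hom Kc X X" using X by (simp add: K.Q.hom_iff)
  note [simp] = rtri_simps[OF X] jtri_simps[OF X] KS.SusM_Ide[of X, simplified] X
  obtain k where "k \<in> Hom Kc (Cosyz J' X) (Cosyz R X)" "SusM Kc (Ide Kc X) \<bullet> bd X = bdry R X \<bullet> k"
    using PE_fill[OF jtri(3,5)[OF X] rtri(1,3,4)[OF X] i] by metis
  then show "\<exists>k. k \<in> Hom Kc (Cosyz J' X) (Cosyz R X) \<and> bdry R X \<bullet> k = bd X" by auto
  obtain k where "k \<in> Hom Kc (Cosyz R X) (Cosyz J' X)" "SusM Kc (Ide Kc X) \<bullet> bdry R X = bd X \<bullet> k"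
    using PE_fill[OF rtri(2,3)[OF X] jtri(4,5,6)[OF X] i] by metis
  then show "\<exists>k. k \<in> Hom Kc (Cosyz R X) (Cosyz J' X) \<and> bd X \<bullet> k = bdry R X" by auto
qed

text \<open>
  Comparison maps between the two relative cosyzygies of X, in both directions, chosen compatibly
  with the boundaries.
\<close>

definition \<xi>0 where "\<xi>0 X = (SOME k. k \<in> Hom Kc (Cosyz J' X) (Cosyz R X) \<and> bdry R X \<bullet> k = bd X)"
definition \<xi>1 where "\<xi>1 X = (SOME k. k \<in> Hom Kc (Cosyz R X) (Cosyz J' X) \<and> bd X \<bullet> k = bdry R X)"
definition \<xi> where "\<xi> X = \<rho> (\<xi>0 X)"

text \<open>
  The composites agree with the identities after composition with the boundaries, hence modulo PE.
\<close>

lemma \<xi>0: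
  assumes X: "X \<in> Ob C"
  shows "\<xi>0 X \<in> Hom Kc (Cosyz J' X) (Cosyz R X)" "bdry R X \<bullet> \<xi>0 X = bd X"
    "\<xi>1 X \<in> Hom Kc (Cosyz R X) (Cosyz J' X)" "bd X \<bullet> \<xi>1 X = bdry R X"
    "\<rho> (\<xi>1 X \<bullet> \<xi>0 X) = \<rho> (Ide Kc (Cosyz J' X))" "\<rho> (\<xi>0 X \<bullet> \<xi>1 X) = \<rho> (Ide Kc (Cosyz R X))"
proof -
  show 0: "\<xi>0 X \<in> Hom Kc (Cosyz J' X) (Cosyz R X)" "bdry R X \<bullet> \<xi>0 X = bd X"
    using someI_ex[OF \<xi>_exists(1)[OF X]] unfolding \<xi>0_def by blast+
  show 1: "\<xi>1 X \<in> Hom Kc (Cosyz R X) (Cosyz J' X)" "bd X \<bullet> \<xi>1 X = bdry R X"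
    using someI_ex[OF \<xi>_exists(2)[OF X]] unfolding \<xi>1_def by blast+
  note [simp] = K.Q_homD[OF 0(1)] K.Q_homD[OF 1(1)] rtri_simps[OF X] jtri_simps[OF X]
  show "\<rho> (\<xi>1 X \<bullet> \<xi>0 X) = \<rho> (Ide Kc (Cosyz J' X))"
    by (rule middle_PE_unique[OF jtri(4,5,6)[OF X]])
      (use 0(2) K.Q.rewrite_under[OF 1(2), of "\<xi>0 X"] in \<open>simp_all add: K.Q.hom_iff\<close>)
  show "\<rho> (\<xi>0 X \<bullet> \<xi>1 X) = \<rho> (Ide Kc (Cosyz R X))"
    by (rule middle_PE_unique[OF rtri(1,3,4)[OF X]])
      (use 1(2) K.Q.rewrite_under[OF 0(2), of "\<xi>1 X"] in \<open>simp_all add: K.Q.hom_iff\<close>)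
qed

lemma \<xi>_iso:
  assumes X: "X \<in> Ob C"
  shows "\<xi> X \<in> Hom Dc (Cosyz J' X) (Cosyz R X)" "is_iso Dc (\<xi> X)"
proof -
  note k = \<xi>0[OF X]
  show "\<xi> X \<in> Hom Dc (Cosyz J' X) (Cosyz R X)" unfolding \<xi>_def by (rule D.q_hom[OF k(1)])
  show "is_iso Dc (\<xi> X)" unfolding \<xi>_def
    by (rule D.Q.isoI[OF D.q_hom[OF k(1)] D.q_hom[OF k(3)]])
      (use D.q_comp_hom[OF k(1,3)] D.q_comp_hom[OF k(3,1)] k(5,6) in \<open>simp_all only: D.q_simps(2)\<close>)
qed

text \<open>
  Both composites have the same boundary: each boundary is natural with respect to f.
\<close>

lemma \<xi>_natural:
  assumes G: "G \<in> Hom F.Kc X Y"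
  shows "\<xi> Y \<cdot>\<^bsub>Dc\<^esub> \<Theta> (SusM F.Kc G) = SusM Dc (\<Theta> G) \<cdot>\<^bsub>Dc\<^esub> \<xi> X"
proof -
  obtain f where f: "f \<in> Hom C X Y" "G = \<sigma> f" using F.K.Q_homE[OF G] .
  have X: "X \<in> Ob C" and Y: "Y \<in> Ob C" using homD[OF f(1)] by blast+
  obtain f' where f': "F.suspends f f'" "f' \<in> Hom C (Cosyz J' X) (Cosyz J' Y)" "SusM F.Kc (\<sigma> f) = \<sigma> f'" using F.SusM_pi[OF f(1)] .
  obtain e where "F.conf_mor (into J' X) (onto J' X) (into J' Y) (onto J' Y) f e f'" using F.suspendsD[OF f'(1) f(1)] by metis
  then have m: "conf_mor (into J' X) (onto J' X) (into J' Y) (onto J' Y) f e f'" unfolding conf_mor_def F.conf_mor_def .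
  from image_mor[OF jtri(1)[OF X] jtri(1)[OF Y] m]
  have n: "SusM Kc (\<pi> f) \<bullet> bd X = bd Y \<bullet> \<pi> f'"
    unfolding jtri(2)[OF X] jtri(2)[OF Y] KS.tri_mor_iff[OF jtri(5)[OF X] jtri(5)[OF Y]] by blast
  note \<pi>f = K.q_hom[OF f(1)]
  obtain B g where g: "g \<in> Hom Kc (Cosyz R X) (Cosyz R Y)" "SusM Kc (\<pi> f) \<bullet> bdry R X = bdry R Y \<bullet> g"
    using rel_suspends_exists[OF \<pi>f] by metis
  note k = \<xi>0[OF X] and l = \<xi>0[OF Y]
  note [simp] = homD[OF f(1)] homD[OF f'(2)] K.Q_homD[OF g(1)] K.Q_homD[OF k(1)] K.Q_homD[OF l(1)]
    rtri_simps[OF X] rtri_simps[OF Y] jtri_simps[OF X] jtri_simps[OF Y]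
  have "\<rho> (\<xi>0 Y \<bullet> \<pi> f') = \<rho> (g \<bullet> \<xi>0 X)"
  proof (rule middle_PE_unique[OF rtri(1,3,4)[OF Y]])
    show "bdry R Y \<bullet> (\<xi>0 Y \<bullet> \<pi> f') = bdry R Y \<bullet> (g \<bullet> \<xi>0 X)"
      using K.Q.rewrite_under[OF l(2), of "\<pi> f'"] K.Q.rewrite_under[OF g(2)[symmetric], of "\<xi>0 X"] k(2) n by simp
  qed (simp_all add: K.Q.hom_iff)
  then show ?thesis unfolding f(2) f'(3) \<xi>_def \<Theta>_\<sigma>[OF f(1)] \<Theta>_\<sigma>[OF f'(2)] SusM_Dc[OF \<pi>f g] by simp
qed

end

section \<open>Comparison of the triangulations\<close>

context frobenius_envelope
begin

lemma std_exists:
  assumes f: "f \<in> Hom C X Y"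
  obtains Z g h k where "g \<in> Hom C Y Z" "h \<in> Hom C Z (Cosyz J X)" "is_pushout C (into J X) f g k"
    "h \<cdot> g = Zero C Y (Cosyz J X)" "h \<cdot> k = onto J X"
proof -
  have e: "conf X (Env J X) (Cosyz J X) (into J X) (onto J X)" using homD[OF f] by (simp add: env)
  obtain g k where po: "is_pushout C (into J X) f g k"
    using pushout_adm_mono[OF confD(2)[OF e] f] confD(1)[OF e] unfolding adm_mono_def by blast
  obtain Z h where gh: "conf Y Z (Cosyz J X) g h" "k \<in> Hom C (Env J X) Z" "h \<cdot> k = onto J X"
    using pushout_conf[OF e f po] .
  show ?thesis using that[OF confD(2,3)[OF gh(1)] po confD(4)[OF gh(1)] gh(3)] .
qed

lemma Dist_iff: "T \<in> Dist Kc \<longleftrightarrow> (\<exists>T0\<in>stable_std C S J. tri_iso Kc T0 T)"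
  unfolding stable_fields tri_iso_stable by blast

end

context frobenius_comparison
begin

lemma Dist_Dc_iff: "T \<in> Dist Dc \<longleftrightarrow> (\<exists>T0\<in>rel_std Kc E R. tri_iso Dc T0 T)"
  unfolding rel_fields tri_iso_rel by blast

text \<open>
  Put \<open>n = \<theta> - 1\<close>. As \<open>\<mu> - 1\<close> factors through PE and the second factor lifts along g, the map n is,
  modulo PE, of the form \<open>f \<bullet> t\<close>. But \<open>n \<bullet> f = 0\<close>, so n squares to zero modulo PE.
\<close>

lemma rel_unipotent:
  assumes T: "(f, g, h) \<in> E" "is_cand Kc X Y Z (f, g, h)"
    and m: "\<theta> \<in> Hom Kc Y Y" "\<mu> \<in> Hom Kc Z Z" "\<theta> \<bullet> f = f" "\<mu> \<bullet> g = g \<bullet> \<theta>"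
    and \<mu>: "\<rho> \<mu> = \<rho> (Ide Kc Z)"
  shows "is_iso Dc (\<rho> \<theta>)"
proof -
  have D: "(f, g, h) \<in> Dist Kc" using T(1) E.dist by blast
  note [simp] = cand_simps[OF T(2)] m(1,2)[THEN K.Q_homD]
  have "Ide Kc Z \<in> Hom Kc Z Z" by (simp add: K.Q.hom_iff)
  then obtain P a b where w: "P \<in> PE" "a \<in> Hom Kc Z P" "b \<in> Hom Kc P Z" "\<mu> = Ide Kc Z \<boxplus>\<^bsub>Kc\<^esub> b \<bullet> a"
    using D.q_eqE[OF \<mu> m(2)] by blast
  obtain b1 where b1: "b1 \<in> Hom Kc P Y" "g \<bullet> b1 = b" using PE_lift[OF w(1) T w(3)] .
  note [simp] = w(2,3)[THEN K.Q_homD] K.Q_homD[OF b1(1)]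
  define n where "n = \<theta> \<boxminus>\<^bsub>Kc\<^esub> Ide Kc Y"
  have n: "n \<in> Hom Kc Y Y" unfolding n_def by (simp add: K.Q.hom_iff)
  note [simp] = K.Q_homD[OF n]
  have nf: "n \<bullet> f = Zero Kc X Y" unfolding n_def using m(3) by simp
  \<comment> \<open>a lift along g of the error (\<mu> - 1) g, which is zero modulo PE\<close>
  let ?k = "b1 \<bullet> (a \<bullet> g)"
  have "g \<bullet> n = g \<bullet> \<theta> \<boxminus>\<^bsub>Kc\<^esub> g" unfolding n_def by simp
  also have "\<dots> = \<mu> \<bullet> g \<boxminus>\<^bsub>Kc\<^esub> g" unfolding m(4) ..
  also have "\<dots> = (g \<boxplus>\<^bsub>Kc\<^esub> b \<bullet> (a \<bullet> g)) \<boxminus>\<^bsub>Kc\<^esub> g" unfolding w(4) by simp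
  also have "\<dots> = b \<bullet> (a \<bullet> g)" by (rule K.Q.add_diff_right) simp_all
  also have "\<dots> = g \<bullet> ?k" unfolding b1(2)[symmetric] by simp
  finally have gn: "g \<bullet> n = g \<bullet> ?k" .
  have "g \<bullet> (n \<boxminus>\<^bsub>Kc\<^esub> ?k) = g \<bullet> n \<boxminus>\<^bsub>Kc\<^esub> g \<bullet> ?k" by (rule K.Q.comp_diff) simp_all
  also have "\<dots> = Zero Kc Y Z" unfolding gn by simp
  finally have "g \<bullet> (n \<boxminus>\<^bsub>Kc\<^esub> ?k) = Zero Kc Y Z" "n \<boxminus>\<^bsub>Kc\<^esub> ?k \<in> Hom Kc Y Y" by (simp_all add: K.Q.hom_iff)
  then obtain t where t: "t \<in> Hom Kc Y X" "n \<boxminus>\<^bsub>Kc\<^esub> ?k = f \<bullet> t" using dist_weak_kernel_middle[OF D T(2)] by metis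
  note [simp] = K.Q_homD[OF t(1)]
  have z: "\<rho> ?k = \<rho> (Zero Kc Y Y)" by (rule D.q_zeroI[OF w(1)]) (simp_all add: b1(1) K.Q.hom_iff)
  have "\<rho> n = \<rho> (f \<bullet> t) \<boxplus>\<^bsub>Dc\<^esub> \<rho> ?k" unfolding t(2)[symmetric] by simp
  also have "\<dots> = \<rho> (f \<bullet> t)" unfolding z by simp
  finally have \<rho>n: "\<rho> n = \<rho> (f \<bullet> t)" .
  have "\<rho> n \<cdot>\<^bsub>Dc\<^esub> \<rho> n = \<rho> n \<cdot>\<^bsub>Dc\<^esub> \<rho> (f \<bullet> t)" by (simp only: \<rho>n)
  also have "\<dots> = \<rho> ((n \<bullet> f) \<bullet> t)" by simp
  also have "\<dots> = Zero Dc Y Y" unfolding nf by simp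
  finally have nn: "\<rho> n \<cdot>\<^bsub>Dc\<^esub> \<rho> n = Zero Dc Y Y" .
  have "\<rho> \<theta> \<boxminus>\<^bsub>Dc\<^esub> Ide Dc Y = \<rho> n" unfolding n_def by simp
  then show ?thesis using D.Q.unipotent_iso[OF D.q_hom[OF m(1)]] nn by simp
qed

text \<open>
  For a given f, the pushout of the relative envelope in C and the homotopy pushout in the stable
  category both complete to distinguished triangles starting at Y, with third map \<open>\<Sigma>f\<close> composed with
  the respective boundary. The comparison maps of the cosyzygies match these third maps, so there are
  fill-ins in both directions, and they are mutually inverse modulo PE up to unipotent maps.
\<close>

lemma std_rel_iso:
  assumes f: "f \<in> Hom C X Y" and gh: "F.conf Y Z (Cosyz J' X) g h"
    and m: "F.conf_mor (into J' X) (onto J' X) g h f k (Ide C (Cosyz J' X))"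
    and T: "is_cand Kc Y Z' (Cosyz R X) (g', h', d')" "(g', h', d') \<in> Dist Kc" "hcart Kc (into R X) (\<pi> f) g' k'"
      "tri_mor Kc (into R X, onto R X, bdry R X) (g', h', d') (\<pi> f, k', Ide Kc (Cosyz R X))"
  shows "tri_iso Dc (\<rho> (\<pi> f), \<rho> (\<pi> g), \<rho> (\<xi>0 X \<bullet> \<pi> h)) (\<rho> (\<pi> f), \<rho> g', \<rho> h')"
proof -
  have X: "X \<in> Ob C" and Y: "Y \<in> Ob C" using homD[OF f] by blast+
  have c: "conf Y Z (Cosyz J' X) g h" using F.confD(1-3)[OF gh] unfolding conf_def rel_sequences_def by blast
  have m': "conf_mor (into J' X) (onto J' X) g h f k (Ide C (Cosyz J' X))" using m unfolding conf_mor_def F.conf_mor_def .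
  have X': "X \<in> Ob Kc" "Y \<in> Ob Kc" using X Y by simp_all
  obtain d where im: "img g h = (\<pi> g, \<pi> h, d)" and cd: "is_cand Kc Y Z (Cosyz J' X) (\<pi> g, \<pi> h, d)"
    using image_cand[OF c] by metis
  have TE: "(\<pi> g, \<pi> h, d) \<in> E" using SE_image[OF F.confD(1)[OF gh]] unfolding im .
  then have TD: "(\<pi> g, \<pi> h, d) \<in> Dist Kc" using E.dist by blast
  note k = \<xi>0[OF X]
  note [simp] = rtri_simps[OF X] jtri_simps[OF X] cand_simps[OF cd] cand_simps[OF T(1)] homD[OF f] k(1,3)[THEN K.Q_homD]
    conf_simps(1-5)[OF c]
  from image_mor[OF jtri(1)[OF X] c m']
  have "SusM Kc (\<pi> f) \<bullet> bd X = d \<bullet> \<pi> (Ide C (Cosyz J' X))"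
    unfolding jtri(2)[OF X] im KS.tri_mor_iff[OF jtri(5)[OF X] cd] by blast
  \<comment> \<open>Both third maps are the suspension of f composed with a boundary, and \<xi>0 and \<xi>1 match
    these boundaries.\<close>
  then have d: "d = SusM Kc (\<pi> f) \<bullet> bd X" by simp
  have "SusM Kc (\<pi> f) \<bullet> bdry R X = d' \<bullet> Ide Kc (Cosyz R X)"
    using T(4) unfolding KS.tri_mor_iff[OF rtri(3)[OF X] T(1)] by blast
  then have d': "d' = SusM Kc (\<pi> f) \<bullet> bdry R X" by simp
  have "tri_mono E (into R X)" using rtri(2)[OF X] unfolding tri_mono_def by blast
  then have TE': "(g', h', d') \<in> E" using E_of_mono[OF T(2)] E.mono_pushout[OF _ T(3)] by blast
  have i: "Ide Kc Y \<in> Hom Kc Y Y" by (simp add: K.Q.hom_iff)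
  note S1 = KS.SusM_Ide[OF X'(2), simplified]
  have "SusM Kc (Ide Kc Y) \<bullet> d = d' \<bullet> \<xi>0 X" unfolding d d' using k(2) S1 by simp
  then obtain c1 where c1: "tri_mor Kc (\<pi> g, \<pi> h, d) (g', h', d') (Ide Kc Y, c1, \<xi>0 X)"
    using dist_fill_middle[OF TD cd T(2,1) i k(1)] by blast
  have "SusM Kc (Ide Kc Y) \<bullet> d' = d \<bullet> \<xi>1 X" unfolding d d' using k(4) S1 by simp
  then obtain c2 where c2: "tri_mor Kc (g', h', d') (\<pi> g, \<pi> h, d) (Ide Kc Y, c2, \<xi>1 X)"
    using dist_fill_middle[OF T(2,1) TD cd i k(3)] by blast
  note h1 = c1[unfolded KS.tri_mor_iff[OF cd T(1)]] and h2 = c2[unfolded KS.tri_mor_iff[OF T(1) cd]]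
  have h: "c1 \<in> Hom Kc Z Z'" "c1 \<bullet> \<pi> g = g' \<bullet> Ide Kc Y" "\<xi>0 X \<bullet> \<pi> h = h' \<bullet> c1"
    "c2 \<in> Hom Kc Z' Z" "c2 \<bullet> g' = \<pi> g \<bullet> Ide Kc Y" "\<xi>1 X \<bullet> h' = \<pi> h \<bullet> c2"
    using h1 h2 by blast+
  note [simp] = h(1,4)[THEN K.Q_homD]
  have hg: "c1 \<bullet> \<pi> g = g'" "c2 \<bullet> g' = \<pi> g" using h(2,5) by simp_all
  note [simp] = hg h(3,6)[THEN K.Q.rewrite_under]
  have "is_iso Dc (\<rho> (c2 \<bullet> c1))"
    by (rule rel_unipotent[OF TE cd _ _ _ _ k(5)]) (simp_all add: K.Q.hom_iff h(3))
  moreover have "is_iso Dc (\<rho> (c1 \<bullet> c2))"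
    by (rule rel_unipotent[OF TE' T(1) _ _ _ _ k(6)]) (simp_all add: K.Q.hom_iff h(6))
  ultimately have iso: "is_iso Dc (\<rho> c1)"
    using D.Q.iso_of_iso_comp[OF D.q_hom[OF h(1)] D.q_hom[OF h(4)]] by simp
  have xh: "\<xi>0 X \<bullet> \<pi> h \<in> Hom Kc Z (Cosyz R X)" by (simp add: K.Q.hom_iff)
  have cand: "is_cand Dc X Y Z (\<rho> (\<pi> f), \<rho> (\<pi> g), \<rho> (\<xi>0 X \<bullet> \<pi> h))" "is_cand Dc X Y Z' (\<rho> (\<pi> f), \<rho> g', \<rho> h')"
    by (simp_all add: D.Q.hom_iff)
  have "tri_mor Dc (\<rho> (\<pi> f), \<rho> (\<pi> g), \<rho> (\<xi>0 X \<bullet> \<pi> h)) (\<rho> (\<pi> f), \<rho> g', \<rho> h') (Ide Dc X, Ide Dc Y, \<rho> c1)"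
    unfolding DS.tri_mor_iff[OF cand] using DS.SusM_Ide[of X] h(3) by (simp add: D.Q.hom_iff)
  then show ?thesis unfolding tri_iso_def using iso D.Q.iso_Ide[of X] D.Q.iso_Ide[of Y] by auto
qed

text \<open>
  The envelope triangle is replaced by the image triangle of a conflation; its pushout along f
  provides the homotopy pushout, which is then transported back.
\<close>

lemma rel_std_exists:
  assumes f: "f \<in> Hom C X Y"
  obtains Z' g' h' d' k' where "is_cand Kc Y Z' (Cosyz R X) (g', h', d')" "(g', h', d') \<in> Dist Kc"
    "hcart Kc (into R X) (\<pi> f) g' k'"
    "tri_mor Kc (into R X, onto R X, bdry R X) (g', h', d') (\<pi> f, k', Ide Kc (Cosyz R X))"
proof -
  have X: "X \<in> Ob C" and Y: "Y \<in> Ob C" using homD[OF f] by blast+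
  note T = rtri(1,3)[OF X]
  obtain X0 Y0 Z0 i p h0 a b c a1 b1 c1 where r: "conf X0 Y0 Z0 i p" "img i p = (\<pi> i, \<pi> p, h0)" and
    "triangle_isomorphism Kc X0 Y0 Z0 (\<pi> i) (\<pi> p) h0 X (Env R X) (Cosyz R X) (into R X) (onto R X) (bdry R X) a b c a1 b1 c1"
    using dist_realize_iso[OF T] .
  then interpret I: triangle_isomorphism Kc X0 Y0 Z0 "\<pi> i" "\<pi> p" h0 X "Env R X" "Cosyz R X" "into R X" "onto R X" "bdry R X"
    a b c a1 b1 c1 by simp
  obtain f1 where f1: "f1 \<in> Hom C X0 Y" "\<pi> f \<bullet> a = \<pi> f1" using K.Q_homE[OF K.Q.comp_hom[OF I.homs(1) K.q_hom[OF f]]] .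
  obtain g k where po: "is_pushout C i f1 g k"
    using pushout_adm_mono[OF confD(2)[OF r(1)] f1(1)] confD(1)[OF r(1)] unfolding adm_mono_def by blast
  obtain Q q where gq: "conf Y Q Z0 g q" "k \<in> Hom C Y0 Q" "q \<cdot> k = p" using pushout_conf[OF r(1) f1(1) po] .
  have kg: "k \<cdot> i = g \<cdot> f1" using po unfolding is_pushout_def is_square_def by blast
  note [simp] = conf_simps[OF r(1)] conf_simps[OF gq(1)] homD[OF gq(2)] homD[OF f1(1)] homD[OF f] rtri_simps[OF X] X Y
  have cm: "conf_mor i p g q f1 k (Ide C Z0)"
    by (rule conf_morI[OF r(1) gq(1) f1(1) gq(2)]) (simp_all add: kg gq(3) hom_iff)
  obtain d where im: "img g q = (\<pi> g, \<pi> q, d)" and cd: "is_cand Kc Y Q Z0 (\<pi> g, \<pi> q, d)" using image_cand[OF gq(1)] by metis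
  note [simp] = cand_simps(3)[OF cd]
  from image_mor[OF r(1) gq(1) cm] have "SusM Kc (\<pi> f1) \<bullet> h0 = d \<bullet> \<pi> (Ide C Z0)"
    unfolding r(2) im KS.tri_mor_iff[OF I.source cd] by blast
  then have d: "d = SusM Kc (\<pi> f1) \<bullet> h0" by simp
  have TD: "(\<pi> g, \<pi> q, d) \<in> Dist Kc" using image_in_Dist[OF gq(1)] unfolding im .
  let ?h = "c \<bullet> \<pi> q" and ?d = "d \<bullet> c1" and ?k = "\<pi> k \<bullet> b1"
  have cand: "is_cand Kc Y Q (Cosyz R X) (\<pi> g, ?h, ?d)" by (simp add: K.Q.hom_iff)
  have "tri_mor Kc (\<pi> g, \<pi> q, d) (\<pi> g, ?h, ?d) (Ide Kc Y, Ide Kc Q, c)"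
    unfolding KS.tri_mor_iff[OF cd cand] using KS.SusM_Ide[of Y] I.homs(3) by (simp add: K.Q.hom_iff)
  then have "tri_iso Kc (\<pi> g, \<pi> q, d) (\<pi> g, ?h, ?d)"
    unfolding tri_iso_def using I.isos(3) K.Q.iso_Ide[of Y] K.Q.iso_Ide[of Q] by auto
  from dist_iso[OF TD this] have D': "(\<pi> g, ?h, ?d) \<in> Dist Kc" .
  have ba: "b \<bullet> (\<pi> i \<bullet> a1) = into R X" by simp
  have fa: "\<pi> f1 \<bullet> a1 = \<pi> f" unfolding f1(2)[symmetric] by simp
  have "hcart Kc (\<pi> i) (\<pi> f1) (\<pi> g) (\<pi> k)"
    by (rule hcart_of_left_square[OF r(1) gq(1,2,3) f1(1) kg[symmetric]])
  from hcart_iso[OF this K.q_hom[OF confD(2)[OF r(1)]] K.q_hom[OF f1(1)] I.homs(1,4) I.inverse(1,2) I.homs(2,5) I.inverse(3,4)]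
  have hc: "hcart Kc (into R X) (\<pi> f) (\<pi> g) ?k" unfolding ba fa .
  have e1: "?k \<bullet> into R X = \<pi> g \<bullet> \<pi> f"
  proof -
    have "?k \<bullet> into R X = \<pi> (k \<cdot> i) \<bullet> a1" using K.Q.comp_assoc'[of a1 "\<pi> i" "\<pi> k"] by simp
    also have "\<dots> = \<pi> g \<bullet> (\<pi> f1 \<bullet> a1)" unfolding kg using K.Q.comp_assoc'[of a1 "\<pi> f1" "\<pi> g"] by simp
    also have "\<dots> = \<pi> g \<bullet> \<pi> f" unfolding fa ..
    finally show ?thesis .
  qed
  have e2: "?h \<bullet> ?k = onto R X"
  proof -
    have "?h \<bullet> ?k = c \<bullet> (\<pi> (q \<cdot> k) \<bullet> b1)" using K.Q.comp_assoc'[of b1 "\<pi> k" "\<pi> q"] by simp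
    also have "\<dots> = onto R X" unfolding gq(3) by simp
    finally show ?thesis .
  qed
  have e3: "SusM Kc (\<pi> f) \<bullet> bdry R X = ?d"
  proof -
    have "SusM Kc (\<pi> f) \<bullet> bdry R X = SusM Kc (\<pi> f) \<bullet> ((bdry R X \<bullet> c) \<bullet> c1)" by simp
    also have "\<dots> = SusM Kc (\<pi> f \<bullet> a) \<bullet> (h0 \<bullet> c1)" unfolding I.squares(3)[symmetric] by (simp del: I.squares I.under)
    also have "\<dots> = ?d" unfolding f1(2) d by simp
    finally show ?thesis .
  qed
  have k: "?k \<in> Hom Kc (Env R X) Q" by (simp add: K.Q.hom_iff)
  have "tri_mor Kc (into R X, onto R X, bdry R X) (\<pi> g, ?h, ?d) (\<pi> f, ?k, Ide Kc (Cosyz R X))"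
    unfolding KS.tri_mor_iff[OF T(2) cand] using e1 e2 e3 k K.q_hom[OF f] by (simp add: K.Q.hom_iff)
  then show ?thesis using that[OF cand D' hc] by blast
qed

lemma \<Theta>_cand:
  assumes "is_cand F.Kc X Y Z (f, g, h)"
  shows "is_cand Dc X Y Z (\<Theta> f, \<Theta> g, \<xi> X \<cdot>\<^bsub>Dc\<^esub> \<Theta> h)"
proof -
  have h: "f \<in> Hom F.Kc X Y" "g \<in> Hom F.Kc Y Z" "h \<in> Hom F.Kc Z (Cosyz J' X)" using assms by simp_all
  have "X \<in> Ob C" using F.K.Q_homD[OF h(1)] by blast
  then show ?thesis using \<Theta>_hom[OF h(1)] \<Theta>_hom[OF h(2)] D.Q.comp_hom[OF \<Theta>_hom[OF h(3)] \<xi>_iso(1)] by simp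
qed

text \<open>
  The comparison functor is fully faithful and \<open>\<xi>\<close> is a natural isomorphism, so the commutativity of
  each square can be tested after applying the functor.
\<close>

lemma \<Theta>_tri_mor_iff:
  assumes c: "is_cand F.Kc X Y Z (f, g, h)" "is_cand F.Kc X' Y' Z' (f', g', h')"
    and m: "a \<in> Hom F.Kc X X'" "b \<in> Hom F.Kc Y Y'" "d \<in> Hom F.Kc Z Z'"
  shows "tri_mor F.Kc (f, g, h) (f', g', h') (a, b, d) \<longleftrightarrow>
    tri_mor Dc (\<Theta> f, \<Theta> g, \<xi> X \<cdot>\<^bsub>Dc\<^esub> \<Theta> h) (\<Theta> f', \<Theta> g', \<xi> X' \<cdot>\<^bsub>Dc\<^esub> \<Theta> h') (\<Theta> a, \<Theta> b, \<Theta> d)"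
proof -
  have h: "f \<in> Hom F.Kc X Y" "g \<in> Hom F.Kc Y Z" "h \<in> Hom F.Kc Z (Cosyz J' X)"
    "f' \<in> Hom F.Kc X' Y'" "g' \<in> Hom F.Kc Y' Z'" "h' \<in> Hom F.Kc Z' (Cosyz J' X')" using c by simp_all
  have X: "X \<in> Ob C" "X' \<in> Ob C" using F.K.Q_homD[OF m(1)] by blast+
  have sa: "SusM F.Kc a \<in> Hom F.Kc (Cosyz J' X) (Cosyz J' X')" using F.KS.SusM_hom[OF m(1)] by simp
  have inj: "u = v \<longleftrightarrow> \<Theta> u = \<Theta> v" if "u \<in> Hom F.Kc x y" "v \<in> Hom F.Kc x y" for u v x y
    using \<Theta>_inj[OF that] by blast
  have 1: "b \<cdot>\<^bsub>F.Kc\<^esub> f = f' \<cdot>\<^bsub>F.Kc\<^esub> a \<longleftrightarrow> \<Theta> b \<cdot>\<^bsub>Dc\<^esub> \<Theta> f = \<Theta> f' \<cdot>\<^bsub>Dc\<^esub> \<Theta> a"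
    using inj[OF F.K.Q.comp_hom[OF h(1) m(2)] F.K.Q.comp_hom[OF m(1) h(4)]]
    unfolding \<Theta>_comp[OF h(1) m(2)] \<Theta>_comp[OF m(1) h(4)] .
  have 2: "d \<cdot>\<^bsub>F.Kc\<^esub> g = g' \<cdot>\<^bsub>F.Kc\<^esub> b \<longleftrightarrow> \<Theta> d \<cdot>\<^bsub>Dc\<^esub> \<Theta> g = \<Theta> g' \<cdot>\<^bsub>Dc\<^esub> \<Theta> b"
    using inj[OF F.K.Q.comp_hom[OF h(2) m(3)] F.K.Q.comp_hom[OF m(2) h(5)]]
    unfolding \<Theta>_comp[OF h(2) m(3)] \<Theta>_comp[OF m(2) h(5)] .
  note \<xi>' = \<xi>_iso[OF X(2)]
  note t = \<Theta>_hom[OF h(3)] \<Theta>_hom[OF h(6)] \<Theta>_hom[OF m(3)] \<Theta>_hom[OF sa] DS.SusM_hom[OF \<Theta>_hom[OF m(1)]]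
  note [simp] = Dc_homD[OF t(1)] Dc_homD[OF t(2)] Dc_homD[OF t(3)] Dc_homD[OF t(4)] Dc_homD[OF t(5)] Dc_homD[OF \<xi>'(1)]
    Dc_homD[OF \<xi>_iso(1)[OF X(1)]]
  let ?u = "\<Theta> (SusM F.Kc a \<cdot>\<^bsub>F.Kc\<^esub> h)" and ?v = "\<Theta> (h' \<cdot>\<^bsub>F.Kc\<^esub> d)"
  have uv: "?u \<in> Hom Dc Z (Cosyz J' X')" "?v \<in> Hom Dc Z (Cosyz J' X')"
    using \<Theta>_hom[OF F.K.Q.comp_hom[OF h(3) sa]] \<Theta>_hom[OF F.K.Q.comp_hom[OF m(3) h(6)]] by blast+
  have canc: "u = v" if "u \<in> Hom Dc Z (Cosyz J' X')" "v \<in> Hom Dc Z (Cosyz J' X')" "\<xi> X' \<cdot>\<^bsub>Dc\<^esub> u = \<xi> X' \<cdot>\<^bsub>Dc\<^esub> v" for u v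
    by (rule D.Q.iso_cancel[OF \<xi>'(2,1) that])
  have lhs: "SusM Dc (\<Theta> a) \<cdot>\<^bsub>Dc\<^esub> (\<xi> X \<cdot>\<^bsub>Dc\<^esub> \<Theta> h) = \<xi> X' \<cdot>\<^bsub>Dc\<^esub> ?u"
    unfolding \<Theta>_comp[OF h(3) sa] using D.Q.rewrite_under[OF \<xi>_natural[OF m(1), symmetric], of "\<Theta> h"] by simp
  have rhs: "(\<xi> X' \<cdot>\<^bsub>Dc\<^esub> \<Theta> h') \<cdot>\<^bsub>Dc\<^esub> \<Theta> d = \<xi> X' \<cdot>\<^bsub>Dc\<^esub> ?v"
    unfolding \<Theta>_comp[OF m(3) h(6)] by simp
  have 3: "SusM F.Kc a \<cdot>\<^bsub>F.Kc\<^esub> h = h' \<cdot>\<^bsub>F.Kc\<^esub> d \<longleftrightarrow>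
    SusM Dc (\<Theta> a) \<cdot>\<^bsub>Dc\<^esub> (\<xi> X \<cdot>\<^bsub>Dc\<^esub> \<Theta> h) = (\<xi> X' \<cdot>\<^bsub>Dc\<^esub> \<Theta> h') \<cdot>\<^bsub>Dc\<^esub> \<Theta> d"
    unfolding lhs rhs inj[OF F.K.Q.comp_hom[OF h(3) sa] F.K.Q.comp_hom[OF m(3) h(6)]]
    by (rule iffI, simp only:, erule canc[OF uv])
  show ?thesis
    unfolding F.KS.tri_mor_iff[OF c] DS.tri_mor_iff[OF \<Theta>_cand[OF c(1)] \<Theta>_cand[OF c(2)]] 1[symmetric] 2[symmetric] 3[symmetric]
    using m \<Theta>_hom[OF m(1)] \<Theta>_hom[OF m(2)] \<Theta>_hom[OF m(3)] by blast
qed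

lemma \<Theta>_tri_iso_iff:
  assumes c: "is_cand F.Kc X Y Z (f, g, h)" "is_cand F.Kc X' Y' Z' (f', g', h')"
  shows "tri_iso F.Kc (f, g, h) (f', g', h') \<longleftrightarrow>
    tri_iso Dc (\<Theta> f, \<Theta> g, \<xi> X \<cdot>\<^bsub>Dc\<^esub> \<Theta> h) (\<Theta> f', \<Theta> g', \<xi> X' \<cdot>\<^bsub>Dc\<^esub> \<Theta> h')"
proof
  assume "tri_iso F.Kc (f, g, h) (f', g', h')"
  then obtain a b d where m: "tri_mor F.Kc (f, g, h) (f', g', h') (a, b, d)" "is_iso F.Kc a" "is_iso F.Kc b" "is_iso F.Kc d"
    unfolding tri_iso_def by blast
  have t: "a \<in> Hom F.Kc X X'" "b \<in> Hom F.Kc Y Y'" "d \<in> Hom F.Kc Z Z'" using m(1) unfolding F.KS.tri_mor_iff[OF c] by blast+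
  show "tri_iso Dc (\<Theta> f, \<Theta> g, \<xi> X \<cdot>\<^bsub>Dc\<^esub> \<Theta> h) (\<Theta> f', \<Theta> g', \<xi> X' \<cdot>\<^bsub>Dc\<^esub> \<Theta> h')"
    unfolding tri_iso_def using m \<Theta>_tri_mor_iff[OF c t] \<Theta>_iso_iff[OF t(1)] \<Theta>_iso_iff[OF t(2)] \<Theta>_iso_iff[OF t(3)] by blast
next
  assume "tri_iso Dc (\<Theta> f, \<Theta> g, \<xi> X \<cdot>\<^bsub>Dc\<^esub> \<Theta> h) (\<Theta> f', \<Theta> g', \<xi> X' \<cdot>\<^bsub>Dc\<^esub> \<Theta> h')"
  then obtain a b d where m: "tri_mor Dc (\<Theta> f, \<Theta> g, \<xi> X \<cdot>\<^bsub>Dc\<^esub> \<Theta> h) (\<Theta> f', \<Theta> g', \<xi> X' \<cdot>\<^bsub>Dc\<^esub> \<Theta> h') (a, b, d)"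
    "is_iso Dc a" "is_iso Dc b" "is_iso Dc d" unfolding tri_iso_def by blast
  have "a \<in> Hom Dc X X'" "b \<in> Hom Dc Y Y'" "d \<in> Hom Dc Z Z'"
    using m(1) unfolding DS.tri_mor_iff[OF \<Theta>_cand[OF c(1)] \<Theta>_cand[OF c(2)]] by blast+
  then obtain a' b' d' where t: "a' \<in> Hom F.Kc X X'" "b' \<in> Hom F.Kc Y Y'" "d' \<in> Hom F.Kc Z Z'" and
    e: "\<Theta> a' = a" "\<Theta> b' = b" "\<Theta> d' = d" using \<Theta>_surj by metis
  show "tri_iso F.Kc (f, g, h) (f', g', h')"
    unfolding tri_iso_def using m[folded e] \<Theta>_tri_mor_iff[OF c t] \<Theta>_iso_iff[OF t(1)] \<Theta>_iso_iff[OF t(2)] \<Theta>_iso_iff[OF t(3)] by blast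
qed

lemma std_comparison:
  assumes f: "f \<in> Hom C X Y" and g: "g \<in> Hom C Y Z" and h: "h \<in> Hom C Z (Cosyz J' X)"
    and po: "is_pushout C (into J' X) f g k" "h \<cdot> g = Zero C Y (Cosyz J' X)" "h \<cdot> k = onto J' X"
    and U: "is_cand Kc Y Z' (Cosyz R X) (g', h', d')" "(g', h', d') \<in> Dist Kc" "hcart Kc (into R X) (\<pi> f) g' k'"
      "tri_mor Kc (into R X, onto R X, bdry R X) (g', h', d') (\<pi> f, k', Ide Kc (Cosyz R X))"
  shows "tri_iso Dc (\<Theta> (\<sigma> f), \<Theta> (\<sigma> g), \<xi> X \<cdot>\<^bsub>Dc\<^esub> \<Theta> (\<sigma> h)) (\<rho> (\<pi> f), \<rho> g', \<rho> h')"
proof -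
  have X: "X \<in> Ob C" using homD[OF f] by blast
  have "\<xi> X \<cdot>\<^bsub>Dc\<^esub> \<Theta> (\<sigma> h) = \<rho> (\<xi>0 X \<bullet> \<pi> h)"
    unfolding \<xi>_def \<Theta>_\<sigma>[OF h] by (rule D.q_comp_hom[OF K.q_hom[OF h] \<xi>0(1)[OF X]])
  then show ?thesis
    using std_rel_iso[OF f F.std_conf[OF f g h po] U] unfolding \<Theta>_\<sigma>[OF f] \<Theta>_\<sigma>[OF g] by simp
qed

text \<open>
  Standard triangles correspond to standard triangles with the same first map, and isomorphisms of
  triangles are both preserved and reflected; this covers both directions.
\<close>

lemma Dist_\<Theta>_iff:
  assumes T: "is_cand F.Kc X Y Z (a, b, c)"
  shows "(a, b, c) \<in> Dist F.Kc \<longleftrightarrow> (\<Theta> a, \<Theta> b, \<xi> X \<cdot>\<^bsub>Dc\<^esub> \<Theta> c) \<in> Dist Dc"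
proof
  assume "(a, b, c) \<in> Dist F.Kc"
  then obtain T0 where T0: "T0 \<in> stable_std C SE J'" "tri_iso F.Kc T0 (a, b, c)" unfolding F.Dist_iff by blast
  obtain f g h X0 Y0 Z0 k where *: "T0 = (\<sigma> f, \<sigma> g, \<sigma> h)" "f \<in> Hom C X0 Y0" "g \<in> Hom C Y0 Z0" "h \<in> Hom C Z0 (Cosyz J' X0)"
     "is_pushout C (into J' X0) f g k" "h \<cdot> g = Zero C Y0 (Cosyz J' X0)" "h \<cdot> k = onto J' X0"
    using T0(1) unfolding stable_std_def stable_functor_def by blast
  have c0: "is_cand F.Kc X0 Y0 Z0 (\<sigma> f, \<sigma> g, \<sigma> h)"
    using F.K.q_hom[OF *(2)] F.K.q_hom[OF *(3)] F.K.q_hom[OF *(4)] by simp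
  obtain Z' g' h' d' k' where U: "is_cand Kc Y0 Z' (Cosyz R X0) (g', h', d')" "(g', h', d') \<in> Dist Kc"
    "hcart Kc (into R X0) (\<pi> f) g' k'"
    "tri_mor Kc (into R X0, onto R X0, bdry R X0) (g', h', d') (\<pi> f, k', Ide Kc (Cosyz R X0))" using rel_std_exists[OF *(2)] .
  have "(\<rho> (\<pi> f), \<rho> g', \<rho> h') \<in> rel_std Kc E R"
    unfolding rel_std_def rel_functor_def using K.q_hom[OF *(2)] U by blast
  moreover have "tri_iso Dc (\<rho> (\<pi> f), \<rho> g', \<rho> h') (\<Theta> a, \<Theta> b, \<xi> X \<cdot>\<^bsub>Dc\<^esub> \<Theta> c)"
    using DS.tri_iso_trans[OF DS.tri_iso_sym[OF std_comparison[OF *(2-7) U]]]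
      T0(2)[unfolded *(1) \<Theta>_tri_iso_iff[OF c0 T]] by blast
  ultimately show "(\<Theta> a, \<Theta> b, \<xi> X \<cdot>\<^bsub>Dc\<^esub> \<Theta> c) \<in> Dist Dc" unfolding Dist_Dc_iff by blast
next
  assume "(\<Theta> a, \<Theta> b, \<xi> X \<cdot>\<^bsub>Dc\<^esub> \<Theta> c) \<in> Dist Dc"
  then obtain T1 where T1: "T1 \<in> rel_std Kc E R" "tri_iso Dc T1 (\<Theta> a, \<Theta> b, \<xi> X \<cdot>\<^bsub>Dc\<^esub> \<Theta> c)" unfolding Dist_Dc_iff by blast
  obtain F' g' h' X0 Y0 Z' k' d' where U: "T1 = (\<rho> F', \<rho> g', \<rho> h')" "F' \<in> Hom Kc X0 Y0"
    "is_cand Kc Y0 Z' (Cosyz R X0) (g', h', d')" "(g', h', d') \<in> Dist Kc" "hcart Kc (into R X0) F' g' k'"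
    "tri_mor Kc (into R X0, onto R X0, bdry R X0) (g', h', d') (F', k', Ide Kc (Cosyz R X0))"
    using T1(1) unfolding rel_std_def rel_functor_def by blast
  obtain f where f: "f \<in> Hom C X0 Y0" "F' = \<pi> f" using K.Q_homE[OF U(2)] .
  obtain Z0 g h k where *: "g \<in> Hom C Y0 Z0" "h \<in> Hom C Z0 (Cosyz J' X0)" "is_pushout C (into J' X0) f g k"
    "h \<cdot> g = Zero C Y0 (Cosyz J' X0)" "h \<cdot> k = onto J' X0" using F.std_exists[OF f(1)] .
  have c0: "is_cand F.Kc X0 Y0 Z0 (\<sigma> f, \<sigma> g, \<sigma> h)"
    using F.K.q_hom[OF f(1)] F.K.q_hom[OF *(1)] F.K.q_hom[OF *(2)] by simp
  have "(\<sigma> f, \<sigma> g, \<sigma> h) \<in> stable_std C SE J'" unfolding stable_std_def stable_functor_def using f(1) * by blast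
  moreover have "tri_iso Dc (\<Theta> (\<sigma> f), \<Theta> (\<sigma> g), \<xi> X0 \<cdot>\<^bsub>Dc\<^esub> \<Theta> (\<sigma> h)) (\<Theta> a, \<Theta> b, \<xi> X \<cdot>\<^bsub>Dc\<^esub> \<Theta> c)"
    using DS.tri_iso_trans[OF std_comparison[OF f(1) * U(3-6)[unfolded f(2)]]] T1(2)[unfolded U(1) f(2)] by blast
  then have "tri_iso F.Kc (\<sigma> f, \<sigma> g, \<sigma> h) (a, b, c)" unfolding \<Theta>_tri_iso_iff[OF c0 T] .
  ultimately show "(a, b, c) \<in> Dist F.Kc" unfolding F.Dist_iff by blast
qed

lemma \<Theta>_add:
  assumes "G \<in> Hom F.Kc X Y" "H \<in> Hom F.Kc X Y" shows "\<Theta> (G \<boxplus>\<^bsub>F.Kc\<^esub> H) = \<Theta> G \<boxplus>\<^bsub>Dc\<^esub> \<Theta> H"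
proof -
  obtain g where g: "g \<in> Hom C X Y" "G = \<sigma> g" using F.K.Q_homE[OF assms(1)] .
  obtain h where h: "h \<in> Hom C X Y" "H = \<sigma> h" using F.K.Q_homE[OF assms(2)] .
  note [simp] = homD[OF g(1)] homD[OF h(1)]
  show ?thesis unfolding g(2) h(2) by simp
qed

lemma \<Theta>_functor: "is_functor F.Kc Dc id \<Theta>"
  unfolding is_functor_def using \<Theta>_hom \<Theta>_comp by auto

lemma \<Theta>'_\<Theta>:
  assumes "G \<in> Hom F.Kc X Y" shows "\<Theta>' (\<Theta> G) = G"
proof -
  obtain g where g: "g \<in> Hom C X Y" "G = \<sigma> g" using F.K.Q_homE[OF assms(1)] .
  show ?thesis unfolding g(2) \<Theta>_\<sigma>[OF g(1)] by (rule \<Theta>'_\<rho>[OF g(1)])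
qed

lemma \<Theta>'_hom:
  assumes "H \<in> Hom Dc X Y" shows "\<Theta>' H \<in> Hom F.Kc X Y" "\<Theta> (\<Theta>' H) = H"
proof -
  obtain G where G: "G \<in> Hom F.Kc X Y" "\<Theta> G = H" using \<Theta>_surj[OF assms] .
  then show "\<Theta>' H \<in> Hom F.Kc X Y" "\<Theta> (\<Theta>' H) = H" using \<Theta>'_\<Theta>[OF G(1)] by auto
qed

lemma \<Theta>'_functor: "is_functor Dc F.Kc id \<Theta>'"
  unfolding is_functor_def
proof (intro conjI ballI allI)
  fix x assume "x \<in> Ob Dc"
  then have x: "x \<in> Ob C" by simp
  then show "id x \<in> Ob F.Kc" by simp
  show "\<Theta>' (Ide Dc x) = Ide F.Kc (id x)" using \<Theta>'_\<rho>[OF ide_hom[OF x]] by simp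
next
  fix x y F assume "F \<in> Hom Dc x y"
  then show "\<Theta>' F \<in> Hom F.Kc (id x) (id y)" using \<Theta>'_hom(1) by simp
next
  fix x y z F G assume h: "F \<in> Hom Dc x y" "G \<in> Hom Dc y z"
  note t = \<Theta>'_hom[OF h(1)] \<Theta>'_hom[OF h(2)]
  have "\<Theta>' (\<Theta> (\<Theta>' G \<cdot>\<^bsub>F.Kc\<^esub> \<Theta>' F)) = \<Theta>' G \<cdot>\<^bsub>F.Kc\<^esub> \<Theta>' F"
    by (rule \<Theta>'_\<Theta>[OF F.K.Q.comp_hom[OF t(1,3)]])
  then show "\<Theta>' (G \<cdot>\<^bsub>Dc\<^esub> F) = \<Theta>' G \<cdot>\<^bsub>F.Kc\<^esub> \<Theta>' F" unfolding \<Theta>_comp[OF t(1,3)] t(2,4) .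
qed

lemma \<Theta>_equivalence: "is_equivalence F.Kc Dc id \<Theta>"
proof -
  have 1: "is_natural_iso F.Kc F.Kc id id (id \<circ> id) (\<Theta>' \<circ> \<Theta>) (Ide F.Kc)"
    unfolding is_natural_iso_def
  proof (intro conjI ballI allI)
    fix x assume x: "x \<in> Ob F.Kc"
    show "Ide F.Kc x \<in> Hom F.Kc (id x) ((id \<circ> id) x)" "is_iso F.Kc (Ide F.Kc x)"
      using F.K.Q.ide_hom[OF x] F.K.Q.iso_Ide[OF x] by simp_all
  next
    fix x y G assume G: "G \<in> Hom F.Kc x y"
    show "Ide F.Kc y \<cdot>\<^bsub>F.Kc\<^esub> id G = (\<Theta>' \<circ> \<Theta>) G \<cdot>\<^bsub>F.Kc\<^esub> Ide F.Kc x"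
      using \<Theta>'_\<Theta>[OF G] F.K.Q.ide_comp[OF G] F.K.Q.comp_ide[OF G] by simp
  qed
  have 2: "is_natural_iso Dc Dc (id \<circ> id) (\<Theta> \<circ> \<Theta>') id id (Ide Dc)"
    unfolding is_natural_iso_def
  proof (intro conjI ballI allI)
    fix x assume x: "x \<in> Ob Dc"
    show "Ide Dc x \<in> Hom Dc ((id \<circ> id) x) (id x)" "is_iso Dc (Ide Dc x)"
      using D.Q.ide_hom[OF x] D.Q.iso_Ide[OF x] by simp_all
  next
    fix x y G assume G: "G \<in> Hom Dc x y"
    show "Ide Dc y \<cdot>\<^bsub>Dc\<^esub> (\<Theta> \<circ> \<Theta>') G = id G \<cdot>\<^bsub>Dc\<^esub> Ide Dc x"
      using \<Theta>'_hom(2)[OF G] D.Q.ide_comp[OF G] D.Q.comp_ide[OF G] by simp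
  qed
  show ?thesis unfolding is_equivalence_def using \<Theta>_functor \<Theta>'_functor 1 2 by blast
qed

lemma \<Theta>_tri_equivalence: "is_tri_equivalence F.Kc Dc id \<Theta>"
  unfolding is_tri_equivalence_def
proof (intro conjI exI)
  show "is_additive_functor F.Kc Dc id \<Theta>"
    unfolding is_additive_functor_def using \<Theta>_functor \<Theta>_add by blast
  show "is_equivalence F.Kc Dc id \<Theta>" by (rule \<Theta>_equivalence)
  show "is_natural_iso F.Kc Dc (id \<circ> SusO F.Kc) (\<Theta> \<circ> SusM F.Kc) (SusO Dc \<circ> id) (SusM Dc \<circ> \<Theta>) \<xi>"
    unfolding is_natural_iso_def using \<xi>_iso \<xi>_natural by simp
  show "\<forall>X Y Z f g h. is_cand F.Kc X Y Z (f, g, h) \<longrightarrow>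
           ((f, g, h) \<in> Dist F.Kc \<longleftrightarrow> (\<Theta> f, \<Theta> g, \<xi> X \<cdot>\<^bsub>Dc\<^esub> \<Theta> h) \<in> Dist Dc)"
    using Dist_\<Theta>_iff by blast
qed

end

theorem theorem6p1:
  fixes F :: "('o, 'm) addcat"
    and S :: "('m \<times> 'm) set"
    and J :: "('o, 'm) envelope"
    and E :: "('m set \<times> 'm set \<times> 'm set) set"
  assumes "frobenius_exact_category F S"
    and "exact_envelope F S J"
    and "frobenius_class (stable_cat F S J) E"
  shows "frobenius_exact_category F (rel_sequences F S J E)
    \<and> exact_proj F (rel_sequences F S J E) = {X \<in> Ob F. X \<in> tri_proj (stable_cat F S J) E}
    \<and> (\<forall>J' R. exact_envelope F (rel_sequences F S J E) J' \<longrightarrow>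
          class_envelope (stable_cat F S J) E R \<longrightarrow>
          (\<exists>\<Theta>O \<Theta>M.
             is_tri_equivalence
               (stable_cat F (rel_sequences F S J E) J')
               (rel_stable_cat (stable_cat F S J) E R) \<Theta>O \<Theta>M
           \<and> (\<forall>X\<in>Ob F. \<Theta>O X = X)
           \<and> (\<forall>X Y. \<forall>f\<in>Hom F X Y.
                 \<Theta>M (stable_functor F (rel_sequences F S J E) f)
                   = rel_functor (stable_cat F S J) E (stable_functor F S f))))"
proof -
  interpret A: frobenius_stable_class F S J E
    by (intro frobenius_stable_class.intro frobenius_envelope.intro frobenius_envelope_axioms.intro
        frobenius_stable_class_axioms.intro assms)
  have "\<exists>\<Theta>O \<Theta>M. is_tri_equivalence (stable_cat F (rel_sequences F S J E) J') (rel_stable_cat (stable_cat F S J) E R) \<Theta>O \<Theta>M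
      \<and> (\<forall>X\<in>Ob F. \<Theta>O X = X)
      \<and> (\<forall>X Y. \<forall>f\<in>Hom F X Y. \<Theta>M (stable_functor F (rel_sequences F S J E) f)
                   = rel_functor (stable_cat F S J) E (stable_functor F S f))"
    if J': "exact_envelope F (rel_sequences F S J E) J'" and R: "class_envelope (stable_cat F S J) E R" for J' R
  proof -
    interpret B: frobenius_comparison F S J E J' R
      by (intro frobenius_comparison.intro A.frobenius_stable_class_axioms frobenius_comparison_axioms.intro J' R)
    show ?thesis
      unfolding stable_functor_def rel_functor_def
      using B.\<Theta>_tri_equivalence B.\<Theta>_\<sigma> by (intro exI[of _ id] exI[of _ B.\<Theta>]) auto
  qed
  moreover have "exact_proj F (rel_sequences F S J E) = {X \<in> Ob F. X \<in> tri_proj (stable_cat F S J) E}"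
    using A.exact_proj_SE A.PE_Ob by blast
  ultimately show ?thesis using A.SE_frobenius by blast
qed

end
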